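(* Let $\Omega=\Omega_1\times\dots\times\Omega_n\subset\mathbb{C}^n$ be a Runge domain with each $\Omega_j\subset\mathbb{C}$ open. The mapping $$\widehat{\Psi}:\mathsf{M}(\Omega)\ni M\mapsto\psi_M\in H(0,\hat{\mathcal{O}}_\Omega),\qquad \psi_M(w)=\sum_{\alpha\in\mathbb{N}^n}m_\alpha w^\alpha,$$ where $M(\zeta^\alpha)=m_\alpha\zeta^\alpha$ for $\alpha\in\mathbb{N}^n$, is an isomorphism between the algebra $\mathsf{M}(\Omega)$ of multipliers on $H(\Omega)$ with composition of operators and the space $H(0,\hat{\mathcal{O}}_\Omega)$ of germs of holomorphic functions at $0$ that extend holomorphically on every set of the form $(\hat{\mathbb{C}}\setminus z_1\Omega_1^{-1})\times\dots\times(\hat{\mathbb{C}}\setminus z_n\Omega_n^{-1})$, $z\in\Omega\setminus\mathcal{N}$, with multiplication of Taylor series at $0$ defined by $$\sum_{\alpha\in\mathbb{N}^n}a_\alpha w^\alpha\ \ast\ \sum_{\alpha\in\mathbb{N}^n}b_\alpha w^\alpha:=\sum_{\alpha\in\mathbb{N}^n}a_\alpha b_\alpha w^\alpha.$$ The multiplier sequence of a given multiplier equals the sequence of Taylor coefficients at $0$ of the corresponding germ. Furthermore, the action of the multiplier $M_\psi\in\mathsf{M}(\Omega)$ associated with $\psi\in H(0,\hat{\mathcal{O}}_\Omega)$ can be calculated explicitly as $$M_\psi(f)(z)=\Big(\frac{-1}{2\pi i}\Big)^n\int_{1/\gamma_1\times\dots\times1/\gamma_n}f(z\zeta^{-1})\,\frac{\psi_{(z)}(\zeta)}{\zeta_1\cdots\zeta_n}\,d\zeta,\qquad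 f\in H(\Omega),\ z\in\Omega\setminus\mathcal{N},$$ where $\psi_{(z)}$ is an extension of $\psi$ to an open neighbourhood $\hat U_1\times\dots\times\hat U_n$ of $(\hat{\mathbb{C}}\setminus z_1\Omega_1^{-1})\times\dots\times(\hat{\mathbb{C}}\setminus z_n\Omega_n^{-1})$ (with $\hat U_j\subset\hat{\mathbb{C}}$ open), and the $\gamma_j$ are finite unions of closed curves chosen for the function $w\mapsto\psi_{(z)}(w^{-1})/(w_1\cdots w_n)$; that is, writing $U_j=\{1/\zeta:\zeta\in\hat U_j\}$, each $\gamma_j$ is contained in $(U_j\cap z_j^{-1}\Omega_j)\setminus\{0\}$ and has winding number $1$ around every point of $\mathbb{C}\setminus U_j$ and $0$ around every point of $\mathbb{C}\setminus z_j^{-1}\Omega_j$. Here $1/\gamma_j$ is the image of $\gamma_j$ under $\zeta\mapsto1/\zeta$.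
   Context: $\mathbb{N}$ includes $0$; $\hat{\mathbb{C}}$ is the Riemann sphere, with $1/0=\infty$ and $1/\infty=0$; $\mathbb{C}_*=\mathbb{C}\setminus\{0\}$; $\mathcal{N}:=\mathbb{C}^n\setminus\mathbb{C}_*^n$. Multiplication in $\mathbb{C}^n$ is coordinatewise and $\zeta^{-1}=(1/\zeta_1,\dots,1/\zeta_n)$. For $A\subset\mathbb{C}$, $A^{-1}=\{1/a:a\in A\}\subset\hat{\mathbb{C}}$ (so $\infty\in A^{-1}$ if $0\in A$). $H(\Omega)$ is the space of holomorphic functions on $\Omega$ with the topology of uniform convergence on compact sets. A domain $\Omega\subset\mathbb{C}^n$ is Runge if every holomorphic function on $\Omega$ can be approximated by polynomials uniformly on every compact subset of $\Omega$. A multiplier on $H(\Omega)$ is a continuous linear map $M:H(\Omega)\to H(\Omega)$ such that for every $\alpha\in\mathbb{N}^n$ there is $m_\alpha\in\mathbb{C}$ with $M(\zeta^\alpha)=m_\alpha\zeta^\alpha$; $(m_\alpha)_\alpha$ is its multiplier sequence. $\mathsf{M}(\Omega)$ is the algebra of all multipliers on $H(\Omega)$. For a set $S\subset\hat{\mathbb{C}}^n$, $H(S)$ is the space of germs of holomorphic functions on $S$, i.e. of functions holomorphic on some open neighbourhood of $S$ in $\hat{\mathbb{C}}^n$. $\hat{\mathcal{O}}_\Omega$ is the family of the sets $(\hat{\mathbb{C}}\setminus z_1\Omega_1^{-1})\times\dots\times(\hat{\mathbb{C}}\setminus z_n\Omega_n^{-1})$, $z\in\Omega\setminus\mathcal{N}$;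 each contains $0\in\mathbb{C}^n$. $H(0,\hat{\mathcal{O}}_\Omega)$ is the space of germs $f\in H(\{0\})$ such that for every $S\in\hat{\mathcal{O}}_\Omega$ there is $f_S\in H(S)$ with $f_S\equiv f$ around $0$.
   Formalization: Germs on the sets in Ô_Ω and the extensions ψ_(z) are required to vanish at points with an infinite coordinate; without this the isomorphism fails if some Ω_j omits 0 (ψ=1, Ω={|z-1|<1}) and the integral formula fails for Ω=ℂ, ψ=1. If 0∈Ω the germ space is unchanged. *)

theory Defs
  imports "HOL-Complex_Analysis.Complex_Analysis" "HOL-Algebra.Algebraic_Closure_Type"
    "HOL-Algebra.QuotRing"
begin

section \<open>Holomorphic functions on subsets of C^n\<close>

definition holo :: "(complex ^ 'n::finite \<Rightarrow> complex) \<Rightarrow> (complex ^ 'n) set \<Rightarrow> bool" where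
  "holo f U \<longleftrightarrow> (\<forall>z\<in>U. \<exists>D. (f has_derivative D) (at z) \<and> (\<forall>c v. D (c *s v) = c * D v))"

definition mono_fun :: "('n \<Rightarrow> nat) \<Rightarrow> complex ^ 'n::finite \<Rightarrow> complex" where
  "mono_fun \<alpha> z = (\<Prod>j\<in>UNIV. (z $ j) ^ \<alpha> j)"

definition poly_fun :: "(complex ^ 'n::finite \<Rightarrow> complex) \<Rightarrow> bool" where
  "poly_fun p \<longleftrightarrow> (\<exists>A c. finite A \<and> p = (\<lambda>z. \<Sum>\<alpha>\<in>A. c \<alpha> * mono_fun \<alpha> z))"

definition runge_domain :: "(complex ^ 'n::finite) set \<Rightarrow> bool" where
  "runge_domain \<Omega> \<longleftrightarrow> open \<Omega> \<and> connected \<Omega> \<and> \<Omega> \<noteq> {} \<and>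
     (\<forall>f K e. holo f \<Omega> \<and> compact K \<and> K \<subseteq> \<Omega> \<and> (0::real) < e \<longrightarrow>
        (\<exists>p. poly_fun p \<and> (\<forall>z\<in>K. dist (p z) (f z) < e)))"

definition cart :: "('n::finite \<Rightarrow> complex set) \<Rightarrow> (complex ^ 'n) set" where
  "cart Om = {z. \<forall>j. z $ j \<in> Om j}"

text \<open>Functions on \<open>\<Omega>\<close> are total functions that vanish outside \<open>\<Omega>\<close>, so that HOL equality
  is equality of functions on \<open>\<Omega>\<close> and the vector space operations are pointwise.\<close>

definition zero_ext :: "(complex ^ 'n::finite) set \<Rightarrow> (complex ^ 'n \<Rightarrow> complex) \<Rightarrow> complex ^ 'n \<Rightarrow> complex"
  where "zero_ext \<Omega> f = (\<lambda>z. if z \<in> \<Omega> then f z else 0)"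

definition hol_space :: "(complex ^ 'n::finite) set \<Rightarrow> (complex ^ 'n \<Rightarrow> complex) set" where
  "hol_space \<Omega> = {f. holo f \<Omega> \<and> (\<forall>z. z \<notin> \<Omega> \<longrightarrow> f z = 0)}"

text \<open>The topology of uniform convergence on compact subsets of \<open>\<Omega>\<close>.\<close>

definition hol_top :: "(complex ^ 'n::finite) set \<Rightarrow> (complex ^ 'n \<Rightarrow> complex) topology" where
  "hol_top \<Omega> = topology (\<lambda>V. V \<subseteq> hol_space \<Omega> \<and>
     (\<forall>f\<in>V. \<exists>K e. compact K \<and> K \<subseteq> \<Omega> \<and> (0::real) < e \<and>
        {g \<in> hol_space \<Omega>. \<forall>z\<in>K. dist (f z) (g z) < e} \<subseteq> V))"

lemma openin_hol_top:
  "openin (hol_top \<Omega>) V \<longleftrightarrow> V \<subseteq> hol_space \<Omega> \<and>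
     (\<forall>f\<in>V. \<exists>K e. compact K \<and> K \<subseteq> \<Omega> \<and> (0::real) < e \<and>
        {g \<in> hol_space \<Omega>. \<forall>z\<in>K. dist (f z) (g z) < e} \<subseteq> V)" (is "_ \<longleftrightarrow> ?P V")
proof -
  have int: "?P (S \<inter> T)" if S: "?P S" and T: "?P T" for S T
  proof (intro conjI ballI)
    show "S \<inter> T \<subseteq> hol_space \<Omega>" using S by blast
    fix f assume f: "f \<in> S \<inter> T"
    obtain K d where K: "compact K" "K \<subseteq> \<Omega>" "(0::real) < d"
      "{g \<in> hol_space \<Omega>. \<forall>z\<in>K. dist (f z) (g z) < d} \<subseteq> S" using S f by (meson IntD1)
    obtain L e where L: "compact L" "L \<subseteq> \<Omega>" "(0::real) < e"
      "{g \<in> hol_space \<Omega>. \<forall>z\<in>L. dist (f z) (g z) < e} \<subseteq> T" using T f by (meson IntD2)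
    have "{g \<in> hol_space \<Omega>. \<forall>z\<in>K \<union> L. dist (f z) (g z) < min d e} \<subseteq> S \<inter> T"
      using K(4) L(4) by auto
    moreover have "compact (K \<union> L)" "K \<union> L \<subseteq> \<Omega>" "0 < min d e"
      using K L by (auto intro: compact_Un)
    ultimately show "\<exists>K e. compact K \<and> K \<subseteq> \<Omega> \<and> (0::real) < e \<and>
        {g \<in> hol_space \<Omega>. \<forall>z\<in>K. dist (f z) (g z) < e} \<subseteq> S \<inter> T" by blast
  qed
  have un: "?P (\<Union>\<K>)" if \<K>: "\<forall>V\<in>\<K>. ?P V" for \<K>
  proof (intro conjI ballI)
    show "\<Union>\<K> \<subseteq> hol_space \<Omega>" using \<K> by blast
    fix f assume "f \<in> \<Union>\<K>"
    then obtain V where V: "V \<in> \<K>" "f \<in> V" by blast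
    then obtain K e where "compact K" "K \<subseteq> \<Omega>" "(0::real) < e"
      "{g \<in> hol_space \<Omega>. \<forall>z\<in>K. dist (f z) (g z) < e} \<subseteq> V" using \<K> by meson
    then show "\<exists>K e. compact K \<and> K \<subseteq> \<Omega> \<and> (0::real) < e \<and>
        {g \<in> hol_space \<Omega>. \<forall>z\<in>K. dist (f z) (g z) < e} \<subseteq> \<Union>\<K>" using V(1) by blast
  qed
  have "istopology ?P"
    unfolding istopology_def using int un by blast
  then show ?thesis
    unfolding hol_top_def by (simp add: topology_inverse')
qed

section \<open>Multipliers\<close>

text \<open>Operators are extensional on \<open>H(\<Omega>)\<close>: equality in HOL is equality on \<open>H(\<Omega>)\<close>.\<close>

definition multipliers ::
  "(complex ^ 'n::finite) set \<Rightarrow> ((complex ^ 'n \<Rightarrow> complex) \<Rightarrow> (complex ^ 'n \<Rightarrow> complex)) set" where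
  "multipliers \<Omega> = {M \<in> extensional (hol_space \<Omega>).
     continuous_map (hol_top \<Omega>) (hol_top \<Omega>) M \<and>
     (\<forall>f\<in>hol_space \<Omega>. \<forall>g\<in>hol_space \<Omega>. M (\<lambda>z. f z + g z) = (\<lambda>z. M f z + M g z)) \<and>
     (\<forall>c. \<forall>f\<in>hol_space \<Omega>. M (\<lambda>z. c * f z) = (\<lambda>z. c * M f z)) \<and>
     (\<forall>\<alpha>. \<exists>m. \<forall>z\<in>\<Omega>. M (zero_ext \<Omega> (mono_fun \<alpha>)) z = m * mono_fun \<alpha> z)}"

definition mult_seq :: "(complex ^ 'n::finite) set \<Rightarrow>
  ((complex ^ 'n \<Rightarrow> complex) \<Rightarrow> (complex ^ 'n \<Rightarrow> complex)) \<Rightarrow> ('n \<Rightarrow> nat) \<Rightarrow> complex" where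
  "mult_seq \<Omega> M \<alpha> = (THE m. \<forall>z\<in>\<Omega>. M (zero_ext \<Omega> (mono_fun \<alpha>)) z = m * mono_fun \<alpha> z)"

definition multiplier_algebra :: "(complex ^ 'n::finite) set \<Rightarrow>
  (complex, (complex ^ 'n \<Rightarrow> complex) \<Rightarrow> (complex ^ 'n \<Rightarrow> complex)) module" where
  "multiplier_algebra \<Omega> =
    \<lparr> carrier = multipliers \<Omega>,
      mult = (\<lambda>M N. compose (hol_space \<Omega>) M N),
      one = (\<lambda>f\<in>hol_space \<Omega>. f),
      zero = (\<lambda>f\<in>hol_space \<Omega>. (\<lambda>z. 0)),
      add = (\<lambda>M N. \<lambda>f\<in>hol_space \<Omega>. (\<lambda>z. M f z + N f z)),
      smult = (\<lambda>c M. \<lambda>f\<in>hol_space \<Omega>. (\<lambda>z. c * M f z)) \<rparr>"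

section \<open>Powers of the Riemann sphere\<close>

text \<open>A point of the Riemann sphere is \<open>Some z\<close> or \<open>None\<close>, the latter being infinity.\<close>

abbreviation rsphere :: "complex option topology" where
  "rsphere \<equiv> Alexandroff_compactification euclidean"

abbreviation rsphere_pow :: "('n::finite \<Rightarrow> complex option) topology" where
  "rsphere_pow \<equiv> product_topology (\<lambda>_. rsphere) UNIV"

fun sphere_inv :: "complex option \<Rightarrow> complex option" where
  "sphere_inv None = Some 0"
| "sphere_inv (Some z) = (if z = 0 then None else Some (1 / z))"

definition recip_set :: "complex set \<Rightarrow> complex option set" where
  "recip_set A = sphere_inv ` Some ` A"

definition emb :: "complex ^ 'n::finite \<Rightarrow> 'n \<Rightarrow> complex option" where
  "emb w = (\<lambda>j. Some (w $ j))"

definition fin_part :: "('n::finite \<Rightarrow> complex option) \<Rightarrow> complex ^ 'n" where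
  "fin_part x = (\<chi> j. the (x j))"

text \<open>The standard atlas has one chart for each set \<open>I\<close> of coordinates; in the coordinates from
  \<open>I\<close> the local parameter is the reciprocal.\<close>

definition chart :: "'n set \<Rightarrow> complex ^ 'n::finite \<Rightarrow> 'n \<Rightarrow> complex option" where
  "chart I w = (\<lambda>j. if j \<in> I then sphere_inv (Some (w $ j)) else Some (w $ j))"

definition sphere_hol :: "(('n::finite \<Rightarrow> complex option) \<Rightarrow> complex) \<Rightarrow> ('n \<Rightarrow> complex option) set \<Rightarrow> bool"
  where "sphere_hol f U \<longleftrightarrow> openin rsphere_pow U \<and>
    (\<forall>I. holo (\<lambda>w. f (chart I w)) {w. chart I w \<in> U})"

text \<open>Koethe's convention for germs on subsets of the sphere: they vanish at the points that have
  an infinite coordinate. For germs on a set of finite points this is no restriction (lemma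
  \<open>sphere_hol0_finite\<close> below), so for \<open>0 \<in> \<Omega>\<close>, where all the sets in \<open>hat_family\<close> consist of
  finite points, the convention does not change the space \<open>ext_germs\<close>.

  If some \<open>\<Omega>\<^sub>j\<close> omits \<open>0\<close> the convention is indispensable. Take \<open>n = 1\<close> and
  \<open>\<Omega> = {z. |z - 1| < 1}\<close>. The constant \<open>1\<close> is holomorphic on the whole sphere; a multiplier
  with these Taylor coefficients would send each polynomial \<open>p\<close> to the constant \<open>p(0)\<close>, but
  \<open>(1 - z)^k\<close> tends to \<open>0\<close> in \<open>H(\<Omega>)\<close> while its value at \<open>0\<close> is \<open>1\<close>.

  The integral formula needs the convention for the extensions too, as it makes
  \<open>\<psi>(1/w) / (w\<^sub>1 \<cdots> w\<^sub>n)\<close> holomorphic where some \<open>w\<^sub>j = 0\<close>. Otherwise, for \<open>n = 1\<close>,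
  \<open>\<Omega> = \<complex>\<close> and \<open>\<psi> = 1\<close> extended to the whole sphere, the cycle would be subject to no
  condition at all, and the integral would be \<open>f(0)\<close> times its winding number about \<open>0\<close>.\<close>

definition sphere_hol0 :: "(('n::finite \<Rightarrow> complex option) \<Rightarrow> complex) \<Rightarrow> ('n \<Rightarrow> complex option) set \<Rightarrow> bool"
  where "sphere_hol0 f U \<longleftrightarrow> sphere_hol f U \<and> (\<forall>x\<in>U. (\<exists>j. x j = None) \<longrightarrow> f x = 0)"

lemma sphere_hol0_finite:
  assumes "\<forall>x\<in>S. \<forall>j. x j \<noteq> None" and "S \<subseteq> U" and "sphere_hol f U"
  shows "\<exists>V. S \<subseteq> V \<and> V \<subseteq> U \<and> sphere_hol0 f V"
proof -
  define F where "F = {x :: 'a \<Rightarrow> complex option. \<forall>j. x j \<noteq> None}"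
  have "F = (\<Pi>\<^sub>E j\<in>UNIV. range Some)"
    unfolding F_def PiE_UNIV_domain by (auto simp: image_iff)
  moreover have "openin rsphere (range Some)"
    using openin_Alexandroff_compactification_image_Some[of euclidean UNIV] by simp
  ultimately have F: "openin rsphere_pow F"
    by (simp add: openin_PiE_gen)
  have "sphere_hol f (U \<inter> F)"
    using assms(3) F unfolding sphere_hol_def holo_def by auto
  moreover have "f x = 0" if "x \<in> U \<inter> F" "x j = None" for x j
    using that by (simp add: F_def del: not_None_eq)
  ultimately have "sphere_hol0 f (U \<inter> F)"
    unfolding sphere_hol0_def by blast
  moreover have "S \<subseteq> U \<inter> F"
    using assms(1,2) unfolding F_def by blast
  ultimately show ?thesis
    by blast
qed

section \<open>Germs\<close>

text \<open>A germ on \<open>S\<close> is a class of functions, holomorphic on neighbourhoods of \<open>S\<close>, any two of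
  which agree on a neighbourhood of \<open>S\<close>.\<close>

definition eq_near :: "('n::finite \<Rightarrow> complex option) set \<Rightarrow>
  (('n \<Rightarrow> complex option) \<Rightarrow> complex) \<Rightarrow> (('n \<Rightarrow> complex option) \<Rightarrow> complex) \<Rightarrow> bool" where
  "eq_near S f g \<longleftrightarrow> (\<exists>W. openin rsphere_pow W \<and> S \<subseteq> W \<and> (\<forall>x\<in>W. f x = g x))"

definition hol_near :: "('n::finite \<Rightarrow> complex option) set \<Rightarrow>
  (('n \<Rightarrow> complex option) \<Rightarrow> complex) set" where
  "hol_near S = {f. \<exists>U. S \<subseteq> U \<and> sphere_hol0 f U}"

definition germ :: "('n::finite \<Rightarrow> complex option) set \<Rightarrow>
  (('n \<Rightarrow> complex option) \<Rightarrow> complex) \<Rightarrow> (('n \<Rightarrow> complex option) \<Rightarrow> complex) set" where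
  "germ S f = {g \<in> hol_near S. eq_near S f g}"

definition germs :: "('n::finite \<Rightarrow> complex option) set \<Rightarrow>
  (('n \<Rightarrow> complex option) \<Rightarrow> complex) set set" where
  "germs S = germ S ` hol_near S"

definition origin :: "('n::finite \<Rightarrow> complex option) set" where
  "origin = {emb 0}"

definition hat_set :: "('n::finite \<Rightarrow> complex set) \<Rightarrow> complex ^ 'n \<Rightarrow> 'n \<Rightarrow> complex option set" where
  "hat_set Om z j = UNIV - map_option (\<lambda>a. z $ j * a) ` recip_set (Om j)"

definition hat_family :: "('n::finite \<Rightarrow> complex set) \<Rightarrow> ('n \<Rightarrow> complex option) set set" where
  "hat_family Om = {Pi UNIV (hat_set Om z) |z. z \<in> cart Om \<and> (\<forall>j. z $ j \<noteq> 0)}"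

definition ext_germs :: "('n::finite \<Rightarrow> complex set) \<Rightarrow> (('n \<Rightarrow> complex option) \<Rightarrow> complex) set set" where
  "ext_germs Om = {F \<in> germs origin. \<forall>S\<in>hat_family Om. \<exists>G\<in>germs S.
     \<exists>f\<in>F. \<exists>g\<in>G. eq_near origin f g}"

definition series_germ :: "(('n::finite \<Rightarrow> nat) \<Rightarrow> complex) \<Rightarrow> (('n \<Rightarrow> complex option) \<Rightarrow> complex) set"
  where "series_germ a = germ origin (\<lambda>x. \<Sum>\<^sub>\<infinity>\<alpha>. a \<alpha> * mono_fun \<alpha> (fin_part x))"

definition taylor :: "(('n::finite \<Rightarrow> complex option) \<Rightarrow> complex) set \<Rightarrow> ('n \<Rightarrow> nat) \<Rightarrow> complex" where
  "taylor F = (THE a. \<exists>f\<in>F. \<forall>\<^sub>F w in nhds 0.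
     ((\<lambda>\<alpha>. a \<alpha> * mono_fun \<alpha> w) has_sum f (emb w)) UNIV)"

definition germ_algebra :: "('n::finite \<Rightarrow> complex set) \<Rightarrow>
  (complex, (('n \<Rightarrow> complex option) \<Rightarrow> complex) set) module" where
  "germ_algebra Om =
    \<lparr> carrier = ext_germs Om,
      mult = (\<lambda>F G. series_germ (\<lambda>\<alpha>. taylor F \<alpha> * taylor G \<alpha>)),
      one = series_germ (\<lambda>\<alpha>. 1),
      zero = germ origin (\<lambda>x. 0),
      add = (\<lambda>F G. \<Union>f\<in>F. \<Union>g\<in>G. germ origin (\<lambda>x. f x + g x)),
      smult = (\<lambda>c F. \<Union>f\<in>F. germ origin (\<lambda>x. c * f x)) \<rparr>"

definition Psi_hat :: "(complex ^ 'n::finite) set \<Rightarrow>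
  ((complex ^ 'n \<Rightarrow> complex) \<Rightarrow> (complex ^ 'n \<Rightarrow> complex)) \<Rightarrow>
  (('n \<Rightarrow> complex option) \<Rightarrow> complex) set" where
  "Psi_hat \<Omega> M = series_germ (mult_seq \<Omega> M)"

section \<open>The integral formula\<close>

text \<open>\<open>g\<close> extends the germ \<open>\<psi>\<close> at the origin to the neighbourhood \<open>\<Prod>\<^sub>j Uh j\<close> of the set in
  \<open>hat_family\<close> given by \<open>z\<close>; membership in \<open>\<psi>\<close> says that \<open>g\<close> represents the germ.\<close>

definition is_extension :: "('n::finite \<Rightarrow> complex set) \<Rightarrow> complex ^ 'n \<Rightarrow>
  (('n \<Rightarrow> complex option) \<Rightarrow> complex) set \<Rightarrow> ('n \<Rightarrow> complex option set) \<Rightarrow>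
  (('n \<Rightarrow> complex option) \<Rightarrow> complex) \<Rightarrow> bool" where
  "is_extension Om z \<psi> Uh g \<longleftrightarrow>
     (\<forall>j. openin rsphere (Uh j) \<and> hat_set Om z j \<subseteq> Uh j) \<and>
     sphere_hol0 g (Pi UNIV Uh) \<and> g \<in> \<psi>"

text \<open>A finite union of closed curves is a list of closed piecewise \<open>C\<^sup>1\<close> paths.\<close>

definition cycle_winding :: "(real \<Rightarrow> complex) list \<Rightarrow> complex \<Rightarrow> complex" where
  "cycle_winding \<Gamma> p = (\<Sum>c\<leftarrow>\<Gamma>. winding_number c p)"

definition admissible_cycles :: "('n::finite \<Rightarrow> complex set) \<Rightarrow> complex ^ 'n \<Rightarrow>
  ('n \<Rightarrow> complex option set) \<Rightarrow> ('n \<Rightarrow> (real \<Rightarrow> complex) list) \<Rightarrow> bool" where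
  "admissible_cycles Om z Uh \<gamma> \<longleftrightarrow> (\<forall>j.
     let U = sphere_inv ` Uh j; V = (\<lambda>a. a / z $ j) ` Om j in
       (\<forall>c\<in>set (\<gamma> j). valid_path c \<and> pathfinish c = pathstart c \<and>
          path_image c \<subseteq> ({w. Some w \<in> U} \<inter> V) - {0}) \<and>
       (\<forall>p. Some p \<notin> U \<longrightarrow> cycle_winding (\<gamma> j) p = 1) \<and>
       (\<forall>p. p \<notin> V \<longrightarrow> cycle_winding (\<gamma> j) p = 0))"

text \<open>The integral of \<open>F\<close> over \<open>\<Gamma>\<^sub>1 \<times> \<cdots> \<times> \<Gamma>\<^sub>n\<close>: the sum, over all choices \<open>k\<close> of one curve from each
  \<open>\<Gamma>\<^sub>j\<close>, of the pulled back integrals over the unit cube.\<close>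

definition cycle_integral :: "('n::finite \<Rightarrow> (real \<Rightarrow> complex) list) \<Rightarrow>
  (complex ^ 'n \<Rightarrow> complex) \<Rightarrow> complex" where
  "cycle_integral \<Gamma> F = (\<Sum>k\<in>{k. \<forall>j. k j < length (\<Gamma> j)}.
     integral (cbox 0 1 :: (real ^ 'n) set)
       (\<lambda>t. F (\<chi> j. (\<Gamma> j ! k j) (t $ j)) *
            (\<Prod>j\<in>UNIV. vector_derivative (\<Gamma> j ! k j) (at (t $ j) within {0..1}))))"

definition inv_cycle :: "(real \<Rightarrow> complex) list \<Rightarrow> (real \<Rightarrow> complex) list" where
  "inv_cycle \<Gamma> = map (\<lambda>c t. 1 / c t) \<Gamma>"

end

theory Submission
  imports Defs
begin

text \<open>
  Given \<open>\<psi> = \<Sum> m\<^sub>\<alpha> w\<^sup>\<alpha>\<close> with its extensions, Cauchy's theorem for cycles, applied in each variable,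
  moves the cycles of the integral formula to large circles when \<open>f\<close> is a monomial, where the
  expansion of \<open>\<psi>\<close> at the origin gives the value \<open>m\<^sub>\<alpha> z\<^sup>\<alpha>\<close>. So the integral bounds the operator
  \<open>z\<^sup>\<alpha> \<mapsto> m\<^sub>\<alpha> z\<^sup>\<alpha>\<close> on polynomials by suprema over compact subsets of \<open>\<Omega>\<close>, locally uniformly near points
  with non-zero coordinates and, by the maximum principle on polydiscs, near all points of \<open>\<Omega>\<close>.
  Since \<open>\<Omega>\<close> is Runge, the operator extends to \<open>H(\<Omega>)\<close>. Cycles exist because the factors of a Runge
  domain are simply connected.

  Conversely, for a multiplier \<open>M\<close> the functional \<open>f \<mapsto> M f z\<close> is bounded by the supremum over a compact
  set \<open>K\<close> and extends to the uniform limits of polynomials on \<open>K\<close>. Applied to the Cauchy kernel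
  \<open>\<zeta> \<mapsto> \<Prod>\<^sub>j 1 / (1 - x\<^sub>j \<zeta>\<^sub>j / z\<^sub>j)\<close>, which is such a limit for all \<open>x\<close> in a neighbourhood of the set of
  the family given by \<open>z\<close>, it yields the extension of \<open>\<Sum> m\<^sub>\<alpha> w\<^sup>\<alpha>\<close>. A multiplier is determined by its
  sequence, so the algebraic assertions reduce to identities between coefficients.
\<close>

text \<open>The power series of \<open>\<psi>\<close> is known only near the origin, whereas
  \<open>f\<close> may live far from it. Monomials bridge the gap: being entire in \<open>w\<close>,
  they let the cycles be pushed out to circles on which \<open>1 / w\<close> is small, whatever
  \<open>\<Omega>\<close> is. The obstacle is the pole of \<open>w ^ k / w\<close> at
  \<open>0\<close> for \<open>k = 0\<close>; it is cancelled by the vanishing of the extension at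
  infinity. The formula concerns only points without zero coordinates, but one cycle serves all
  nearby points as well, and a torus avoiding the coordinate hyperplanes controls the rest of
  \<open>\<Omega>\<close>. In the converse direction the Runge property yields the kernel only for
  \<open>x\<close> in a closed set, while an extension needs an open one. Being a uniform limit of
  polynomials is an open condition on the kernel, because inverses can be perturbed by a Neumann
  series; homogeneous coordinates make this work at infinity too. Several variables are treated one
  at a time, so that essentially only one-variable complex analysis enters.\<close>

no_notation fps_nth (infixl "$" 75)

subsection \<open>Separately holomorphic functions\<close>

definition vupd :: "'a ^ 'n \<Rightarrow> 'n \<Rightarrow> 'a \<Rightarrow> 'a ^ 'n" where
  "vupd w j x = (\<chi> i. if i = j then x else w $ i)"

lemma vupd_nth [simp]: "vupd w j x $ i = (if i = j then x else w $ i)"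
  by (simp add: vupd_def)

lemma vupd_vupd [simp]: "vupd (vupd w j x) j y = vupd w j y"
  by (simp add: vec_eq_iff)

lemma vupd_same [simp]: "vupd w j (w $ j) = w"
  by (simp add: vec_eq_iff)

lemma vupd_commute: "i \<noteq> j \<Longrightarrow> vupd (vupd w j x) i y = vupd (vupd w i y) j x"
  by (auto simp: vec_eq_iff)

lemma vupd_in_cart: "w \<in> cart D \<Longrightarrow> x \<in> D j \<Longrightarrow> vupd w j x \<in> cart D"
  by (simp add: cart_def)

lemma continuous_on_vupd [continuous_intros]:
  fixes f :: "'b::topological_space \<Rightarrow> 'a::topological_space ^ 'n"
  assumes "continuous_on S f" "continuous_on S g"
  shows "continuous_on S (\<lambda>x. vupd (f x) j (g x))"
  unfolding vupd_def
proof (rule continuous_on_vec_lambda)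
  fix i show "continuous_on S (\<lambda>x. if i = j then g x else f x $ i)"
    by (cases "i = j") (auto intro!: assms continuous_on_component)
qed

lemma open_cart: "(\<And>j. open (D j)) \<Longrightarrow> open (cart D)"
  unfolding cart_def by (rule open_vector_box) simp

lemma compact_cart:
  assumes "\<And>j. compact (K j)"
  shows "compact (cart K :: (complex ^ 'n::finite) set)"
proof -
  have "bounded (cart K)"
  proof -
    have "\<forall>j. \<exists>B. \<forall>x\<in>K j. norm x \<le> B"
      using assms by (simp add: compact_imp_bounded flip: bounded_iff)
    then obtain B where B: "\<And>j x. x \<in> K j \<Longrightarrow> norm x \<le> B j" by metis
    have "norm w \<le> (\<Sum>j\<in>UNIV. B j)" if "w \<in> cart K" for w
    proof -
      have "norm w \<le> (\<Sum>j\<in>UNIV. norm (w $ j))" by (metis L2_set_le_sum norm_vec_def norm_ge_zero)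
      also have "\<dots> \<le> (\<Sum>j\<in>UNIV. B j)"
        by (rule sum_mono) (use that B in \<open>auto simp: cart_def\<close>)
      finally show ?thesis .
    qed
    then show ?thesis by (auto simp: bounded_iff)
  qed
  moreover have "closed (cart K)"
    unfolding cart_def by (rule closed_vector_box) (simp add: assms compact_imp_closed)
  ultimately show ?thesis by (simp add: compact_eq_bounded_closed)
qed

text \<open>On open products this is equivalent to \<open>holo\<close> by Osgood's lemma. The
  separate form passes directly through contour integrals in a single variable.\<close>

definition csh :: "(complex ^ 'n::finite \<Rightarrow> complex) \<Rightarrow> ('n \<Rightarrow> complex set) \<Rightarrow> bool" where
  "csh F D \<longleftrightarrow> continuous_on (cart D) F \<and>
     (\<forall>w\<in>cart D. \<forall>j. (\<lambda>x. F (vupd w j x)) holomorphic_on D j)"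

lemma csh_continuous: "csh F D \<Longrightarrow> continuous_on (cart D) F"
  by (simp add: csh_def)

lemma csh_slice: "csh F D \<Longrightarrow> w \<in> cart D \<Longrightarrow> (\<lambda>x. F (vupd w j x)) holomorphic_on D j"
  by (simp add: csh_def)

lemma cart_mono: "(\<And>j. D' j \<subseteq> D j) \<Longrightarrow> cart D' \<subseteq> cart D"
  by (auto simp: cart_def)

lemma csh_subset: "csh F D \<Longrightarrow> (\<And>j. D' j \<subseteq> D j) \<Longrightarrow> csh F D'"
  unfolding csh_def using cart_mono[of D' D]
  by (meson continuous_on_subset holomorphic_on_subset subsetD)

lemma csh_cong:
  assumes "csh F D" "\<And>w. w \<in> cart D \<Longrightarrow> F w = G w"
  shows "csh G D"
  unfolding csh_def
proof (intro conjI ballI allI)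
  show "continuous_on (cart D) G"
    using assms continuous_on_cong[of "cart D" "cart D" F G] by (auto simp: csh_def)
  fix w j assume w: "w \<in> cart D"
  show "(\<lambda>x. G (vupd w j x)) holomorphic_on D j"
    using csh_slice[OF assms(1) w]
    by (rule holomorphic_transform) (simp add: assms(2) vupd_in_cart w)
qed

lemma csh_const [simp, intro]: "csh (\<lambda>w. c) D"
  by (simp add: csh_def)

lemma csh_add [intro]: "csh F D \<Longrightarrow> csh G D \<Longrightarrow> csh (\<lambda>w. F w + G w) D"
  by (auto simp: csh_def intro!: continuous_intros holomorphic_intros)

lemma csh_mult [intro]: "csh F D \<Longrightarrow> csh G D \<Longrightarrow> csh (\<lambda>w. F w * G w) D"
  by (auto simp: csh_def intro!: continuous_intros holomorphic_intros)

lemma csh_diff [intro]: "csh F D \<Longrightarrow> csh G D \<Longrightarrow> csh (\<lambda>w. F w - G w) D"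
  by (auto simp: csh_def intro!: continuous_intros holomorphic_intros)

lemma csh_sum [intro]: "(\<And>i. i \<in> A \<Longrightarrow> csh (F i) D) \<Longrightarrow> csh (\<lambda>w. \<Sum>i\<in>A. F i w) D"
  by (induction A rule: infinite_finite_induct) auto

lemma csh_prod [intro]: "(\<And>i. i \<in> A \<Longrightarrow> csh (F i) D) \<Longrightarrow> csh (\<lambda>w. \<Prod>i\<in>A. F i w) D"
  by (induction A rule: infinite_finite_induct) auto

lemma csh_coord:
  assumes "f holomorphic_on D j"
  shows "csh (\<lambda>w. f (w $ j)) D"
  unfolding csh_def
proof (intro conjI ballI allI)
  show "continuous_on (cart D) (\<lambda>w. f (w $ j))"
    by (rule continuous_on_compose2[OF holomorphic_on_imp_continuous_on[OF assms]])
       (auto simp: cart_def intro!: continuous_intros)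
  fix w i assume "w \<in> cart D"
  show "(\<lambda>x. f (vupd w i x $ j)) holomorphic_on D i"
    using assms by (cases "i = j") auto
qed

lemma csh_compose_coord:
  assumes "csh F D'" "\<And>j. \<phi> j holomorphic_on D j" "\<And>j. \<phi> j ` D j \<subseteq> D' j"
  shows "csh (\<lambda>w. F (\<chi> j. \<phi> j (w $ j))) D"
  unfolding csh_def
proof (intro conjI ballI allI)
  have c: "continuous_on (cart D) (\<lambda>w. \<phi> j (w $ j))" for j
    using csh_coord[OF assms(2)] by (rule csh_continuous)
  show "continuous_on (cart D) (\<lambda>w. F (\<chi> j. \<phi> j (w $ j)))"
    by (rule continuous_on_compose2[OF csh_continuous[OF assms(1)]])
       (use assms(3) in \<open>auto simp: cart_def intro!: continuous_on_vec_lambda c[unfolded cart_def], blast\<close>)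
  fix w j assume w: "w \<in> cart D"
  have eq: "(\<chi> i. \<phi> i (vupd w j x $ i)) = vupd (\<chi> i. \<phi> i (w $ i)) j (\<phi> j x)" for x
    by (simp add: vec_eq_iff)
  have "(\<chi> i. \<phi> i (w $ i)) \<in> cart D'"
    using w assms(3) by (auto simp: cart_def)
  then have "((\<lambda>x. F (vupd (\<chi> i. \<phi> i (w $ i)) j x)) \<circ> \<phi> j) holomorphic_on D j"
    using assms(3) by (intro holomorphic_on_compose_gen[OF assms(2), of _ "D' j"] csh_slice[OF assms(1)]) auto
  then show "(\<lambda>x. F (\<chi> i. \<phi> i (vupd w j x $ i))) holomorphic_on D j"
    by (simp only: eq o_def)
qed

text \<open>The difference of two neighbouring slices is uniformly small on a disc, by joint
  continuity and compactness of the disc; Cauchy's inequality turns this into closeness of the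
  derivatives. What remains is continuity of the derivative along one fixed slice.\<close>

lemma csh_partial_continuous:
  assumes F: "csh F D" and op: "\<And>j. open (D j)"
  shows "continuous_on (cart D) (\<lambda>w. deriv (\<lambda>x. F (vupd w j x)) (w $ j))"
proof -
  let ?d = "\<lambda>w x. deriv (\<lambda>x. F (vupd w j x)) x"
  have "\<exists>d>0. \<forall>w\<in>cart D. dist w w0 < d \<longrightarrow> dist (?d w (w $ j)) (?d w0 (w0 $ j)) < e"
    if w0: "w0 \<in> cart D" and e: "0 < e" for w0 e
  proof -
    have "w0 $ j \<in> D j" using w0 by (simp add: cart_def)
    then obtain r where r: "0 < r" "cball (w0 $ j) r \<subseteq> D j"
      using op open_contains_cball by meson
    let ?K = "cball (w0 $ j) r"
    have "continuous_on (cart D \<times> ?K) (\<lambda>p. F (vupd (fst p) j (snd p)))"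
      by (rule continuous_on_compose2[OF csh_continuous[OF F]])
         (use r in \<open>auto intro!: continuous_intros vupd_in_cart\<close>)
    \<comment> \<open>Cauchy's inequality on a disc of radius \<open>r / 2\<close> will turn the
      bound \<open>e * r / 8\<close> into \<open>e / 4\<close>.\<close>
    moreover have "0 < e * r / 8" using e r by simp
    ultimately obtain X0 where X0: "w0 \<in> X0" "open X0"
      "\<forall>w\<in>X0 \<inter> cart D. \<forall>x\<in>?K. dist (F (vupd w j x)) (F (vupd w0 j x)) \<le> e * r / 8"
      by (rule continuous_on_prod_compactE[OF _ compact_cball w0]) auto
    obtain d1 where d1: "d1 > 0" "ball w0 d1 \<subseteq> X0" using X0 open_contains_ball by meson
    have "(\<lambda>x. deriv (\<lambda>x. F (vupd w0 j x)) x) holomorphic_on D j"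
      by (rule holomorphic_deriv[OF csh_slice[OF F w0] op])
    then have "continuous_on (D j) (\<lambda>x. ?d w0 x)"
      by (rule holomorphic_on_imp_continuous_on)
    then obtain d2 where d2: "d2 > 0" "\<And>x. x \<in> D j \<Longrightarrow> dist x (w0 $ j) < d2 \<Longrightarrow>
        dist (?d w0 x) (?d w0 (w0 $ j)) < e / 2"
      using \<open>w0 $ j \<in> D j\<close> e unfolding continuous_on_iff by (meson half_gt_zero)
    let ?d' = "min (min d1 d2) (r / 2)"
    have "dist (?d w (w $ j)) (?d w0 (w0 $ j)) < e" if w: "w \<in> cart D" and wd: "dist w w0 < ?d'" for w
    proof -
      have wj: "dist (w $ j) (w0 $ j) < ?d'" using dist_vec_nth_le[of w j w0] wd by linarith
      have sub: "cball (w $ j) (r/2) \<subseteq> ?K"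
        using wj by (intro subsetI) (smt (verit) dist_triangle dist_commute mem_cball field_sum_of_halves)
      let ?\<psi> = "\<lambda>x. F (vupd w j x) - F (vupd w0 j x)"
      have h1: "(\<lambda>x. F (vupd w j x)) holomorphic_on D j" "(\<lambda>x. F (vupd w0 j x)) holomorphic_on D j"
        using csh_slice[OF F] w w0 by auto
      have hol: "?\<psi> holomorphic_on D j" using h1 by (intro holomorphic_intros)
      have "norm ((deriv ^^ 1) ?\<psi> (w $ j)) \<le> fact 1 * (e * r / 8) / (r/2) ^ 1"
      proof (rule Cauchy_inequality)
        show "?\<psi> holomorphic_on ball (w $ j) (r/2)"
          using hol sub r(2) by (meson ball_subset_cball holomorphic_on_subset subset_trans)
        show "continuous_on (cball (w $ j) (r/2)) ?\<psi>"
          using hol sub r(2) by (meson holomorphic_on_imp_continuous_on continuous_on_subset subset_trans)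
        show "0 < r/2" using r by simp
        fix x assume "norm (w $ j - x) = r/2"
        then have "x \<in> ?K" using sub by (auto simp: dist_norm)
        then show "norm (?\<psi> x) \<le> e * r / 8"
          using X0(3) d1 w wd by (force simp: dist_norm dist_commute norm_minus_commute)
      qed
      also have "\<dots> = e / 4" using r by (simp add: field_simps)
      finally have "norm (deriv ?\<psi> (w $ j)) \<le> e / 4" by simp
      moreover have "w $ j \<in> D j" using w by (simp add: cart_def)
      then have "deriv ?\<psi> (w $ j) = ?d w (w $ j) - ?d w0 (w $ j)"
        using h1 op holomorphic_on_imp_differentiable_at by (intro deriv_diff) blast+
      ultimately have "dist (?d w (w $ j)) (?d w0 (w $ j)) \<le> e / 4" by (simp add: dist_norm)
      moreover have "dist (?d w0 (w $ j)) (?d w0 (w0 $ j)) < e / 2"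
        using d2 wj \<open>w $ j \<in> D j\<close> by auto
      ultimately show ?thesis
        using dist_triangle[of "?d w (w $ j)" "?d w0 (w0 $ j)" "?d w0 (w $ j)"] e by linarith
    qed
    moreover have "?d' > 0" using d1 d2 r by simp
    ultimately show ?thesis by blast
  qed
  then show ?thesis unfolding continuous_on_iff by blast
qed

text \<open>The increment is split into steps that change one coordinate at a time. On each step the
  mean value inequality is applied to the slice minus its linear part, whose derivative is small by
  continuity of the partial derivatives.\<close>

lemma holo_if_continuous_partials:
  assumes U: "open U"
    and der: "\<And>z i. z \<in> U \<Longrightarrow> ((\<lambda>x. F (vupd z i x)) has_field_derivative D i z) (at (z $ i))"
    and cont: "\<And>i. continuous_on U (D i)"
  shows "holo F (U :: (complex ^ 'n::finite) set)"
  unfolding holo_def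
proof
  fix z assume z: "z \<in> U"
  let ?L = "\<lambda>v::complex ^ 'n. \<Sum>i\<in>UNIV. D i z * v $ i"
  have bl: "bounded_linear ?L"
    by (intro bounded_linear_sum bounded_linear_mult_right bounded_linear_compose[OF bounded_linear_mult_right]
        bounded_linear_vec_nth)
  have key: "\<exists>d>0. \<forall>y. norm (y - z) < d \<longrightarrow> norm (F y - F z - ?L (y - z)) \<le> e * norm (y - z)"
    if "e > 0" for e
  proof -
    let ?e = "e / CARD('n)"
    have e: "?e > 0" using that by simp
    obtain d0 where d0: "d0 > 0" "ball z d0 \<subseteq> U" using U z open_contains_ball by meson
    have "\<forall>i. \<exists>d>0. \<forall>y\<in>U. dist y z < d \<longrightarrow> dist (D i y) (D i z) < ?e"
      using cont z e unfolding continuous_on_iff by blast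
    then obtain dd where dd: "\<And>i. dd i > 0" "\<And>i y. y \<in> U \<Longrightarrow> dist y z < dd i \<Longrightarrow> dist (D i y) (D i z) < ?e"
      by metis
    define d where "d = min d0 (Min (range dd))"
    have d: "d > 0" "\<And>i. d \<le> dd i" "d \<le> d0" using d0 dd by (auto simp: d_def min.coboundedI2)
    have "norm (F y - F z - ?L (y - z)) \<le> e * norm (y - z)" if y: "norm (y - z) < d" for y
    proof -
      define v where "v = y - z"
      \<comment> \<open>The point in which only the coordinates in \<open>S\<close> have been
        displaced; the induction on \<open>S\<close> below adds one step at a time.\<close>
      define w where "w S = z + (\<chi> i. if i \<in> S then v $ i else 0)" for S
      have wS: "norm ((\<chi> i. if i \<in> S then x i else 0) :: complex ^ 'n) \<le> norm v"
        if "\<And>i. i \<in> S \<Longrightarrow> norm (x i) \<le> norm (v $ i)" for S x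
        by (rule norm_le_componentwise_cart) (use that in auto)
      have "norm (F (w S) - F z - (\<Sum>i\<in>S. D i z * v $ i)) \<le> (\<Sum>i\<in>S. ?e * norm (v $ i))" for S
        using finite[of S]
      proof (induction S)
        case empty
        then show ?case by (simp add: w_def zero_vec_def[symmetric])
      next
        case (insert i S)
        let ?s = "closed_segment (z $ i) (z $ i + v $ i)"
        have wi: "w S = vupd (w S) i (z $ i)" "w (insert i S) = vupd (w S) i (z $ i + v $ i)"
          using insert(2) by (auto simp: w_def vec_eq_iff)
        let ?f = "\<lambda>x. F (vupd (w S) i x) - D i z * x"
        have inU: "vupd (w S) i x \<in> U \<and> dist (vupd (w S) i x) z < dd i" if x: "x \<in> ?s" for x
        proof -
          have "vupd (w S) i x - z = (\<chi> k. if k \<in> insert i S then (if k = i then x - z $ i else v $ k) else 0)"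
            using insert(2) by (auto simp: w_def vec_eq_iff)
          moreover have "norm (x - z $ i) \<le> norm (v $ i)"
            using x segment_bound1[OF x] by simp
          ultimately have "norm (vupd (w S) i x - z) \<le> norm v"
            using wS[of "insert i S" "\<lambda>k. if k = i then x - z $ i else v $ k"] by simp
          then have "norm (vupd (w S) i x - z) < d" using y by (simp add: v_def)
          then show ?thesis using d(2)[of i] d(3) d0(2) by (auto simp: dist_norm norm_minus_commute subset_iff)
        qed
        have "norm (?f (z $ i + v $ i) - ?f (z $ i)) \<le> ?e * norm ((z $ i + v $ i) - z $ i)"
        proof (rule field_differentiable_bound[of ?s ?f "\<lambda>x. D i (vupd (w S) i x) - D i z"])
          show "convex ?s" by simp
          fix x assume x: "x \<in> ?s"
          have "((\<lambda>x. F (vupd (vupd (w S) i x) i x)) has_field_derivative D i (vupd (w S) i x)) (at x)"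
            using der[of "vupd (w S) i x" i] inU[OF x] by simp
          then have "((\<lambda>x. F (vupd (w S) i x)) has_field_derivative D i (vupd (w S) i x)) (at x)"
            by simp
          then have "(?f has_field_derivative D i (vupd (w S) i x) - D i z) (at x)"
            by (auto intro!: derivative_eq_intros)
          then show "(?f has_field_derivative D i (vupd (w S) i x) - D i z) (at x within ?s)"
            by (rule has_field_derivative_at_within)
          show "norm (D i (vupd (w S) i x) - D i z) \<le> ?e"
            using dd(2)[of "vupd (w S) i x" i] inU[OF x] by (simp add: dist_norm less_imp_le)
        qed auto
        then have "norm (F (w (insert i S)) - F (w S) - D i z * v $ i) \<le> ?e * norm (v $ i)"
          using wi by (simp add: algebra_simps)
        moreover have "F (w (insert i S)) - F z - (\<Sum>k\<in>insert i S. D k z * v $ k) =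
            (F (w S) - F z - (\<Sum>k\<in>S. D k z * v $ k)) + (F (w (insert i S)) - F (w S) - D i z * v $ i)"
          by (simp add: sum.insert[OF insert(1,2)])
        moreover have "(\<Sum>k\<in>insert i S. ?e * norm (v $ k)) = (\<Sum>k\<in>S. ?e * norm (v $ k)) + ?e * norm (v $ i)"
          by (simp add: sum.insert[OF insert(1,2)])
        ultimately show ?case
          using norm_triangle_mono[OF insert(3), of "F (w (insert i S)) - F (w S) - D i z * v $ i" "?e * norm (v $ i)"]
          by (simp only:)
      qed
      from this[of UNIV] have "norm (F y - F z - ?L v) \<le> (\<Sum>i\<in>UNIV. ?e * norm (v $ i))"
        by (simp only: w_def UNIV_I if_True vec_lambda_eta) (simp only: v_def add_diff_cancel_left' add_diff_eq)
      also have "\<dots> \<le> (\<Sum>i\<in>(UNIV::'n set). ?e * norm v)"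
        by (rule sum_mono) (rule mult_left_mono[OF Finite_Cartesian_Product.norm_nth_le less_imp_le[OF e]])
      also have "\<dots> = e * norm v" by simp
      finally show ?thesis by (simp add: v_def)
    qed
    then show ?thesis using d by blast
  qed
  have "(F has_derivative ?L) (at z)"
    unfolding has_derivative_at_alt using bl key by blast
  moreover have "?L (c *s v) = c * ?L v" for c v
    by (simp add: sum_distrib_left mult.assoc mult.left_commute)
  ultimately show "\<exists>D. (F has_derivative D) (at z) \<and> (\<forall>c v. D (c *s v) = c * D v)" by blast
qed

lemma csh_imp_holo:
  assumes "csh F D" "\<And>j. open (D j)"
  shows "holo F (cart D)"
proof (rule holo_if_continuous_partials[of "cart D" F "\<lambda>j w. deriv (\<lambda>x. F (vupd w j x)) (w $ j)"])
  show "open (cart D)" using assms(2) by (rule open_cart)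
  fix z i assume "z \<in> cart D"
  then have "(\<lambda>x. F (vupd z i x)) holomorphic_on D i" "z $ i \<in> D i"
    using assms(1) by (auto simp: csh_slice cart_def)
  then show "((\<lambda>x. F (vupd z i x)) has_field_derivative deriv (\<lambda>x. F (vupd z i x)) (z $ i)) (at (z $ i))"
    using assms(2) by (intro DERIV_deriv_iff_field_differentiable[THEN iffD2] holomorphic_on_imp_differentiable_at)
qed (rule csh_partial_continuous[OF assms])

lemma holo_slice:
  assumes "holo F U" "vupd w j x \<in> U"
  shows "(\<lambda>x. F (vupd w j x)) field_differentiable at x"
proof -
  obtain D where D: "(F has_derivative D) (at (vupd w j x))" "\<And>c v. D (c *s v) = c * D v"
    using assms by (auto simp: holo_def)
  have eq: "vupd w j y = vupd w j 0 + y *s axis j 1" for y :: complex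
    by (simp add: vec_eq_iff axis_def)
  have "((\<lambda>y. vupd w j 0 + y *s axis j 1) has_derivative (\<lambda>h. h *s axis j 1)) (at x)"
  proof -
    have "linear (\<lambda>h::complex. h *s (axis j 1 :: complex ^ 'a))"
      by (rule linearI) (auto simp: vec_eq_iff algebra_simps)
    then have "bounded_linear (\<lambda>h::complex. h *s (axis j 1 :: complex ^ 'a))"
      by (simp add: linear_linear)
    then show ?thesis
      by (auto intro!: derivative_eq_intros dest: bounded_linear_imp_has_derivative)
  qed
  then have "((\<lambda>y. vupd w j y) has_derivative (\<lambda>h. h *s axis j 1)) (at x)"
    by (simp flip: eq)
  from diff_chain_at[OF this D(1)] have "((\<lambda>x. F (vupd w j x)) has_derivative (\<lambda>h. h * D (axis j 1))) (at x)"
    by (simp add: o_def D(2))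
  then have "((\<lambda>x. F (vupd w j x)) has_field_derivative D (axis j 1)) (at x)"
    by (simp add: has_field_derivative_def mult.commute[of _ "D _"])
  then show ?thesis by (auto simp: field_differentiable_def)
qed

lemma holo_imp_continuous_on: "holo F U \<Longrightarrow> continuous_on U F"
  unfolding holo_def
  by (meson continuous_at_imp_continuous_on has_derivative_continuous)

lemma holo_subset: "holo F U \<Longrightarrow> V \<subseteq> U \<Longrightarrow> holo F V"
  by (auto simp: holo_def)

lemma holo_imp_csh:
  assumes "holo F (cart D)"
  shows "csh F D"
proof -
  have "(\<lambda>x. F (vupd w j x)) field_differentiable (at x within D j)" if "w \<in> cart D" "x \<in> D j" for w j x
    using holo_slice[OF assms vupd_in_cart[of w D x j, OF that]] by (rule field_differentiable_at_within)
  then show ?thesis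
    unfolding csh_def holomorphic_on_def using holo_imp_continuous_on[OF assms] by blast
qed

lemma holo_cart_iff: "(\<And>j. open (D j)) \<Longrightarrow> holo F (cart D) \<longleftrightarrow> csh F D"
  using csh_imp_holo holo_imp_csh by blast

section \<open>Local criteria and uniform limits of holomorphic functions\<close>

lemma polydisc_in_open:
  fixes U :: "(complex ^ 'n::finite) set"
  assumes "open U" "z \<in> U"
  obtains r where "r > 0" "cart (\<lambda>j. cball (z $ j) r) \<subseteq> U"
proof -
  obtain e where e: "e > 0" "ball z e \<subseteq> U" using assms open_contains_ball by meson
  let ?r = "e / (2 * CARD('n))"
  have "w \<in> U" if "w \<in> cart (\<lambda>j. cball (z $ j) ?r)" for w
  proof -
    have "norm (w - z) \<le> (\<Sum>j\<in>UNIV. norm ((w - z) $ j))" by (metis L2_set_le_sum norm_vec_def norm_ge_zero)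
    also have "\<dots> \<le> (\<Sum>j\<in>(UNIV::'n set). ?r)"
      by (rule sum_mono) (use that in \<open>auto simp: cart_def dist_norm norm_minus_commute\<close>)
    also have "\<dots> = e / 2" by simp
    finally show ?thesis using e by (auto simp: dist_norm norm_minus_commute subset_iff)
  qed
  then show ?thesis using that[of ?r] e by auto
qed

lemma holo_local:
  assumes "\<And>z. z \<in> U \<Longrightarrow> \<exists>V. z \<in> V \<and> holo F V"
  shows "holo F U"
  using assms unfolding holo_def by blast

lemma holo_cong_open:
  assumes "holo F U" "open U" "\<And>z. z \<in> U \<Longrightarrow> F z = G z"
  shows "holo G U"
  unfolding holo_def
proof
  fix z assume z: "z \<in> U"
  then obtain D where "(F has_derivative D) (at z)" "\<forall>c v. D (c *s v) = c * D v"
    using assms(1) by (auto simp: holo_def)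
  moreover have "(G has_derivative D) (at z)"
    using calculation(1) assms(2) z by (rule has_derivative_transform_within_open) (use assms in auto)
  ultimately show "\<exists>D. (G has_derivative D) (at z) \<and> (\<forall>c v. D (c *s v) = c * D v)" by blast
qed

text \<open>By Osgood's lemma, Weierstrass's theorem in each variable suffices: on a small polydisc
  the uniform limit is continuous, and its slices are uniform limits of holomorphic
  functions.\<close>

lemma holo_uniform_limit:
  assumes U: "open U"
    and lim: "\<And>z. z \<in> U \<Longrightarrow> \<exists>r>0. ball z r \<subseteq> U \<and>
      (\<forall>e>0. \<exists>G. holo G U \<and> (\<forall>w\<in>ball z r. dist (G w) (F w) \<le> e))"
  shows "holo F U"
proof (rule holo_local)
  fix z assume "z \<in> U"
  then obtain r where r: "r > 0" "ball z r \<subseteq> U"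
    and G: "\<And>e. e > 0 \<Longrightarrow> \<exists>G. holo G U \<and> (\<forall>w\<in>ball z r. dist (G w) (F w) \<le> e)"
    using lim by blast
  have "\<forall>n. \<exists>G. holo G U \<and> (\<forall>w\<in>ball z r. dist (G w) (F w) \<le> inverse (Suc n))"
    by (intro allI G) simp
  then obtain g where g: "\<And>n. holo (g n) U" "\<And>n w. w \<in> ball z r \<Longrightarrow> dist (g n w) (F w) \<le> inverse (Suc n)"
    by metis
  obtain s where s: "s > 0" "cart (\<lambda>j. cball (z $ j) s) \<subseteq> ball z r"
    using polydisc_in_open[of "ball z r" z] r by auto
  let ?D = "\<lambda>j. ball (z $ j) s"
  have sub: "cart ?D \<subseteq> ball z r" using s cart_mono[of ?D "\<lambda>j. cball (z $ j) s"] by (meson ball_subset_cball subset_trans)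
  have ul: "uniform_limit (ball z r) g F sequentially"
    unfolding uniform_limit_iff
  proof (intro allI impI)
    fix e :: real assume "e > 0"
    then obtain N where N: "inverse (real (Suc N)) < e" using reals_Archimedean by blast
    show "\<forall>\<^sub>F n in sequentially. \<forall>x\<in>ball z r. dist (g n x) (F x) < e"
      unfolding eventually_sequentially
    proof (intro exI allI impI ballI)
      fix n x assume "N \<le> n" "x \<in> ball z r"
      then have "dist (g n x) (F x) \<le> inverse (real (Suc n))" using g by blast
      also have "\<dots> \<le> inverse (real (Suc N))" using \<open>N \<le> n\<close> by (simp add: field_simps)
      finally show "dist (g n x) (F x) < e" using N by linarith
    qed
  qed
  have csg: "csh (g n) ?D" for n
    using holo_subset[OF g(1)] sub r by (meson holo_imp_csh subset_trans)
  have "csh F ?D" unfolding csh_def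
  proof (intro conjI ballI allI)
    show "continuous_on (cart ?D) F"
      by (rule uniform_limit_theorem[OF _ uniform_limit_on_subset[OF ul sub]])
         (auto intro!: always_eventually csh_continuous csg)
    fix w j assume w: "w \<in> cart ?D"
    show "(\<lambda>x. F (vupd w j x)) holomorphic_on ?D j"
    proof (rule holomorphic_uniform_sequence[of _ "\<lambda>n x. g n (vupd w j x)"])
      show "(\<lambda>x. g n (vupd w j x)) holomorphic_on ?D j" for n using csh_slice[OF csg w] .
      fix x assume x: "x \<in> ?D j"
      obtain d where d: "d > 0" "cball x d \<subseteq> ?D j" using x open_contains_cball open_ball by meson
      have "uniform_limit (cball x d) (\<lambda>n x. g n (vupd w j x)) (\<lambda>x. F (vupd w j x)) sequentially"
        unfolding uniform_limit_iff
      proof (intro allI impI)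
        fix e :: real assume "e > 0"
        then have "\<forall>\<^sub>F n in sequentially. \<forall>x\<in>ball z r. dist (g n x) (F x) < e"
          using ul by (simp add: uniform_limit_iff)
        moreover have "vupd w j y \<in> ball z r" if "y \<in> cball x d" for y
          using vupd_in_cart[OF w, of y j] that d sub by blast
        ultimately show "\<forall>\<^sub>F n in sequentially. \<forall>y\<in>cball x d. dist (g n (vupd w j y)) (F (vupd w j y)) < e"
          by (elim eventually_mono) blast
      qed
      then show "\<exists>d>0. cball x d \<subseteq> ?D j \<and> uniform_limit (cball x d) (\<lambda>n x. g n (vupd w j x)) (\<lambda>x. F (vupd w j x)) sequentially"
        using d by blast
    qed simp
  qed
  then have "holo F (cart ?D)" by (rule csh_imp_holo) simp
  moreover have "z \<in> cart ?D" using s by (simp add: cart_def)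
  ultimately show "\<exists>V. z \<in> V \<and> holo F V" by blast
qed

subsection \<open>Iterated analytic functionals\<close>

text \<open>Polynomial paths have continuous, hence bounded, derivatives, so integrals over them can
  be estimated and differentiated under the integral sign; the derivative of a general piecewise C1
  path may be unbounded. The value of \<open>L\<close> is prescribed only on functions holomorphic
  on \<open>D\<close>.\<close>

definition afun :: "complex set \<Rightarrow> ((complex \<Rightarrow> complex) \<Rightarrow> complex) \<Rightarrow> bool" where
  "afun D L \<longleftrightarrow> (\<exists>ps. (\<forall>p\<in>set ps. polynomial_function p \<and> path_image p \<subseteq> D) \<and>
     (\<forall>f. f holomorphic_on D \<longrightarrow> L f = (\<Sum>p\<leftarrow>ps. contour_integral p f)))"

text \<open>Uniformly close paths with the same end points have the same integrals of holomorphic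
  functions, so the path can be exchanged for a polynomial approximation.\<close>

lemma afun_contour_integral:
  assumes "open D" "valid_path c" "path_image c \<subseteq> D"
  shows "afun D (contour_integral c)"
proof -
  have c: "path c" using assms(2) by (rule valid_path_imp_path)
  obtain d where d: "d > 0" and dd: "\<And>g h. \<lbrakk>valid_path g; valid_path h;
      \<forall>t\<in>{0..1}. norm (g t - c t) < d \<and> norm (h t - c t) < d;
      pathstart h = pathstart g \<and> pathfinish h = pathfinish g\<rbrakk> \<Longrightarrow>
      path_image h \<subseteq> D \<and> (\<forall>f. f holomorphic_on D \<longrightarrow> contour_integral h f = contour_integral g f)"
    using contour_integral_nearby_ends[OF assms(1) c assms(3)] by metis
  obtain p where p: "polynomial_function p" "pathstart p = pathstart c" "pathfinish p = pathfinish c"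
    "\<And>t. t \<in> {0..1} \<Longrightarrow> norm (p t - c t) < d"
    using path_approx_polynomial_function[OF c d] by metis
  have "path_image p \<subseteq> D \<and> (\<forall>f. f holomorphic_on D \<longrightarrow> contour_integral p f = contour_integral c f)"
    by (rule dd[of c p]) (use assms(2) p d in \<open>auto intro: valid_path_polynomial_function\<close>)
  then show ?thesis
    unfolding afun_def using p(1) by (intro exI[of _ "[p]"]) auto
qed

lemma afun_sum_list:
  assumes "\<And>x. x \<in> set xs \<Longrightarrow> afun D (L x)"
  shows "afun D (\<lambda>f. \<Sum>x\<leftarrow>xs. L x f)"
  using assms
proof (induction xs)
  case Nil
  show ?case by (auto simp: afun_def intro!: exI[of _ "[]"])
next
  case (Cons x xs)
  obtain ps where ps: "\<forall>p\<in>set ps. polynomial_function p \<and> path_image p \<subseteq> D"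
    "\<And>f. f holomorphic_on D \<Longrightarrow> L x f = (\<Sum>p\<leftarrow>ps. contour_integral p f)"
    using Cons.prems[of x] by (auto simp: afun_def)
  obtain qs where qs: "\<forall>p\<in>set qs. polynomial_function p \<and> path_image p \<subseteq> D"
    "\<And>f. f holomorphic_on D \<Longrightarrow> (\<Sum>x\<leftarrow>xs. L x f) = (\<Sum>p\<leftarrow>qs. contour_integral p f)"
    using Cons by (auto simp: afun_def)
  show ?case unfolding afun_def
    using ps qs by (intro exI[of _ "ps @ qs"]) auto
qed

lemma poly_path_integrable:
  assumes "polynomial_function p" "path_image p \<subseteq> D" "open D" "f holomorphic_on D"
  shows "f contour_integrable_on p"
  using assms by (meson contour_integrable_holomorphic_simple valid_path_polynomial_function)

lemma afun_add:
  assumes "afun D L" "open D" "f holomorphic_on D" "g holomorphic_on D"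
  shows "L (\<lambda>x. f x + g x) = L f + L g"
proof -
  obtain ps where ps: "\<And>p. p \<in> set ps \<Longrightarrow> polynomial_function p \<and> path_image p \<subseteq> D"
    "\<And>f. f holomorphic_on D \<Longrightarrow> L f = (\<Sum>p\<leftarrow>ps. contour_integral p f)"
    using assms(1) by (auto simp: afun_def)
  have "map (\<lambda>p. contour_integral p (\<lambda>x. f x + g x)) ps = map (\<lambda>p. contour_integral p f + contour_integral p g) ps"
    using ps(1) assms by (auto intro!: contour_integral_add poly_path_integrable[where D = D])
  then show ?thesis using assms by (simp add: ps(2) holomorphic_on_add sum_list_addf cong: map_cong)
qed

lemma afun_cmult:
  assumes "afun D L" "open D" "f holomorphic_on D"
  shows "L (\<lambda>x. c * f x) = c * L f"
proof -
  obtain ps where ps: "\<And>p. p \<in> set ps \<Longrightarrow> polynomial_function p \<and> path_image p \<subseteq> D"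
    "\<And>f. f holomorphic_on D \<Longrightarrow> L f = (\<Sum>p\<leftarrow>ps. contour_integral p f)"
    using assms(1) by (auto simp: afun_def)
  have "map (\<lambda>p. contour_integral p (\<lambda>x. c * f x)) ps = map (\<lambda>p. c * contour_integral p f) ps"
    using ps(1) assms by (auto intro!: contour_integral_lmul poly_path_integrable[where D = D])
  then show ?thesis using assms by (simp add: ps(2) holomorphic_on_mult sum_list_const_mult cong: map_cong)
qed

lemma afun_cong:
  assumes "afun D L" "f holomorphic_on D" "\<And>x. x \<in> D \<Longrightarrow> f x = g x"
  shows "L f = L g"
proof -
  obtain ps where ps: "\<And>p. p \<in> set ps \<Longrightarrow> polynomial_function p \<and> path_image p \<subseteq> D"
    "\<And>f. f holomorphic_on D \<Longrightarrow> L f = (\<Sum>p\<leftarrow>ps. contour_integral p f)"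
    using assms(1) by (auto simp: afun_def)
  have "map (\<lambda>p. contour_integral p f) ps = map (\<lambda>p. contour_integral p g) ps"
    using ps(1) assms by (auto intro!: contour_integral_eq)
  moreover have "g holomorphic_on D" using assms(2,3) by (rule holomorphic_transform) auto
  ultimately show ?thesis using assms by (simp add: ps(2) cong: map_cong)
qed

lemma poly_path_bound:
  assumes p: "polynomial_function p"
  obtains C where "C \<ge> 0" "\<And>f B. f contour_integrable_on p \<Longrightarrow> (\<And>x. x \<in> path_image p \<Longrightarrow> norm (f x) \<le> B) \<Longrightarrow>
    norm (contour_integral p f) \<le> C * B"
proof -
  obtain p' where p': "polynomial_function p'" "\<And>x. (p has_vector_derivative p' x) (at x)"
    using has_vector_derivative_polynomial_function[OF p] by metis
  have "bounded (p' ` {0..1})"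
    using continuous_on_polymonial_function[OF p'(1)]
    by (intro compact_imp_bounded compact_continuous_image) auto
  then obtain C where C: "C > 0" "\<And>x. x \<in> {0..1} \<Longrightarrow> norm (p' x) \<le> C"
    by (auto simp: bounded_pos)
  have "norm (contour_integral p f) \<le> C * B"
    if f: "f contour_integrable_on p" and B: "\<And>x. x \<in> path_image p \<Longrightarrow> norm (f x) \<le> B" for f B
  proof -
    have "((\<lambda>t. f (p t) * vector_derivative p (at t)) has_integral contour_integral p f) {0..1}"
      using has_contour_integral_integral[OF f] by (simp add: has_contour_integral)
    then have "((\<lambda>t. f (p t) * p' t) has_integral contour_integral p f) {0..1}"
      by (simp add: vector_derivative_at[OF p'(2)])
    moreover have pp: "p t \<in> path_image p" if "t \<in> {0..1}" for t
      using that by (simp add: path_image_def)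
    moreover have B0: "0 \<le> B"
      by (rule order_trans[OF norm_ge_zero B[OF pp[of 0]]]) simp
    moreover have "norm (f (p t) * p' t) \<le> C * B" if "t \<in> {0..1}" for t
      using mult_mono[OF B[OF pp[OF that]] C(2)[OF that]] B0 by (simp add: norm_mult mult.commute)
    ultimately show ?thesis
      using has_integral_bound[of "C * B" "\<lambda>t. f (p t) * p' t" _ 0 1] C by auto
  qed
  then show ?thesis using that C by (meson less_imp_le)
qed

text \<open>\<open>K\<close> is the union of the path images. This is continuity with respect to
  uniform convergence on compact sets, with constants independent of \<open>f\<close>.\<close>

lemma afun_bound:
  assumes L: "afun D L" and D: "open D"
  obtains K C where "compact K" "K \<subseteq> D" "C \<ge> 0"
    "\<And>f B. f holomorphic_on D \<Longrightarrow> B \<ge> 0 \<Longrightarrow> (\<And>x. x \<in> K \<Longrightarrow> norm (f x) \<le> B) \<Longrightarrow> norm (L f) \<le> C * B"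
proof -
  obtain ps where ps: "\<And>p. p \<in> set ps \<Longrightarrow> polynomial_function p \<and> path_image p \<subseteq> D"
    "\<And>f. f holomorphic_on D \<Longrightarrow> L f = (\<Sum>p\<leftarrow>ps. contour_integral p f)"
    using assms(1) by (auto simp: afun_def)
  have "\<forall>p\<in>set ps. \<exists>C\<ge>0. \<forall>f B. f contour_integrable_on p \<longrightarrow> (\<forall>x\<in>path_image p. norm (f x) \<le> B) \<longrightarrow>
    norm (contour_integral p f) \<le> C * B"
  proof
    fix p assume "p \<in> set ps"
    then have "polynomial_function p" using ps(1) by blast
    from poly_path_bound[OF this] show "\<exists>C\<ge>0. \<forall>f B. f contour_integrable_on p \<longrightarrow> (\<forall>x\<in>path_image p. norm (f x) \<le> B) \<longrightarrow>
      norm (contour_integral p f) \<le> C * B" by metis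
  qed
  then obtain C where C: "\<And>p. p \<in> set ps \<Longrightarrow> C p \<ge> 0" "\<And>p f B. p \<in> set ps \<Longrightarrow> f contour_integrable_on p \<Longrightarrow>
     (\<forall>x\<in>path_image p. norm (f x) \<le> B) \<Longrightarrow> norm (contour_integral p f) \<le> C p * B"
    by metis
  define K where "K = (\<Union>p\<in>set ps. path_image p)"
  have "compact K"
    unfolding K_def using ps(1)
    by (intro compact_UN) (auto intro: compact_valid_path_image valid_path_polynomial_function)
  moreover have "K \<subseteq> D" using ps(1) by (auto simp: K_def)
  moreover have "norm (L f) \<le> (\<Sum>p\<leftarrow>ps. C p) * B"
    if f: "f holomorphic_on D" and B: "\<And>x. x \<in> K \<Longrightarrow> norm (f x) \<le> B" for f B
  proof -
    have "norm (L f) \<le> (\<Sum>p\<leftarrow>ps. norm (contour_integral p f))"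
      unfolding ps(2)[OF f] by (induction ps) (auto intro: norm_triangle_mono)
    also have "\<dots> \<le> (\<Sum>p\<leftarrow>ps. C p * B)"
    proof (rule sum_list_mono)
      fix p assume p: "p \<in> set ps"
      then have "f contour_integrable_on p"
        using ps(1) f D poly_path_integrable by blast
      then show "norm (contour_integral p f) \<le> C p * B"
        using p B by (intro C(2)) (auto simp: K_def)
    qed
    finally show ?thesis by (simp add: sum_list_mult_const)
  qed
  moreover have "(\<Sum>p\<leftarrow>ps. C p) \<ge> 0" using C(1) by (auto intro!: sum_list_nonneg)
  ultimately show ?thesis using that by metis
qed

lemma csh_poly_path_integral:
  assumes F: "csh F D" and op: "\<And>j. open (D j)" and p: "polynomial_function p" "path_image p \<subseteq> D j"
  shows "csh (\<lambda>w. contour_integral p (\<lambda>x. F (vupd w j x))) D"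
proof -
  obtain p' where p': "polynomial_function p'" "\<And>x. (p has_vector_derivative p' x) (at x)"
    using has_vector_derivative_polynomial_function[OF p(1)] by metis
  let ?f = "\<lambda>w t. F (vupd w j (p t)) * p' t"
  have ci: "contour_integral p (\<lambda>x. F (vupd w j x)) = integral (cbox 0 1) (?f w)" for w
    by (simp add: contour_integral_integral vector_derivative_at[OF p'(2)])
  have pD: "p t \<in> D j" if "t \<in> cbox 0 1" for t using p(2) that by (auto simp: path_image_def)
  have cp: "continuous_on A p" "continuous_on A p'" for A
    using continuous_on_polymonial_function p(1) p'(1) by auto
  have cp2: "continuous_on A (\<lambda>x. p (snd x))" "continuous_on A (\<lambda>x. p' (snd x))" for A :: "('x::topological_space \<times> real) set"
    by (rule continuous_on_compose2[OF cp(1)[of UNIV]], auto intro!: continuous_intros)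
       (rule continuous_on_compose2[OF cp(2)[of UNIV]], auto intro!: continuous_intros)
  have cont: "continuous_on (cart D \<times> cbox 0 1) (\<lambda>(w, t). ?f w t)"
    unfolding split_beta
    by (intro continuous_on_mult cp2 continuous_on_compose2[OF csh_continuous[OF F]] continuous_on_vupd continuous_on_fst continuous_on_id)
       (auto intro!: vupd_in_cart pD)
  have "csh (\<lambda>w. integral (cbox 0 1) (?f w)) D"
    unfolding csh_def
  proof (intro conjI ballI allI)
    show "continuous_on (cart D) (\<lambda>w. integral (cbox 0 1) (?f w))"
      by (rule integral_continuous_on_param[OF cont])
    fix w i assume w: "w \<in> cart D"
    show "(\<lambda>x. integral (cbox 0 1) (?f (vupd w i x))) holomorphic_on D i"
    \<comment> \<open>For \<open>i = j\<close> the coordinate is overwritten by the path and the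
      integral is constant in it; otherwise one differentiates under the integral sign.\<close>
    proof (cases "i = j")
      case True
      then show ?thesis by simp
    next
      case False
      have "(\<lambda>x. integral (cbox 0 1) (?f (vupd w i x))) holomorphic_on ball x r"
        if x: "ball x r \<subseteq> D i" for x r
      proof (rule leibniz_rule_holomorphic)
        let ?d = "\<lambda>u. deriv (\<lambda>y. F (vupd u i y)) (u $ i)"
        fix y t assume y: "y \<in> ball x r" and t: "t \<in> cbox (0::real) 1"
        have u: "vupd w j (p t) \<in> cart D" using w pD[OF t] by (rule vupd_in_cart)
        have "((\<lambda>y. F (vupd (vupd w j (p t)) i y)) has_field_derivative deriv (\<lambda>y. F (vupd (vupd w j (p t)) i y)) y) (at y)"
          by (rule holomorphic_derivI[OF csh_slice[OF F u] op]) (use x y in blast)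
        then show "((\<lambda>y. ?f (vupd w i y) t) has_field_derivative
            ?d (vupd (vupd w i y) j (p t)) * p' t) (at y within ball x r)"
          using has_field_derivative_at_within[OF DERIV_cmult_right, of _ _ y "p' t" "ball x r"] 
          by (simp add: vupd_commute[OF False])
      next
        fix y assume y: "y \<in> ball x r"
        then have "vupd w i y \<in> cart D" using w x by (auto intro: vupd_in_cart)
        then have "continuous_on (cbox 0 1) (\<lambda>t. (\<lambda>(w, t). ?f w t) (vupd w i y, t))"
          by (intro continuous_on_compose2[OF cont]) (auto intro!: continuous_intros)
        then show "?f (vupd w i y) integrable_on cbox 0 1"
          by (intro integrable_continuous) simp
      next
        show "continuous_on (ball x r \<times> cbox 0 1) (\<lambda>(y, t).
          deriv (\<lambda>y'. F (vupd (vupd (vupd w i y) j (p t)) i y')) (vupd (vupd w i y) j (p t) $ i) * p' t)"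
          unfolding split_beta
          by (intro continuous_on_mult cp2 continuous_on_compose2[OF csh_partial_continuous[OF F op]]
              continuous_on_vupd continuous_on_fst continuous_on_id continuous_on_const)
             (use x in \<open>auto intro!: vupd_in_cart pD w\<close>)
      qed simp
      note ball_hol = this
      show ?thesis
        unfolding holomorphic_on_def
      proof
        fix x assume "x \<in> D i"
        then obtain r where r: "r > 0" "ball x r \<subseteq> D i"
          using op[of i] open_contains_ball by blast
        have "(\<lambda>x. integral (cbox 0 1) (?f (vupd w i x))) field_differentiable at x"
          using holomorphic_on_imp_differentiable_at[OF ball_hol[OF r(2)]] r(1) by simp
        then show "(\<lambda>x. integral (cbox 0 1) (?f (vupd w i x))) field_differentiable at x within D i"
          by (rule field_differentiable_at_within)
      qed
    qed
  qed
  then show ?thesis by (simp add: ci)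
qed

lemma csh_afun:
  assumes F: "csh F D" and op: "\<And>j. open (D j)" and L: "afun (D j) L"
  shows "csh (\<lambda>w. L (\<lambda>x. F (vupd w j x))) D"
proof -
  obtain ps where ps: "\<And>p. p \<in> set ps \<Longrightarrow> polynomial_function p \<and> path_image p \<subseteq> D j"
    "\<And>f. f holomorphic_on D j \<Longrightarrow> L f = (\<Sum>p\<leftarrow>ps. contour_integral p f)"
    using L by (auto simp: afun_def)
  have "csh (\<lambda>w. \<Sum>p\<leftarrow>ps. contour_integral p (\<lambda>x. F (vupd w j x))) D"
    using ps(1) by (induction ps) (auto intro!: csh_add csh_poly_path_integral[OF F op])
  then show ?thesis
    by (rule csh_cong) (simp add: ps(2) csh_slice[OF F])
qed

text \<open>The head of the list is the outermost functional. Coordinates outside the list are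
  parameters, while the entries of \<open>w\<close> at listed positions are overwritten.\<close>

fun It :: "'n list \<Rightarrow> ('n \<Rightarrow> (complex \<Rightarrow> complex) \<Rightarrow> complex) \<Rightarrow> (complex ^ 'n \<Rightarrow> complex) \<Rightarrow> complex ^ 'n \<Rightarrow> complex" where
  "It [] L F w = F w"
| "It (j # js) L F w = L j (\<lambda>x. It js L F (vupd w j x))"

lemma It_agree:
  assumes "\<And>j. j \<notin> set js \<Longrightarrow> w $ j = w' $ j"
  shows "It js L F w = It js L F w'"
  using assms
proof (induction js arbitrary: w w')
  case Nil
  then have "w = w'" by (simp add: vec_eq_iff)
  then show ?case by simp
next
  case (Cons j js)
  have "It js L F (vupd w j x) = It js L F (vupd w' j x)" for x
    by (rule Cons.IH) (use Cons.prems in auto)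
  then show ?case by simp
qed

context
  fixes D :: "'n::finite \<Rightarrow> complex set" and L :: "'n \<Rightarrow> (complex \<Rightarrow> complex) \<Rightarrow> complex"
  assumes op: "\<And>j. open (D j)" and L: "\<And>j. afun (D j) (L j)"
begin

lemma It_csh: "csh F D \<Longrightarrow> csh (It js L F) D"
proof (induction js)
  case Nil
  then show ?case by (rule csh_cong) simp
next
  case (Cons j js)
  show ?case
    using csh_afun[OF Cons.IH[OF Cons.prems] op L] by (rule csh_cong) simp
qed

lemma It_cong:
  assumes "csh F D" "w \<in> cart D" "\<And>w. w \<in> cart D \<Longrightarrow> F w = G w"
  shows "It js L F w = It js L G w"
  using assms(2)
proof (induction js arbitrary: w)
  case (Cons j js)
  show ?case
    using csh_slice[OF It_csh[OF assms(1)] Cons.prems] Cons.IH vupd_in_cart[OF Cons.prems]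
    by (auto intro!: afun_cong[OF L])
qed (simp add: assms(3))

lemma It_add:
  assumes "csh F D" "csh G D" "w \<in> cart D"
  shows "It js L (\<lambda>w. F w + G w) w = It js L F w + It js L G w"
  using assms(3)
proof (induction js arbitrary: w)
  case (Cons j js)
  have "L j (\<lambda>x. It js L (\<lambda>w. F w + G w) (vupd w j x)) = L j (\<lambda>x. It js L F (vupd w j x) + It js L G (vupd w j x))"
    by (rule afun_cong[OF L])
       (use Cons assms in \<open>auto intro!: csh_slice It_csh intro: vupd_in_cart\<close>)
  then show ?case
    using afun_add[OF L op csh_slice[OF It_csh[OF assms(1)] Cons.prems] csh_slice[OF It_csh[OF assms(2)] Cons.prems]]
    by simp
qed simp

lemma It_cmult:
  assumes "csh F D" "w \<in> cart D"
  shows "It js L (\<lambda>w. c * F w) w = c * It js L F w"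
  using assms(2)
proof (induction js arbitrary: w)
  case (Cons j js)
  have "L j (\<lambda>x. It js L (\<lambda>w. c * F w) (vupd w j x)) = L j (\<lambda>x. c * It js L F (vupd w j x))"
    by (rule afun_cong[OF L])
       (use Cons assms in \<open>auto intro!: csh_slice It_csh intro: vupd_in_cart\<close>)
  then show ?case
    using afun_cmult[OF L op csh_slice[OF It_csh[OF assms(1)] Cons.prems]]
    by simp
qed simp

lemma It_diff:
  assumes "csh F D" "csh G D" "w \<in> cart D"
  shows "It js L (\<lambda>w. F w - G w) w = It js L F w - It js L G w"
  using It_add[OF assms(1) csh_mult[OF csh_const[of "-1"] assms(2)] assms(3)] It_cmult[OF assms(2,3), of js "-1"]
  by simp

lemma It_zero: "w \<in> cart D \<Longrightarrow> It js L (\<lambda>w. 0) w = 0"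
  using It_cmult[of "\<lambda>w. 0" w js 0] by simp

lemma It_sum:
  assumes "\<And>i. i \<in> A \<Longrightarrow> csh (F i) D" "w \<in> cart D"
  shows "It js L (\<lambda>w. \<Sum>i\<in>A. F i w) w = (\<Sum>i\<in>A. It js L (F i) w)"
  using assms(1)
proof (induction A rule: infinite_finite_induct)
  case (insert x A)
  have "It js L (\<lambda>w. F x w + (\<Sum>i\<in>A. F i w)) w = It js L (F x) w + It js L (\<lambda>w. \<Sum>i\<in>A. F i w) w"
    by (rule It_add) (use insert assms in auto)
  then show ?case using insert by simp
qed (use assms It_zero in auto)

lemma It_pull:
  assumes "csh F D" "w \<in> cart D" "j \<notin> set js" "g holomorphic_on D j"
  shows "It js L (\<lambda>w. g (w $ j) * F w) w = g (w $ j) * It js L F w"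
  using assms(2,3)
proof (induction js arbitrary: w)
  case (Cons i js)
  have "L i (\<lambda>x. It js L (\<lambda>w. g (w $ j) * F w) (vupd w i x)) = L i (\<lambda>x. g (w $ j) * It js L F (vupd w i x))"
  proof (rule afun_cong[OF L])
    show "(\<lambda>x. It js L (\<lambda>w. g (w $ j) * F w) (vupd w i x)) holomorphic_on D i"
      by (intro csh_slice It_csh csh_mult csh_coord assms Cons.prems)
    fix x assume "x \<in> D i"
    then show "It js L (\<lambda>w. g (w $ j) * F w) (vupd w i x) = g (w $ j) * It js L F (vupd w i x)"
      using Cons.IH[of "vupd w i x"] Cons.prems by (auto intro: vupd_in_cart)
  qed
  then show ?case
    using afun_cmult[OF L op csh_slice[OF It_csh[OF assms(1)] Cons.prems(1)]]
    by simp
qed simp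

lemma It_prod:
  assumes "\<And>j. f j holomorphic_on D j" "w \<in> cart D" "distinct js"
  shows "It js L (\<lambda>w. \<Prod>i\<in>UNIV. f i (w $ i)) w = (\<Prod>i\<in>set js. L i (f i)) * (\<Prod>i\<in>-set js. f i (w $ i))"
  using assms(2,3)
proof (induction js arbitrary: w)
  case (Cons j js)
  let ?c = "(\<Prod>i\<in>set js. L i (f i)) * (\<Prod>i\<in>-set (j#js). f i (w $ i))"
  have [simp]: "csh (\<lambda>w. \<Prod>i\<in>UNIV. f i (w $ i)) D" by (intro csh_prod csh_coord assms)
  have "L j (\<lambda>x. It js L (\<lambda>w. \<Prod>i\<in>UNIV. f i (w $ i)) (vupd w j x)) = L j (\<lambda>x. ?c * f j x)"
  proof (rule afun_cong[OF L])
    show "(\<lambda>x. It js L (\<lambda>w. \<Prod>i\<in>UNIV. f i (w $ i)) (vupd w j x)) holomorphic_on D j"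
      by (intro csh_slice It_csh Cons.prems) simp
    fix x assume x: "x \<in> D j"
    have eq: "- set js = insert j (- set (j # js))" using Cons.prems by auto
    have "(\<Prod>i\<in>-set js. f i (vupd w j x $ i)) = f j x * (\<Prod>i\<in>-set (j#js). f i (w $ i))"
      unfolding eq by (subst prod.insert) (auto intro!: prod.cong)
    then show "It js L (\<lambda>w. \<Prod>i\<in>UNIV. f i (w $ i)) (vupd w j x) = ?c * f j x"
      using Cons.IH[OF vupd_in_cart[OF Cons.prems(1) x]] Cons.prems by simp
  qed
  then show ?case
    using afun_cmult[OF L op assms(1), of j ?c] Cons.prems by (simp add: mult_ac)
qed simp

text \<open>The bound on \<open>F\<close> is required only at points that agree with
  \<open>w\<close> in the coordinates that are not integrated, so the estimate can be applied on a
  single slice. \<open>K\<close> and \<open>C\<close> depend neither on \<open>F\<close> nor on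
  \<open>w\<close>.\<close>

lemma It_bound:
  assumes "distinct js"
  obtains K C where "\<And>j. compact (K j)" "\<And>j. K j \<subseteq> D j" "C \<ge> 0"
    "\<And>F w B. csh F D \<Longrightarrow> w \<in> cart D \<Longrightarrow> B \<ge> 0 \<Longrightarrow>
      (\<And>u. u \<in> cart D \<Longrightarrow> (\<And>j. j \<in> set js \<Longrightarrow> u $ j \<in> K j) \<Longrightarrow> (\<And>j. j \<notin> set js \<Longrightarrow> u $ j = w $ j) \<Longrightarrow> norm (F u) \<le> B) \<Longrightarrow>
      norm (It js L F w) \<le> C * B"
  using assms
proof (induction js arbitrary: thesis)
  case Nil
  show ?case
  proof (rule Nil(1)[of "\<lambda>_. {}" 1])
    fix F :: "complex ^ 'n \<Rightarrow> complex" and w B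
    assume "w \<in> cart D" "\<And>u. u \<in> cart D \<Longrightarrow> (\<And>j. j \<in> set [] \<Longrightarrow> u $ j \<in> {}) \<Longrightarrow> (\<And>j. j \<notin> set [] \<Longrightarrow> u $ j = w $ j) \<Longrightarrow> norm (F u) \<le> B"
    then show "norm (It [] L F w) \<le> 1 * B" by simp
  qed auto
next
  case (Cons j js)
  obtain K C where K: "\<And>j. compact (K j)" "\<And>j. K j \<subseteq> D j" "C \<ge> 0"
    "\<And>F w B. csh F D \<Longrightarrow> w \<in> cart D \<Longrightarrow> B \<ge> 0 \<Longrightarrow>
      (\<And>u. u \<in> cart D \<Longrightarrow> (\<And>j. j \<in> set js \<Longrightarrow> u $ j \<in> K j) \<Longrightarrow> (\<And>j. j \<notin> set js \<Longrightarrow> u $ j = w $ j) \<Longrightarrow> norm (F u) \<le> B) \<Longrightarrow>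
      norm (It js L F w) \<le> C * B"
    using Cons.IH Cons.prems(2) by (metis (no_types, lifting) distinct.simps(2))
  obtain K' C' where K': "compact K'" "K' \<subseteq> D j" "C' \<ge> 0"
    "\<And>f B. f holomorphic_on D j \<Longrightarrow> B \<ge> 0 \<Longrightarrow> (\<And>x. x \<in> K' \<Longrightarrow> norm (f x) \<le> B) \<Longrightarrow> norm (L j f) \<le> C' * B"
    using afun_bound[OF L op] by metis
  show ?case
  proof (rule Cons.prems(1)[of "K(j := K')" "C' * C"])
    fix F w B
    assume F: "csh F D" and w: "w \<in> cart D" and B: "B \<ge> (0::real)"
      and le: "\<And>u. u \<in> cart D \<Longrightarrow> (\<And>i. i \<in> set (j # js) \<Longrightarrow> u $ i \<in> (K(j := K')) i) \<Longrightarrow>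
        (\<And>i. i \<notin> set (j # js) \<Longrightarrow> u $ i = w $ i) \<Longrightarrow> norm (F u) \<le> B"
    have "norm (It js L F (vupd w j x)) \<le> C * B" if x: "x \<in> K'" for x
    proof (rule K(4)[OF F _ B])
      show "vupd w j x \<in> cart D" using w x K' by (auto intro: vupd_in_cart)
      fix u assume u: "u \<in> cart D" "\<And>j. j \<in> set js \<Longrightarrow> u $ j \<in> K j" "\<And>i. i \<notin> set js \<Longrightarrow> u $ i = vupd w j x $ i"
      show "norm (F u) \<le> B"
        by (rule le) (use u x Cons.prems(2) in auto)
    qed
    then have "norm (L j (\<lambda>x. It js L F (vupd w j x))) \<le> C' * (C * B)"
      using B K(3) by (intro K'(4) csh_slice It_csh F w) auto
    then show "norm (It (j # js) L F w) \<le> C' * C * B" by (simp add: mult.assoc)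
  qed (use K K' in auto)
qed

end

subsection \<open>Integrals over cubes\<close>

text \<open>The derivative of a piecewise \<open>C\<^sup>1\<close> path in the sense of \<^const>\<open>valid_path\<close> need not be absolutely
  integrable near its exceptional points, so that Fubini's theorem is not available. Instead the
  iterated contour integral of a holomorphic function is regarded as an additive function of boxes
  whose local behaviour determines the gauge integral. The estimates are relative to the following
  increasing function, which has a jump on either side of every exceptional point.\<close>

definition jump :: "real set \<Rightarrow> real \<Rightarrow> real" where
  "jump S t = t + (\<Sum>s\<in>S. of_bool (s \<le> t) + of_bool (s < t))"

lemma jump_diff_ge:
  assumes "a \<le> b"
  shows "b - a \<le> jump S b - jump S a"
proof -
  have "(\<Sum>s\<in>S. of_bool (s \<le> a) + of_bool (s < a)) \<le> (\<Sum>s\<in>S. of_bool (s \<le> b) + of_bool (s < b) :: real)"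
    by (rule sum_mono) (use assms in auto)
  then show ?thesis by (simp add: jump_def)
qed

lemma jump_diff_ge_1:
  assumes "a < b" "s \<in> S" "finite S" "a \<le> s" "s \<le> b"
  shows "1 \<le> jump S b - jump S a"
proof -
  let ?f = "\<lambda>t s. of_bool (s \<le> t) + of_bool (s < t) :: real"
  have "1 \<le> ?f b s - ?f a s" using assms by auto
  also have "\<dots> \<le> (\<Sum>s\<in>S. ?f b s - ?f a s)"
    by (rule member_le_sum) (use assms in auto)
  finally show ?thesis using assms(1) by (simp add: jump_def sum_subtractf)
qed

text \<open>Away from \<open>S\<close> this is differentiability. At a point of \<open>S\<close> the
  value \<open>d s\<close> is arbitrary; there continuity makes the left side at most
  \<open>\<eta>\<close>, while \<open>jump S\<close> increases by at least \<open>1\<close>.\<close>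

lemma path_increment_estimate:
  fixes c :: "real \<Rightarrow> complex"
  assumes cont: "continuous_on {0..1} c" and fin: "finite S"
    and der: "\<And>s. s \<in> {0..1} - S \<Longrightarrow> (c has_vector_derivative d s) (at s within {0..1})"
    and s: "s \<in> {0..1}" and \<eta>: "\<eta> > 0"
  obtains \<delta> where "\<delta> > 0" "\<And>a b. 0 \<le> a \<Longrightarrow> a \<le> s \<Longrightarrow> s \<le> b \<Longrightarrow> b \<le> 1 \<Longrightarrow> a < b \<Longrightarrow> b - a < \<delta> \<Longrightarrow>
    norm (c b - c a - (b - a) *\<^sub>R d s) \<le> \<eta> * (jump S b - jump S a)"
proof (cases "s \<in> S")
  case False
  then have "(c has_derivative (\<lambda>h. h *\<^sub>R d s)) (at s within {0..1})"
    using der s by (auto simp: has_vector_derivative_def)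
  then obtain \<delta> where \<delta>: "\<delta> > 0" "\<And>y. y \<in> {0..1} \<Longrightarrow> norm (y - s) < \<delta> \<Longrightarrow>
      norm (c y - c s - (y - s) *\<^sub>R d s) \<le> \<eta> * norm (y - s)"
    using \<eta> unfolding has_derivative_within_alt by metis
  have "norm (c b - c a - (b - a) *\<^sub>R d s) \<le> \<eta> * (jump S b - jump S a)"
    if ab: "0 \<le> a" "a \<le> s" "s \<le> b" "b \<le> 1" "b - a < \<delta>" for a b
  proof -
    have "c b - c a - (b - a) *\<^sub>R d s = (c b - c s - (b - s) *\<^sub>R d s) - (c a - c s - (a - s) *\<^sub>R d s)"
      by (simp add: algebra_simps)
    then have "norm (c b - c a - (b - a) *\<^sub>R d s) \<le> norm (c b - c s - (b - s) *\<^sub>R d s) + norm (c a - c s - (a - s) *\<^sub>R d s)"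
      by (simp only: norm_triangle_ineq4)
    also have "\<dots> \<le> \<eta> * norm (b - s) + \<eta> * norm (a - s)"
      by (rule add_mono; rule \<delta>(2)) (use ab in auto)
    also have "\<dots> = \<eta> * (b - a)" using ab by (simp add: algebra_simps)
    also have "\<dots> \<le> \<eta> * (jump S b - jump S a)"
      by (rule mult_left_mono[OF jump_diff_ge]) (use ab \<eta> in auto)
    finally show ?thesis .
  qed
  then show ?thesis using that \<delta>(1) by blast
next
  case True
  obtain \<delta>1 where \<delta>1: "\<delta>1 > 0" "\<And>y. y \<in> {0..1} \<Longrightarrow> dist y s < \<delta>1 \<Longrightarrow> dist (c y) (c s) < \<eta> / 4"
    using cont s \<eta> unfolding continuous_on_iff by (metis zero_less_divide_iff zero_less_numeral)
  \<comment> \<open>Keeps the term with \<open>d s\<close>, which has no meaning as a derivative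
    here, below \<open>\<eta> / 2\<close>; the added \<open>1\<close> avoids division by
    zero.\<close>
  define \<delta>2 where "\<delta>2 = \<eta> / (2 * (norm (d s) + 1))"
  have \<delta>2: "\<delta>2 > 0" "\<delta>2 * norm (d s) \<le> \<eta> / 2"
    using \<eta> by (auto simp: \<delta>2_def field_simps add_pos_nonneg)
  have "norm (c b - c a - (b - a) *\<^sub>R d s) \<le> \<eta> * (jump S b - jump S a)"
    if ab: "0 \<le> a" "a \<le> s" "s \<le> b" "b \<le> 1" "a < b" "b - a < min \<delta>1 \<delta>2" for a b
  proof -
    have "dist (c b) (c s) < \<eta> / 4" "dist (c a) (c s) < \<eta> / 4"
      by (rule \<delta>1(2); use ab in \<open>auto simp: dist_real_def\<close>)+
    then have "norm (c b - c a) \<le> \<eta> / 2"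
      using dist_triangle2[of "c b" "c a" "c s"] by (simp add: dist_norm)
    moreover have "norm ((b - a) *\<^sub>R d s) \<le> \<delta>2 * norm (d s)"
      using ab by (auto intro!: mult_right_mono)
    ultimately have "norm (c b - c a - (b - a) *\<^sub>R d s) \<le> \<eta> * 1"
      using \<delta>2(2) norm_triangle_ineq4[of "c b - c a" "(b - a) *\<^sub>R d s"] by linarith
    also have "\<dots> \<le> \<eta> * (jump S b - jump S a)"
      by (rule mult_left_mono[OF jump_diff_ge_1[OF _ True fin]]) (use ab \<eta> in auto)
    finally show ?thesis .
  qed
  then show ?thesis using that[of "min \<delta>1 \<delta>2"] \<delta>1(1) \<delta>2(1) by auto
qed

lemma interval_bounds_vec:
  fixes a b :: "real ^ 'n::finite"
  assumes "\<And>j. a $ j \<le> b $ j"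
  shows "interval_lowerbound (cbox a b) = a" "interval_upperbound (cbox a b) = b"
  using assms by (auto intro!: interval_lowerbound interval_upperbound simp: Basis_vec_def inner_axis)

text \<open>Once it is set to \<open>0\<close> on the empty box, an additive function of boxes is an
  operative set function, and such functions sum up over divisions.\<close>

lemma box_additive_tagged_division:
  fixes G :: "real ^ 'n::finite \<Rightarrow> real ^ 'n \<Rightarrow> 'v::real_vector"
  assumes split: "\<And>a b k m. (\<And>j. a $ j \<le> b $ j) \<Longrightarrow> a $ k \<le> m \<Longrightarrow> m \<le> b $ k \<Longrightarrow>
      G a b = G a (vupd b k m) + G (vupd a k m) b"
    and ab: "\<And>j. a $ j \<le> b $ j"
    and p: "p tagged_division_of cbox a b"
  shows "(\<Sum>(x, K)\<in>p. G (interval_lowerbound K) (interval_upperbound K)) = G a b"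
proof -
  define g where "g K = (if K = {} then 0 else G (interval_lowerbound K) (interval_upperbound K))" for K
  have ne: "cbox a b \<noteq> {} \<longleftrightarrow> (\<forall>j. a $ j \<le> b $ j)" for a b :: "real ^ 'n"
    by (simp add: interval_ne_empty_cart)
  have g: "g (cbox a b) = G a b" if "\<And>j. a $ j \<le> b $ j" for a b
    using that ne[of a b] by (simp add: g_def interval_bounds_vec)
  \<comment> \<open>Cutting a degenerate box across its flat direction gives the same box twice,
    hence \<open>G a b = G a b + G a b\<close>.\<close>
  have degenerate: "G a b = 0" if "\<And>j. a $ j \<le> b $ j" "a $ k = b $ k" for a b k
  proof -
    have "G a b = G a (vupd b k (a $ k)) + G (vupd a k (a $ k)) b"
      by (rule split) (use that in auto)
    then show ?thesis using that(2) by (metis add_cancel_right_right vupd_same)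
  qed
  interpret operative plus 0 g
  proof
    fix a b :: "real ^ 'n"
    assume e: "box a b = {}"
    show "g (cbox a b) = 0"
    proof (cases "\<forall>j. a $ j \<le> b $ j")
      case True
      then obtain k where "a $ k = b $ k" using e by (force simp: interval_eq_empty_cart intro: antisym)
      then show ?thesis using True degenerate g by metis
    qed (use ne[of a b] in \<open>auto simp: g_def\<close>)
  next
    fix a b :: "real ^ 'n" and c and k' :: "real ^ 'n"
    assume "k' \<in> Basis"
    then obtain k where k: "k' = axis k 1" by (auto simp: Basis_vec_def)
    have i1: "cbox a b \<inter> {x. x $ k \<le> c} = cbox a (vupd b k (min (b $ k) c))"
      unfolding set_eq_iff Int_iff mem_box_cart mem_Collect_eq vupd_nth by auto
    have i2: "cbox a b \<inter> {x. x $ k \<ge> c} = cbox (vupd a k (max (a $ k) c)) b"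
      unfolding set_eq_iff Int_iff mem_box_cart mem_Collect_eq vupd_nth by auto
    have "g (cbox a b) = g (cbox a b \<inter> {x. x $ k \<le> c}) + g (cbox a b \<inter> {x. x $ k \<ge> c})"
    proof (cases "\<forall>j. a $ j \<le> b $ j")
      case True
      consider "c < a $ k" | "b $ k < c" | "a $ k \<le> c" "c \<le> b $ k" by linarith
      then show ?thesis
      proof cases
        case 1
        then have "cbox a (vupd b k (min (b $ k) c)) = {}" using ne[of a "vupd b k (min (b $ k) c)"]
          by (metis min.coboundedI2 min_def not_less vupd_nth order.trans)
        moreover have "vupd a k (max (a $ k) c) = a" using 1 by (simp add: max_def)
        ultimately show ?thesis unfolding i1 i2 by (simp add: g_def)
      next
        case 2
        then have "cbox (vupd a k (max (a $ k) c)) b = {}" using ne[of "vupd a k (max (a $ k) c)" b]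
          by (metis max.cobounded2 not_less order.trans vupd_nth)
        moreover have "vupd b k (min (b $ k) c) = b" using 2 by (simp add: min_def)
        ultimately show ?thesis unfolding i1 i2 by (simp add: g_def)
      next
        case 3
        then have *: "min (b $ k) c = c" "max (a $ k) c = c" by auto
        have "g (cbox a (vupd b k c)) = G a (vupd b k c)" "g (cbox (vupd a k c) b) = G (vupd a k c) b"
          using True 3 by (auto intro!: g)
        then show ?thesis unfolding i1 i2 * using split[of a b k c] g[of a b] True 3 by simp
      qed
    next
      case False
      then have "cbox a b = {}" using ne by blast
      then show ?thesis by (simp add: g_def)
    qed
    then show "g (cbox a b) = g (cbox a b \<inter> {x. x \<bullet> k' \<le> c}) + g (cbox a b \<inter> {x. x \<bullet> k' \<ge> c})"
      by (simp add: k inner_axis)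
  qed
  have "(\<Sum>(x, K)\<in>p. g K) = g (cbox a b)"
    using tagged_division[OF p] by (simp add: sum_def)
  moreover have "(\<Sum>(x, K)\<in>p. g K) = (\<Sum>(x, K)\<in>p. G (interval_lowerbound K) (interval_upperbound K))"
    by (rule sum.cong) (use tagged_division_ofD(2)[OF p] in \<open>force simp: g_def\<close>)+
  ultimately show ?thesis using g[OF ab] by simp
qed

lemma It_cong_fun:
  assumes op: "\<And>j. open (D j)" and L: "\<And>j. afun (D j) (L j)" and L': "\<And>j. afun (D j) (L' j)"
    and eq: "\<And>j f. j \<in> set js \<Longrightarrow> f holomorphic_on D j \<Longrightarrow> L j f = L' j f"
    and F: "csh F D" and w: "w \<in> cart D"
  shows "It js L F w = It js L' F w"
  using eq w
proof (induction js arbitrary: w)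
  case (Cons j js)
  have "L j (\<lambda>x. It js L F (vupd w j x)) = L j (\<lambda>x. It js L' F (vupd w j x))"
    using Cons by (intro afun_cong[OF L] csh_slice It_csh op L F) (auto intro: vupd_in_cart)
  also have "\<dots> = L' j (\<lambda>x. It js L' F (vupd w j x))"
    using Cons.prems by (intro Cons.prems(1) csh_slice It_csh op L' F) auto
  finally show ?case by simp
qed simp

text \<open>Only the functional in position \<open>k\<close> is decomposed. With subpaths as
  functionals this is additivity of the iterated integral when a box is cut across direction
  \<open>k\<close>.\<close>

lemma It_split:
  assumes op: "\<And>j. open (D j)" and L: "\<And>j. afun (D j) (L j)"
    and L1: "\<And>j. afun (D j) (L1 j)" and L2: "\<And>j. afun (D j) (L2 j)"
    and eq: "\<And>j. j \<noteq> k \<Longrightarrow> L j = L1 j \<and> L j = L2 j"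
    and add: "\<And>f. f holomorphic_on D k \<Longrightarrow> L k f = L1 k f + L2 k f"
    and F: "csh F D" and w: "w \<in> cart D" and js: "distinct js" "k \<in> set js"
  shows "It js L F w = It js L1 F w + It js L2 F w"
  using w js
proof (induction js arbitrary: w)
  case (Cons j js)
  show ?case
  proof (cases "j = k")
    case True
    have "It js L1 F v = It js L F v \<and> It js L2 F v = It js L F v" if v: "v \<in> cart D" for v
    proof -
      have "L1 i f = L i f" "L2 i f = L i f" if "i \<in> set js" for i f
        using that Cons.prems True eq by (metis distinct.simps(2))+
      then show ?thesis
        by (auto intro!: It_cong_fun[OF op L1 L _ F v] It_cong_fun[OF op L2 L _ F v])
    qed
    then have "L1 k (\<lambda>x. It js L1 F (vupd w k x)) = L1 k (\<lambda>x. It js L F (vupd w k x))"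
       "L2 k (\<lambda>x. It js L2 F (vupd w k x)) = L2 k (\<lambda>x. It js L F (vupd w k x))"
      using Cons.prems(1)
      by (auto intro!: afun_cong[OF L1] afun_cong[OF L2] csh_slice It_csh op L1 L2 F intro: vupd_in_cart)
    then show ?thesis
      using True add[OF csh_slice[OF It_csh[OF op L F] Cons.prems(1)]] by simp
  next
    case False
    have "L j (\<lambda>x. It js L F (vupd w j x)) = L j (\<lambda>x. It js L1 F (vupd w j x) + It js L2 F (vupd w j x))"
      using Cons.prems False by (intro afun_cong[OF L] csh_slice It_csh op L F Cons.IH) (auto intro: vupd_in_cart)
    also have "\<dots> = L j (\<lambda>x. It js L1 F (vupd w j x)) + L j (\<lambda>x. It js L2 F (vupd w j x))"
      using Cons.prems by (intro afun_add[OF L op] csh_slice It_csh op L1 L2 F)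
    finally show ?thesis using eq[OF False] by (metis It.simps(2))
  qed
qed simp

text \<open>Both integrals are the difference of the values of a primitive at the end
  points.\<close>

lemma contour_integral_convex_line:
  assumes "f holomorphic_on S" "convex S" "open S" "valid_path g" "path_image g \<subseteq> S"
  shows "contour_integral g f = contour_integral (linepath (pathstart g) (pathfinish g)) f"
proof -
  obtain h where h: "\<And>x. x \<in> S \<Longrightarrow> (h has_field_derivative f x) (at x within S)"
    using holomorphic_convex_primitive' assms(1,2,3) by metis
  have "pathstart g \<in> S" "pathfinish g \<in> S"
    using assms(5) by auto
  then have "closed_segment (pathstart g) (pathfinish g) \<subseteq> S"
    using assms(2) by (simp add: closed_segment_subset)
  then show ?thesis
    using contour_integral_primitive[OF h assms(4,5)]
      contour_integral_primitive[OF h, of "linepath (pathstart g) (pathfinish g)"]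
    by (simp add: contour_integral_unique)
qed

lemma It_line_const:
  assumes "distinct js"
  shows "It js (\<lambda>j. contour_integral (linepath (p j) (q j))) (\<lambda>_. k) w = k * (\<Prod>j\<in>set js. q j - p j)"
  using assms by (induction js arbitrary: w) (auto simp: mult_ac)

lemma It_line_bound:
  assumes B: "\<And>j. open (B j)" "\<And>j. convex (B j)" and pq: "\<And>j. p j \<in> B j" "\<And>j. q j \<in> B j"
    and G: "csh G B" "\<And>w. w \<in> cart B \<Longrightarrow> norm (G w) \<le> \<eta>" and \<eta>: "\<eta> \<ge> 0"
    and w: "w \<in> cart B" and js: "distinct js"
  shows "norm (It js (\<lambda>j. contour_integral (linepath (p j) (q j))) G w) \<le> \<eta> * (\<Prod>j\<in>set js. norm (q j - p j))"
  using w js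
proof (induction js arbitrary: w)
  case (Cons j js)
  let ?L = "\<lambda>j. contour_integral (linepath (p j) (q j))"
  have seg: "closed_segment (p j) (q j) \<subseteq> B j" for j
    using B pq by (simp add: closed_segment_subset)
  then have L: "afun (B j) (?L j)" for j
    using B by (intro afun_contour_integral) auto
  have "norm (?L j (\<lambda>x. It js ?L G (vupd w j x))) \<le> (\<eta> * (\<Prod>j\<in>set js. norm (q j - p j))) * norm (q j - p j)"
  proof (rule contour_integral_bound_linepath)
    show "(\<lambda>x. It js ?L G (vupd w j x)) contour_integrable_on linepath (p j) (q j)"
      using contour_integrable_holomorphic_simple[OF csh_slice[OF It_csh[OF B(1) L G(1)] Cons.prems(1)] B(1), of "linepath (p j) (q j)" j] seg[of j]
      by simp
    show "0 \<le> \<eta> * (\<Prod>j\<in>set js. norm (q j - p j))" using \<eta> by (simp add: prod_nonneg)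
    fix x assume "x \<in> closed_segment (p j) (q j)"
    then show "norm (It js ?L G (vupd w j x)) \<le> \<eta> * (\<Prod>j\<in>set js. norm (q j - p j))"
      using Cons seg by (auto intro!: Cons.IH vupd_in_cart)
  qed
  then show ?case using Cons.prems by (simp add: mult_ac)
qed (use G in auto)

lemma valid_path_derivative:
  assumes "valid_path c"
  obtains S where "finite S" "\<And>s. s \<in> {0..1} - S \<Longrightarrow>
    (c has_vector_derivative vector_derivative c (at s within {0..1})) (at s)"
proof -
  obtain S d where S: "finite S" "\<And>x. x \<in> {0..1} - S \<Longrightarrow> (c has_vector_derivative d x) (at x)"
    using assms unfolding valid_path_def piecewise_C1_differentiable_on_def C1_differentiable_on_def by metis
  have "vector_derivative c (at s within {0..1}) = d s" if "s \<in> {0..1} - S" for s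
    using vector_derivative_within_cbox[of 0 1 s c "d s"] that S(2)[OF that]
    by (auto simp: has_vector_derivative_at_within)
  then show ?thesis using that S by metis
qed

context
  fixes F :: "complex ^ 'n::finite \<Rightarrow> complex" and D :: "'n \<Rightarrow> complex set" and c :: "'n \<Rightarrow> real \<Rightarrow> complex"
    and js :: "'n list" and w0 :: "complex ^ 'n"
  assumes F: "csh F D" and op: "\<And>j. open (D j)"
    and c: "\<And>j. valid_path (c j)" "\<And>j. path_image (c j) \<subseteq> D j"
    and js: "distinct js" "set js = UNIV" and w0: "w0 \<in> cart D"
begin

text \<open>Clamping to the unit interval makes the subpaths below stay within the paths, and their
  integrals additive, for arbitrary boxes.\<close>

private definition "cl t = max 0 (min t (1::real))"

private definition Lb :: "real ^ 'n \<Rightarrow> real ^ 'n \<Rightarrow> 'n \<Rightarrow> (complex \<Rightarrow> complex) \<Rightarrow> complex" where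
  "Lb a b j = contour_integral (subpath (cl (a $ j)) (cl (b $ j)) (c j))"

text \<open>The additive function of boxes that should have the pulled back integrand as its
  density.\<close>

private definition Th :: "real ^ 'n \<Rightarrow> real ^ 'n \<Rightarrow> complex" where
  "Th a b = It js (Lb a b) F w0"

private lemma cl_in: "0 \<le> cl t" "cl t \<le> 1" by (auto simp: cl_def)

private lemma cl_id: "0 \<le> t \<Longrightarrow> t \<le> 1 \<Longrightarrow> cl t = t" by (auto simp: cl_def)

private lemma Lb_afun: "afun (D j) (Lb a b j)"
  unfolding Lb_def
  using cl_in path_image_subpath_subset[of "cl (a $ j)" "cl (b $ j)" "c j"] c
  by (intro afun_contour_integral op valid_path_subpath) (auto intro: subsetD[OF c(2)])

private lemma Th_split:
  shows "Th a b = Th a (vupd b k m) + Th (vupd a k m) b"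
  unfolding Th_def
proof (rule It_split[OF op Lb_afun Lb_afun Lb_afun _ _ F w0 js(1), where k = k])
  show "Lb a b j = Lb a (vupd b k m) j \<and> Lb a b j = Lb (vupd a k m) b j" if "j \<noteq> k" for j
    using that by (simp add: Lb_def)
  fix f assume "f holomorphic_on D k"
  then have "f contour_integrable_on c k"
    using contour_integrable_holomorphic_simple c op by blast
  then show "Lb a b k f = Lb a (vupd b k m) k f + Lb (vupd a k m) b k f"
    using contour_integral_subpath_combine[OF _ c(1), of f k "cl (a $ k)" "cl m" "cl (b $ k)"] cl_in
    by (simp add: Lb_def)
qed (simp add: js)

private lemma Th_degenerate:
  assumes "a $ k = b $ k"
  shows "Th a b = 0"
  using Th_split[of a b k "a $ k"] assms by (metis add_cancel_right_right vupd_same)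

text \<open>Near the tag \<open>F\<close> is almost constant on a product of discs, and there the
  subpaths can be replaced by their chords. So \<open>Th a b\<close> is nearly the value of
  \<open>F\<close> at the tag times the product of the increments of the paths, and each increment
  is compared with derivative times length.\<close>

private lemma local_estimate:
  fixes t :: "real ^ 'n" and S :: "'n \<Rightarrow> real set"
  assumes t: "\<And>j. 0 \<le> t $ j" "\<And>j. t $ j \<le> 1" and \<epsilon>: "\<epsilon> > 0"
    and S: "\<And>j. finite (S j)"
    and der: "\<And>j s. s \<in> {0..1} - S j \<Longrightarrow> (c j has_vector_derivative d j s) (at s within {0..1})"
  shows "\<exists>\<delta>>0. \<forall>a b. (\<forall>j. 0 \<le> a $ j \<and> a $ j \<le> t $ j \<and> t $ j \<le> b $ j \<and> b $ j \<le> 1 \<and> b $ j - a $ j < \<delta>) \<longrightarrow>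
    norm ((\<Prod>j\<in>UNIV. b $ j - a $ j) *\<^sub>R (F (\<chi> j. c j (t $ j)) * (\<Prod>j\<in>UNIV. d j (t $ j))) - Th a b)
      \<le> \<epsilon> * (\<Prod>j\<in>UNIV. jump (S j) (b $ j) - jump (S j) (a $ j))"
proof -
  define P where "P = (\<chi> j. c j (t $ j))"
  \<comment> \<open>\<open>M - 1\<close> bounds the derivatives at the tag. \<open>C\<close>
    collects the final error: every factor costs \<open>M\<close>, replacing the increments by
    derivatives costs \<open>norm (F P) * n\<close>, and freezing \<open>F\<close> costs
    \<open>1\<close>.\<close>
  define M where "M = 1 + (\<Sum>j\<in>UNIV. norm (d j (t $ j)))"
  define n where "n = real CARD('n)"
  define C where "C = M ^ CARD('n) * (1 + norm (F P) * n)"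
  define \<eta> where "\<eta> = min 1 (\<epsilon> / C)"
  have M: "M \<ge> 1" by (simp add: M_def sum_nonneg)
  have dM: "norm (d j (t $ j)) + 1 \<le> M" for j
    unfolding M_def using member_le_sum[of j UNIV "\<lambda>j. norm (d j (t $ j))"] by simp
  have "C > 0" using M by (simp add: C_def n_def add_pos_nonneg)
  then have \<eta>: "\<eta> > 0" "\<eta> \<le> 1" "\<eta> * C \<le> \<epsilon>"
    using \<epsilon> by (auto simp: \<eta>_def min_def field_simps)
  have PD: "P \<in> cart D" using t by (auto simp: P_def cart_def path_image_def intro!: subsetD[OF c(2)])
  have "open (cart D \<inter> F -` ball (F P) \<eta>)"
    using continuous_open_preimage[OF csh_continuous[OF F] open_cart[OF op]] by blast
  moreover have "P \<in> cart D \<inter> F -` ball (F P) \<eta>" using PD \<eta> by simp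
  ultimately obtain r where r: "r > 0" "cart (\<lambda>j. cball (P $ j) r) \<subseteq> cart D \<inter> F -` ball (F P) \<eta>"
    by (rule polydisc_in_open)
  define B where "B j = ball (P $ j) r" for j
  have cB: "cart B \<subseteq> cart (\<lambda>j. cball (P $ j) r)" unfolding B_def by (rule cart_mono) auto
  have PB: "P \<in> cart B" using r by (simp add: cart_def B_def)
  have BD: "B j \<subseteq> D j" for j
  proof
    fix x assume "x \<in> B j"
    then have "vupd P j x \<in> cart D" using vupd_in_cart[OF PB] cB r(2) by blast
    then show "x \<in> D j" by (auto simp: cart_def dest: spec[of _ j])
  qed
  have Bo: "open (B j)" "convex (B j)" for j by (auto simp: B_def)
  have FB: "csh F B" by (rule csh_subset[OF F BD])
  have Fle: "norm (F u - F P) \<le> \<eta>" if "u \<in> cart B" for u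
    using that cB r(2) by (force simp: dist_norm norm_minus_commute)
  have "\<exists>\<delta>>0. \<forall>a b. 0 \<le> a \<and> a \<le> t $ j \<and> t $ j \<le> b \<and> b \<le> 1 \<and> a < b \<and> b - a < \<delta> \<longrightarrow>
    norm (c j b - c j a - (b - a) *\<^sub>R d j (t $ j)) \<le> \<eta> * (jump (S j) b - jump (S j) a)" for j
  proof -
    have "continuous_on {0..1} (c j)" using c(1)[of j] valid_path_imp_path path_def by blast
    from path_increment_estimate[OF this S[of j] der[of _ j] _ \<eta>(1), of "t $ j"] t show ?thesis
      by (metis atLeastAtMost_iff)
  qed
  then obtain \<delta>1 where \<delta>1: "\<And>j. \<delta>1 j > 0" "\<And>j a b. 0 \<le> a \<Longrightarrow> a \<le> t $ j \<Longrightarrow> t $ j \<le> b \<Longrightarrow> b \<le> 1 \<Longrightarrow> a < b \<Longrightarrow> b - a < \<delta>1 j \<Longrightarrow>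
    norm (c j b - c j a - (b - a) *\<^sub>R d j (t $ j)) \<le> \<eta> * (jump (S j) b - jump (S j) a)" by metis
  have "\<exists>\<delta>>0. \<forall>s\<in>{0..1}. dist s (t $ j) < \<delta> \<longrightarrow> c j s \<in> B j" for j
  proof -
    have "continuous_on {0..1} (c j)" using c(1)[of j] valid_path_imp_path path_def by blast
    then show ?thesis
      using t r(1) unfolding continuous_on_iff B_def P_def by (metis atLeastAtMost_iff dist_commute mem_ball vec_lambda_beta)
  qed
  then obtain \<delta>2 where \<delta>2: "\<And>j. \<delta>2 j > 0" "\<And>j s. s \<in> {0..1} \<Longrightarrow> dist s (t $ j) < \<delta>2 j \<Longrightarrow> c j s \<in> B j" by metis
  define \<delta> where "\<delta> = Min (range (\<lambda>j. min (\<delta>1 j) (\<delta>2 j)))"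
  have \<delta>: "\<delta> > 0" "\<delta> \<le> \<delta>1 j" "\<delta> \<le> \<delta>2 j" for j
  proof -
    show "\<delta> > 0" using \<delta>1(1) \<delta>2(1) by (auto simp: \<delta>_def)
    have "\<delta> \<le> min (\<delta>1 j) (\<delta>2 j)" unfolding \<delta>_def by (rule Min_le) auto
    then show "\<delta> \<le> \<delta>1 j" "\<delta> \<le> \<delta>2 j" by auto
  qed
  have "norm ((\<Prod>j\<in>UNIV. b $ j - a $ j) *\<^sub>R (F P * (\<Prod>j\<in>UNIV. d j (t $ j))) - Th a b)
      \<le> \<epsilon> * (\<Prod>j\<in>UNIV. jump (S j) (b $ j) - jump (S j) (a $ j))"
    if ab: "\<And>j. 0 \<le> a $ j \<and> a $ j \<le> t $ j \<and> t $ j \<le> b $ j \<and> b $ j \<le> 1 \<and> b $ j - a $ j < \<delta>" for a b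
  \<comment> \<open>Boxes without interior are set apart because the increment estimate at an
    exceptional point needs \<open>a < b\<close>.\<close>
  proof (cases "\<exists>k. a $ k = b $ k")
    case True
    then obtain k where k: "a $ k = b $ k" by blast
    have z: "(\<Prod>j\<in>UNIV. b $ j - a $ j) = 0" by (rule prod_zero) (use k in \<open>auto intro: exI[of _ k]\<close>)
    have "0 \<le> (\<Prod>j\<in>UNIV. jump (S j) (b $ j) - jump (S j) (a $ j))"
    proof (rule prod_nonneg)
      fix j show "0 \<le> jump (S j) (b $ j) - jump (S j) (a $ j)"
        using jump_diff_ge[of "a $ j" "b $ j" "S j"] ab[of j] by linarith
    qed
    then show ?thesis unfolding z using Th_degenerate[OF k] \<epsilon> by simp
  next
    case False
    then have lt: "a $ j < b $ j" for j using ab[of j] by (metis order.trans order.not_eq_order_implies_strict)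
    define \<Phi> where "\<Phi> j = jump (S j) (b $ j) - jump (S j) (a $ j)" for j
    define \<Delta> where "\<Delta> j = c j (b $ j) - c j (a $ j)" for j
    have \<Phi>: "b $ j - a $ j \<le> \<Phi> j" "\<Phi> j > 0" for j
      using jump_diff_ge[of "a $ j" "b $ j" "S j"] lt[of j] by (auto simp: \<Phi>_def)
    have est: "norm (\<Delta> j - (b $ j - a $ j) *\<^sub>R d j (t $ j)) \<le> \<eta> * \<Phi> j" for j
      unfolding \<Delta>_def \<Phi>_def using ab[of j] lt[of j] \<delta>(2)[of j] by (intro \<delta>1(2)) auto
    have n1: "norm ((b $ j - a $ j) *\<^sub>R d j (t $ j)) \<le> (M - 1) * \<Phi> j" for j
    proof -
      have "norm ((b $ j - a $ j) *\<^sub>R d j (t $ j)) = norm (d j (t $ j)) * (b $ j - a $ j)" using lt[of j] by simp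
      also have "\<dots> \<le> (M - 1) * \<Phi> j" using dM[of j] \<Phi>[of j] lt[of j] M by (intro mult_mono) auto
      finally show ?thesis .
    qed
    have n2: "norm (\<Delta> j) \<le> M * \<Phi> j" for j
    proof -
      have "norm (\<Delta> j) \<le> \<eta> * \<Phi> j + (M - 1) * \<Phi> j"
        using norm_triangle_sub[of "\<Delta> j" "(b $ j - a $ j) *\<^sub>R d j (t $ j)"] est[of j] n1[of j] by linarith
      also have "\<dots> \<le> 1 * \<Phi> j + (M - 1) * \<Phi> j" using \<eta> \<Phi>[of j] by (intro add_mono mult_right_mono) auto
      finally show ?thesis by (simp add: algebra_simps)
    qed
    let ?X = "\<Prod>j\<in>UNIV. M * \<Phi> j"
    have X: "?X = M ^ CARD('n) * (\<Prod>j\<in>UNIV. \<Phi> j)" by (simp add: prod.distrib)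
    have pd: "norm ((\<Prod>j\<in>UNIV. \<Delta> j) - (\<Prod>j\<in>UNIV. (b $ j - a $ j) *\<^sub>R d j (t $ j))) \<le> ?X * (n * \<eta>)"
    proof -
      \<comment> \<open>Division by \<open>M * \<Phi> j\<close> brings all factors into the closed
        unit disc, where a difference of products is at most the sum of the differences.\<close>
      let ?s = "\<lambda>j. complex_of_real (M * \<Phi> j)"
      have s: "norm (?s j) = M * \<Phi> j" "?s j \<noteq> 0" "M * \<Phi> j > 0" for j
        using \<Phi>(2)[of j] M by (auto simp: norm_mult)
      let ?z = "\<lambda>j. \<Delta> j / ?s j" and ?w = "\<lambda>j. ((b $ j - a $ j) *\<^sub>R d j (t $ j)) / ?s j"
      have "norm ((\<Prod>j\<in>UNIV. ?z j) - (\<Prod>j\<in>UNIV. ?w j)) \<le> (\<Sum>j\<in>UNIV. norm (?z j - ?w j))"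
      proof (rule norm_prod_diff)
        fix j show "norm (?z j) \<le> 1" using n2[of j] s[of j] by (simp only: norm_divide s(1) divide_le_eq_1_pos)
        have "(M - 1) * \<Phi> j \<le> M * \<Phi> j" using \<Phi>(2)[of j] by simp
        then show "norm (?w j) \<le> 1" using n1[of j] s[of j] by (simp only: norm_divide s(1) divide_le_eq_1_pos)
      qed
      also have "\<dots> \<le> (\<Sum>j\<in>(UNIV::'n set). \<eta>)"
      proof (rule sum_mono)
        fix j
        have "norm (?z j - ?w j) = norm (\<Delta> j - (b $ j - a $ j) *\<^sub>R d j (t $ j)) / (M * \<Phi> j)"
          by (simp only: diff_divide_distrib[symmetric] norm_divide s(1))
        also have "\<dots> \<le> \<eta> * \<Phi> j / (M * \<Phi> j)" using est[of j] s(3)[of j] by (intro divide_right_mono) auto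
        also have "\<dots> \<le> \<eta>" using M \<Phi>(2)[of j] \<eta> by (simp add: field_simps)
        finally show "norm (?z j - ?w j) \<le> \<eta>" .
      qed
      finally have a: "norm ((\<Prod>j\<in>UNIV. ?z j) - (\<Prod>j\<in>UNIV. ?w j)) \<le> n * \<eta>" by (simp add: n_def)
      have "(\<Prod>j\<in>UNIV. \<Delta> j) - (\<Prod>j\<in>UNIV. (b $ j - a $ j) *\<^sub>R d j (t $ j)) =
         (\<Prod>j\<in>UNIV. ?s j) * ((\<Prod>j\<in>UNIV. ?z j) - (\<Prod>j\<in>UNIV. ?w j))"
        using s(2) by (simp only: right_diff_distrib prod.distrib[symmetric] nonzero_mult_div_cancel_left times_divide_eq_right not_False_eq_True)
      then have "norm ((\<Prod>j\<in>UNIV. \<Delta> j) - (\<Prod>j\<in>UNIV. (b $ j - a $ j) *\<^sub>R d j (t $ j))) =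
         ?X * norm ((\<Prod>j\<in>UNIV. ?z j) - (\<Prod>j\<in>UNIV. ?w j))"
        by (simp only: norm_mult prod_norm[symmetric] s(1))
      also have "\<dots> \<le> ?X * (n * \<eta>)"
        by (rule mult_left_mono[OF a]) (use s(3) in \<open>simp add: prod_nonneg less_imp_le\<close>)
      finally show ?thesis .
    qed
    let ?LL = "\<lambda>j. contour_integral (linepath (c j (a $ j)) (c j (b $ j)))"
    have sub: "path_image (subpath (cl (a $ j)) (cl (b $ j)) (c j)) \<subseteq> B j" for j
    proof -
      have "c j s \<in> B j" if "a $ j \<le> s" "s \<le> b $ j" for s
        using that ab[of j] \<delta>(3)[of j] by (intro \<delta>2(2)) (auto simp: dist_real_def)
      then show ?thesis
        using ab[of j] by (auto simp: cl_id path_image_subpath)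
    qed
    have cab: "c j (a $ j) \<in> B j" "c j (b $ j) \<in> B j" for j
      using ab[of j] \<delta>(3)[of j] by (auto intro!: \<delta>2(2) simp: dist_real_def)
    have vs: "valid_path (subpath (cl (a $ j)) (cl (b $ j)) (c j))" for j
      using cl_in by (intro valid_path_subpath c) auto
    have afL: "afun (B j) (Lb a b j)" for j
      unfolding Lb_def by (rule afun_contour_integral[OF Bo(1) vs sub])
    have afLL: "afun (B j) (?LL j)" for j
      by (rule afun_contour_integral[OF Bo(1)]) (use cab Bo in \<open>auto simp: closed_segment_subset\<close>)
    \<comment> \<open>The base point is moved into the small product \<open>B\<close>, on which
      subpaths may be exchanged for chords.\<close>
    have "Th a b = It js (Lb a b) F P"
      unfolding Th_def by (rule It_agree) (use js in auto)
    also have "\<dots> = It js ?LL F P"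
    proof (rule It_cong_fun[OF Bo(1) afL afLL _ FB PB])
      fix j f assume "f holomorphic_on B j"
      then show "Lb a b j f = ?LL j f"
        unfolding Lb_def using contour_integral_convex_line[OF _ Bo(2) Bo(1) vs sub, of f j] ab[of j] by (simp add: cl_id)
    qed
    finally have ThL: "Th a b = It js ?LL F P" .
    have "norm (It js ?LL (\<lambda>u. F u - F P) P) \<le> \<eta> * (\<Prod>j\<in>set js. norm (\<Delta> j))"
      unfolding \<Delta>_def by (rule It_line_bound[OF Bo]) (use cab FB Fle \<eta> PB js in auto)
    also have "\<dots> \<le> \<eta> * ?X"
      using js n2 \<eta> by (auto intro!: mult_left_mono prod_mono)
    finally have "norm (It js ?LL (\<lambda>u. F u - F P) P) \<le> \<eta> * ?X" .
    moreover have "It js ?LL (\<lambda>u. F u - F P) P = It js ?LL F P - It js ?LL (\<lambda>u. F P) P"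
      by (rule It_diff[OF Bo(1) afLL FB csh_const PB])
    moreover have "It js ?LL (\<lambda>u. F P) P = F P * (\<Prod>j\<in>UNIV. \<Delta> j)"
      using It_line_const[OF js(1)] js(2) by (simp add: \<Delta>_def)
    ultimately have e1: "norm (Th a b - F P * (\<Prod>j\<in>UNIV. \<Delta> j)) \<le> \<eta> * ?X"
      by (simp add: ThL)
    have "(\<Prod>j\<in>UNIV. b $ j - a $ j) *\<^sub>R (F P * (\<Prod>j\<in>UNIV. d j (t $ j))) = F P * (\<Prod>j\<in>UNIV. (b $ j - a $ j) *\<^sub>R d j (t $ j))"
      by (simp add: scaleR_conv_of_real prod.distrib mult_ac)
    then have "norm ((\<Prod>j\<in>UNIV. b $ j - a $ j) *\<^sub>R (F P * (\<Prod>j\<in>UNIV. d j (t $ j))) - Th a b) =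
      norm (F P * ((\<Prod>j\<in>UNIV. \<Delta> j) - (\<Prod>j\<in>UNIV. (b $ j - a $ j) *\<^sub>R d j (t $ j))) + (Th a b - F P * (\<Prod>j\<in>UNIV. \<Delta> j)))"
      by (simp add: norm_minus_commute right_diff_distrib)
    also have "\<dots> \<le> norm (F P) * (?X * (n * \<eta>)) + \<eta> * ?X"
      by (rule norm_triangle_mono[OF _ e1]) (use pd in \<open>auto simp: norm_mult intro!: mult_left_mono\<close>)
    also have "\<dots> = (\<eta> * C) * (\<Prod>j\<in>UNIV. \<Phi> j)" by (simp add: X C_def algebra_simps)
    also have "\<dots> \<le> \<epsilon> * (\<Prod>j\<in>UNIV. \<Phi> j)"
      by (rule mult_right_mono[OF \<eta>(3)]) (use \<Phi>(2) in \<open>simp add: prod_nonneg less_imp_le\<close>)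
    finally show ?thesis by (simp add: \<Phi>_def)
  qed
  then show ?thesis using \<delta>(1) unfolding P_def by blast
qed

text \<open>When the local estimate is summed over a fine tagged division, the values of
  \<open>Th\<close> add up to the iterated integral, and the errors add up to
  \<open>\<epsilon> * \<omega> 0 1\<close>, because the product of the jump increments is additive
  as well.\<close>

theorem cube_integral_eq_It:
  "((\<lambda>t::real ^ 'n. F (\<chi> j. c j (t $ j)) * (\<Prod>j\<in>UNIV. vector_derivative (c j) (at (t $ j) within {0..1})))
     has_integral It js (\<lambda>j. contour_integral (c j)) F w0) (cbox 0 1)"
proof -
  have "\<exists>S. finite S \<and> (\<forall>s \<in> {0..1} - S. (c j has_vector_derivative vector_derivative (c j) (at s within {0..1})) (at s))" for j
    using valid_path_derivative[OF c(1)[of j]] by metis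
  then obtain S where S: "\<And>j. finite (S j)" "\<And>j s. s \<in> {0..1} - S j \<Longrightarrow>
     (c j has_vector_derivative vector_derivative (c j) (at s within {0..1})) (at s)"
    by metis
  let ?d = "\<lambda>j s. vector_derivative (c j) (at s within {0..1})"
  let ?f = "\<lambda>t::real ^ 'n. F (\<chi> j. c j (t $ j)) * (\<Prod>j\<in>UNIV. ?d j (t $ j))"
  define \<omega> where "\<omega> a b = (\<Prod>j\<in>UNIV. jump (S j) (b $ j) - jump (S j) (a $ j))" for a b :: "real ^ 'n"
  have \<omega>0: "\<omega> 0 1 \<ge> 0"
    unfolding \<omega>_def
  proof (rule prod_nonneg)
    fix j show "0 \<le> jump (S j) ((1 :: real ^ 'n) $ j) - jump (S j) ((0 :: real ^ 'n) $ j)"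
      using jump_diff_ge[of 0 1 "S j"] by simp
  qed
  have Th01: "Th 0 1 = It js (\<lambda>j. contour_integral (c j)) F w0"
    unfolding Th_def Lb_def by (simp add: cl_def)
  show ?thesis
    unfolding has_integral Th01[symmetric]
  proof (intro allI impI)
    fix e :: real assume e: "e > 0"
    define \<epsilon> where "\<epsilon> = e / (2 * (\<omega> 0 1 + 1))"
    have \<epsilon>: "\<epsilon> > 0" "\<epsilon> * \<omega> 0 1 < e"
      using e \<omega>0 by (auto simp: \<epsilon>_def field_simps add_pos_nonneg)
    define Q where "Q t \<delta> \<longleftrightarrow> (\<forall>a b. (\<forall>j. 0 \<le> a $ j \<and> a $ j \<le> t $ j \<and> t $ j \<le> b $ j \<and> b $ j \<le> 1 \<and> b $ j - a $ j < \<delta>) \<longrightarrow>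
      norm ((\<Prod>j\<in>UNIV. b $ j - a $ j) *\<^sub>R ?f t - Th a b) \<le> \<epsilon> * \<omega> a b)" for t :: "real ^ 'n" and \<delta> :: real
    have "\<exists>\<delta>>0. t \<in> cbox 0 1 \<longrightarrow> Q t \<delta>" for t :: "real ^ 'n"
    proof (cases "t \<in> cbox 0 1")
      case True
      then have "0 \<le> t $ j" "t $ j \<le> 1" for j by (auto simp: mem_box_cart)
      moreover have "(c j has_vector_derivative ?d j s) (at s within {0..1})" if "s \<in> {0..1} - S j" for j s
        using S(2)[OF that] by (rule has_vector_derivative_at_within)
      ultimately show ?thesis
        unfolding \<omega>_def Q_def using local_estimate[where t = t and S = S and d = ?d, OF _ _ \<epsilon>(1) S(1)] by blast
    qed (auto intro!: exI[of _ 1])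
    then obtain \<delta> where \<delta>: "\<And>t::real ^ 'n. \<delta> t > 0" "\<And>t. t \<in> cbox 0 1 \<Longrightarrow> Q t (\<delta> t)"
      by metis
    show "\<exists>\<gamma>. gauge \<gamma> \<and> (\<forall>\<D>. \<D> tagged_division_of cbox 0 1 \<and> \<gamma> fine \<D> \<longrightarrow>
       norm ((\<Sum>(x, k)\<in>\<D>. measure lborel k *\<^sub>R ?f x) - Th 0 1) < e)"
    \<comment> \<open>A box inside a ball of radius \<open>\<delta> t / 2\<close> has all edges
      shorter than \<open>\<delta> t\<close>.\<close>
    proof (intro exI[of _ "\<lambda>t. ball t (\<delta> t / 2)"] conjI allI impI)
      show "gauge (\<lambda>t. ball t (\<delta> t / 2))" using \<delta>(1) by (auto simp: gauge_def)
      fix p :: "((real ^ 'n) \<times> (real ^ 'n) set) set"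
      assume p: "p tagged_division_of cbox 0 1 \<and> (\<lambda>t. ball t (\<delta> t / 2)) fine p"
      let ?l = interval_lowerbound and ?u = interval_upperbound
      have fin: "finite p" using p by (meson tagged_division_of_finite)
      have s1: "(\<Sum>(x, K)\<in>p. Th (?l K) (?u K)) = Th 0 1"
        by (rule box_additive_tagged_division[OF Th_split]) (use p in auto)
      have s2: "(\<Sum>(x, K)\<in>p. \<omega> (?l K) (?u K)) = \<omega> 0 1"
      proof (rule box_additive_tagged_division)
        fix a b :: "real ^ 'n" and k m
        have r: "(\<Prod>j\<in>UNIV. g j) = g k * (\<Prod>j\<in>UNIV - {k}. g j)" for g :: "'n \<Rightarrow> real"
          by (simp add: prod.remove)
        have "(\<Prod>j\<in>UNIV - {k}. jump (S j) (vupd b k m $ j) - jump (S j) (a $ j)) = (\<Prod>j\<in>UNIV - {k}. jump (S j) (b $ j) - jump (S j) (a $ j))"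
          "(\<Prod>j\<in>UNIV - {k}. jump (S j) (b $ j) - jump (S j) (vupd a k m $ j)) = (\<Prod>j\<in>UNIV - {k}. jump (S j) (b $ j) - jump (S j) (a $ j))"
          by (auto intro!: prod.cong)
        then show "\<omega> a b = \<omega> a (vupd b k m) + \<omega> (vupd a k m) b"
          unfolding \<omega>_def r by (simp add: algebra_simps)
      qed (use p in auto)
      have le: "norm (measure lborel K *\<^sub>R ?f x - Th (?l K) (?u K)) \<le> \<epsilon> * \<omega> (?l K) (?u K)" if xK: "(x, K) \<in> p" for x K
      proof -
        obtain a b where K: "K = cbox a b" "x \<in> K" "K \<subseteq> cbox 0 1"
          using p xK tagged_division_ofD(2,3,4) by metis
        have fine: "K \<subseteq> ball x (\<delta> x / 2)" using p xK by (auto simp: fine_def)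
        have abx: "a $ j \<le> x $ j" "x $ j \<le> b $ j" for j using K by (auto simp: mem_box_cart)
        then have ab: "a $ j \<le> b $ j" for j by (meson order.trans)
        then have "a \<in> K" "b \<in> K" using K by (auto simp: mem_box_cart)
        then have "dist x a < \<delta> x / 2" "dist x b < \<delta> x / 2" "a \<in> cbox 0 1" "b \<in> cbox 0 1" using fine K by auto
        then have "dist b a < \<delta> x" using dist_triangle2[of b a x] by (simp add: dist_commute)
        then have "b $ j - a $ j < \<delta> x" for j
          using dist_vec_nth_le[of b j a] by (simp add: dist_real_def)
        moreover have "0 \<le> a $ j" "b $ j \<le> 1" for j
          using \<open>a \<in> cbox 0 1\<close> \<open>b \<in> cbox 0 1\<close> by (auto simp: mem_box_cart)
        ultimately have "norm ((\<Prod>j\<in>UNIV. b $ j - a $ j) *\<^sub>R ?f x - Th a b) \<le> \<epsilon> * \<omega> a b"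
          using abx K \<delta>(2)[of x] unfolding Q_def by blast
        moreover have "measure lborel K = (\<Prod>j\<in>UNIV. b $ j - a $ j)"
          using K \<open>a \<in> K\<close> by (auto intro!: content_cbox_cart)
        ultimately show ?thesis using ab K(1) by (simp add: interval_bounds_vec)
      qed
      have "(\<Sum>(x, k)\<in>p. measure lborel k *\<^sub>R ?f x) - Th 0 1 = (\<Sum>(x, K)\<in>p. measure lborel K *\<^sub>R ?f x - Th (?l K) (?u K))"
        unfolding s1[symmetric] by (simp add: sum_subtractf split_beta)
      also have "norm \<dots> \<le> (\<Sum>(x, K)\<in>p. \<epsilon> * \<omega> (?l K) (?u K))"
        unfolding split_beta by (rule sum_norm_le) (use le in auto)
      also have "\<dots> = \<epsilon> * \<omega> 0 1"
        unfolding s2[symmetric] by (simp add: sum_distrib_left split_beta)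
      finally show "norm ((\<Sum>(x, k)\<in>p. measure lborel k *\<^sub>R ?f x) - Th 0 1) < e"
        using \<epsilon>(2) by linarith
    qed
  qed
qed

end

subsection \<open>Cauchy's theorem for cycles\<close>

text \<open>Each loop is reached from the base point and left again along the same connecting path,
  so the two passages cancel.\<close>

lemma join_loops:
  assumes C: "open C" "connected C" "a \<in> C"
    and \<Gamma>: "\<And>c. c \<in> set \<Gamma> \<Longrightarrow> valid_path c \<and> pathfinish c = pathstart c \<and> path_image c \<subseteq> C"
  obtains g where "valid_path g" "pathstart g = a" "pathfinish g = a" "path_image g \<subseteq> C"
    "\<And>f. f holomorphic_on C \<Longrightarrow> contour_integral g f = (\<Sum>c\<leftarrow>\<Gamma>. contour_integral c f)"
  using \<Gamma>
proof (induction \<Gamma> arbitrary: thesis)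
  case Nil
  show ?case
  proof (rule Nil(1)[of "linepath a a"])
    show "valid_path (linepath a a)" by (rule valid_path_linepath)
    show "path_image (linepath a a) \<subseteq> C" using C(3) by (simp add: closed_segment_idem)
    show "contour_integral (linepath a a) f = (\<Sum>c\<leftarrow>[]. contour_integral c f)" for f
      by (simp only: contour_integral_trivial list.map sum_list.Nil)
  qed (rule pathstart_linepath pathfinish_linepath)+
next
  case (Cons c \<Gamma>)
  obtain g where g: "valid_path g" "pathstart g = a" "pathfinish g = a" "path_image g \<subseteq> C"
    "\<And>f. f holomorphic_on C \<Longrightarrow> contour_integral g f = (\<Sum>c\<leftarrow>\<Gamma>. contour_integral c f)"
    using Cons.IH Cons.prems(2) by (metis list.set_intros(2))
  have c: "valid_path c" "pathfinish c = pathstart c" "path_image c \<subseteq> C"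
    using Cons.prems(2)[of c] by auto
  then have "pathstart c \<in> C" by auto
  then obtain p where p: "polynomial_function p" "path_image p \<subseteq> C" "pathstart p = a" "pathfinish p = pathstart c"
    using connected_open_polynomial_connected C by metis
  then have vp: "valid_path p" by (simp add: valid_path_polynomial_function)
  let ?g = "p +++ c +++ reversepath p +++ g"
  show ?case
  proof (rule Cons.prems(1)[of ?g])
    show "valid_path ?g" "pathstart ?g = a" "pathfinish ?g = a" "path_image ?g \<subseteq> C"
      using p vp c g by (auto intro!: valid_path_join simp: path_image_join)
    fix f assume f: "f holomorphic_on C"
    have i: "f contour_integrable_on q" if "valid_path q" "path_image q \<subseteq> C" for q
      using contour_integrable_holomorphic_simple[OF f C(1)] that by blast
    have "contour_integral ?g f = contour_integral p f + (contour_integral c f + (contour_integral (reversepath p) f + contour_integral g f))"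
      using p vp c g by (simp add: contour_integral_join i contour_integrable_join path_image_join)
    then show "contour_integral ?g f = (\<Sum>c\<leftarrow>c # \<Gamma>. contour_integral c f)"
      using g(5)[OF f] vp by (simp add: contour_integral_reversepath)
  qed
qed

lemma sum_list_partition:
  fixes h :: "'a \<Rightarrow> 'c::comm_monoid_add"
  assumes "finite A" "\<And>x. x \<in> set xs \<Longrightarrow> k x \<in> A"
  shows "(\<Sum>x\<leftarrow>xs. h x) = (\<Sum>a\<in>A. \<Sum>x\<leftarrow>filter (\<lambda>x. k x = a) xs. h x)"
  using assms(2)
proof (induction xs)
  case (Cons x xs)
  have "(\<Sum>a\<in>A. \<Sum>x\<leftarrow>filter (\<lambda>x. k x = a) (x # xs). h x) =
      (\<Sum>a\<in>A. (if k x = a then h x else 0) + (\<Sum>x\<leftarrow>filter (\<lambda>x. k x = a) xs. h x))"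
    by (rule sum.cong) auto
  then show ?case using Cons assms(1) by (simp add: sum.distrib)
qed simp

text \<open>A segment from \<open>p\<close> to a point of \<open>C\<close> is followed until it
  meets the frontier of \<open>C\<close>; the part traversed is \<open>T\<close>. Winding numbers of
  loops inside \<open>C\<close> therefore agree at \<open>p\<close> and \<open>q\<close>.\<close>

lemma frontier_on_connected_set:
  fixes C :: "complex set"
  assumes C: "open C" "C \<noteq> {}" and p: "p \<notin> C"
  obtains q T where "q \<in> closure C" "q \<notin> C" "connected T" "p \<in> T" "q \<in> T" "T \<inter> C = {}"
proof -
  obtain x0 where x0: "x0 \<in> C" using C by blast
  obtain h where h: "path h" "pathstart h = p" "path_image h \<subseteq> - C" "pathfinish h \<in> frontier (- C)"
    using exists_path_subpath_to_frontier_closed[of "- C" "linepath p x0"] C(1) p x0 by auto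
  have "pathfinish h \<in> closure C" "pathfinish h \<notin> C"
    using h(4)[unfolded frontier_complement] C(1) by (auto simp: frontier_def interior_open)
  then show ?thesis
    using that[of "pathfinish h" "path_image h"] h by (auto simp: connected_path_image)
qed

lemma loop_winding_constant:
  assumes "path c" "pathfinish c = pathstart c" "connected T" "T \<inter> path_image c = {}" "x \<in> T" "y \<in> T"
  shows "winding_number c x = winding_number c y"
  using winding_number_constant[OF assms(1-4)] assms(5,6) unfolding constant_on_def by metis

text \<open>Loops outside \<open>C\<close> stay off its closure, so their total winding number is
  constant there. Every point off \<open>C\<close> is connected, outside \<open>C\<close>, to a
  frontier point, which is not in \<open>U\<close>; at such a point the two groups of loops cancel.
  Hence the loops in \<open>C\<close> have one constant total winding number off \<open>C\<close>,
  and a point far away shows that it is \<open>0\<close>.\<close>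

lemma component_cycle_winding:
  assumes U: "open U" and C: "C \<in> components U"
    and \<Gamma>: "\<And>c. c \<in> set \<Gamma> \<Longrightarrow> valid_path c \<and> pathfinish c = pathstart c \<and> path_image c \<subseteq> U"
    and 0: "\<And>p. p \<notin> U \<Longrightarrow> (\<Sum>c\<leftarrow>\<Gamma>. winding_number c p) = 0"
    and p: "p \<notin> C"
  shows "(\<Sum>c\<leftarrow>filter (\<lambda>c. path_image c \<subseteq> C) \<Gamma>. winding_number c p) = 0"
proof -
  let ?\<Gamma>C = "filter (\<lambda>c. path_image c \<subseteq> C) \<Gamma>" and ?\<Gamma>D = "filter (\<lambda>c. \<not> path_image c \<subseteq> C) \<Gamma>"
  have split: "(\<Sum>c\<leftarrow>\<Gamma>. h c) = (\<Sum>c\<leftarrow>?\<Gamma>C. h c) + (\<Sum>c\<leftarrow>?\<Gamma>D. h c)" for h :: "_ \<Rightarrow> complex"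
    by (induction \<Gamma>) auto
  have Co: "open C" "connected C" "C \<noteq> {}"
    using C U open_components in_components_connected in_components_nonempty by blast+
  have pth: "path c" if "c \<in> set \<Gamma>" for c using \<Gamma>[OF that] valid_path_imp_path by blast
  have disj: "closure C \<inter> path_image c = {}" if c: "c \<in> set ?\<Gamma>D" for c
  proof -
    have cU: "path_image c \<subseteq> U" using \<Gamma> c by auto
    have "connected (path_image c)" "path_image c \<noteq> {}" using pth c by (auto simp: connected_path_image)
    then obtain C' where C': "C' \<in> components U" "path_image c \<subseteq> C'"
      using exists_component_superset[of "path_image c" U] cU by (metis subset_empty)
    then have "C \<inter> C' = {}" using C c components_nonoverlap by force
    then have "closure C \<inter> C' = {}"
      using open_components[OF U C'(1)] open_Int_closure_eq_empty by (metis inf_commute)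
    then show ?thesis using C'(2) by blast
  qed
  have wD: "winding_number c x = winding_number c y" if "c \<in> set ?\<Gamma>D" "x \<in> closure C" "y \<in> closure C" for c x y
    by (rule loop_winding_constant[of c "closure C"]) (use that \<Gamma> pth disj[OF that(1)] Co in \<open>auto intro: connected_imp_connected_closure\<close>)
  \<comment> \<open>A frontier point lying in \<open>U\<close> would belong to another component,
    which is open and would meet \<open>C\<close>.\<close>
  have notU: "q \<notin> U" if "q \<in> closure C" "q \<notin> C" for q
  proof
    assume "q \<in> U"
    then obtain C' where C': "C' \<in> components U" "q \<in> C'"
      by (metis Union_components UnionE)
    then have "C \<inter> C' \<noteq> {}"
      using open_components[OF U C'(1)] that(1) open_Int_closure_eq_empty by (metis IntI empty_iff inf_commute)
    then show False using C C' that(2) components_nonoverlap by blast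
  qed
  obtain x0 where x0: "x0 \<in> C" using Co by blast
  have K: "(\<Sum>c\<leftarrow>?\<Gamma>C. winding_number c y) = - (\<Sum>c\<leftarrow>?\<Gamma>D. winding_number c x)"
    if y: "y \<notin> C" and x: "x \<in> C" for x y
  proof -
    obtain q T where q: "q \<in> closure C" "q \<notin> C" "connected T" "y \<in> T" "q \<in> T" "T \<inter> C = {}"
      using frontier_on_connected_set[OF Co(1,3) y] by metis
    have "(\<Sum>c\<leftarrow>?\<Gamma>C. winding_number c y) = (\<Sum>c\<leftarrow>?\<Gamma>C. winding_number c q)"
      by (intro arg_cong[of _ _ sum_list] map_cong refl loop_winding_constant[where T = T])
         (use q \<Gamma> pth in auto)
    moreover have "(\<Sum>c\<leftarrow>?\<Gamma>D. winding_number c x) = (\<Sum>c\<leftarrow>?\<Gamma>D. winding_number c q)"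
      by (intro arg_cong[of _ _ sum_list] map_cong refl wD) (use q x closure_subset in auto)
    ultimately show ?thesis
      using 0[OF notU[OF q(1,2)]] by (simp add: split add_eq_0_iff2)
  qed
  have "bounded (\<Union>c\<in>set \<Gamma>. path_image c)"
    using pth by (auto intro!: bounded_UN bounded_path_image)
  then obtain R where R: "(\<Union>c\<in>set \<Gamma>. path_image c) \<subseteq> cball 0 R"
    by (force simp: bounded_iff)
  have far: "winding_number c x = 0" if "c \<in> set \<Gamma>" "x \<notin> cball 0 R" for c x
    by (rule winding_number_zero_outside[of c "cball 0 R"]) (use that \<Gamma> pth R in auto)
  show ?thesis
  \<comment> \<open>If \<open>C\<close> reaches beyond the disc, the loops outside \<open>C\<close>
    are tested there; otherwise the loops in \<open>C\<close> are tested at a far point, which is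
    off \<open>C\<close>.\<close>
  proof (cases "\<exists>x\<in>C. x \<notin> cball 0 R")
    case True
    then obtain x where x: "x \<in> C" "x \<notin> cball 0 R" by blast
    have "(\<Sum>c\<leftarrow>?\<Gamma>D. winding_number c x) = (\<Sum>c\<leftarrow>?\<Gamma>D. 0)"
      by (intro arg_cong[of _ _ sum_list] map_cong refl far) (use x in auto)
    then show ?thesis using K[OF p x(1)] by simp
  next
    case False
    have "of_real (\<bar>R\<bar> + 1) \<notin> cball (0::complex) R" by simp
    moreover from this have "of_real (\<bar>R\<bar> + 1) \<notin> C" using False by blast
    moreover have "(\<Sum>c\<leftarrow>?\<Gamma>C. winding_number c (of_real (\<bar>R\<bar> + 1))) = (\<Sum>c\<leftarrow>?\<Gamma>C. 0)"
      by (intro arg_cong[of _ _ sum_list] map_cong refl far) (use calculation in auto)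
    ultimately show ?thesis using K[OF p x0] K[of "of_real (\<bar>R\<bar> + 1)" x0] x0 by simp
  qed
qed

text \<open>The loops are sorted by the components of \<open>U\<close>, and those in one component
  are joined to a single closed path in it. Its winding numbers vanish off the component, not merely
  off \<open>U\<close>, so Cauchy's theorem for one closed path applies.\<close>

theorem Cauchy_theorem_cycle:
  assumes U: "open U" and f: "f holomorphic_on U"
    and \<Gamma>: "\<And>c. c \<in> set \<Gamma> \<Longrightarrow> valid_path c \<and> pathfinish c = pathstart c \<and> path_image c \<subseteq> U"
    and 0: "\<And>p. p \<notin> U \<Longrightarrow> (\<Sum>c\<leftarrow>\<Gamma>. winding_number c p) = 0"
  shows "(\<Sum>c\<leftarrow>\<Gamma>. contour_integral c f) = 0"
proof -
  have "\<exists>C\<in>components U. path_image c \<subseteq> C" if c: "c \<in> set \<Gamma>" for c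
  proof -
    have "connected (path_image c)" "path_image c \<noteq> {}" "path_image c \<subseteq> U"
      using \<Gamma>[OF c] valid_path_imp_path by (auto simp: connected_path_image)
    then show ?thesis
      using exists_component_superset[of "path_image c" U] by (metis subset_empty)
  qed
  then obtain k where k: "\<And>c. c \<in> set \<Gamma> \<Longrightarrow> k c \<in> components U" "\<And>c. c \<in> set \<Gamma> \<Longrightarrow> path_image c \<subseteq> k c"
    by metis
  have "(\<Sum>c\<leftarrow>filter (\<lambda>c. k c = C) \<Gamma>. contour_integral c f) = 0" if C: "C \<in> k ` set \<Gamma>" for C
  proof -
    have Cc: "C \<in> components U" using C k(1) by auto
    have eq: "filter (\<lambda>c. k c = C) \<Gamma> = filter (\<lambda>c. path_image c \<subseteq> C) \<Gamma>"
    proof (rule filter_cong[OF refl])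
      fix c assume c: "c \<in> set \<Gamma>"
      have "path_image c \<noteq> {}" by simp
      then have "k c = C" if "path_image c \<subseteq> C"
        using that k[OF c] Cc components_nonoverlap[of "k c" U C] by blast
      then show "(k c = C) = (path_image c \<subseteq> C)" using k(2)[OF c] by auto
    qed
    note Co = open_components[OF U Cc] in_components_connected[OF Cc] in_components_nonempty[OF Cc] in_components_subset[OF Cc]
    obtain a where a: "a \<in> C" using Co by blast
    have \<Gamma>': "valid_path c \<and> pathfinish c = pathstart c \<and> path_image c \<subseteq> C" if "c \<in> set (filter (\<lambda>c. path_image c \<subseteq> C) \<Gamma>)" for c
      using that \<Gamma> by auto
    obtain g where g: "valid_path g" "pathstart g = a" "pathfinish g = a" "path_image g \<subseteq> C"
      "\<And>f. f holomorphic_on C \<Longrightarrow> contour_integral g f = (\<Sum>c\<leftarrow>filter (\<lambda>c. path_image c \<subseteq> C) \<Gamma>. contour_integral c f)"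
      by (rule join_loops[OF Co(1,2) a, of "filter (\<lambda>c. path_image c \<subseteq> C) \<Gamma>"]) (use \<Gamma>' in blast, blast)
    have "winding_number g p = 0" if p: "p \<notin> C" for p
    proof -
      have "contour_integral g (\<lambda>w. 1 / (w - p)) = (\<Sum>c\<leftarrow>filter (\<lambda>c. path_image c \<subseteq> C) \<Gamma>. contour_integral c (\<lambda>w. 1 / (w - p)))"
        using p by (intro g(5) holomorphic_intros) auto
      also have "\<dots> = (\<Sum>c\<leftarrow>filter (\<lambda>c. path_image c \<subseteq> C) \<Gamma>. 2 * of_real pi * \<i> * winding_number c p)"
      proof (intro arg_cong[of _ _ sum_list] map_cong refl)
        fix c assume "c \<in> set (filter (\<lambda>c. path_image c \<subseteq> C) \<Gamma>)"
        then have "valid_path c" "p \<notin> path_image c" using \<Gamma>'[of c] p by blast+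
        then show "contour_integral c (\<lambda>w. 1 / (w - p)) = 2 * of_real pi * \<i> * winding_number c p"
          by (simp add: winding_number_valid_path)
      qed
      also have "\<dots> = 0"
      proof -
        have "(\<Sum>c\<leftarrow>filter (\<lambda>c. path_image c \<subseteq> C) \<Gamma>. winding_number c p) = 0"
          by (rule component_cycle_winding[OF U Cc _ _ p]) (use \<Gamma> 0 in blast)+
        then show ?thesis by (simp only: sum_list_const_mult mult_zero_right)
      qed
      finally have "contour_integral g (\<lambda>w. 1 / (w - p)) = 0" .
      moreover have "p \<notin> path_image g" using g p by blast
      ultimately show ?thesis
        by (simp add: winding_number_valid_path[OF g(1)])
    qed
    then have "(f has_contour_integral 0) g"
      using g Co f by (intro Cauchy_theorem_global[of C]) (auto intro: holomorphic_on_subset)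
    then show ?thesis
      using g(5)[OF holomorphic_on_subset[OF f Co(4)]] eq by (simp add: contour_integral_unique)
  qed
  then show ?thesis
    using sum_list_partition[of "k ` set \<Gamma>" \<Gamma> k "\<lambda>c. contour_integral c f"] by simp
qed

section \<open>Integrals over products of cycles as iterated integrals\<close>

lemma It_cong_functionals: "(\<And>j. j \<in> set js \<Longrightarrow> L j = L' j) \<Longrightarrow> It js L F w = It js L' F w"
  by (induction js arbitrary: w) auto

text \<open>The iterated integral is multilinear in the functionals; expanding all sums gives one
  term for each choice function.\<close>

lemma It_sum_functionals:
  fixes m :: "'n::finite \<Rightarrow> nat"
  assumes op: "\<And>j. open (D j)" and L: "\<And>j i. i < m j \<Longrightarrow> afun (D j) (L j i)"
    and F: "csh F D" and w: "w \<in> cart D" and js: "distinct js"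
  shows "It js (\<lambda>j f. \<Sum>i<m j. L j i f) F w = (\<Sum>k\<in>PiE (set js) (\<lambda>j. {..<m j}). It js (\<lambda>j. L j (k j)) F w)"
  using w js
proof (induction js arbitrary: w)
  case (Cons j js)
  let ?P = "PiE (set js) (\<lambda>j. {..<m j})" and ?S = "\<lambda>j f. \<Sum>i<m j. L j i f"
  have csk: "csh (It js (\<lambda>j. L j (k j)) F) D" if "k \<in> ?P" for k
  proof -
    \<comment> \<open>Off \<open>js\<close> the index \<open>k i\<close> is \<open>undefined\<close>
      and may be out of range; the zero functional takes its place.\<close>
    define L' where "L' i = (if i \<in> set js then L i (k i) else (\<lambda>f. \<Sum>x\<leftarrow>([]::nat list). 0))" for i
    have "afun (D i) (L' i)" for i
      using that L[of "k i" i] afun_sum_list[of "[]" "D i"] by (auto simp: L'_def PiE_iff)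
    from It_csh[OF op this F, of js] show ?thesis
      by (rule csh_cong) (rule It_cong_functionals, simp add: L'_def)
  qed
  have fin: "finite ?P" by (rule finite_PiE) auto
  have hol: "(\<lambda>x. It js (\<lambda>j. L j (k j)) F (vupd w j x)) holomorphic_on D j" if "k \<in> ?P" for k
    using csh_slice[OF csk[OF that] Cons.prems(1)] .
  have Lsum: "L j i (\<lambda>x. \<Sum>k\<in>A. h k x) = (\<Sum>k\<in>A. L j i (h k))"
    if "i < m j" "\<And>k. k \<in> A \<Longrightarrow> h k holomorphic_on D j" for i A and h :: "('a \<Rightarrow> nat) \<Rightarrow> complex \<Rightarrow> complex"
    using that(2)
  proof (induction A rule: infinite_finite_induct)
    case (insert x A)
    have "L j i (\<lambda>y. h x y + (\<Sum>k\<in>A. h k y)) = L j i (h x) + L j i (\<lambda>y. \<Sum>k\<in>A. h k y)"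
      by (rule afun_add[OF L[OF that(1)] op]) (use insert in \<open>auto intro!: holomorphic_on_sum\<close>)
    then show ?case using insert by simp
  qed (use afun_cmult[OF L[OF that(1)] op, of "\<lambda>_. 0" 0] in auto)
  have "It (j # js) ?S F w = (\<Sum>i<m j. L j i (\<lambda>x. It js ?S F (vupd w j x)))" by simp
  also have "\<dots> = (\<Sum>i<m j. L j i (\<lambda>x. \<Sum>k\<in>?P. It js (\<lambda>j. L j (k j)) F (vupd w j x)))"
  proof (intro sum.cong refl)
    fix i assume i: "i \<in> {..<m j}"
    have "L j i (\<lambda>x. \<Sum>k\<in>?P. It js (\<lambda>j. L j (k j)) F (vupd w j x)) = L j i (\<lambda>x. It js ?S F (vupd w j x))"
    proof (rule afun_cong[OF L])
      show "i < m j" using i by simp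
      show "(\<lambda>x. \<Sum>k\<in>?P. It js (\<lambda>j. L j (k j)) F (vupd w j x)) holomorphic_on D j"
        by (intro holomorphic_on_sum hol)
      fix x assume "x \<in> D j"
      then show "(\<Sum>k\<in>?P. It js (\<lambda>j. L j (k j)) F (vupd w j x)) = It js ?S F (vupd w j x)"
        using Cons.prems by (intro Cons.IH[symmetric]) (auto intro: vupd_in_cart)
    qed
    then show "L j i (\<lambda>x. It js ?S F (vupd w j x)) = L j i (\<lambda>x. \<Sum>k\<in>?P. It js (\<lambda>j. L j (k j)) F (vupd w j x))" by simp
  qed
  also have "\<dots> = (\<Sum>i<m j. \<Sum>k\<in>?P. L j i (\<lambda>x. It js (\<lambda>j. L j (k j)) F (vupd w j x)))"
    by (intro sum.cong refl Lsum hol) auto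
  also have "\<dots> = (\<Sum>(i, k)\<in>{..<m j} \<times> ?P. L j i (\<lambda>x. It js (\<lambda>j. L j (k j)) F (vupd w j x)))"
    by (simp add: sum.cartesian_product)
  also have "\<dots> = (\<Sum>(i, k)\<in>{..<m j} \<times> ?P. It (j # js) (\<lambda>l. L l ((k(j := i)) l)) F w)"
  proof (intro sum.cong refl, clarify)
    fix i k
    have "It js (\<lambda>j. L j (k j)) F v = It js (\<lambda>l. L l ((k(j := i)) l)) F v" for v
      by (rule It_cong_functionals) (use Cons.prems(2) in auto)
    then show "L j i (\<lambda>x. It js (\<lambda>j. L j (k j)) F (vupd w j x)) = It (j # js) (\<lambda>l. L l ((k(j := i)) l)) F w"
      by simp
  qed
  also have "\<dots> = (\<Sum>k\<in>(\<lambda>(i, k). k(j := i)) ` ({..<m j} \<times> ?P). It (j # js) (\<lambda>l. L l (k l)) F w)"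
    by (subst sum.reindex) (use Cons.prems(2) in \<open>auto intro!: inj_combinator sum.cong simp: o_def\<close>)
  also have "(\<lambda>(i, k). k(j := i)) ` ({..<m j} \<times> ?P) = PiE (set (j # js)) (\<lambda>j. {..<m j})"
    by (simp add: PiE_insert_eq)
  finally show ?case .
qed simp

definition cyc :: "(real \<Rightarrow> complex) list \<Rightarrow> (complex \<Rightarrow> complex) \<Rightarrow> complex" where
  "cyc \<Gamma> f = (\<Sum>c\<leftarrow>\<Gamma>. contour_integral c f)"

lemma afun_cyc:
  assumes "open D" "\<And>c. c \<in> set \<Gamma> \<Longrightarrow> valid_path c \<and> path_image c \<subseteq> D"
  shows "afun D (cyc \<Gamma>)"
  unfolding cyc_def by (intro afun_sum_list afun_contour_integral) (use assms in auto)

text \<open>This turns the gauge integrals over the cube, one for each choice of curves, into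
  iterated one-variable integrals, to which Cauchy's theorem for cycles applies.\<close>

lemma cycle_integral_eq_It:
  fixes F :: "complex ^ 'n::finite \<Rightarrow> complex"
  assumes F: "csh F D" and op: "\<And>j. open (D j)"
    and \<Gamma>: "\<And>j c. c \<in> set (\<Gamma> j) \<Longrightarrow> valid_path c \<and> path_image c \<subseteq> D j"
    and js: "distinct js" "set js = UNIV" and w: "w \<in> cart D"
  shows "cycle_integral \<Gamma> F = It js (\<lambda>j. cyc (\<Gamma> j)) F w"
proof -
  have \<Gamma>': "valid_path (\<Gamma> j ! i)" "path_image (\<Gamma> j ! i) \<subseteq> D j" if "i < length (\<Gamma> j)" for j i
    using \<Gamma>[OF nth_mem[OF that]] by auto
  have "cycle_integral \<Gamma> F = (\<Sum>k\<in>{k. \<forall>j. k j < length (\<Gamma> j)}. It js (\<lambda>j. contour_integral (\<Gamma> j ! k j)) F w)"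
    unfolding cycle_integral_def
  proof (intro sum.cong refl)
    fix k assume "k \<in> {k. \<forall>j. k j < length (\<Gamma> j)}"
    then show "integral (cbox 0 1) (\<lambda>t::real ^ 'n. F (\<chi> j. (\<Gamma> j ! k j) (t $ j)) *
        (\<Prod>j\<in>UNIV. vector_derivative (\<Gamma> j ! k j) (at (t $ j) within {0..1}))) =
      It js (\<lambda>j. contour_integral (\<Gamma> j ! k j)) F w"
      using cube_integral_eq_It[OF F op _ _ js w, of "\<lambda>j. \<Gamma> j ! k j"] \<Gamma>' by (auto intro!: integral_unique)
  qed
  also have "{k. \<forall>j. k j < length (\<Gamma> j)} = PiE (set js) (\<lambda>j. {..<length (\<Gamma> j)})"
    by (auto simp: js PiE_UNIV_domain)
  also have "(\<Sum>k\<in>\<dots>. It js (\<lambda>j. contour_integral (\<Gamma> j ! k j)) F w) =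
      It js (\<lambda>j f. \<Sum>i<length (\<Gamma> j). contour_integral (\<Gamma> j ! i) f) F w"
    by (rule It_sum_functionals[OF op _ F w js(1), symmetric]) (rule afun_contour_integral[OF op \<Gamma>'])
  also have "\<dots> = It js (\<lambda>j. cyc (\<Gamma> j)) F w"
    by (rule It_cong_functionals) (auto simp: cyc_def sum_list_sum_nth atLeast0LessThan)
  finally show ?thesis .
qed

lemma vector_derivative_inverse_path:
  fixes c :: "real \<Rightarrow> complex"
  assumes "(c has_vector_derivative d) (at s)" "c s \<noteq> 0" "s \<in> {0..1}"
  shows "vector_derivative (\<lambda>t. 1 / c t) (at s within {0..1}) = - 1 / (c s)\<^sup>2 * d"
proof -
  have "((\<lambda>w. 1 / w) has_field_derivative - 1 / (c s)\<^sup>2) (at (c s) within c ` {0..1})"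
    using assms(2) by (auto intro!: derivative_eq_intros simp: power2_eq_square)
  from field_vector_diff_chain_within[OF has_vector_derivative_at_within[OF assms(1)] this]
  have "((\<lambda>t. 1 / c t) has_vector_derivative d * (- 1 / (c s)\<^sup>2)) (at s within {0..1})"
    by (simp add: o_def)
  then show ?thesis
    using vector_derivative_within_cbox[of 0 1 s "\<lambda>t. 1 / c t"] assms(3) by (auto simp: mult.commute)
qed

text \<open>The substitution \<open>\<zeta> = 1 / w\<close>, carried out pointwise by the chain
  rule: the exceptional points of the paths give finitely many hyperplanes in the cube, which form a
  null set.\<close>

lemma cycle_integral_inv_cycle:
  fixes G :: "complex ^ 'n::finite \<Rightarrow> complex"
  assumes \<Gamma>: "\<And>j c. c \<in> set (\<Gamma> j) \<Longrightarrow> valid_path c \<and> 0 \<notin> path_image c"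
  shows "cycle_integral (\<lambda>j. inv_cycle (\<Gamma> j)) G =
    cycle_integral \<Gamma> (\<lambda>w. G (\<chi> j. 1 / w $ j) * (\<Prod>j\<in>UNIV. - 1 / (w $ j)\<^sup>2))"
  unfolding cycle_integral_def
proof (intro sum.cong)
  show "{k. \<forall>j. k j < length (inv_cycle (\<Gamma> j))} = {k. \<forall>j. k j < length (\<Gamma> j)}"
    by (simp add: inv_cycle_def)
  fix k assume "k \<in> {k. \<forall>j. k j < length (\<Gamma> j)}"
  then have k: "k j < length (\<Gamma> j)" for j by auto
  define c where "c j = \<Gamma> j ! k j" for j
  have c: "valid_path (c j)" "0 \<notin> path_image (c j)" for j
    using \<Gamma>[OF nth_mem[OF k[of j]]] by (auto simp: c_def)
  have ic: "inv_cycle (\<Gamma> j) ! k j = (\<lambda>t. 1 / c j t)" for j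
    using k[of j] by (simp add: inv_cycle_def c_def)
  have "\<exists>S. finite S \<and> (\<forall>s \<in> {0..1} - S. (c j has_vector_derivative vector_derivative (c j) (at s within {0..1})) (at s))" for j
    using valid_path_derivative[OF c(1)[of j]] by metis
  then obtain S where S: "\<And>j. finite (S j)" "\<And>j s. s \<in> {0..1} - S j \<Longrightarrow>
     (c j has_vector_derivative vector_derivative (c j) (at s within {0..1})) (at s)"
    by metis
  define N where "N = (\<Union>j. \<Union>a\<in>S j. {t :: real ^ 'n. t $ j = a})"
  have "negligible {t :: real ^ 'n. t $ j = a}" for j a
  proof -
    have "axis j 1 \<in> (Basis :: (real ^ 'n) set)" by (auto simp: Basis_vec_def)
    from negligible_standard_hyperplane[OF this, of a] show ?thesis by (simp add: inner_axis inner_real_def)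
  qed
  then have "negligible N"
    unfolding N_def using S(1) by (auto intro!: negligible_Union)
  moreover have "G (\<chi> j. 1 / (c j) (t $ j)) * (\<Prod>j\<in>UNIV. vector_derivative (\<lambda>t. 1 / c j t) (at (t $ j) within {0..1})) =
     G (\<chi> j. 1 / (\<chi> j. c j (t $ j)) $ j) * (\<Prod>j\<in>UNIV. - 1 / ((\<chi> j. c j (t $ j)) $ j)\<^sup>2) *
       (\<Prod>j\<in>UNIV. vector_derivative (c j) (at (t $ j) within {0..1}))"
    if t: "t \<in> cbox 0 1 - N" for t :: "real ^ 'n"
  proof -
    have tj: "t $ j \<in> {0..1} - S j" for j using t by (auto simp: N_def mem_box_cart)
    have "c j (t $ j) \<noteq> 0" for j
      using c(2)[of j] tj[of j] by (auto simp: path_image_def)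
    then have "vector_derivative (\<lambda>t. 1 / c j t) (at (t $ j) within {0..1}) =
        - 1 / (c j (t $ j))\<^sup>2 * vector_derivative (c j) (at (t $ j) within {0..1})" for j
      using S(2)[OF tj] tj by (intro vector_derivative_inverse_path) auto
    then show ?thesis by (simp only: prod.distrib mult.assoc vec_lambda_beta)
  qed
  ultimately show "integral (cbox 0 1) (\<lambda>t::real ^ 'n. G (\<chi> j. (inv_cycle (\<Gamma> j) ! k j) (t $ j)) *
       (\<Prod>j\<in>UNIV. vector_derivative (inv_cycle (\<Gamma> j) ! k j) (at (t $ j) within {0..1}))) =
     integral (cbox 0 1) (\<lambda>t. G (\<chi> j. 1 / (\<chi> j. (\<Gamma> j ! k j) (t $ j)) $ j) * (\<Prod>j\<in>UNIV. - 1 / ((\<chi> j. (\<Gamma> j ! k j) (t $ j)) $ j)\<^sup>2) *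
       (\<Prod>j\<in>UNIV. vector_derivative (\<Gamma> j ! k j) (at (t $ j) within {0..1})))"
    unfolding ic c_def[symmetric] by (intro integral_spike[symmetric]) auto
qed

lemma holomorphic_division_at_0:
  assumes "open D" "Q holomorphic_on D" "0 \<in> D \<Longrightarrow> Q 0 = 0"
  obtains q where "q holomorphic_on D" "\<And>w. w \<noteq> 0 \<Longrightarrow> q w = Q w / w"
proof (cases "(0::complex) \<in> D")
  case True
  show ?thesis
    by (rule that[OF pole_lemma_open[OF assms(2,1), of 0]]) (use assms(3) True in auto)
next
  case False
  then have "w \<noteq> 0" if "w \<in> D" for w using that by blast
  then have "(\<lambda>w. Q w / w) holomorphic_on D"
    by (intro holomorphic_intros assms) auto
  then show ?thesis using that by blast
qed

text \<open>The complement of \<open>D\<close> lies inside the circle, so cycle and circle both wind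
  once around each of its points and their difference is null-homologous in \<open>D\<close>. The
  condition \<open>Q 0 = 0\<close> removes the pole that occurs at \<open>0\<close> for
  \<open>k = 0\<close>; for \<open>Q w = \<psi> (1 / w)\<close> it is the vanishing at
  infinity.\<close>

lemma cycle_eq_circle:
  assumes D: "open D" and R: "R > 0" "\<And>w. R \<le> norm w \<Longrightarrow> w \<in> D"
    and Q: "Q holomorphic_on D" "0 \<in> D \<Longrightarrow> Q 0 = 0"
    and \<Gamma>: "\<And>c. c \<in> set \<Gamma> \<Longrightarrow> valid_path c \<and> pathfinish c = pathstart c \<and> path_image c \<subseteq> D - {0}"
    and 1: "\<And>p. p \<notin> D \<Longrightarrow> cycle_winding \<Gamma> p = 1"
  shows "cyc \<Gamma> (\<lambda>w. w ^ k / w * Q w) = contour_integral (circlepath 0 R) (\<lambda>w. w ^ k / w * Q w)"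
proof -
  obtain q where q: "q holomorphic_on D" "\<And>w. w \<noteq> 0 \<Longrightarrow> q w = Q w / w"
    using holomorphic_division_at_0[OF D Q] by metis
  \<comment> \<open>The two functions agree off \<open>0\<close>, hence on all the curves, but only
    \<open>?f\<close> is holomorphic at \<open>0\<close>.\<close>
  let ?f = "\<lambda>w. w ^ k * q w" and ?g = "\<lambda>w. w ^ k / w * Q w"
  have circ: "path_image (circlepath 0 R) \<subseteq> D - {0}" using R by auto
  have "(\<Sum>c\<leftarrow>reversepath (circlepath 0 R) # \<Gamma>. contour_integral c ?f) = 0"
  proof (rule Cauchy_theorem_cycle[OF D])
    show "?f holomorphic_on D" by (intro holomorphic_intros q)
    show "valid_path c \<and> pathfinish c = pathstart c \<and> path_image c \<subseteq> D" if "c \<in> set (reversepath (circlepath 0 R) # \<Gamma>)" for c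
      using that \<Gamma> circ by (auto simp: valid_path_reversepath)
    fix p assume p: "p \<notin> D"
    then have "norm p < R" using R(2) not_le by blast
    then have "winding_number (circlepath 0 R) p = 1" by (intro winding_number_circlepath) simp
    moreover have "p \<notin> path_image (circlepath 0 R)" using p circ by blast
    ultimately show "(\<Sum>c\<leftarrow>reversepath (circlepath 0 R) # \<Gamma>. winding_number c p) = 0"
      using 1[OF p] by (simp add: cycle_winding_def winding_number_reversepath)
  qed
  then have "(\<Sum>c\<leftarrow>\<Gamma>. contour_integral c ?f) = contour_integral (circlepath 0 R) ?f"
    by (simp add: contour_integral_reversepath)
  moreover have "(\<Sum>c\<leftarrow>\<Gamma>. contour_integral c ?f) = cyc \<Gamma> ?g"
    unfolding cyc_def
  proof (intro arg_cong[of _ _ sum_list] map_cong refl contour_integral_eq)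
    fix c w assume "c \<in> set \<Gamma>" "w \<in> path_image c"
    then have "w \<noteq> 0" using \<Gamma> by blast
    then show "w ^ k * q w = w ^ k / w * Q w" by (simp add: q(2))
  qed
  moreover have "contour_integral (circlepath 0 R) ?f = contour_integral (circlepath 0 R) ?g"
  proof (rule contour_integral_eq)
    fix w assume "w \<in> path_image (circlepath 0 R)"
    then have "w \<noteq> 0" using circ by blast
    then show "w ^ k * q w = w ^ k / w * Q w" by (simp add: q(2))
  qed
  ultimately show ?thesis by simp
qed

subsection \<open>Cycles and large circles\<close>

lemma It_zero_slice:
  assumes op: "\<And>j. open (D j)" and L: "\<And>j. afun (D j) (L j)" and F: "csh F D"
    and js: "distinct js" "j \<notin> set js" and w: "w \<in> cart D" "w $ j = x"
    and 0: "\<And>u. u \<in> cart D \<Longrightarrow> u $ j = x \<Longrightarrow> F u = 0"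
  shows "It js L F w = 0"
proof (rule It_bound[OF op L js(1)])
  fix K C
  assume *: "\<And>F w B. csh F D \<Longrightarrow> w \<in> cart D \<Longrightarrow> B \<ge> 0 \<Longrightarrow>
      (\<And>u. u \<in> cart D \<Longrightarrow> (\<And>j. j \<in> set js \<Longrightarrow> u $ j \<in> K j) \<Longrightarrow> (\<And>j. j \<notin> set js \<Longrightarrow> u $ j = w $ j) \<Longrightarrow> norm (F u) \<le> B) \<Longrightarrow>
      norm (It js L F w) \<le> C * B"
  have "norm (It js L F w) \<le> C * 0"
    by (rule *[OF F w(1)]) (use 0 js(2) w(2) in auto)
  then show "It js L F w = 0" by simp
qed

text \<open>Cycles are exchanged for circles from the innermost variable outwards. With circles
  inside, the inner integral is, apart from the singular factor in the variable \<open>j\<close>,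
  holomorphic on all of \<open>D j\<close>; it vanishes at \<open>0\<close> if \<open>0\<close>
  belongs to \<open>D j\<close>, as \<open>cycle_eq_circle\<close> requires.\<close>

lemma It_cycles_eq_circles:
  fixes Q :: "complex ^ 'n::finite \<Rightarrow> complex"
  assumes D: "\<And>j. open (D j)" and R: "\<And>j. R j > 0" "\<And>j w. R j \<le> norm w \<Longrightarrow> w \<in> D j"
    and Q: "csh Q D" "\<And>w j. w \<in> cart D \<Longrightarrow> w $ j = 0 \<Longrightarrow> Q w = 0"
    and \<Gamma>: "\<And>j c. c \<in> set (\<Gamma> j) \<Longrightarrow> valid_path c \<and> pathfinish c = pathstart c \<and> path_image c \<subseteq> D j - {0}"
    and 1: "\<And>j p. p \<notin> D j \<Longrightarrow> cycle_winding (\<Gamma> j) p = 1"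
    and w: "w \<in> cart (\<lambda>j. D j - {0})" and js: "distinct js"
  shows "It js (\<lambda>j. cyc (\<Gamma> j)) (\<lambda>w. (\<Prod>i\<in>UNIV. w $ i ^ \<alpha> i / w $ i) * Q w) w =
    It js (\<lambda>j. contour_integral (circlepath 0 (R j))) (\<lambda>w. (\<Prod>i\<in>UNIV. w $ i ^ \<alpha> i / w $ i) * Q w) w"
  using w js
proof (induction js arbitrary: w)
  case (Cons j js)
  let ?D = "\<lambda>j. D j - {0}"
  let ?F = "\<lambda>w. (\<Prod>i\<in>UNIV. w $ i ^ \<alpha> i / w $ i) * Q w"
  let ?L = "\<lambda>j. cyc (\<Gamma> j)" and ?L' = "\<lambda>j. contour_integral (circlepath 0 (R j))"
  let ?G = "\<lambda>w. (\<Prod>i\<in>UNIV - {j}. w $ i ^ \<alpha> i / w $ i) * Q w"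
  \<comment> \<open>\<open>0\<close> is readmitted in the coordinate \<open>j\<close> alone: its
    singular factor is pulled out of the integral, while the other variables keep theirs.\<close>
  define E where "E = (\<lambda>i. D i - {0})(j := D j)"
  have opD: "open (?D i)" for i using D by (simp add: open_delete)
  have opE: "open (E i)" for i using D by (simp add: E_def open_delete)
  have circ: "path_image (circlepath 0 (R i)) \<subseteq> ?D i" for i using R(1)[of i] R(2)[where j = i] by auto
  have L: "afun (?D i) (?L i)" for i by (rule afun_cyc[OF opD]) (use \<Gamma> in blast)
  have L': "afun (?D i) (?L' i)" for i by (rule afun_contour_integral[OF opD]) (use circ in auto)
  have L'E: "afun (E i) (?L' i)" for i
    by (rule afun_contour_integral[OF opE]) (use circ[of i] in \<open>auto simp: E_def\<close>)
  have F: "csh ?F ?D"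
    by (intro csh_mult csh_prod csh_coord csh_subset[OF Q(1)]) (auto intro!: holomorphic_intros)
  have G: "csh ?G E"
    unfolding E_def
    by (intro csh_mult csh_prod csh_coord csh_subset[OF Q(1)]) (auto intro!: holomorphic_intros)
  have ED: "cart ?D \<subseteq> cart E" "cart E \<subseteq> cart D" by (auto simp: cart_def E_def split: if_splits)
  have GD: "csh ?G ?D" by (rule csh_subset[OF G]) (auto simp: E_def)
  have pull: "It js ?L' ?F u = u $ j ^ \<alpha> j / u $ j * It js ?L' ?G u" if u: "u \<in> cart ?D" for u
  proof -
    have "It js ?L' ?F u = It js ?L' (\<lambda>u. u $ j ^ \<alpha> j / u $ j * ?G u) u"
      by (rule It_cong[OF opD L' F u]) (simp add: prod.remove mult.assoc)
    also have "\<dots> = u $ j ^ \<alpha> j / u $ j * It js ?L' ?G u"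
      by (rule It_pull[OF opD L' GD u]) (use Cons.prems(2) in \<open>auto intro!: holomorphic_intros\<close>)
    finally show ?thesis .
  qed
  define q where "q x = It js ?L' ?G (vupd w j x)" for x
  have wE: "w \<in> cart E" using Cons.prems(1) ED by blast
  have "It (j # js) ?L ?F w = ?L j (\<lambda>x. It js ?L ?F (vupd w j x))" by simp
  also have "\<dots> = ?L j (\<lambda>x. x ^ \<alpha> j / x * q x)"
  proof (rule afun_cong[OF L])
    show "(\<lambda>x. It js ?L ?F (vupd w j x)) holomorphic_on ?D j"
      by (rule csh_slice[OF It_csh[OF opD L F] Cons.prems(1)])
    fix x assume "x \<in> ?D j"
    then have u: "vupd w j x \<in> cart ?D" by (intro vupd_in_cart Cons.prems)
    then show "It js ?L ?F (vupd w j x) = x ^ \<alpha> j / x * q x"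
      using Cons.IH[OF u] pull[OF u] Cons.prems(2) by (simp add: q_def)
  qed
  also have "\<dots> = ?L' j (\<lambda>x. x ^ \<alpha> j / x * q x)"
  proof (rule cycle_eq_circle[OF D R(1) R(2)])
    have "(\<lambda>x. It js ?L' ?G (vupd w j x)) holomorphic_on E j"
      by (rule csh_slice[OF It_csh[OF opE L'E G] wE])
    then show "q holomorphic_on D j" by (simp add: q_def[abs_def] E_def)
    assume z: "0 \<in> D j"
    show "q 0 = 0" unfolding q_def
    proof (rule It_zero_slice[OF opE L'E G, where j = j and x = 0])
      show "vupd w j 0 \<in> cart E" by (rule vupd_in_cart[OF wE]) (use z in \<open>simp add: E_def\<close>)
      fix u assume "u \<in> cart E" "u $ j = 0"
      then show "?G u = 0" using Q(2)[of u j] ED by auto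
    qed (use Cons.prems(2) in auto)
  qed (use \<Gamma> 1 in auto)
  also have "\<dots> = ?L' j (\<lambda>x. It js ?L' ?F (vupd w j x))"
  proof (rule afun_cong[OF L', symmetric])
    show "(\<lambda>x. It js ?L' ?F (vupd w j x)) holomorphic_on ?D j"
      by (rule csh_slice[OF It_csh[OF opD L' F] Cons.prems(1)])
    fix x assume "x \<in> ?D j"
    then have u: "vupd w j x \<in> cart ?D" by (intro vupd_in_cart Cons.prems)
    then show "It js ?L' ?F (vupd w j x) = x ^ \<alpha> j / x * q x"
      using pull[OF u] by (simp add: q_def)
  qed
  finally show ?case by simp
qed simp

subsection \<open>Power series\<close>

text \<open>Abel's condition on the terms at radius \<open>r\<close>. It gives convergence on the
  open polydisc of that radius and is easily transferred to sums and to smaller radii.\<close>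

definition bnd :: "(('n::finite \<Rightarrow> nat) \<Rightarrow> complex) \<Rightarrow> real \<Rightarrow> bool" where
  "bnd a r \<longleftrightarrow> r > 0 \<and> (\<exists>C. \<forall>\<alpha>. norm (a \<alpha>) * r ^ (\<Sum>j\<in>UNIV. \<alpha> j) \<le> C)"

lemma norm_mono_fun: "norm (mono_fun \<alpha> w) = (\<Prod>j\<in>UNIV. norm (w $ j) ^ \<alpha> j)"
  by (simp add: mono_fun_def norm_power flip: prod_norm)

lemma csh_mono_fun [intro]: "csh (mono_fun \<alpha>) D"
proof -
  have "csh (\<lambda>w. \<Prod>j\<in>UNIV. w $ j ^ \<alpha> j) D"
    by (intro csh_prod csh_coord holomorphic_intros)
  then show ?thesis by (simp add: mono_fun_def[abs_def])
qed

lemma geometric_has_sum: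
  fixes u :: "complex ^ 'n::finite"
  assumes "\<And>j. norm (u $ j) < 1"
  shows "((\<lambda>\<alpha>. mono_fun \<alpha> u) has_sum (\<Prod>j\<in>UNIV. 1 / (1 - u $ j))) UNIV"
    and "(\<lambda>\<alpha>. norm (mono_fun \<alpha> u)) summable_on UNIV"
proof -
  have abs: "Infinite_Set_Sum.abs_summable_on (\<lambda>n. u $ j ^ n) UNIV" for j
    using assms[of j] by (simp add: norm_power abs_summable_on_nat_iff' summable_geometric summable_norm_cancel)
  have "Infinite_Set_Sum.abs_summable_on (\<lambda>\<alpha>. \<Prod>j\<in>UNIV. u $ j ^ \<alpha> j) (PiE UNIV (\<lambda>_. UNIV))"
    by (rule abs_summable_on_prod_PiE) (use abs in auto)
  then show s: "(\<lambda>\<alpha>. norm (mono_fun \<alpha> u)) summable_on UNIV"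
    by (simp add: mono_fun_def abs_summable_equivalent)
  have abs2: "(\<lambda>n. norm (u $ j ^ n)) summable_on UNIV" for j
    using abs[of j] by (simp add: abs_summable_equivalent)
  have "infsum (\<lambda>\<alpha>. mono_fun \<alpha> u) UNIV = (\<Prod>j\<in>UNIV. infsum (\<lambda>n. u $ j ^ n) UNIV)"
    using infsum_prod_PiE_abs[of UNIV "\<lambda>j n. u $ j ^ n" "\<lambda>_. UNIV"] abs2 by (simp add: mono_fun_def)
  also have "\<dots> = (\<Prod>j\<in>UNIV. 1 / (1 - u $ j))"
  proof (rule prod.cong[OF refl])
    fix j
    have "((\<lambda>n. u $ j ^ n) has_sum (1 / (1 - u $ j))) UNIV"
      using abs2[of j] geometric_sums[of "u $ j"] assms[of j]
      by (metis abs_summable_summable has_sum_imp_sums has_sum_infsum sums_unique2)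
    then show "infsum (\<lambda>n. u $ j ^ n) UNIV = 1 / (1 - u $ j)" by (rule infsumI)
  qed
  finally show "((\<lambda>\<alpha>. mono_fun \<alpha> u) has_sum (\<Prod>j\<in>UNIV. 1 / (1 - u $ j))) UNIV"
    using has_sum_infsum[OF abs_summable_summable[OF s]] by simp
qed

text \<open>Abel's lemma: compared with radius \<open>r\<close>, the monomial of
  \<open>\<alpha>\<close> gains \<open>q\<close> to the power of the total degree, and the multiple
  geometric series in \<open>q\<close> is a convergent majorant.\<close>

lemma bnd_uniform:
  fixes a :: "('n::finite \<Rightarrow> nat) \<Rightarrow> complex"
  assumes a: "bnd a r" and q: "0 \<le> q" "q < 1"
  shows "uniform_limit {w. \<forall>j. norm (w $ j) \<le> q * r} (\<lambda>A w. \<Sum>\<alpha>\<in>A. a \<alpha> * mono_fun \<alpha> w)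
      (\<lambda>w. \<Sum>\<^sub>\<infinity>\<alpha>. a \<alpha> * mono_fun \<alpha> w) (finite_subsets_at_top UNIV)"
    and "\<And>w. (\<And>j. norm (w $ j) \<le> q * r) \<Longrightarrow> (\<lambda>\<alpha>. a \<alpha> * mono_fun \<alpha> w) summable_on UNIV"
proof -
  obtain C where r: "r > 0" and C: "\<And>\<alpha>. norm (a \<alpha>) * r ^ (\<Sum>j\<in>UNIV. \<alpha> j) \<le> C"
    using a by (auto simp: bnd_def)
  let ?q = "(\<chi> j. complex_of_real q) :: complex ^ 'n"
  have s: "(\<lambda>\<alpha>. C * norm (mono_fun \<alpha> ?q)) summable_on UNIV"
    by (intro summable_on_cmult_right geometric_has_sum(2)) (use q in simp)
  have le: "norm (a \<alpha> * mono_fun \<alpha> w) \<le> C * norm (mono_fun \<alpha> ?q)" if w: "\<And>j. norm (w $ j) \<le> q * r" for \<alpha> w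
  proof -
    have "norm (mono_fun \<alpha> w) \<le> (\<Prod>j\<in>UNIV. (q * r) ^ \<alpha> j)"
      unfolding norm_mono_fun by (rule prod_mono) (use w in \<open>auto intro: power_mono\<close>)
    also have "\<dots> = r ^ (\<Sum>j\<in>UNIV. \<alpha> j) * norm (mono_fun \<alpha> ?q)"
      unfolding norm_mono_fun power_sum prod.distrib[symmetric] using q by (simp add: power_mult_distrib mult.commute)
    finally have "norm (a \<alpha> * mono_fun \<alpha> w) \<le> norm (a \<alpha>) * (r ^ (\<Sum>j\<in>UNIV. \<alpha> j) * norm (mono_fun \<alpha> ?q))"
      by (simp add: norm_mult mult_left_mono)
    also have "\<dots> \<le> C * norm (mono_fun \<alpha> ?q)"
      using mult_right_mono[OF C[of \<alpha>], of "norm (mono_fun \<alpha> ?q)"] by (simp add: mult.assoc)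
    finally show ?thesis .
  qed
  show "uniform_limit {w. \<forall>j. norm (w $ j) \<le> q * r} (\<lambda>A w. \<Sum>\<alpha>\<in>A. a \<alpha> * mono_fun \<alpha> w)
      (\<lambda>w. \<Sum>\<^sub>\<infinity>\<alpha>. a \<alpha> * mono_fun \<alpha> w) (finite_subsets_at_top UNIV)"
    by (rule Weierstrass_m_test_general[OF _ s]) (use le in auto)
  show "(\<lambda>\<alpha>. a \<alpha> * mono_fun \<alpha> w) summable_on UNIV" if "\<And>j. norm (w $ j) \<le> q * r" for w
    by (rule abs_summable_summable, rule summable_on_comparison_test[OF s]) (use le that in auto)
qed

lemma bnd_approx:
  fixes a :: "('n::finite \<Rightarrow> nat) \<Rightarrow> complex"
  assumes a: "bnd a r" and q: "0 \<le> q" "q < 1" and e: "e > 0"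
  obtains A where "finite A" "\<forall>B w. finite B \<longrightarrow> A \<subseteq> B \<longrightarrow> (\<forall>j. norm (w $ j) \<le> q * r) \<longrightarrow>
    dist (\<Sum>\<alpha>\<in>B. a \<alpha> * mono_fun \<alpha> w) (\<Sum>\<^sub>\<infinity>\<alpha>. a \<alpha> * mono_fun \<alpha> w) < e"
proof -
  have "\<forall>\<^sub>F A in finite_subsets_at_top UNIV. \<forall>w\<in>{w. \<forall>j. norm (w $ j) \<le> q * r}.
    dist (\<Sum>\<alpha>\<in>A. a \<alpha> * mono_fun \<alpha> w) (\<Sum>\<^sub>\<infinity>\<alpha>. a \<alpha> * mono_fun \<alpha> w) < e"
    using bnd_uniform(1)[OF a q] e unfolding uniform_limit_iff by blast
  then show ?thesis
    unfolding eventually_finite_subsets_at_top using that by auto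
qed

lemma bnd_has_sum:
  assumes "bnd a r" "\<And>j. norm (w $ j) < r"
  shows "((\<lambda>\<alpha>. a \<alpha> * mono_fun \<alpha> w) has_sum (\<Sum>\<^sub>\<infinity>\<alpha>. a \<alpha> * mono_fun \<alpha> w)) UNIV"
proof -
  have r: "r > 0" using assms by (simp add: bnd_def)
  define q where "q = Max (range (\<lambda>j. norm (w $ j))) / r"
  have "norm (w $ j) \<le> Max (range (\<lambda>j. norm (w $ j)))" for j by (rule Max_ge) auto
  then have "norm (w $ j) \<le> q * r" for j using r by (simp add: q_def)
  moreover have "q < 1" using assms(2) r by (auto simp: q_def)
  moreover have "q \<ge> 0"
    using order.trans[OF norm_ge_zero calculation(1)] r by (simp add: zero_le_mult_iff)
  ultimately have "(\<lambda>\<alpha>. a \<alpha> * mono_fun \<alpha> w) summable_on UNIV"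
    using bnd_uniform(2)[OF assms(1)] by blast
  then show ?thesis by (rule has_sum_infsum)
qed

lemma bnd_smaller:
  assumes "bnd a r" "0 < s" "s \<le> r"
  shows "bnd a s"
proof -
  obtain C where C: "\<And>\<alpha>. norm (a \<alpha>) * r ^ (\<Sum>j\<in>UNIV. \<alpha> j) \<le> C"
    using assms by (auto simp: bnd_def)
  have "norm (a \<alpha>) * s ^ (\<Sum>j\<in>UNIV. \<alpha> j) \<le> C" for \<alpha>
    using mult_left_mono[OF power_mono, of s r "norm (a \<alpha>)" "\<Sum>j\<in>UNIV. \<alpha> j"] C[of \<alpha>] assms(2,3) by simp
  then show ?thesis using assms(2) by (auto simp: bnd_def)
qed

lemma has_sum_imp_bnd:
  fixes a :: "('n::finite \<Rightarrow> nat) \<Rightarrow> complex"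
  assumes "s > 0" "(\<lambda>\<alpha>. a \<alpha> * mono_fun \<alpha> (\<chi> j. complex_of_real s)) summable_on UNIV"
  shows "bnd a s"
proof -
  let ?f = "\<lambda>\<alpha>. a \<alpha> * mono_fun \<alpha> (\<chi> j. complex_of_real s)"
  have s: "(\<lambda>\<alpha>. norm (?f \<alpha>)) summable_on UNIV"
    using assms(2) by (simp add: summable_on_iff_abs_summable_on_complex)
  have "norm (a \<alpha>) * s ^ (\<Sum>j\<in>UNIV. \<alpha> j) \<le> (\<Sum>\<^sub>\<infinity>\<alpha>. norm (?f \<alpha>))" for \<alpha>
  proof -
    have "norm (a \<alpha>) * s ^ (\<Sum>j\<in>UNIV. \<alpha> j) = (\<Sum>\<alpha>\<in>{\<alpha>}. norm (?f \<alpha>))"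
      using assms(1) by (simp add: norm_mult norm_mono_fun power_sum)
    also have "\<dots> \<le> (\<Sum>\<^sub>\<infinity>\<alpha>. norm (?f \<alpha>))"
      by (rule finite_sum_le_infsum[OF s]) auto
    finally show ?thesis .
  qed
  then show ?thesis using assms(1) by (auto simp: bnd_def)
qed

lemma bnd_csh:
  fixes a :: "('n::finite \<Rightarrow> nat) \<Rightarrow> complex"
  assumes "bnd a r"
  shows "csh (\<lambda>w. \<Sum>\<^sub>\<infinity>\<alpha>. a \<alpha> * mono_fun \<alpha> w) (\<lambda>_. ball 0 r)"
proof (rule holo_imp_csh, rule holo_uniform_limit)
  show "open (cart (\<lambda>_. ball 0 r) :: (complex ^ 'n) set)" by (rule open_cart) simp
  fix z :: "complex ^ 'n" assume z: "z \<in> cart (\<lambda>_. ball 0 r)"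
  have r: "r > 0" using assms by (simp add: bnd_def)
  define m where "m = Max (range (\<lambda>j. norm (z $ j)))"
  have m: "norm (z $ j) \<le> m" for j unfolding m_def by (rule Max_ge) auto
  have mr: "m < r" "0 \<le> m" using z order.trans[OF norm_ge_zero m] by (auto simp: m_def cart_def)
  define d where "d = (r - m) / 2"
  define q where "q = (m + d) / r"
  have d: "d > 0" using mr by (simp add: d_def)
  have q: "0 \<le> q" "q < 1" "q * r = m + d" using mr r by (auto simp: q_def d_def field_simps)
  have wle: "norm (w $ j) \<le> q * r" if "w \<in> ball z d" for w j
  proof -
    have "norm (w $ j) \<le> norm (z $ j) + norm (w $ j - z $ j)" by (rule norm_triangle_sub)
    also have "norm (w $ j - z $ j) \<le> d"
      using dist_vec_nth_le[of w j z] that by (simp add: dist_norm norm_minus_commute)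
    finally show ?thesis using m[of j] q(3) by linarith
  qed
  show "\<exists>d>0. ball z d \<subseteq> cart (\<lambda>_. ball 0 r) \<and> (\<forall>e>0. \<exists>G. holo G (cart (\<lambda>_. ball 0 r)) \<and>
    (\<forall>w\<in>ball z d. dist (G w) (\<Sum>\<^sub>\<infinity>\<alpha>. a \<alpha> * mono_fun \<alpha> w) \<le> e))"
  proof (intro exI[of _ d] conjI allI impI)
    have "q * r < r" using q(2) r mult_strict_right_mono[of q 1 r] by simp
    then have "norm (w $ j) < r" if "w \<in> ball z d" for w j
      using wle[OF that, of j] by linarith
    then show "ball z d \<subseteq> cart (\<lambda>_. ball 0 r)"
      by (simp add: cart_def subset_iff)
    fix e :: real assume "e > 0"
    then obtain A where A0: "finite A" "\<forall>B w. finite B \<longrightarrow> A \<subseteq> B \<longrightarrow> (\<forall>j. norm (w $ j) \<le> q * r) \<longrightarrow>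
      dist (\<Sum>\<alpha>\<in>B. a \<alpha> * mono_fun \<alpha> w) (\<Sum>\<^sub>\<infinity>\<alpha>. a \<alpha> * mono_fun \<alpha> w) < e"
      by (rule bnd_approx[OF assms q(1,2)])
    note A = A0(1) A0(2)[rule_format]
    have "holo (\<lambda>w. \<Sum>\<alpha>\<in>A. a \<alpha> * mono_fun \<alpha> w) (cart (\<lambda>_. ball 0 r))"
      by (rule csh_imp_holo, intro csh_sum csh_mult csh_const csh_mono_fun) simp
    then show "\<exists>G. holo G (cart (\<lambda>_. ball 0 r)) \<and> (\<forall>w\<in>ball z d. dist (G w) (\<Sum>\<^sub>\<infinity>\<alpha>. a \<alpha> * mono_fun \<alpha> w) \<le> e)"
      using A(2)[OF A(1) order.refl wle] by (meson less_imp_le)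
  qed (rule d)
qed

lemma contour_integral_circlepath_power:
  assumes "R > 0"
  shows "contour_integral (circlepath 0 R) (\<lambda>w. w ^ k / w * (1 / w) ^ b) = (if k = b then 2 * of_real pi * \<i> else 0)"
proof (cases "b \<le> k")
  case True
  have "((\<lambda>w. w ^ (k - b) / (w - 0)) has_contour_integral (2 * of_real pi * \<i> * 0 ^ (k - b))) (circlepath 0 R)"
    using assms by (intro Cauchy_integral_circlepath continuous_intros holomorphic_intros) auto
  moreover have "contour_integral (circlepath 0 R) (\<lambda>w. w ^ k / w * (1 / w) ^ b) = contour_integral (circlepath 0 R) (\<lambda>w. w ^ (k - b) / (w - 0))"
    by (rule contour_integral_eq) (use True assms in \<open>auto simp: power_diff field_simps\<close>)
  ultimately show ?thesis using True by (auto simp: contour_integral_unique)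
next
  case False
  have "((\<lambda>w. 1 / (w - 0) ^ Suc (b - k)) has_contour_integral ((2 * pi * \<i>) / fact (b - k) * (deriv ^^ (b - k)) (\<lambda>_. 1) 0)) (circlepath 0 R)"
    using assms by (intro Cauchy_has_contour_integral_higher_derivative_circlepath continuous_intros holomorphic_intros) auto
  moreover have "(deriv ^^ (b - k)) (\<lambda>_. 1) (0::complex) = 0" using False by (simp add: higher_deriv_const)
  moreover have "contour_integral (circlepath 0 R) (\<lambda>w. w ^ k / w * (1 / w) ^ b) = contour_integral (circlepath 0 R) (\<lambda>w. 1 / (w - 0) ^ Suc (b - k))"
  proof (rule contour_integral_eq)
    fix w assume "w \<in> path_image (circlepath 0 R)"
    then have w: "w \<noteq> 0" using assms by auto
    have "w ^ b = w ^ k * w ^ (b - k)" using False by (simp flip: power_add)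
    then show "w ^ k / w * (1 / w) ^ b = 1 / (w - 0) ^ Suc (b - k)" using w by (simp add: field_simps)
  qed
  ultimately show ?thesis using False by (simp add: contour_integral_unique)
qed

lemma compact_cart_bounded:
  assumes "csh P D" "\<And>j. compact (K j)" "\<And>j. K j \<subseteq> D j"
  obtains B where "B > 0" "\<And>u. u \<in> cart K \<Longrightarrow> norm (P u) \<le> B"
proof -
  have "compact (P ` cart K)"
    by (intro compact_continuous_image compact_cart assms continuous_on_subset[OF csh_continuous[OF assms(1)]] cart_mono)
  then have "bounded (P ` cart K)" by (rule compact_imp_bounded)
  then show ?thesis using that by (auto simp: bounded_pos)
qed

lemma It_full_bound:
  assumes op: "\<And>j. open (D j)" and L: "\<And>j. afun (D j) (L j)" and js: "distinct js" "set js = UNIV"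
  obtains K C where "\<And>j. compact (K j)" "\<And>j. K j \<subseteq> D j" "C \<ge> 0"
    "\<And>F w B. csh F D \<Longrightarrow> w \<in> cart D \<Longrightarrow> B \<ge> 0 \<Longrightarrow> (\<And>u. u \<in> cart K \<Longrightarrow> norm (F u) \<le> B) \<Longrightarrow> norm (It js L F w) \<le> C * B"
proof (rule It_bound[OF op L js(1)])
  fix K C
  assume *: "\<And>F w B. csh F D \<Longrightarrow> w \<in> cart D \<Longrightarrow> B \<ge> 0 \<Longrightarrow>
      (\<And>u. u \<in> cart D \<Longrightarrow> (\<And>j. j \<in> set js \<Longrightarrow> u $ j \<in> K j) \<Longrightarrow> (\<And>j. j \<notin> set js \<Longrightarrow> u $ j = w $ j) \<Longrightarrow> norm (F u) \<le> B) \<Longrightarrow>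
      norm (It js L F w) \<le> C * B" and K: "\<And>j. compact (K j)" "\<And>j. K j \<subseteq> D j" "C \<ge> 0"
  have "norm (It js L F w) \<le> C * B"
    if "csh F D" "w \<in> cart D" "B \<ge> 0" "\<And>u. u \<in> cart K \<Longrightarrow> norm (F u) \<le> B" for F w B
    by (rule *[OF that(1-3)]) (use that(4) js(2) in \<open>auto simp: cart_def\<close>)
  then show thesis using that K by blast
qed

text \<open>The fixed factor \<open>P\<close>, typically the singular part of an integrand, is
  bounded on \<open>K\<close> and absorbed into \<open>C\<close>, so that uniform limits can be
  taken in the other factor.\<close>

lemma It_approx:
  assumes op: "\<And>j. open (D j)" and L: "\<And>j. afun (D j) (L j)" and js: "distinct js" "set js = UNIV"
    and P: "csh P D"
  obtains K C where "\<And>j. compact (K j)" "\<And>j. K j \<subseteq> D j" "C \<ge> 0"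
    "\<And>F G w e. csh F D \<Longrightarrow> csh G D \<Longrightarrow> w \<in> cart D \<Longrightarrow> e \<ge> 0 \<Longrightarrow> (\<And>u. u \<in> cart K \<Longrightarrow> norm (F u - G u) \<le> e) \<Longrightarrow>
      norm (It js L (\<lambda>u. P u * F u) w - It js L (\<lambda>u. P u * G u) w) \<le> C * e"
proof (rule It_full_bound[OF op L js])
  fix K C
  assume K: "\<And>j. compact (K j)" "\<And>j. K j \<subseteq> D j" "C \<ge> 0"
    and *: "\<And>F w B. csh F D \<Longrightarrow> w \<in> cart D \<Longrightarrow> B \<ge> 0 \<Longrightarrow> (\<And>u. u \<in> cart K \<Longrightarrow> norm (F u) \<le> B) \<Longrightarrow> norm (It js L F w) \<le> C * B"
  obtain B where B: "B > 0" "\<And>u. u \<in> cart K \<Longrightarrow> norm (P u) \<le> B"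
    using compact_cart_bounded[OF P K(1,2)] by blast
  have "norm (It js L (\<lambda>u. P u * F u) w - It js L (\<lambda>u. P u * G u) w) \<le> (C * B) * e"
    if FG: "csh F D" "csh G D" "w \<in> cart D" "e \<ge> 0" "\<And>u. u \<in> cart K \<Longrightarrow> norm (F u - G u) \<le> e" for F G w e
  proof -
    have "It js L (\<lambda>u. P u * F u) w - It js L (\<lambda>u. P u * G u) w = It js L (\<lambda>u. P u * F u - P u * G u) w"
      by (rule It_diff[OF op L, symmetric]) (use FG P in auto)
    also have "norm \<dots> \<le> C * (B * e)"
    proof (rule *)
      fix u assume u: "u \<in> cart K"
      have "norm (P u * F u - P u * G u) = norm (P u) * norm (F u - G u)"
        by (simp flip: right_diff_distrib add: norm_mult)
      also have "\<dots> \<le> B * e" using B FG(4,5) u by (intro mult_mono) (auto simp: less_imp_le)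
      finally show "norm (P u * F u - P u * G u) \<le> B * e" .
    qed (use FG P B in auto)
    finally show ?thesis by (simp add: mult.assoc)
  qed
  moreover have "C * B \<ge> 0" using B K by simp
  ultimately show thesis using that K by blast
qed

lemma compact_norm_gap:
  fixes K :: "'n::finite \<Rightarrow> complex set"
  assumes "\<And>j. compact (K j)" "\<And>j x. x \<in> K j \<Longrightarrow> s < norm x" "s > 0"
  obtains m where "m > s" "\<And>j x. x \<in> K j \<Longrightarrow> m \<le> norm x"
proof -
  have c: "compact (\<Union>j. K j)" using assms(1) by (intro compact_UN) auto
  show ?thesis
  proof (cases "(\<Union>j. K j) = {}")
    case True
    then show ?thesis using that[of "s + 1"] by auto
  next
    case False
    then obtain x where x: "x \<in> (\<Union>j. K j)" "\<And>y. y \<in> (\<Union>j. K j) \<Longrightarrow> norm x \<le> norm y"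
      using continuous_attains_inf[OF c False continuous_on_norm[OF continuous_on_id]] by blast
    then show ?thesis using that[of "norm x"] assms(2) by blast
  qed
qed

text \<open>Cauchy's coefficient formula after inversion: on compact subsets of the exterior domain
  the series in \<open>1 / w\<close> converges uniformly, and integrating its terms leaves only
  \<open>\<beta> = \<alpha>\<close>.\<close>

lemma It_circles_power_series:
  fixes a :: "('n::finite \<Rightarrow> nat) \<Rightarrow> complex"
  assumes a: "bnd a r" and R: "\<And>j. R j > 1 / r" and js: "distinct js" "set js = UNIV"
    and w: "\<And>j. norm (w $ j) > 1 / r"
  shows "It js (\<lambda>j. contour_integral (circlepath 0 (R j)))
      (\<lambda>w. (\<Prod>i\<in>UNIV. w $ i ^ \<alpha> i / w $ i) * (\<Sum>\<^sub>\<infinity>\<beta>. a \<beta> * mono_fun \<beta> (\<chi> i. 1 / w $ i))) w =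
    (2 * of_real pi * \<i>) ^ CARD('n) * a \<alpha>"
proof -
  have r: "r > 0" using a by (simp add: bnd_def)
  define D where "D = (\<lambda>_::'n. {x::complex. 1 / r < norm x})"
  have op: "open (D j)" for j
    unfolding D_def by (intro open_Collect_less continuous_intros)
  have D0: "x \<noteq> 0" if "x \<in> D j" for x j using that r by (auto simp: D_def)
  have Rp: "R j > 0" for j using R[of j] r by (meson divide_pos_pos less_trans zero_less_one)
  let ?L = "\<lambda>j. contour_integral (circlepath 0 (R j))"
  have L: "afun (D j) (?L j)" for j
    by (rule afun_contour_integral[OF op]) (use R[of j] Rp[of j] in \<open>auto simp: D_def\<close>)
  let ?P = "\<lambda>w. \<Prod>i\<in>UNIV. w $ i ^ \<alpha> i / w $ i"
  let ?H = "\<lambda>w. \<Sum>\<^sub>\<infinity>\<beta>. a \<beta> * mono_fun \<beta> (\<chi> i. 1 / w $ i)"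
  have P: "csh ?P D" by (intro csh_prod csh_coord) (use D0 in \<open>auto intro!: holomorphic_intros\<close>)
  have inv: "(\<lambda>x. 1 / x) holomorphic_on D j" for j using D0 by (auto intro!: holomorphic_intros)
  have invm: "(\<lambda>x. 1 / x) ` D j \<subseteq> ball 0 r" for j
  proof clarify
    fix x assume "x \<in> D j"
    then have "1 / r < norm x" "0 < norm x" using D0 by (auto simp: D_def)
    then show "1 / x \<in> ball 0 r" using r by (simp add: norm_divide field_simps)
  qed
  have H: "csh ?H D" by (rule csh_compose_coord[OF bnd_csh[OF a] inv invm])
  have mono: "csh (\<lambda>w. mono_fun \<beta> (\<chi> i. 1 / w $ i)) D" for \<beta>
    by (rule csh_compose_coord[OF csh_mono_fun inv invm])
  have wD: "w \<in> cart D" using w by (simp add: cart_def D_def)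
  obtain K C where K: "\<And>j. compact (K j)" "\<And>j. K j \<subseteq> D j" "C \<ge> 0"
    "\<And>F G w e. csh F D \<Longrightarrow> csh G D \<Longrightarrow> w \<in> cart D \<Longrightarrow> e \<ge> 0 \<Longrightarrow> (\<And>u. u \<in> cart K \<Longrightarrow> norm (F u - G u) \<le> e) \<Longrightarrow>
      norm (It js ?L (\<lambda>u. ?P u * F u) w - It js ?L (\<lambda>u. ?P u * G u) w) \<le> C * e"
    by (rule It_approx[OF op L js P]) (rule that; blast)
  obtain m where m: "m > 1 / r" "\<And>j x. x \<in> K j \<Longrightarrow> m \<le> norm x"
    using compact_norm_gap[of K "1 / r"] K(1,2) r by (auto simp: D_def subset_iff)
  \<comment> \<open>With this choice \<open>norm (1 / u $ j) \<le> 1 / m = q * r\<close> for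
    \<open>u\<close> in \<open>cart K\<close>.\<close>
  define q where "q = 1 / (m * r)"
  have mp: "m > 0" using m(1) r by (meson divide_pos_pos less_trans zero_less_one)
  have q: "0 \<le> q" "q < 1" using m(1) r mp by (auto simp: q_def field_simps)
  have Kq: "norm ((\<chi> i. 1 / u $ i) $ j) \<le> q * r" if "u \<in> cart K" for u :: "complex ^ 'n" and j
  proof -
    have "m \<le> norm (u $ j)" using m(2)[of "u $ j" j] that by (simp add: cart_def)
    then have "1 / norm (u $ j) \<le> 1 / m" using mp by (intro frac_le) auto
    then show ?thesis using r by (simp add: norm_divide q_def)
  qed
  let ?c = "(2 * of_real pi * \<i>) ^ CARD('n) * a \<alpha>"
  have "norm (It js ?L (\<lambda>u. ?P u * ?H u) w - ?c) \<le> C * e" if e: "e > 0" for e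
  proof -
    obtain A where A0: "finite A" "\<forall>B w. finite B \<longrightarrow> A \<subseteq> B \<longrightarrow> (\<forall>j. norm (w $ j) \<le> q * r) \<longrightarrow>
      dist (\<Sum>\<alpha>\<in>B. a \<alpha> * mono_fun \<alpha> w) (\<Sum>\<^sub>\<infinity>\<alpha>. a \<alpha> * mono_fun \<alpha> w) < e"
      by (rule bnd_approx[OF a q e])
    note A = A0(1) A0(2)[rule_format]
    \<comment> \<open>\<open>\<alpha>\<close> is adjoined so that its coefficient certainly occurs
      in the finite sum.\<close>
    define B where "B = insert \<alpha> A"
    let ?G = "\<lambda>w. \<Sum>\<beta>\<in>B. a \<beta> * mono_fun \<beta> (\<chi> i. 1 / w $ i)"
    have fB: "finite B" "A \<subseteq> B" using A(1) by (auto simp: B_def)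
    have G: "csh ?G D" by (intro csh_sum csh_mult csh_const mono)
    have "norm (It js ?L (\<lambda>u. ?P u * ?H u) w - It js ?L (\<lambda>u. ?P u * ?G u) w) \<le> C * e"
    proof (rule K(4)[OF H G wD])
      fix u assume "u \<in> cart K"
      then show "norm (?H u - ?G u) \<le> e"
        using A(2)[OF fB Kq, of u] by (simp add: dist_norm norm_minus_commute less_imp_le)
    qed (use e in simp)
    moreover have "It js ?L (\<lambda>u. ?P u * ?G u) w = (\<Sum>\<beta>\<in>B. It js ?L (\<lambda>u. a \<beta> * (?P u * mono_fun \<beta> (\<chi> i. 1 / u $ i))) w)"
      unfolding sum_distrib_left mult.left_commute[of "?P _"]
      by (rule It_sum[OF op L _ wD]) (intro csh_mult csh_const P mono)
    also have "\<dots> = (\<Sum>\<beta>\<in>B. a \<beta> * (if \<beta> = \<alpha> then (2 * of_real pi * \<i>) ^ CARD('n) else 0))"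
    proof (rule sum.cong[OF refl])
      fix \<beta>
      have "It js ?L (\<lambda>u. ?P u * mono_fun \<beta> (\<chi> i. 1 / u $ i)) w = It js ?L (\<lambda>u. \<Prod>i\<in>UNIV. u $ i ^ \<alpha> i / u $ i * (1 / u $ i) ^ \<beta> i) w"
        by (simp only: mono_fun_def prod.distrib vec_lambda_beta)
      also have "\<dots> = (\<Prod>i\<in>UNIV. ?L i (\<lambda>x. x ^ \<alpha> i / x * (1 / x) ^ \<beta> i))"
      proof -
        have "(\<lambda>x. x ^ \<alpha> i / x * (1 / x) ^ \<beta> i) holomorphic_on D i" for i
          by (intro holomorphic_intros) (use D0 in auto)
        from It_prod[OF op L this wD js(1)] show ?thesis by (simp only: js(2) Compl_UNIV_eq prod.empty mult_1_right)
      qed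
      also have "\<dots> = (\<Prod>i\<in>UNIV. if \<alpha> i = \<beta> i then 2 * of_real pi * \<i> else 0)"
        by (intro prod.cong refl contour_integral_circlepath_power Rp)
      also have "\<dots> = (if \<beta> = \<alpha> then (2 * of_real pi * \<i>) ^ CARD('n) else 0)"
      proof (cases "\<beta> = \<alpha>")
        case False
        then obtain i where i: "\<alpha> i \<noteq> \<beta> i" by (metis ext)
        have "(\<Prod>i\<in>UNIV. if \<alpha> i = \<beta> i then 2 * of_real pi * \<i> else 0) = (0 :: complex)"
          by (rule prod_zero) (use i in \<open>auto intro!: bexI[of _ i]\<close>)
        then show ?thesis using False by simp
      qed simp
      finally have *: "It js ?L (\<lambda>u. ?P u * mono_fun \<beta> (\<chi> i. 1 / u $ i)) w = (if \<beta> = \<alpha> then (2 * of_real pi * \<i>) ^ CARD('n) else 0)" .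
      show "It js ?L (\<lambda>u. a \<beta> * (?P u * mono_fun \<beta> (\<chi> i. 1 / u $ i))) w = a \<beta> * (if \<beta> = \<alpha> then (2 * of_real pi * \<i>) ^ CARD('n) else 0)"
        unfolding *[symmetric] by (rule It_cmult[OF op L _ wD]) (intro csh_mult P mono)
    qed
    also have "\<dots> = ?c" using fB by (simp add: B_def mult.commute if_distrib cong: if_cong)
    ultimately show ?thesis by simp
  qed
  note le = this
  have "norm (It js ?L (\<lambda>u. ?P u * ?H u) w - ?c) \<le> 0"
  proof (rule field_le_epsilon)
    fix e :: real assume e: "e > 0"
    have "norm (It js ?L (\<lambda>u. ?P u * ?H u) w - ?c) \<le> C * (e / (C + 1))"
      by (rule le) (use e K(3) in simp)
    also have "\<dots> \<le> 0 + e" using K(3) e by (simp add: field_simps)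
    finally show "norm (It js ?L (\<lambda>u. ?P u * ?H u) w - ?c) \<le> 0 + e" .
  qed
  then show ?thesis by simp
qed

section \<open>Uniqueness and existence of Taylor expansions\<close>

lemma enum_list:
  obtains js :: "'n::finite list" where "distinct js" "set js = UNIV"
  using finite_distinct_list[OF finite[of "UNIV :: 'n set"]] by blast

text \<open>On large circles the coefficient formula reads off \<open>a \<alpha>\<close> from values
  of the series near the origin only, and these are \<open>0\<close>.\<close>

lemma power_series_zero:
  fixes a :: "('n::finite \<Rightarrow> nat) \<Rightarrow> complex"
  assumes a: "bnd a r" and z: "\<And>w. (\<And>j. norm (w $ j) < s) \<Longrightarrow> (\<Sum>\<^sub>\<infinity>\<alpha>. a \<alpha> * mono_fun \<alpha> w) = 0" and s: "s > 0"
  shows "a \<alpha> = 0"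
proof -
  obtain js :: "'n list" where js: "distinct js" "set js = UNIV" by (rule enum_list)
  define t where "t = min r s"
  have t: "t > 0" using a s by (simp add: t_def bnd_def)
  have bt: "bnd a t" by (rule bnd_smaller[OF a t]) (simp add: t_def)
  define D where "D = (\<lambda>_::'n. {x::complex. 1 / t < norm x})"
  have op: "open (D j)" for j unfolding D_def by (intro open_Collect_less continuous_intros)
  define R where "R = 1 / t + 1"
  let ?w = "(\<chi> i. complex_of_real R) :: complex ^ 'n"
  have R: "R > 0" "1 / t < R" using t by (auto simp: R_def add_pos_pos)
  let ?L = "\<lambda>j::'n. contour_integral (circlepath 0 R)"
  have L: "afun (D j) (?L j)" for j
    by (rule afun_contour_integral[OF op]) (use R in \<open>auto simp: D_def\<close>)
  have wD: "?w \<in> cart D" using R by (simp add: cart_def D_def)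
  let ?H = "\<lambda>w. (\<Prod>i\<in>UNIV. w $ i ^ \<alpha> i / w $ i) * (\<Sum>\<^sub>\<infinity>\<beta>. a \<beta> * mono_fun \<beta> (\<chi> i. 1 / w $ i))"
  have "It js ?L (\<lambda>_. 0) ?w = It js ?L ?H ?w"
  proof (rule It_cong[OF op L csh_const wD])
    fix w assume w: "w \<in> cart D"
    have "norm ((\<chi> i. 1 / w $ i) $ j) < s" for j
    proof -
      have "1 / t < norm (w $ j)" using w by (simp add: cart_def D_def)
      then have "1 / norm (w $ j) < t" using t by (smt (verit) divide_less_eq less_divide_eq mult.commute zero_less_divide_1_iff)
      then show ?thesis by (simp add: norm_divide t_def)
    qed
    then show "0 = ?H w" using z by simp
  qed
  also have "\<dots> = (2 * of_real pi * \<i>) ^ CARD('n) * a \<alpha>"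
    by (rule It_circles_power_series[OF bt _ js]) (use R in auto)
  finally show ?thesis using It_zero[OF op L wD] by simp
qed

text \<open>The coordinates of \<open>u\<close> stay between \<open>\<rho>\<close> and
  \<open>r\<close>, so that the denominators of the variables not integrated do not vanish. Each
  application of Cauchy's formula puts the coordinate of \<open>w\<close> in place of the variable
  integrated.\<close>

lemma It_circle_Cauchy:
  fixes f :: "complex ^ 'n::finite \<Rightarrow> complex"
  assumes f: "csh f (\<lambda>_. ball 0 r)" and \<rho>: "0 < \<rho>" "\<rho> < s" "s < r" and w: "\<And>j. norm (w $ j) < \<rho>"
    and u: "\<And>j. \<rho> < norm (u $ j)" "\<And>j. norm (u $ j) < r" and js: "distinct js"
  shows "It js (\<lambda>j. contour_integral (circlepath 0 s)) (\<lambda>\<zeta>. f \<zeta> * (\<Prod>i\<in>UNIV. 1 / (\<zeta> $ i - w $ i))) u =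
    (2 * of_real pi * \<i>) ^ length js * (f (\<chi> i. if i \<in> set js then w $ i else u $ i) * (\<Prod>i\<in>-set js. 1 / (u $ i - w $ i)))"
  using u js
proof (induction js arbitrary: u)
  case Nil
  then show ?case by (simp add: vec_lambda_eta)
next
  case (Cons j js)
  define v where "v = (\<chi> i. if i \<in> set js then w $ i else u $ i)"
  let ?p = "\<Prod>i\<in>-set (j # js). 1 / (u $ i - w $ i)"
  define h where "h \<zeta> = (2 * of_real pi * \<i>) ^ length js * (f (vupd v j \<zeta>) * ?p)" for \<zeta>
  have v: "v \<in> cart (\<lambda>_. ball 0 r)"
    using Cons.prems(2) less_trans[OF w] \<rho> by (auto simp: v_def cart_def intro: less_trans)
  have h: "h holomorphic_on ball 0 r"
    unfolding h_def[abs_def] by (intro holomorphic_intros csh_slice[OF f v])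
  have "contour_integral (circlepath 0 s) (\<lambda>x. It js (\<lambda>j. contour_integral (circlepath 0 s)) (\<lambda>\<zeta>. f \<zeta> * (\<Prod>i\<in>UNIV. 1 / (\<zeta> $ i - w $ i))) (vupd u j x)) =
    contour_integral (circlepath 0 s) (\<lambda>x. h x / (x - w $ j))"
  proof (rule contour_integral_eq)
    fix x assume "x \<in> path_image (circlepath 0 s)"
    then have x: "norm x = s" using \<rho> by simp
    have u': "\<rho> < norm (vupd u j x $ i)" "norm (vupd u j x $ i) < r" for i
      using Cons.prems x \<rho> by auto
    have eq: "- set js = insert j (- set (j # js))" using Cons.prems by auto
    have "(\<Prod>i\<in>-set js. 1 / (vupd u j x $ i - w $ i)) = 1 / (x - w $ j) * ?p"
      unfolding eq by (subst prod.insert) (auto intro!: prod.cong)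
    moreover have "(\<chi> i. if i \<in> set js then w $ i else vupd u j x $ i) = vupd v j x"
      using Cons.prems(3) by (auto simp: vec_eq_iff v_def)
    ultimately show "It js (\<lambda>j. contour_integral (circlepath 0 s)) (\<lambda>\<zeta>. f \<zeta> * (\<Prod>i\<in>UNIV. 1 / (\<zeta> $ i - w $ i))) (vupd u j x) = h x / (x - w $ j)"
      using Cons.IH[OF u'] Cons.prems(3) by (simp add: h_def)
  qed
  also have "\<dots> = 2 * of_real pi * \<i> * h (w $ j)"
  proof (rule contour_integral_unique, rule Cauchy_integral_circlepath)
    show "continuous_on (cball 0 s) h"
      using holomorphic_on_imp_continuous_on[OF h] by (rule continuous_on_subset) (use \<rho> in auto)
    show "h holomorphic_on ball 0 s" using h by (rule holomorphic_on_subset) (use \<rho> in auto)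
    show "norm (w $ j - 0) < s" using w[of j] \<rho> by simp
  qed
  also have "h (w $ j) = (2 * of_real pi * \<i>) ^ length js * (f (\<chi> i. if i \<in> set (j # js) then w $ i else u $ i) * ?p)"
    unfolding h_def by (rule arg_cong[where f = "\<lambda>z. _ * (f z * _)"]) (auto simp: vec_eq_iff v_def)
  finally show ?case by (simp add: mult_ac)
qed

text \<open>The Cauchy kernel on a torus is expanded into the geometric series in
  \<open>w / \<zeta>\<close>, which converges uniformly on a compact set controlling the iterated
  integral; termwise integration gives the coefficients.\<close>

theorem taylor_exists:
  fixes f :: "complex ^ 'n::finite \<Rightarrow> complex"
  assumes f: "csh f (\<lambda>_. ball 0 r)" and r: "r > 0"
  obtains a \<rho> where "bnd a \<rho>" "\<And>w. (\<And>j. norm (w $ j) < \<rho>) \<Longrightarrow> ((\<lambda>\<alpha>. a \<alpha> * mono_fun \<alpha> w) has_sum f w) UNIV"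
proof -
  obtain js :: "'n list" where js: "distinct js" "set js = UNIV" by (rule enum_list)
  have len: "length js = CARD('n)" using distinct_card[OF js(1)] js(2) by simp
  \<comment> \<open>Any \<open>0 < \<rho> < s < r\<close> would do: \<open>s\<close> is the radius
    of the torus of integration, \<open>\<rho>\<close> that of the polydisc on which the expansion
    is obtained.\<close>
  define \<rho> s where "\<rho> = r / 4" and "s = r / 2"
  have \<rho>: "0 < \<rho>" "\<rho> < s" "s < r" using r by (auto simp: \<rho>_def s_def)
  define D where "D = (\<lambda>_::'n. {x::complex. \<rho> < norm x \<and> norm x < r})"
  have op: "open (D j)" for j
    unfolding D_def by (intro open_Collect_conj open_Collect_less continuous_intros)
  have D0: "x \<noteq> 0" if "x \<in> D j" for x j using that \<rho> by (auto simp: D_def)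
  let ?L = "\<lambda>j::'n. contour_integral (circlepath 0 s)"
  have L: "afun (D j) (?L j)" for j
    by (rule afun_contour_integral[OF op]) (use \<rho> in \<open>auto simp: D_def\<close>)
  let ?u = "(\<chi> i. complex_of_real s) :: complex ^ 'n"
  have u: "?u \<in> cart D" using \<rho> by (simp add: cart_def D_def)
  let ?c = "(2 * of_real pi * \<i>) ^ CARD('n) :: complex"
  have c0: "?c \<noteq> 0" by simp
  have fD: "csh f D" by (rule csh_subset[OF f]) (auto simp: D_def)
  let ?P = "\<lambda>\<zeta>. f \<zeta> * (\<Prod>i\<in>UNIV. 1 / \<zeta> $ i)"
  have inv: "(\<lambda>x. 1 / x) holomorphic_on D j" for j using D0 by (auto intro!: holomorphic_intros)
  have P: "csh ?P D" by (intro csh_mult csh_prod csh_coord fD inv)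
  have Pm: "csh (\<lambda>\<zeta>. mono_fun \<alpha> (\<chi> i. 1 / \<zeta> $ i)) D" for \<alpha>
    by (rule csh_compose_coord[OF csh_mono_fun[of \<alpha> "\<lambda>_. UNIV"] inv]) auto
  define a where "a \<alpha> = It js ?L (\<lambda>\<zeta>. ?P \<zeta> * mono_fun \<alpha> (\<chi> i. 1 / \<zeta> $ i)) ?u / ?c" for \<alpha>
  obtain K C where K: "\<And>j. compact (K j)" "\<And>j. K j \<subseteq> D j" "C \<ge> 0"
    "\<And>F G w e. csh F D \<Longrightarrow> csh G D \<Longrightarrow> w \<in> cart D \<Longrightarrow> e \<ge> 0 \<Longrightarrow> (\<And>u. u \<in> cart K \<Longrightarrow> norm (F u - G u) \<le> e) \<Longrightarrow>
      norm (It js ?L (\<lambda>u. ?P u * F u) w - It js ?L (\<lambda>u. ?P u * G u) w) \<le> C * e"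
    by (rule It_approx[OF op L js P]) (rule that; blast)
  have K\<rho>: "\<rho> < norm (\<zeta> $ j)" if "\<zeta> \<in> cart K" for \<zeta> :: "complex ^ 'n" and j
    using that K(2)[of j] by (auto simp: cart_def D_def)
  have "bnd a \<rho>"
    unfolding bnd_def
  proof (intro conjI exI[of _ "C / norm ?c"] allI)
    fix \<alpha> :: "'n \<Rightarrow> nat"
    let ?s = "\<Sum>j\<in>UNIV. \<alpha> j"
    have "norm (It js ?L (\<lambda>\<zeta>. ?P \<zeta> * mono_fun \<alpha> (\<chi> i. 1 / \<zeta> $ i)) ?u - It js ?L (\<lambda>\<zeta>. ?P \<zeta> * 0) ?u) \<le> C * (1 / \<rho> ^ ?s)"
    proof (rule K(4)[OF Pm csh_const u])
      fix \<zeta> assume "\<zeta> \<in> cart K"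
      then have "norm ((\<chi> i. 1 / \<zeta> $ i) $ j) \<le> 1 / \<rho>" for j
        using K\<rho>[of \<zeta> j] \<rho> by (simp add: norm_divide frac_le)
      then have "norm (mono_fun \<alpha> (\<chi> i. 1 / \<zeta> $ i)) \<le> (\<Prod>j\<in>UNIV. (1 / \<rho>) ^ \<alpha> j)"
        unfolding norm_mono_fun by (intro prod_mono conjI power_mono) auto
      also have "\<dots> = 1 / \<rho> ^ ?s" by (simp add: power_sum power_divide prod_dividef)
      finally show "norm (mono_fun \<alpha> (\<chi> i. 1 / \<zeta> $ i) - 0) \<le> 1 / \<rho> ^ ?s" by simp
    qed (use \<rho> in simp)
    then have "norm (?c * a \<alpha>) \<le> C * (1 / \<rho> ^ ?s)"
      using It_zero[OF op L u] c0 by (simp add: a_def)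
    then have "norm ?c * norm (a \<alpha>) * \<rho> ^ ?s \<le> C"
      using \<rho>(1) by (simp add: norm_mult field_simps)
    then show "norm (a \<alpha>) * \<rho> ^ ?s \<le> C / norm ?c"
      using c0 by (simp add: field_simps)
  qed (rule \<rho>)
  moreover have "((\<lambda>\<alpha>. a \<alpha> * mono_fun \<alpha> w) has_sum f w) UNIV" if w: "\<And>j. norm (w $ j) < \<rho>" for w :: "complex ^ 'n"
  proof -
    define m where "m = Max (range (\<lambda>j. norm (w $ j)))"
    have m: "norm (w $ j) \<le> m" for j unfolding m_def by (rule Max_ge) auto
    have m\<rho>: "m < \<rho>" "0 \<le> m" using w order.trans[OF norm_ge_zero m] by (auto simp: m_def)
    define q where "q = m / \<rho>"
    have q: "0 \<le> q" "q < 1" using m\<rho> \<rho> by (auto simp: q_def)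
    \<comment> \<open>The geometric series is the power series with all coefficients
      \<open>1\<close>, so \<open>bnd_approx\<close> supplies uniform partial sums.\<close>
    have b1: "bnd (\<lambda>_::'n \<Rightarrow> nat. 1) 1" by (auto simp: bnd_def)
    have qle: "norm ((\<chi> i. w $ i / \<zeta> $ i) $ j) \<le> q * 1" if "\<zeta> \<in> cart K" for \<zeta> :: "complex ^ 'n" and j
      using K\<rho>[OF that, of j] m[of j] \<rho> m\<rho> by (auto simp: norm_divide q_def intro!: frac_le)
    let ?G = "\<lambda>A \<zeta>. \<Sum>\<alpha>\<in>A. mono_fun \<alpha> w * mono_fun \<alpha> (\<chi> i. 1 / \<zeta> $ i)"
    let ?H = "\<lambda>\<zeta>. \<Prod>i\<in>UNIV. 1 / (1 - w $ i * (1 / \<zeta> $ i))"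
    have lt1: "norm (w $ i * (1 / x)) < 1" if "x \<in> D i" for i x
    proof -
      have "norm (w $ i) < norm x" using w[of i] that by (simp add: D_def)
      then show ?thesis by (simp add: norm_divide norm_mult divide_less_eq)
    qed
    have ne1: "1 - w $ i * (1 / x) \<noteq> 0" if "x \<in> D i" for i x
      using lt1[OF that] by (metis eq_iff_diff_eq_0 less_irrefl norm_one)
    have H: "csh ?H D"
      by (intro csh_prod csh_coord holomorphic_intros) (use D0 ne1 in auto)
    have G: "csh (?G A) D" for A by (intro csh_sum csh_mult csh_const Pm)
    have PH: "It js ?L (\<lambda>\<zeta>. ?P \<zeta> * ?H \<zeta>) ?u = ?c * f w"
    proof -
      have "It js ?L (\<lambda>\<zeta>. ?P \<zeta> * ?H \<zeta>) ?u = It js ?L (\<lambda>\<zeta>. f \<zeta> * (\<Prod>i\<in>UNIV. 1 / (\<zeta> $ i - w $ i))) ?u"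
      proof (rule It_cong[OF op L csh_mult[OF P H] u])
        fix \<zeta> assume \<zeta>: "\<zeta> \<in> cart D"
        have "1 / \<zeta> $ i * (1 / (1 - w $ i * (1 / \<zeta> $ i))) = 1 / (\<zeta> $ i - w $ i)" for i
        proof -
          have "\<zeta> $ i \<in> D i" using \<zeta> by (simp add: cart_def)
          then have "\<zeta> $ i * (1 - w $ i * (1 / \<zeta> $ i)) = \<zeta> $ i - w $ i"
            using D0 by (simp add: algebra_simps)
          then show ?thesis by (simp only: times_divide_times_eq mult_1)
        qed
        then show "?P \<zeta> * ?H \<zeta> = f \<zeta> * (\<Prod>i\<in>UNIV. 1 / (\<zeta> $ i - w $ i))"
          by (simp only: mult.assoc prod.distrib[symmetric])
      qed
      also have "\<dots> = ?c * f w"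
        using It_circle_Cauchy[OF f \<rho> w, of ?u js] js \<rho> len by (simp add: vec_lambda_eta)
      finally show ?thesis .
    qed
    have PG: "It js ?L (\<lambda>\<zeta>. ?P \<zeta> * ?G A \<zeta>) ?u = ?c * (\<Sum>\<alpha>\<in>A. a \<alpha> * mono_fun \<alpha> w)" for A
    proof -
      have "It js ?L (\<lambda>\<zeta>. ?P \<zeta> * ?G A \<zeta>) ?u = It js ?L (\<lambda>\<zeta>. \<Sum>\<alpha>\<in>A. mono_fun \<alpha> w * (?P \<zeta> * mono_fun \<alpha> (\<chi> i. 1 / \<zeta> $ i))) ?u"
        by (simp only: sum_distrib_left mult.left_commute)
      also have "\<dots> = (\<Sum>\<alpha>\<in>A. It js ?L (\<lambda>\<zeta>. mono_fun \<alpha> w * (?P \<zeta> * mono_fun \<alpha> (\<chi> i. 1 / \<zeta> $ i))) ?u)"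
        by (rule It_sum[OF op L _ u]) (intro csh_mult csh_const Pm csh_prod csh_coord fD inv)
      also have "\<dots> = (\<Sum>\<alpha>\<in>A. mono_fun \<alpha> w * It js ?L (\<lambda>\<zeta>. ?P \<zeta> * mono_fun \<alpha> (\<chi> i. 1 / \<zeta> $ i)) ?u)"
        by (intro sum.cong refl It_cmult[OF op L csh_mult[OF P Pm] u])
      also have "\<dots> = ?c * (\<Sum>\<alpha>\<in>A. a \<alpha> * mono_fun \<alpha> w)"
        using c0 by (simp add: a_def sum_distrib_left mult.commute)
      finally show ?thesis .
    qed
    show ?thesis
      unfolding has_sum_def
    proof (rule tendstoI)
      fix e :: real assume e: "e > 0"
      define e' where "e' = e * norm ?c / (C + 1)"
      have e': "e' > 0" using e K(3) c0 by (simp add: e'_def)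
      obtain A where A0: "finite A" "\<forall>B w. finite B \<longrightarrow> A \<subseteq> B \<longrightarrow> (\<forall>j. norm ((w :: complex ^ 'n) $ j) \<le> q * 1) \<longrightarrow>
        dist (\<Sum>\<alpha>\<in>B. 1 * mono_fun \<alpha> w) (\<Sum>\<^sub>\<infinity>\<alpha>. 1 * mono_fun \<alpha> w) < e'"
        by (rule bnd_approx[OF b1 q e'])
      note A = A0(1) A0(2)[rule_format]
      have "dist (\<Sum>\<alpha>\<in>B. a \<alpha> * mono_fun \<alpha> w) (f w) < e" if B: "finite B" "A \<subseteq> B" for B
      proof -
        have "norm (It js ?L (\<lambda>\<zeta>. ?P \<zeta> * ?G B \<zeta>) ?u - It js ?L (\<lambda>\<zeta>. ?P \<zeta> * ?H \<zeta>) ?u) \<le> C * e'"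
        proof (rule K(4)[OF G H u])
          fix \<zeta> assume \<zeta>: "\<zeta> \<in> cart K"
          let ?v = "\<chi> i. w $ i / \<zeta> $ i"
          have "norm (?v $ j) < 1" for j using qle[OF \<zeta>, of j] q by linarith
          then have "(\<Sum>\<^sub>\<infinity>\<alpha>. mono_fun \<alpha> ?v) = ?H \<zeta>"
            using infsumI[OF geometric_has_sum(1)[of ?v]] by simp
          moreover have "?G B \<zeta> = (\<Sum>\<alpha>\<in>B. mono_fun \<alpha> ?v)"
            unfolding mono_fun_def prod.distrib[symmetric] power_mult_distrib[symmetric] by simp
          ultimately show "norm (?G B \<zeta> - ?H \<zeta>) \<le> e'"
            using A(2)[OF B qle[OF \<zeta>]] by (simp add: dist_norm less_imp_le)
        qed (use e' in simp)
        then have "norm ?c * norm ((\<Sum>\<alpha>\<in>B. a \<alpha> * mono_fun \<alpha> w) - f w) \<le> C * e'"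
          unfolding PG PH by (simp flip: norm_mult add: right_diff_distrib)
        also have "\<dots> < norm ?c * e"
          using K(3) e c0 by (simp add: e'_def field_simps add_pos_nonneg)
        finally show ?thesis using c0 by (simp add: dist_norm)
      qed
      then show "\<forall>\<^sub>F B in finite_subsets_at_top UNIV. dist (\<Sum>\<alpha>\<in>B. a \<alpha> * mono_fun \<alpha> w) (f w) < e"
        unfolding eventually_finite_subsets_at_top using A(1) by (intro exI[of _ A]) auto
    qed
  qed
  ultimately show ?thesis using that by blast
qed

subsection \<open>Topology of powers of the sphere\<close>

lemma topspace_rsphere: "topspace rsphere = UNIV"
  by (simp add: UNIV_option_conv)

lemma topspace_rsphere_pow: "topspace rsphere_pow = UNIV"
  by (simp add: topspace_rsphere PiE_UNIV_domain del: topspace_Alexandroff_compactification)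

lemma rsphere_open_finite_part:
  assumes "openin rsphere E"
  shows "open {u. Some u \<in> E}"
  using openin_continuous_map_preimage[OF continuous_map_Some assms] by simp

lemma rsphere_open_infinity:
  assumes "openin rsphere E" "None \<in> E"
  obtains R where "R > 0" "\<And>u. norm u > R \<Longrightarrow> Some u \<in> E"
proof -
  obtain C where C: "compact C" "E = insert None (Some ` (UNIV - C))"
    using assms by (auto simp: openin_Alexandroff_compactification)
  obtain R where R: "R > 0" "\<And>x. x \<in> C \<Longrightarrow> norm x \<le> R"
    using compact_imp_bounded[OF C(1)] by (auto simp: bounded_pos)
  show ?thesis by (rule that[OF R(1)]) (use C(2) R(2) in force)
qed

lemma rsphere_openI:
  assumes fin: "open {u. Some u \<in> E}" and inf: "None \<in> E \<Longrightarrow> \<exists>R. \<forall>u. norm u > R \<longrightarrow> Some u \<in> E"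
  shows "openin rsphere E"
proof (cases "None \<in> E")
  case False
  then have "E = Some ` {u. Some u \<in> E}"
    by (auto simp: image_iff) (metis not_None_eq)
  then show ?thesis using fin by (metis openin_Alexandroff_compactification open_openin)
next
  case True
  define C where "C = - {u. Some u \<in> E}"
  obtain R where R: "\<And>u. norm u > R \<Longrightarrow> Some u \<in> E" using inf True by blast
  have "closed C" using fin by (simp add: C_def closed_Compl)
  moreover have "bounded C" using R by (auto simp: C_def bounded_iff not_le[symmetric] intro!: exI[of _ R])
  ultimately have "compactin euclidean C" "closedin euclidean C"
    by (auto simp: compact_eq_bounded_closed)
  moreover have "E = insert None (Some ` (topspace euclidean - C))"
  proof (rule Set.set_eqI)
    fix x show "x \<in> E \<longleftrightarrow> x \<in> insert None (Some ` (topspace euclidean - C))"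
      using True by (cases x) (auto simp: C_def)
  qed
  ultimately show ?thesis unfolding openin_Alexandroff_compactification by blast
qed

lemma openin_sphere_product:
  assumes "\<And>j. openin rsphere (E j)"
  shows "openin rsphere_pow (Pi UNIV E :: ('n::finite \<Rightarrow> complex option) set)"
  using assms by (simp add: openin_PiE_gen flip: PiE_UNIV_domain)

lemma compact_rsphere_pow: "compact_space (rsphere_pow :: ('n::finite \<Rightarrow> complex option) topology)"
  by (simp add: compact_space_product_topology)

lemma regular_rsphere: "regular_space rsphere"
proof -
  have "locally_compact_space (euclidean :: complex topology)"
    unfolding locally_compact_space_def
  proof
    fix x :: complex
    have "openin euclidean (ball x 1) \<and> compactin euclidean (cball x 1) \<and> x \<in> ball x 1 \<and> ball x 1 \<subseteq> cball x 1"
      by auto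
    then show "\<exists>U K. openin euclidean U \<and> compactin euclidean K \<and> x \<in> U \<and> U \<subseteq> K" by blast
  qed
  then show ?thesis
    by (intro compact_Hausdorff_imp_regular_space) (auto simp: Hausdorff_space_Alexandroff_compactification)
qed

lemma rsphere_UNIV: "openin rsphere UNIV" "closedin rsphere UNIV"
  by (metis openin_topspace topspace_rsphere) (metis closedin_topspace topspace_rsphere)

text \<open>Wallace's tube lemma. By regularity the products of closed neighbourhoods of the
  \<open>K j\<close> have only the product of the \<open>K j\<close> in common; removing
  \<open>U\<close> leaves closed sets with empty intersection, and compactness reduces them to
  finitely many.\<close>

lemma sphere_tube:
  fixes K :: "'n::finite \<Rightarrow> complex option set"
  assumes K: "\<And>j. closedin rsphere (K j)" and U: "openin rsphere_pow U" "Pi UNIV K \<subseteq> U"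
  obtains V where "\<And>j. openin rsphere (V j)" "\<And>j. K j \<subseteq> V j" "Pi UNIV V \<subseteq> U"
proof -
  define \<C> where "\<C> = {C :: 'n \<Rightarrow> complex option set. \<forall>j. closedin rsphere (C j) \<and> (\<exists>V. openin rsphere V \<and> K j \<subseteq> V \<and> V \<subseteq> C j)}"
  define \<U> where "\<U> = (\<lambda>C. Pi UNIV C - U) ` \<C>"
  have "closedin rsphere_pow (Pi UNIV C - U)" if "C \<in> \<C>" for C
    using that U(1) by (auto simp: \<C>_def closedin_product_topology PiE_UNIV_domain[symmetric] intro!: closedin_diff)
  then have cl: "\<forall>C\<in>\<U>. closedin rsphere_pow C" by (auto simp: \<U>_def)
  have "\<Inter>\<U> = {}"
  proof (rule ccontr)
    assume "\<Inter>\<U> \<noteq> {}"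
    then obtain x where "x \<in> \<Inter>\<U>" by blast
    then have x: "\<And>C. C \<in> \<C> \<Longrightarrow> x \<in> Pi UNIV C - U" unfolding \<U>_def by blast
    have "(\<lambda>_. UNIV) \<in> \<C>"
      unfolding \<C>_def using rsphere_UNIV by (intro CollectI allI conjI exI[of _ UNIV]) auto
    then have "x \<notin> U" using x by blast
    then obtain j where j: "x j \<notin> K j" using U(2) by auto
    moreover have "x j \<in> topspace rsphere" by (cases "x j") auto
    ultimately obtain A V where AV: "openin rsphere A" "openin rsphere V" "x j \<in> A" "K j \<subseteq> V" "disjnt A V"
      using regular_rsphere K unfolding regular_space_def by (metis DiffI)
    have "(\<lambda>_. UNIV)(j := topspace rsphere - A) \<in> \<C>"
    proof -
      have "closedin rsphere (topspace rsphere - A)" using AV(1) by blast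
      moreover have "V \<subseteq> topspace rsphere - A" using AV openin_subset[OF AV(2)] by (auto simp: disjnt_def)
      ultimately show ?thesis using AV rsphere_UNIV unfolding \<C>_def by auto
    qed
    from x[OF this] have "x \<in> Pi UNIV ((\<lambda>_. UNIV)(j := topspace rsphere - A))" by blast
    from Pi_mem[OF this, of j] have "x j \<in> topspace rsphere - A" by simp
    then show False using AV(3) by blast
  qed
  then obtain \<F> where \<F>: "finite \<F>" "\<F> \<subseteq> \<U>" "\<Inter>\<F> = {}"
    using compact_rsphere_pow[unfolded compact_space_fip, rule_format, of \<U>] cl by auto
  then obtain \<D> where \<D>: "finite \<D>" "\<D> \<subseteq> \<C>" "\<F> = (\<lambda>C. Pi UNIV C - U) ` \<D>"
    unfolding \<U>_def by (meson finite_subset_image)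
  have "\<forall>C\<in>\<D>. \<exists>V. \<forall>j. openin rsphere (V j) \<and> K j \<subseteq> V j \<and> V j \<subseteq> C j"
  proof
    fix C assume "C \<in> \<D>"
    then have "\<forall>j. \<exists>V. openin rsphere V \<and> K j \<subseteq> V \<and> V \<subseteq> C j" using \<D>(2) unfolding \<C>_def by blast
    then show "\<exists>V. \<forall>j. openin rsphere (V j) \<and> K j \<subseteq> V j \<and> V j \<subseteq> C j" by (rule choice)
  qed
  then obtain W where W: "\<And>C j. C \<in> \<D> \<Longrightarrow> openin rsphere (W C j) \<and> K j \<subseteq> W C j \<and> W C j \<subseteq> C j"
    by metis
  define V where "V j = topspace rsphere \<inter> \<Inter>((\<lambda>C. W C j) ` \<D>)" for j
  have V: "openin rsphere (V j)" for j
  proof (cases "\<D> = {}")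
    case False
    then show ?thesis
      unfolding V_def using W \<D>(1) by (intro openin_Int openin_topspace openin_INT2) auto
  qed (simp only: V_def image_empty Inter_empty Int_UNIV_right openin_topspace)
  have KV: "K j \<subseteq> V j" for j
    using W closedin_subset[OF K] by (auto simp: V_def)
  have "Pi UNIV V \<subseteq> U"
  proof
    fix x assume "x \<in> Pi UNIV V"
    then have "x i \<in> V i" for i by (rule Pi_mem) simp
    then have "x i \<in> W C i" if "C \<in> \<D>" for C i using that unfolding V_def by blast
    then have xC: "x \<in> Pi UNIV C" if "C \<in> \<D>" for C
      using W[OF that] that by (intro Pi_I) blast
    show "x \<in> U"
    proof (rule ccontr)
      assume "x \<notin> U"
      then have "x \<in> \<Inter>\<F>" using xC by (auto simp: \<D>(3))
      then show False using \<F>(3) by blast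
    qed
  qed
  then show ?thesis using that V KV by blast
qed

lemma continuous_map_emb: "continuous_map euclidean rsphere_pow emb"
proof -
  have "continuous_map euclidean euclidean (\<lambda>w::complex ^ 'n. w $ k)" for k
    by (simp add: continuous_on_component)
  from continuous_map_compose[OF this continuous_map_Some]
  have "continuous_map euclidean rsphere (\<lambda>w::complex ^ 'n. Some (w $ k))" for k
    by (simp only: o_def)
  then show ?thesis unfolding continuous_map_componentwise_UNIV emb_def by blast
qed

text \<open>Charts act coordinate by coordinate; this is the action on one of them. It shows the
  preimage of a product to be a product, so that \<open>csh\<close> can be used.\<close>

definition csx :: "'n set \<Rightarrow> 'n \<Rightarrow> complex \<Rightarrow> complex option" where
  "csx I j v = (if j \<in> I then sphere_inv (Some v) else Some v)"

lemma chart_csx: "chart I w = (\<lambda>j. csx I j (w $ j))"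
  by (simp add: chart_def csx_def)

lemma chart_vimage_Pi: "{w. chart I w \<in> Pi UNIV E} = cart (\<lambda>j. {v. csx I j v \<in> E j})"
  by (auto simp: chart_csx cart_def)

lemma open_csx:
  assumes "openin rsphere E"
  shows "open {v. csx I j v \<in> E}"
proof (cases "j \<in> I")
  case True
  have 1: "open {v. v \<noteq> 0 \<and> Some (1 / v) \<in> E}"
  proof -
    have "open ((- {0}) \<inter> (\<lambda>v. 1 / v) -` {u. Some u \<in> E})"
      by (intro continuous_open_preimage rsphere_open_finite_part assms) (auto intro!: continuous_intros)
    moreover have "(- {0}) \<inter> (\<lambda>v. 1 / v) -` {u. Some u \<in> E} = {v. v \<noteq> 0 \<and> Some (1 / v) \<in> E}" by auto
    ultimately show ?thesis by simp
  qed
  have eq: "{v. csx I j v \<in> E} = {v. v \<noteq> 0 \<and> Some (1 / v) \<in> E} \<union> (if None \<in> E then {0} else {})"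
    using True by (auto simp: csx_def)
  show ?thesis
  proof (cases "None \<in> E")
    case n: True
    obtain R where R: "R > 0" "\<And>u. norm u > R \<Longrightarrow> Some u \<in> E" by (rule rsphere_open_infinity[OF assms n]) (rule that; blast)
    have "Some (1 / v) \<in> E" if "v \<noteq> 0" "norm v < 1 / R" for v
      using that R(1) by (intro R(2)) (simp add: norm_divide field_simps)
    then have "{v. v \<noteq> 0 \<and> Some (1 / v) \<in> E} \<union> {0} = {v. v \<noteq> 0 \<and> Some (1 / v) \<in> E} \<union> ball 0 (1 / R)"
      using R(1) by auto
    then show ?thesis using 1 n eq by (simp add: open_Un)
  qed (use 1 eq in simp)
next
  case False
  then show ?thesis using rsphere_open_finite_part[OF assms] by (simp add: csx_def)
qed

lemma sphere_hol_product:
  assumes "\<And>j. openin rsphere (E j)"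
  shows "sphere_hol f (Pi UNIV E) \<longleftrightarrow> (\<forall>I. csh (\<lambda>w. f (chart I w)) (\<lambda>j. {v. csx I j v \<in> E j}))"
proof -
  have "holo (\<lambda>w. f (chart I w)) {w. chart I w \<in> Pi UNIV E} \<longleftrightarrow> csh (\<lambda>w. f (chart I w)) (\<lambda>j. {v. csx I j v \<in> E j})" for I
    unfolding chart_vimage_Pi by (rule holo_cart_iff) (rule open_csx[OF assms])
  then show ?thesis unfolding sphere_hol_def using openin_sphere_product[of E] assms by simp
qed

subsection \<open>Germs at the origin\<close>

definition nbhd0 :: "real \<Rightarrow> ('n::finite \<Rightarrow> complex option) set" where
  "nbhd0 r = Pi UNIV (\<lambda>_. Some ` ball 0 r)"

lemma open_nbhd0: "openin rsphere_pow (nbhd0 r)"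
  unfolding nbhd0_def by (rule openin_sphere_product) (simp add: openin_Alexandroff_compactification_image_Some)

lemma nbhd0_iff: "x \<in> nbhd0 r \<longleftrightarrow> (\<exists>w. x = emb w \<and> (\<forall>j. norm (w $ j) < r))"
proof
  assume "x \<in> nbhd0 r"
  then have "\<forall>j. \<exists>u. x j = Some u \<and> norm u < r" using Pi_mem[of x UNIV "\<lambda>_. Some ` ball 0 r"] unfolding nbhd0_def by fastforce
  then obtain u where u: "\<And>j. x j = Some (u j) \<and> norm (u j) < r" by metis
  then show "\<exists>w. x = emb w \<and> (\<forall>j. norm (w $ j) < r)"
    by (intro exI[of _ "\<chi> j. u j"]) (auto simp: emb_def)
qed (auto simp: nbhd0_def emb_def)

lemma emb_in_nbhd0 [simp]: "emb w \<in> nbhd0 r \<longleftrightarrow> (\<forall>j. norm (w $ j) < r)"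
  by (auto simp: nbhd0_def emb_def)

lemma origin_nbhd0: "r > 0 \<Longrightarrow> origin \<subseteq> nbhd0 r"
  by (simp add: origin_def)

lemma nbhd_origin:
  assumes "openin rsphere_pow W" "origin \<subseteq> W"
  obtains r where "r > 0" "nbhd0 r \<subseteq> (W :: ('n::finite \<Rightarrow> complex option) set)"
proof -
  have "open {w. emb w \<in> W}"
    using openin_continuous_map_preimage[OF continuous_map_emb assms(1)] by simp
  moreover have "0 \<in> {w. emb w \<in> W}" using assms(2) by (simp add: origin_def)
  ultimately obtain r where r: "r > 0" "cart (\<lambda>j. cball ((0 :: complex ^ 'n) $ j) r) \<subseteq> {w. emb w \<in> W}"
    by (rule polydisc_in_open)
  have "nbhd0 r \<subseteq> W"
  proof
    fix x assume "x \<in> (nbhd0 r :: ('n \<Rightarrow> complex option) set)"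
    then obtain w where w: "x = emb w" "\<And>j. norm (w $ j) < r" by (auto simp: nbhd0_iff)
    then have "w \<in> cart (\<lambda>j. cball ((0 :: complex ^ 'n) $ j) r)" by (simp add: cart_def less_imp_le)
    then show "x \<in> W" using r(2) w(1) by blast
  qed
  then show ?thesis using that r by blast
qed

lemma eq_near_origin_iff:
  "eq_near origin f g \<longleftrightarrow> (\<exists>r>0. \<forall>w. (\<forall>j. norm (w $ j) < r) \<longrightarrow> f (emb w) = g (emb w))"
proof
  assume "eq_near origin f g"
  then obtain W where W: "openin rsphere_pow W" "origin \<subseteq> W" "\<forall>x\<in>W. f x = g x"
    by (auto simp: eq_near_def)
  obtain r where "r > 0" "nbhd0 r \<subseteq> W" using nbhd_origin[OF W(1,2)] by blast
  then show "\<exists>r>0. \<forall>w. (\<forall>j. norm (w $ j) < r) \<longrightarrow> f (emb w) = g (emb w)"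
    using W(3) by (meson emb_in_nbhd0 subsetD)
next
  assume "\<exists>r>0. \<forall>w. (\<forall>j. norm (w $ j) < r) \<longrightarrow> f (emb w) = g (emb w)"
  then obtain r where r: "r > 0" "\<And>w. (\<forall>j. norm (w $ j) < r) \<Longrightarrow> f (emb w) = g (emb w)" by blast
  then show "eq_near origin f g"
    unfolding eq_near_def using open_nbhd0[of r] origin_nbhd0[of r]
    by (intro exI[of _ "nbhd0 r"]) (auto simp: nbhd0_iff)
qed

lemma eq_near_refl: "eq_near S f f"
  unfolding eq_near_def
  by (intro exI[of _ UNIV]) (metis openin_topspace subset_UNIV topspace_rsphere_pow)

lemma eq_near_sym: "eq_near S f g \<Longrightarrow> eq_near S g f"
  by (auto simp: eq_near_def)

lemma eq_near_trans: "eq_near S f g \<Longrightarrow> eq_near S g h \<Longrightarrow> eq_near S f h"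
  unfolding eq_near_def by (metis IntD1 IntD2 le_inf_iff openin_Int)

lemma eq_near_map2: "eq_near S f f' \<Longrightarrow> eq_near S g g' \<Longrightarrow> eq_near S (\<lambda>x. h (f x) (g x)) (\<lambda>x. h (f' x) (g' x))"
  unfolding eq_near_def by (elim exE, rename_tac V W, rule_tac x = "V \<inter> W" in exI) auto

lemma germ_eq: "eq_near S f g \<Longrightarrow> germ S f = germ S g"
  unfolding germ_def by (meson eq_near_sym eq_near_trans)

lemma in_germ_iff: "g \<in> germ S f \<longleftrightarrow> g \<in> hol_near S \<and> eq_near S f g"
  by (simp add: germ_def)

definition psum :: "(('n::finite \<Rightarrow> nat) \<Rightarrow> complex) \<Rightarrow> ('n \<Rightarrow> complex option) \<Rightarrow> complex" where
  "psum a x = (\<Sum>\<^sub>\<infinity>\<alpha>. a \<alpha> * mono_fun \<alpha> (fin_part x))"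

definition conv :: "(('n::finite \<Rightarrow> nat) \<Rightarrow> complex) \<Rightarrow> bool" where
  "conv a \<longleftrightarrow> (\<exists>r. bnd a r)"

lemma series_germ_psum: "series_germ a = germ origin (psum a)"
  by (simp add: series_germ_def psum_def[abs_def])

lemma fin_part_emb [simp]: "fin_part (emb w) = w"
  by (simp add: fin_part_def emb_def)

lemma psum_emb: "psum a (emb w) = (\<Sum>\<^sub>\<infinity>\<alpha>. a \<alpha> * mono_fun \<alpha> w)"
  by (simp add: psum_def)

text \<open>No point of \<open>nbhd0 r\<close> has an infinite coordinate. Hence the inverted
  coordinates of a chart stay off \<open>0\<close>, where \<open>1 / v\<close> is holomorphic, and
  the vanishing condition at infinity is void.\<close>

lemma psum_hol_near:
  assumes "conv a"
  shows "psum a \<in> hol_near origin"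
proof -
  obtain r where r: "bnd a r" using assms by (auto simp: conv_def)
  then have r0: "r > 0" by (simp add: bnd_def)
  define E where "E = (\<lambda>_::'a. Some ` ball (0::complex) r)"
  have E: "openin rsphere (E j)" for j
    by (simp add: E_def openin_Alexandroff_compactification_image_Some)
  have "csh (\<lambda>w. psum a (chart I w)) (\<lambda>j. {v. csx I j v \<in> E j})" for I
  proof -
    define \<phi> where "\<phi> j v = (if j \<in> I then 1 / v else v)" for j and v :: complex
    have dom: "v \<noteq> 0 \<and> norm (1 / v) < r" if "csx I j v \<in> E j" "j \<in> I" for j v
      using that by (auto simp: csx_def E_def split: if_splits)
    have dom2: "norm v < r" if "csx I j v \<in> E j" "j \<notin> I" for j v
      using that by (auto simp: csx_def E_def)
    have "csh (\<lambda>w. \<Sum>\<^sub>\<infinity>\<alpha>. a \<alpha> * mono_fun \<alpha> (\<chi> j. \<phi> j (w $ j))) (\<lambda>j. {v. csx I j v \<in> E j})"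
    proof (rule csh_compose_coord[OF bnd_csh[OF r]])
      fix j
      show "\<phi> j holomorphic_on {v. csx I j v \<in> E j}"
        unfolding \<phi>_def using dom by (cases "j \<in> I") (auto intro!: holomorphic_intros)
      show "\<phi> j ` {v. csx I j v \<in> E j} \<subseteq> ball 0 r"
        using dom dom2 by (auto simp: \<phi>_def)
    qed
    then show ?thesis
    proof (rule csh_cong)
      fix w assume w: "w \<in> cart (\<lambda>j. {v. csx I j v \<in> E j})"
      have "fin_part (chart I w) = (\<chi> j. \<phi> j (w $ j))"
        using dom w by (auto simp: vec_eq_iff fin_part_def chart_def \<phi>_def cart_def)
      then show "(\<Sum>\<^sub>\<infinity>\<alpha>. a \<alpha> * mono_fun \<alpha> (\<chi> j. \<phi> j (w $ j))) = psum a (chart I w)"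
        by (simp add: psum_def)
    qed
  qed
  then have "sphere_hol (psum a) (nbhd0 r)"
    unfolding nbhd0_def E_def[symmetric] using sphere_hol_product[of E "psum a", OF E] by (simp add: E_def)
  then have "sphere_hol0 (psum a) (nbhd0 r)"
    unfolding sphere_hol0_def by (auto simp: nbhd0_iff emb_def)
  then show ?thesis unfolding hol_near_def using origin_nbhd0[OF r0] by blast
qed

lemma hol_near_origin_psum:
  assumes "f \<in> hol_near origin"
  obtains a where "conv (a :: ('n::finite \<Rightarrow> nat) \<Rightarrow> complex)" "eq_near origin (psum a) f"
proof -
  obtain U where U: "origin \<subseteq> U" "sphere_hol f U"
    using assms by (auto simp: hol_near_def sphere_hol0_def)
  then have "openin rsphere_pow U" "holo (\<lambda>w. f (chart {} w)) {w. chart {} w \<in> U}"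
    by (auto simp: sphere_hol_def)
  moreover have "chart {} w = emb w" for w :: "complex ^ 'n" by (simp add: chart_def emb_def)
  ultimately have h: "openin rsphere_pow U" "holo (\<lambda>w. f (emb w)) {w. emb w \<in> U}" by auto
  obtain r where r: "r > 0" "nbhd0 r \<subseteq> U" using nbhd_origin[OF h(1) U(1)] by blast
  have "cart (\<lambda>_. ball 0 r) \<subseteq> {w. emb w \<in> U}"
    using r(2) by (auto simp: cart_def intro!: subsetD[OF r(2)])
  then have "csh (\<lambda>w. f (emb w)) (\<lambda>_. ball 0 r)"
    using holo_imp_csh holo_subset[OF h(2)] by blast
  then obtain a \<rho> where a: "bnd a \<rho>" "\<And>w. (\<And>j. norm (w $ j) < \<rho>) \<Longrightarrow> ((\<lambda>\<alpha>. a \<alpha> * mono_fun \<alpha> w) has_sum f (emb w)) UNIV"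
    using taylor_exists[OF _ r(1)] by blast
  have "eq_near origin (psum a) f"
    unfolding eq_near_origin_iff using a by (intro exI[of _ \<rho>]) (auto simp: psum_emb bnd_def infsumI)
  moreover have "conv a" using a(1) by (auto simp: conv_def)
  ultimately show ?thesis using that by blast
qed

lemma bnd_combine:
  assumes "bnd a r" "bnd b r"
  shows "bnd (\<lambda>\<alpha>. a \<alpha> + c * b \<alpha>) r"
proof -
  let ?s = "\<lambda>\<alpha>. \<Sum>j\<in>UNIV. \<alpha> j"
  obtain A B where A: "\<And>\<alpha>. norm (a \<alpha>) * r ^ ?s \<alpha> \<le> A" and B: "\<And>\<alpha>. norm (b \<alpha>) * r ^ ?s \<alpha> \<le> B" and r: "r > 0"
    using assms by (auto simp: bnd_def)
  have "norm (a \<alpha> + c * b \<alpha>) * r ^ ?s \<alpha> \<le> A + norm c * B" for \<alpha>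
  proof -
    have "norm (a \<alpha> + c * b \<alpha>) * r ^ ?s \<alpha> \<le> (norm (a \<alpha>) + norm c * norm (b \<alpha>)) * r ^ ?s \<alpha>"
      using r norm_triangle_ineq[of "a \<alpha>" "c * b \<alpha>"] by (intro mult_right_mono) (auto simp: norm_mult)
    also have "\<dots> = norm (a \<alpha>) * r ^ ?s \<alpha> + norm c * (norm (b \<alpha>) * r ^ ?s \<alpha>)" by (simp add: algebra_simps)
    also have "\<dots> \<le> A + norm c * B" using A B by (intro add_mono mult_left_mono) auto
    finally show ?thesis .
  qed
  then show ?thesis using r by (auto simp: bnd_def)
qed

lemma conv_common:
  assumes "conv a" "conv b"
  obtains r where "bnd a r" "bnd b r"
proof -
  obtain r s where rs: "bnd a r" "bnd b s" using assms by (auto simp: conv_def)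
  then have "0 < min r s" by (auto simp: bnd_def)
  then show ?thesis using that[of "min r s"] bnd_smaller[OF rs(1)] bnd_smaller[OF rs(2)] by simp
qed

lemma psum_combine:
  assumes "conv a" "conv b"
  shows "eq_near origin (psum (\<lambda>\<alpha>. a \<alpha> + c * b \<alpha>)) (\<lambda>x. psum a x + c * psum b x)"
proof -
  obtain r where r: "bnd a r" "bnd b r" by (rule conv_common[OF assms])
  have "psum (\<lambda>\<alpha>. a \<alpha> + c * b \<alpha>) (emb w) = psum a (emb w) + c * psum b (emb w)" if w: "\<And>j. norm (w $ j) < r" for w
  proof -
    have "((\<lambda>\<alpha>. a \<alpha> * mono_fun \<alpha> w + c * (b \<alpha> * mono_fun \<alpha> w)) has_sum
       (psum a (emb w) + c * psum b (emb w))) UNIV"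
      unfolding psum_emb by (intro has_sum_add has_sum_cmult_right bnd_has_sum[OF r(1) w] bnd_has_sum[OF r(2) w])
    then show ?thesis unfolding psum_emb by (intro infsumI) (simp add: algebra_simps)
  qed
  then show ?thesis unfolding eq_near_origin_iff using r by (intro exI[of _ r]) (auto simp: bnd_def)
qed

lemma conv_combine: "conv a \<Longrightarrow> conv b \<Longrightarrow> conv (\<lambda>\<alpha>. a \<alpha> + c * b \<alpha>)"
  using conv_common bnd_combine unfolding conv_def by metis

lemma psum_unique:
  assumes "conv a" "conv b" "eq_near origin (psum a) (psum b)"
  shows "a = b"
proof
  fix \<alpha>
  let ?d = "\<lambda>\<alpha>. a \<alpha> + (-1) * b \<alpha>"
  have "eq_near origin (\<lambda>x. psum a x + (-1) * psum b x) (\<lambda>x. psum b x + (-1) * psum b x)"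
    using eq_near_map2[OF assms(3) eq_near_refl[of _ "psum b"], of "\<lambda>u v. u + (-1) * v"] .
  then have "eq_near origin (psum ?d) (\<lambda>x. 0)"
    using eq_near_trans[OF psum_combine[OF assms(1,2), of "-1"]] by simp
  then obtain s where s: "s > 0" "\<And>w. (\<forall>j. norm (w $ j) < s) \<Longrightarrow> psum ?d (emb w) = 0"
    unfolding eq_near_origin_iff by blast
  obtain r where r: "bnd ?d r" using conv_combine[OF assms(1,2), of "-1"] by (auto simp: conv_def)
  have "?d \<alpha> = 0"
    by (rule power_series_zero[OF r _ s(1)]) (use s(2) in \<open>simp add: psum_emb\<close>)
  then show "a \<alpha> = b \<alpha>" by simp
qed

lemma eventually_has_sum_imp_conv:
  fixes b :: "('n::finite \<Rightarrow> nat) \<Rightarrow> complex"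
  assumes "\<forall>\<^sub>F w in nhds 0. ((\<lambda>\<alpha>. b \<alpha> * mono_fun \<alpha> w) has_sum f (emb w)) UNIV"
  shows "conv b" "eq_near origin (psum b) f"
proof -
  obtain S where S: "open S" "0 \<in> S" "\<And>w. w \<in> S \<Longrightarrow> ((\<lambda>\<alpha>. b \<alpha> * mono_fun \<alpha> w) has_sum f (emb w)) UNIV"
    using assms by (auto simp: eventually_nhds)
  obtain r where r: "r > 0" "cart (\<lambda>j. cball ((0::complex ^ 'n) $ j) r) \<subseteq> S" using polydisc_in_open[OF S(1,2)] by blast
  have w: "((\<lambda>\<alpha>. b \<alpha> * mono_fun \<alpha> w) has_sum f (emb w)) UNIV" if "\<And>j. norm (w $ j) \<le> r" for w
    by (rule S(3), rule subsetD[OF r(2)]) (use that in \<open>simp add: cart_def\<close>)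
  \<comment> \<open>Convergence at the single point with all coordinates equal to \<open>r\<close>
    already bounds all terms.\<close>
  have "bnd b r"
    by (rule has_sum_imp_bnd[OF r(1)], rule has_sum_imp_summable, rule w) (use r in simp)
  then show "conv b" by (auto simp: conv_def)
  show "eq_near origin (psum b) f"
    unfolding eq_near_origin_iff using r(1) w by (intro exI[of _ r]) (auto simp: psum_emb intro!: infsumI less_imp_le)
qed

text \<open>\<open>taylor\<close> admits every representative of the germ. Any two agree near the
  origin, so uniqueness of power series settles the choice.\<close>

lemma taylor_series_germ:
  assumes a: "conv (a :: ('n::finite \<Rightarrow> nat) \<Rightarrow> complex)"
  shows "taylor (series_germ a) = a"
  unfolding taylor_def
proof (rule the_equality)
  obtain r where r: "bnd a r" using a by (auto simp: conv_def)
  then have "r > 0" by (simp add: bnd_def)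
  then have "open (cart (\<lambda>_. ball 0 r) :: (complex ^ 'n) set)" "(0::complex ^ 'n) \<in> cart (\<lambda>_. ball 0 r)"
    using open_cart[of "\<lambda>_. ball 0 r"] by (auto simp: cart_def)
  moreover have "((\<lambda>\<alpha>. a \<alpha> * mono_fun \<alpha> w) has_sum psum a (emb w)) UNIV" if "w \<in> cart (\<lambda>_. ball 0 r)" for w
    unfolding psum_emb by (rule bnd_has_sum[OF r]) (use that in \<open>simp add: cart_def\<close>)
  ultimately have "\<forall>\<^sub>F w in nhds 0. ((\<lambda>\<alpha>. a \<alpha> * mono_fun \<alpha> w) has_sum psum a (emb w)) UNIV"
    unfolding eventually_nhds by blast
  moreover have "psum a \<in> series_germ a"
    by (simp add: series_germ_psum in_germ_iff psum_hol_near[OF a] eq_near_refl)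
  ultimately show "\<exists>f\<in>series_germ a. \<forall>\<^sub>F w in nhds 0. ((\<lambda>\<alpha>. a \<alpha> * mono_fun \<alpha> w) has_sum f (emb w)) UNIV"
    by blast
  fix b assume "\<exists>f\<in>series_germ a. \<forall>\<^sub>F w in nhds 0. ((\<lambda>\<alpha>. b \<alpha> * mono_fun \<alpha> w) has_sum f (emb w)) UNIV"
  then obtain f where f: "f \<in> series_germ a" "\<forall>\<^sub>F w in nhds 0. ((\<lambda>\<alpha>. b \<alpha> * mono_fun \<alpha> w) has_sum f (emb w)) UNIV"
    by blast
  have "eq_near origin (psum a) f" using f(1) by (simp add: series_germ_psum in_germ_iff)
  then have "eq_near origin (psum b) (psum a)"
    using eventually_has_sum_imp_conv(2)[OF f(2)] eq_near_sym eq_near_trans by blast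
  then show "b = a"
    by (rule psum_unique[OF eventually_has_sum_imp_conv(1)[OF f(2)] a])
qed

section \<open>The sets of the family and the germs that extend to them\<close>

lemma hat_set_Some: "Some u \<in> hat_set Om z j \<longleftrightarrow> (\<forall>a\<in>Om j. a \<noteq> 0 \<longrightarrow> u * a \<noteq> z $ j)" 
proof -
  have "Some u \<in> map_option (\<lambda>a. z $ j * a) ` recip_set (Om j) \<longleftrightarrow> (\<exists>a\<in>Om j. a \<noteq> 0 \<and> u = z $ j * (1 / a))"
    unfolding recip_set_def image_image
    by (auto simp: image_iff split: if_splits intro!: bexI)
  then show ?thesis by (auto simp: hat_set_def field_simps)
qed

lemma hat_set_None: "None \<in> hat_set Om z j \<longleftrightarrow> 0 \<notin> Om j"
  unfolding hat_set_def recip_set_def image_image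
  by (auto simp: image_iff split: if_splits)

lemma zero_in_hat_set: "z $ j \<noteq> 0 \<Longrightarrow> Some 0 \<in> hat_set Om z j"
  by (simp add: hat_set_Some)

lemma origin_subset_hat: "(\<And>j. z $ j \<noteq> 0) \<Longrightarrow> origin \<subseteq> Pi UNIV (hat_set Om z)"
  by (simp add: origin_def emb_def zero_in_hat_set)

text \<open>The finite part of the complement is the preimage of \<open>Om j\<close> under
  \<open>u \<mapsto> z $ j / u\<close>. Infinity belongs to the complement only if
  \<open>0 \<in> Om j\<close>, and then a disc about \<open>0\<close> in \<open>Om j\<close> yields
  a neighbourhood of infinity.\<close>

lemma closed_hat_set:
  assumes "open (Om j)" "z $ j \<noteq> 0"
  shows "closedin rsphere (hat_set Om z j)"
proof -
  let ?E = "- hat_set Om z j"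
  have fin: "{u. Some u \<in> ?E} = (- {0}) \<inter> (\<lambda>u. z $ j / u) -` Om j"
  proof (rule Set.set_eqI)
    fix u
    show "u \<in> {u. Some u \<in> ?E} \<longleftrightarrow> u \<in> (- {0}) \<inter> (\<lambda>u. z $ j / u) -` Om j"
    proof (cases "u = 0")
      case False
      then have "u * a = z $ j \<longleftrightarrow> a = z $ j / u" for a by (auto simp: field_simps)
      then show ?thesis using False assms(2) by (auto simp: hat_set_Some)
    qed (simp add: zero_in_hat_set assms(2))
  qed
  have "openin rsphere ?E"
  proof (rule rsphere_openI)
    show "open {u. Some u \<in> ?E}" unfolding fin
      by (intro continuous_open_preimage assms) (auto intro!: continuous_intros)
    assume "None \<in> ?E"
    then have "0 \<in> Om j" by (simp add: hat_set_None)
    then obtain e where e: "e > 0" "ball 0 e \<subseteq> Om j" using assms(1) open_contains_ball by blast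
    have "Some u \<in> ?E" if u: "norm u > norm (z $ j) / e" for u
    proof -
      have "0 \<le> norm (z $ j) / e" using e(1) by simp
      then have "u \<noteq> 0" using u by auto
      moreover have "norm (z $ j / u) < e" using u e(1) \<open>u \<noteq> 0\<close> by (simp add: norm_divide field_simps)
      ultimately have "u \<in> {u. Some u \<in> ?E}" unfolding fin using e(2) by auto
      then show ?thesis by simp
    qed
    then show "\<exists>R. \<forall>u. norm u > R \<longrightarrow> Some u \<in> ?E" by blast
  qed
  then show ?thesis
    unfolding closedin_def topspace_rsphere Compl_eq_Diff_UNIV by simp
qed

text \<open>The germs of \<open>ext_germs\<close>, described by their Taylor coefficients.
  Extensions are asked for on products of open sets, the form in which the integral formula uses
  them.\<close>

definition ext_seq :: "('n::finite \<Rightarrow> complex set) \<Rightarrow> (('n \<Rightarrow> nat) \<Rightarrow> complex) \<Rightarrow> bool" where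
  "ext_seq Om a \<longleftrightarrow> conv a \<and> (\<forall>z\<in>cart Om. (\<forall>j. z $ j \<noteq> 0) \<longrightarrow> (\<exists>Uh g. is_extension Om z (series_germ a) Uh g))"

lemma is_extension_iff:
  assumes "\<And>j. z $ j \<noteq> 0"
  shows "is_extension Om z (series_germ a) Uh g \<longleftrightarrow>
    (\<forall>j. openin rsphere (Uh j) \<and> hat_set Om z j \<subseteq> Uh j) \<and> sphere_hol0 g (Pi UNIV Uh) \<and> eq_near origin (psum a) g"
proof -
  have "g \<in> hol_near origin" if "\<forall>j. hat_set Om z j \<subseteq> Uh j" "sphere_hol0 g (Pi UNIV Uh)"
  proof -
    have "origin \<subseteq> Pi UNIV Uh" using origin_subset_hat[of z Om] assms that(1) Pi_mono[of UNIV "hat_set Om z" Uh] by blast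
    then show ?thesis using that(2) by (auto simp: hol_near_def)
  qed
  then show ?thesis unfolding is_extension_def series_germ_psum in_germ_iff by blast
qed

text \<open>A neighbourhood of a set of the family can be shrunk to a product by
  \<open>sphere_tube\<close>, since the factors of the set are closed in the sphere.\<close>

lemma ext_germs_iff:
  assumes op: "\<And>j. open (Om j)"
  shows "F \<in> ext_germs Om \<longleftrightarrow> (\<exists>a. ext_seq Om a \<and> F = series_germ a)"
proof
  assume F: "F \<in> ext_germs Om"
  then obtain f0 where f0: "f0 \<in> hol_near origin" "F = germ origin f0"
    by (auto simp: ext_germs_def germs_def)
  obtain a where a: "conv a" "eq_near origin (psum a) f0" using hol_near_origin_psum[OF f0(1)] by blast
  have Fa: "F = series_germ a" using germ_eq[OF a(2)] f0(2) by (simp add: series_germ_psum)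
  have "\<exists>Uh g. is_extension Om z (series_germ a) Uh g" if z: "z \<in> cart Om" "\<And>j. z $ j \<noteq> 0" for z
  proof -
    have "Pi UNIV (hat_set Om z) \<in> hat_family Om" using z by (auto simp: hat_family_def)
    then obtain G f g where G: "G \<in> germs (Pi UNIV (hat_set Om z))" "f \<in> F" "g \<in> G" "eq_near origin f g"
      using F by (auto simp: ext_germs_def)
    then have "g \<in> hol_near (Pi UNIV (hat_set Om z))" by (auto simp: germs_def in_germ_iff)
    then obtain U where U: "Pi UNIV (hat_set Om z) \<subseteq> U" "sphere_hol0 g U" by (auto simp: hol_near_def)
    have "openin rsphere_pow U" using U(2) by (auto simp: sphere_hol0_def sphere_hol_def)
    then obtain V where V: "\<And>j. openin rsphere (V j)" "\<And>j. hat_set Om z j \<subseteq> V j" "Pi UNIV V \<subseteq> U"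
      using sphere_tube[OF closed_hat_set[OF op] _ U(1)] z(2) by metis
    have "holo (\<lambda>w. g (chart I w)) {w. chart I w \<in> Pi UNIV V}" for I
      by (rule holo_subset[of _ "{w. chart I w \<in> U}"]) (use U(2) V(3) in \<open>auto simp: sphere_hol0_def sphere_hol_def\<close>)
    then have "sphere_hol0 g (Pi UNIV V)"
      using U(2) V(3) openin_sphere_product[of V] V(1) unfolding sphere_hol0_def sphere_hol_def by blast
    moreover have "eq_near origin (psum a) g"
      using G(2,4) eq_near_trans by (auto simp: Fa series_germ_psum in_germ_iff)
    ultimately show ?thesis using V is_extension_iff[OF z(2)] by blast
  qed
  then show "\<exists>a. ext_seq Om a \<and> F = series_germ a" using a(1) Fa by (auto simp: ext_seq_def)
next
  assume "\<exists>a. ext_seq Om a \<and> F = series_germ a"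
  then obtain a where a: "ext_seq Om a" "F = series_germ a" by blast
  then have c: "conv a" by (simp add: ext_seq_def)
  have aF: "psum a \<in> F" by (simp add: a(2) series_germ_psum in_germ_iff psum_hol_near[OF c] eq_near_refl)
  have "F \<in> germs origin"
    using psum_hol_near[OF c] by (auto simp: a(2) series_germ_psum germs_def)
  moreover have "\<exists>G\<in>germs S. \<exists>f\<in>F. \<exists>g\<in>G. eq_near origin f g" if S: "S \<in> hat_family Om" for S
  proof -
    obtain z where z0: "S = Pi UNIV (hat_set Om z)" "z \<in> cart Om" "\<forall>j. z $ j \<noteq> 0"
      using S unfolding hat_family_def by blast
    note z = z0(1,2) z0(3)[rule_format]
    then obtain Uh g where "is_extension Om z (series_germ a) Uh g" using a by (auto simp: ext_seq_def)
    then have g: "\<forall>j. hat_set Om z j \<subseteq> Uh j" "sphere_hol0 g (Pi UNIV Uh)" "eq_near origin (psum a) g"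
      by (auto simp: is_extension_iff[OF z(3)])
    have "S \<subseteq> Pi UNIV Uh" using g(1) z(1) by (auto simp: Pi_iff)
    then have "g \<in> hol_near S" using g(2) by (auto simp: hol_near_def)
    then have "germ S g \<in> germs S" "g \<in> germ S g" by (auto simp: germs_def in_germ_iff eq_near_refl)
    then show ?thesis using aF g(3) by blast
  qed
  ultimately show "F \<in> ext_germs Om" by (simp add: ext_germs_def)
qed

subsection \<open>Runge domains and existence of cycles\<close>

lemma csh_poly_fun:
  assumes "poly_fun p"
  shows "csh p D"
proof -
  obtain A c where p: "p = (\<lambda>z. \<Sum>\<alpha>\<in>A. c \<alpha> * mono_fun \<alpha> z)" using assms by (auto simp: poly_fun_def)
  show ?thesis unfolding p by (intro csh_sum csh_mult csh_const csh_mono_fun)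
qed

text \<open>A function on \<open>Om j\<close> is regarded as a function on the product and
  approximated by polynomials on a copy, in one slice, of the compact set that controls the contour
  integral. Restricted to the slice these polynomials are entire, so their integrals over the loop
  vanish, and so does the limit.\<close>

lemma runge_factor_simply_connected:
  fixes Om :: "'n::finite \<Rightarrow> complex set"
  assumes op: "\<And>j. open (Om j)" and R: "runge_domain (cart Om)"
  shows "simply_connected (Om j)"
proof -
  obtain w where w: "w \<in> cart Om" using R by (auto simp: runge_domain_def)
  have im: "(\<lambda>w. w $ j) ` cart Om = Om j"
  proof
    show "Om j \<subseteq> (\<lambda>w. w $ j) ` cart Om"
    proof
      fix x assume "x \<in> Om j"
      then show "x \<in> (\<lambda>w. w $ j) ` cart Om"
        by (intro image_eqI[of _ _ "vupd w j x"] vupd_in_cart w) auto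
    qed
  qed (auto simp: cart_def)
  have "connected ((\<lambda>w. w $ j) ` cart Om)"
    using R by (intro connected_continuous_image continuous_on_component) (auto simp: runge_domain_def)
  then have conn: "connected (Om j)" by (simp add: im)
  have "(f has_contour_integral 0) g"
    if g: "valid_path g" "path_image g \<subseteq> Om j" "pathfinish g = pathstart g" and f: "f holomorphic_on Om j" for g f
  proof -
    obtain K C where K: "compact K" "K \<subseteq> Om j" "C \<ge> 0"
      "\<And>f B. f holomorphic_on Om j \<Longrightarrow> B \<ge> 0 \<Longrightarrow> (\<And>x. x \<in> K \<Longrightarrow> norm (f x) \<le> B) \<Longrightarrow> norm (contour_integral g f) \<le> C * B"
      using afun_bound[OF afun_contour_integral[OF op g(1,2)] op] by blast
    have "csh (\<lambda>w. f (w $ j)) Om" using csh_coord[of f Om j] f by blast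
    then have F: "holo (\<lambda>w. f (w $ j)) (cart Om)" by (rule csh_imp_holo) (rule op)
    have cK: "compact ((\<lambda>x. vupd w j x) ` K)" "(\<lambda>x. vupd w j x) ` K \<subseteq> cart Om"
      using K w by (auto intro!: compact_continuous_image continuous_intros vupd_in_cart)
    have le: "norm (contour_integral g f) \<le> C * e" if e: "e > 0" for e
    proof -
      obtain p where p: "poly_fun p" "\<forall>z\<in>(\<lambda>x. vupd w j x) ` K. dist (p z) (f (z $ j)) < e"
        using R F cK e unfolding runge_domain_def by blast
      let ?p = "\<lambda>x. p (vupd w j x)"
      have ph: "?p holomorphic_on UNIV"
        using csh_slice[OF csh_poly_fun[OF p(1), of "\<lambda>_. UNIV"], of w j] by (simp add: cart_def)
      then have "(?p has_contour_integral 0) g"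
        using g by (intro Cauchy_theorem_global[of UNIV]) auto
      then have "contour_integral g ?p = 0" by (rule contour_integral_unique)
      moreover have "contour_integral g (\<lambda>x. f x - ?p x) = contour_integral g f - contour_integral g ?p"
        by (intro contour_integral_diff contour_integrable_holomorphic_simple[OF _ op[of j]] g f holomorphic_on_subset[OF ph]) auto
      moreover have "norm (contour_integral g (\<lambda>x. f x - ?p x)) \<le> C * e"
      proof (rule K(4))
        show "(\<lambda>x. f x - ?p x) holomorphic_on Om j"
          by (intro holomorphic_intros f holomorphic_on_subset[OF ph]) auto
        fix x assume "x \<in> K"
        then have "dist (p (vupd w j x)) (f (vupd w j x $ j)) < e" using p(2) by blast
        then show "norm (f x - ?p x) \<le> e" by (simp add: dist_norm norm_minus_commute)
      qed (use e in simp)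
      ultimately show ?thesis by simp
    qed
    have "norm (contour_integral g f) \<le> 0"
    proof (rule field_le_epsilon)
      fix e :: real assume e: "e > 0"
      have "norm (contour_integral g f) \<le> C * (e / (C + 1))" by (rule le) (use e K(3) in simp)
      also have "\<dots> \<le> 0 + e" using K(3) e by (simp add: field_simps)
      finally show "norm (contour_integral g f) \<le> 0 + e" .
    qed
    moreover have "f contour_integrable_on g"
      using contour_integrable_holomorphic_simple[OF f op g(1,2)] .
    ultimately show ?thesis using has_contour_integral_integral by fastforce
  qed
  then show ?thesis using conn simply_connected_eq_contour_integral_zero[OF op[of j]] by blast
qed

section \<open>Cycles around compact subsets of simply connected domains\<close>

lemma winding_number_holomorphic_image:
  assumes "valid_path \<gamma>" "g holomorphic_on S" "open S" "path_image \<gamma> \<subseteq> S" "p \<notin> g ` path_image \<gamma>"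
  shows "winding_number (g \<circ> \<gamma>) p = 1 / (2 * pi * \<i>) * contour_integral \<gamma> (\<lambda>w. deriv g w / (g w - p))"
proof -
  have v: "valid_path (g \<circ> \<gamma>)" by (rule valid_path_compose_holomorphic[OF assms(1-4)])
  obtain T where T: "finite T" "\<And>s. s \<in> {0..1} - T \<Longrightarrow>
      (\<gamma> has_vector_derivative vector_derivative \<gamma> (at s within {0..1})) (at s)"
    using valid_path_derivative[OF assms(1)] by metis
  have "contour_integral (g \<circ> \<gamma>) (\<lambda>w. 1 / (w - p)) = contour_integral \<gamma> (\<lambda>w. deriv g w / (g w - p))"
    unfolding contour_integral_integral
  proof (rule integral_spike[OF negligible_finite[OF T(1)]])
    fix s assume s: "s \<in> {0..1} - T"
    have "\<gamma> s \<in> S" using assms(4) s by (auto simp: path_image_def)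
    then have "(g has_field_derivative deriv g (\<gamma> s)) (at (\<gamma> s))"
      using holomorphic_derivI[OF assms(2,3)] by blast
    then have "(g has_field_derivative deriv g (\<gamma> s)) (at (\<gamma> s) within \<gamma> ` UNIV)"
      by (rule has_field_derivative_at_within)
    from field_vector_diff_chain_at[OF T(2)[OF s]] this
    have "((g \<circ> \<gamma>) has_vector_derivative vector_derivative \<gamma> (at s within {0..1}) * deriv g (\<gamma> s)) (at s)"
      using \<open>(g has_field_derivative deriv g (\<gamma> s)) (at (\<gamma> s))\<close> by blast
    then show "deriv g (\<gamma> s) / (g (\<gamma> s) - p) * vector_derivative \<gamma> (at s) =
        1 / ((g \<circ> \<gamma>) s - p) * vector_derivative (g \<circ> \<gamma>) (at s)"
      using T(2)[OF s] by (simp add: vector_derivative_at)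
  qed
  moreover have "p \<notin> path_image (g \<circ> \<gamma>)" using assms(5) by (simp add: path_image_compose)
  ultimately show ?thesis using winding_number_valid_path[OF v] by simp
qed

text \<open>The curve is the image, under the inverse \<open>g\<close> of the Riemann map
  \<open>f\<close>, of a circle around the image of \<open>L\<close>. Its winding numbers come from
  the argument principle: \<open>g - p\<close> has a single simple zero inside for \<open>p\<close>
  in \<open>L\<close> and none for \<open>p\<close> outside \<open>V\<close>.\<close>

lemma simply_connected_cycle:
  assumes V: "open V" "simply_connected V" "V \<noteq> {}" and L: "compact L" "L \<subseteq> V"
  obtains c where "valid_path c" "pathfinish c = pathstart c" "path_image c \<subseteq> V - L - {0}"
    "\<And>p. p \<in> L \<Longrightarrow> winding_number c p = 1" "\<And>p. p \<notin> V \<Longrightarrow> winding_number c p = 0"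
proof (cases "V = UNIV")
  case True
  obtain R where R: "R > 0" "\<And>x. x \<in> L \<Longrightarrow> norm x \<le> R"
    using compact_imp_bounded[OF L(1)] by (auto simp: bounded_pos)
  show ?thesis
  proof (rule that[of "circlepath 0 (R + 1)"])
    show "path_image (circlepath 0 (R + 1)) \<subseteq> V - L - {0}" using R True by force
    show "winding_number (circlepath 0 (R + 1)) p = 1" if "p \<in> L" for p
      using R(2)[OF that] by (intro winding_number_circlepath) simp
  qed (use True in auto)
next
  case False
  then obtain f g where f: "f holomorphic_on V" and g: "g holomorphic_on ball 0 1"
    and fV: "\<And>z. z \<in> V \<Longrightarrow> f z \<in> ball 0 1" "\<And>z. z \<in> V \<Longrightarrow> g (f z) = z"
    and gB: "\<And>z. z \<in> ball 0 1 \<Longrightarrow> g z \<in> V" "\<And>z. z \<in> ball 0 1 \<Longrightarrow> f (g z) = z"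
    using Riemann_mapping_theorem[of V] V by metis
  have "compact (f ` L)"
    using L f holomorphic_on_imp_continuous_on continuous_on_subset compact_continuous_image by metis
  moreover have "f ` L \<subseteq> ball 0 1" using fV L by blast
  ultimately obtain \<rho> where \<rho>: "0 \<le> \<rho>" "\<rho> < 1" "\<And>x. x \<in> f ` L \<Longrightarrow> norm x \<le> \<rho>"
  proof (cases "f ` L = {}")
    case True
    then show ?thesis using that[of 0] by auto
  next
    case False
    obtain x where x: "x \<in> f ` L" "\<And>y. y \<in> f ` L \<Longrightarrow> norm y \<le> norm x"
      using continuous_attains_sup[OF \<open>compact (f ` L)\<close> False continuous_on_norm[OF continuous_on_id]] by blast
    then have "norm x < 1" using \<open>f ` L \<subseteq> ball 0 1\<close> by force
    then show ?thesis using that[of "norm x"] x(2) by auto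
  qed
  \<comment> \<open>Excluding one radius keeps the curve off \<open>0\<close>; of two candidates
    between \<open>\<rho>\<close> and \<open>1\<close> at least one differs from
    \<open>norm (f 0)\<close>.\<close>
  obtain r where r: "\<rho> < r" "r < 1" "r \<noteq> norm (f 0)"
  proof (cases "norm (f 0) = (\<rho> + 1) / 2")
    case True
    then show ?thesis using that[of "(\<rho> + 3) / 4"] \<rho> by (simp add: field_simps)
  next
    case False
    then show ?thesis using that[of "(\<rho> + 1) / 2"] \<rho> by (simp add: field_simps)
  qed
  have r0: "r > 0" using \<rho> r by simp
  let ?\<gamma> = "circlepath 0 r"
  have pi: "path_image ?\<gamma> = sphere 0 r" "path_image ?\<gamma> \<subseteq> ball 0 1" using r0 r by auto
  have wn: "winding_number (g \<circ> ?\<gamma>) p = 1 / (2 * pi * \<i>) * contour_integral ?\<gamma> (\<lambda>w. deriv g w / (g w - p))"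
    if "p \<notin> g ` sphere 0 r" for p
    by (rule winding_number_holomorphic_image[OF _ g]) (use pi that in auto)
  have dg: "deriv g holomorphic_on ball 0 1" by (rule holomorphic_deriv[OF g]) simp
  show ?thesis
  proof (rule that[of "g \<circ> ?\<gamma>"])
    show "valid_path (g \<circ> ?\<gamma>)" by (rule valid_path_compose_holomorphic[OF _ g]) (use pi in auto)
    show "pathfinish (g \<circ> ?\<gamma>) = pathstart (g \<circ> ?\<gamma>)" by (simp add: pathstart_compose pathfinish_compose)
    show "path_image (g \<circ> ?\<gamma>) \<subseteq> V - L - {0}"
    proof
      fix y assume "y \<in> path_image (g \<circ> ?\<gamma>)"
      then obtain x where x: "y = g x" "norm x = r" using pi(1) by (auto simp: path_image_compose)
      then have xb: "x \<in> ball 0 1" using r by simp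
      have fy: "f y = x" using gB(2)[OF xb] x by simp
      have "y \<notin> L" using \<rho>(3)[of x] fy x(2) r(1) by force
      moreover have "y \<noteq> 0" using fy x(2) r(3) by auto
      ultimately show "y \<in> V - L - {0}" using gB(1)[OF xb] x(1) by simp
    qed
    show "winding_number (g \<circ> ?\<gamma>) p = 0" if p: "p \<notin> V" for p
    proof -
      have "((\<lambda>w. deriv g w / (g w - p)) has_contour_integral 0) ?\<gamma>"
        by (rule Cauchy_theorem_disc_simple[of _ 0 1])
           (use p gB(1) g dg pi in \<open>auto intro!: holomorphic_intros\<close>)
      moreover have "p \<notin> g ` sphere 0 r" using p gB(1) r by auto
      ultimately show ?thesis using wn by (simp add: contour_integral_unique)
    qed
    show "winding_number (g \<circ> ?\<gamma>) p = 1" if p: "p \<in> L" for p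
    proof -
      define a where "a = f p"
      have a: "norm a < r" "a \<in> ball 0 1" "g a = p"
        using \<rho>(3)[of a] p r fV L by (auto simp: a_def)
      \<comment> \<open>The factorization \<open>g w - p = (w - a) * q w\<close> with zero-free
        \<open>q\<close> splits the logarithmic derivative into \<open>1 / (w - a)\<close> and a
        function holomorphic in the disc.\<close>
      define q where "q w = (if w = a then deriv g a else (g w - g a) / (w - a))" for w
      have q: "q holomorphic_on ball 0 1" unfolding q_def[abs_def] by (rule pole_lemma_open[OF g]) simp
      have gq: "g w = p + (w - a) * q w" for w using a(3) by (simp add: q_def)
      have inj: "g w \<noteq> p" if "w \<in> ball 0 1" "w \<noteq> a" for w
        using gB(2)[OF that(1)] gB(2)[OF a(2)] a(3) that(2) by metis
      \<comment> \<open>This follows from the chain rule, since \<open>f \<circ> g\<close> is the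
        identity on the disc.\<close>
      have "deriv g a \<noteq> 0"
      proof
        assume 0: "deriv g a = 0"
        have "(g has_field_derivative 0) (at a)" using holomorphic_derivI[OF g open_ball a(2)] 0 by simp
        moreover have "p \<in> V" using p L by blast
        then have "(f has_field_derivative deriv f p) (at (g a))" using holomorphic_derivI[OF f V(1)] a(3) by simp
        ultimately have "((f \<circ> g) has_field_derivative deriv f p * 0) (at a)" by (intro DERIV_chain)
        moreover have "((\<lambda>x. x) has_field_derivative 1) (at a)" by (rule DERIV_ident)
        then have "((f \<circ> g) has_field_derivative 1) (at a)"
          by (rule has_field_derivative_transform_within_open[OF _ open_ball a(2)]) (use gB(2) in auto)
        ultimately show False using DERIV_unique by fastforce
      qed
      then have q0: "q w \<noteq> 0" if "w \<in> ball 0 1" for w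
        using inj[OF that] a(3) by (auto simp: q_def)
      have dq: "deriv g w / (g w - p) = 1 / (w - a) + deriv q w / q w" if w: "w \<in> sphere 0 r" for w
      proof -
        have wb: "w \<in> ball 0 1" "w \<noteq> a" using w r a(1) by auto
        have "((\<lambda>w. p + (w - a) * q w) has_field_derivative q w + (w - a) * deriv q w) (at w)"
          using holomorphic_derivI[OF q open_ball wb(1)] by (auto intro!: derivative_eq_intros)
        then have "(g has_field_derivative q w + (w - a) * deriv q w) (at w)" by (simp flip: gq)
        then have "deriv g w = q w + (w - a) * deriv q w" by (rule DERIV_imp_deriv)
        moreover have "g w - p = (w - a) * q w" by (simp add: gq)
        ultimately have "deriv g w / (g w - p) = (q w + (w - a) * deriv q w) / ((w - a) * q w)"
          by (simp only:)
        also have "\<dots> = 1 / (w - a) + deriv q w / q w"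
          using wb q0[OF wb(1)] by (simp add: add_divide_distrib)
        finally show ?thesis .
      qed
      have "((\<lambda>w. 1 / (w - a)) has_contour_integral (2 * of_real pi * \<i> * 1)) ?\<gamma>"
        using a(1) by (intro Cauchy_integral_circlepath) auto
      moreover have "((\<lambda>w. deriv q w / q w) has_contour_integral 0) ?\<gamma>"
        by (rule Cauchy_theorem_disc_simple[of _ 0 1])
           (use pi q0 in \<open>auto intro!: holomorphic_intros q holomorphic_deriv\<close>)
      ultimately have "((\<lambda>w. 1 / (w - a) + deriv q w / q w) has_contour_integral (2 * of_real pi * \<i>)) ?\<gamma>"
        using has_contour_integral_add by fastforce
      then have "contour_integral ?\<gamma> (\<lambda>w. deriv g w / (g w - p)) = 2 * of_real pi * \<i>"
        using contour_integral_eq[of ?\<gamma> "\<lambda>w. deriv g w / (g w - p)"] dq pi(1)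
        by (metis (no_types, lifting) contour_integral_unique)
      moreover have "p \<notin> g ` sphere 0 r" using inj a(1) r by force
      ultimately show ?thesis using wn by simp
    qed
  qed
qed

text \<open>The finite points of the set called \<open>U_j\<close> in the theorem, the reciprocal of
  \<open>Uh j\<close>.\<close>

definition inv_dom :: "('n \<Rightarrow> complex option set) \<Rightarrow> 'n \<Rightarrow> complex set" where
  "inv_dom Uh j = {p. sphere_inv (Some p) \<in> Uh j}"

lemma sphere_inv_sphere_inv [simp]: "sphere_inv (sphere_inv x) = x"
  by (cases x) auto

lemma in_sphere_inv_image: "Some p \<in> sphere_inv ` E \<longleftrightarrow> sphere_inv (Some p) \<in> E"
  by (metis image_iff sphere_inv_sphere_inv)

lemma inv_dom_csx: "inv_dom Uh j = {p. csx UNIV j p \<in> Uh j}"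
  by (simp add: inv_dom_def csx_def)

lemma open_inv_dom: "openin rsphere (Uh j) \<Longrightarrow> open (inv_dom Uh j)"
  unfolding inv_dom_csx by (rule open_csx)

lemma inv_dom_large:
  assumes "openin rsphere (Uh j)" "Some 0 \<in> Uh j"
  obtains R where "R > 0" "\<And>p. norm p \<ge> R \<Longrightarrow> p \<in> inv_dom Uh j"
proof -
  obtain e where e: "e > 0" "ball 0 e \<subseteq> {u. Some u \<in> Uh j}"
    using rsphere_open_finite_part[OF assms(1)] assms(2) open_contains_ball by blast
  show ?thesis
  proof (rule that[of "2 / e"])
    fix p :: complex assume p: "norm p \<ge> 2 / e"
    have "0 < norm p" using p e(1) by (meson divide_pos_pos less_le_trans zero_less_numeral)
    then have "1 / p \<in> ball 0 e" "p \<noteq> 0" using p e(1) by (auto simp: norm_divide field_simps)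
    then show "p \<in> inv_dom Uh j" using e(2) by (auto simp: inv_dom_def)
  qed (use e in simp)
qed

lemma admissible_cycles_iff:
  "admissible_cycles Om z Uh \<gamma> \<longleftrightarrow> (\<forall>j.
     (\<forall>c\<in>set (\<gamma> j). valid_path c \<and> pathfinish c = pathstart c \<and>
        path_image c \<subseteq> (inv_dom Uh j \<inter> (\<lambda>a. a / z $ j) ` Om j) - {0}) \<and>
     (\<forall>p. p \<notin> inv_dom Uh j \<longrightarrow> cycle_winding (\<gamma> j) p = 1) \<and>
     (\<forall>p. p \<notin> (\<lambda>a. a / z $ j) ` Om j \<longrightarrow> cycle_winding (\<gamma> j) p = 0))"
  unfolding admissible_cycles_def Let_def in_sphere_inv_image by (simp add: inv_dom_def)

lemma scaled_image: "z \<noteq> 0 \<Longrightarrow> (\<lambda>a. a / z) ` V = {w::complex. z * w \<in> V}"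
  by (force simp: image_iff)

text \<open>The cycle has to surround the complement of \<open>inv_dom Uh j\<close>. This complement
  is compact because \<open>Uh j\<close> is a neighbourhood of \<open>0\<close>, and it lies in the
  scaled \<open>Om j\<close> because \<open>Uh j\<close> contains
  \<open>hat_set Om z j\<close>.\<close>

lemma admissible_cycles_exist:
  assumes op: "\<And>j. open (Om j)" and sc: "\<And>j. simply_connected (Om j)" and z: "z \<in> cart Om" "\<And>j. z $ j \<noteq> 0"
    and Uh: "\<And>j. openin rsphere (Uh j)" "\<And>j. hat_set Om z j \<subseteq> Uh j"
  shows "\<exists>\<gamma>. admissible_cycles Om z Uh \<gamma>"
proof -
  have "\<exists>c. valid_path c \<and> pathfinish c = pathstart c \<and> path_image c \<subseteq> (inv_dom Uh j \<inter> (\<lambda>a. a / z $ j) ` Om j) - {0} \<and>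
     (\<forall>p. p \<notin> inv_dom Uh j \<longrightarrow> winding_number c p = 1) \<and> (\<forall>p. p \<notin> (\<lambda>a. a / z $ j) ` Om j \<longrightarrow> winding_number c p = 0)" for j
  proof -
    let ?V = "(\<lambda>a. a / z $ j) ` Om j" and ?L = "- inv_dom Uh j"
    have V: "open ?V" unfolding scaled_image[OF z(2)]
      using open_vimage[OF op, of "\<lambda>w. z $ j * w" j] by (simp add: vimage_def continuous_intros)
    have homeo: "Om j homeomorphic ?V"
      unfolding homeomorphic_def homeomorphism_def
      using z(2)[of j] by (intro exI[of _ "\<lambda>a. a / z $ j"] exI[of _ "\<lambda>a. z $ j * a"]) (auto intro!: continuous_intros simp: image_image)
    have scV: "simply_connected ?V" using homeomorphic_simply_connected_eq[OF homeo] sc by blast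
    have ne: "?V \<noteq> {}" using z(1) by (auto simp: cart_def)
    have "Some 0 \<in> Uh j" using Uh(2)[of j] zero_in_hat_set[OF z(2)] by blast
    then obtain R where R: "R > 0" "\<And>p. norm p \<ge> R \<Longrightarrow> p \<in> inv_dom Uh j" using inv_dom_large[of Uh j, OF Uh(1)] by blast
    have "bounded ?L" unfolding bounded_iff using R(2) by (intro exI[of _ R]) force
    moreover have "closed ?L" using open_inv_dom[of Uh j, OF Uh(1)] by (simp add: closed_Compl)
    ultimately have L: "compact ?L" by (simp add: compact_eq_bounded_closed)
    have LV: "?L \<subseteq> ?V"
    proof
      fix p assume "p \<in> ?L"
      then have p: "sphere_inv (Some p) \<notin> hat_set Om z j" using Uh(2)[of j] by (auto simp: inv_dom_def)
      show "p \<in> ?V"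
      proof (cases "p = 0")
        case True
        then have "0 \<in> Om j" using p by (simp add: hat_set_None)
        then show ?thesis using True by force
      next
        case False
        then obtain a where "a \<in> Om j" "1 / p * a = z $ j" using p by (auto simp: hat_set_Some)
        then show ?thesis using False z(2)[of j] by (auto simp: field_simps intro!: image_eqI[of _ _ a])
      qed
    qed
    obtain c where "valid_path c" "pathfinish c = pathstart c" "path_image c \<subseteq> ?V - ?L - {0}"
      "\<And>p. p \<in> ?L \<Longrightarrow> winding_number c p = 1" "\<And>p. p \<notin> ?V \<Longrightarrow> winding_number c p = 0"
      using simply_connected_cycle[OF V scV ne L LV] by blast
    then show ?thesis by (intro exI[of _ c]) auto
  qed
  then obtain c where c: "\<And>j. valid_path (c j) \<and> pathfinish (c j) = pathstart (c j) \<and> path_image (c j) \<subseteq> (inv_dom Uh j \<inter> (\<lambda>a. a / z $ j) ` Om j) - {0} \<and>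
     (\<forall>p. p \<notin> inv_dom Uh j \<longrightarrow> winding_number (c j) p = 1) \<and> (\<forall>p. p \<notin> (\<lambda>a. a / z $ j) ` Om j \<longrightarrow> winding_number (c j) p = 0)"
    by metis
  then have "admissible_cycles Om z Uh (\<lambda>j. [c j])"
    unfolding admissible_cycles_iff by (simp add: cycle_winding_def)
  then show ?thesis by blast
qed

subsection \<open>The integral formula for monomials\<close>

text \<open>The circles can be taken so large that \<open>1 / w\<close> enters the polydisc on which
  \<open>g\<close> is the sum of its series; then the coefficient formula applies.\<close>

lemma coefficient_identity:
  fixes a :: "('n::finite \<Rightarrow> nat) \<Rightarrow> complex"
  assumes a: "conv a" and Uh: "\<And>j. openin rsphere (Uh j)" "\<And>j. Some 0 \<in> Uh j"
    and g: "sphere_hol0 g (Pi UNIV Uh)" "eq_near origin (psum a) g"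
    and \<gamma>: "\<And>j c. c \<in> set (\<gamma> j) \<Longrightarrow> valid_path c \<and> pathfinish c = pathstart c \<and> path_image c \<subseteq> inv_dom Uh j - {0}"
      "\<And>j p. p \<notin> inv_dom Uh j \<Longrightarrow> cycle_winding (\<gamma> j) p = 1"
    and js: "distinct js" "set js = UNIV" and w: "w \<in> cart (\<lambda>j. inv_dom Uh j - {0})"
  shows "It js (\<lambda>j. cyc (\<gamma> j)) (\<lambda>w. (\<Prod>i\<in>UNIV. w $ i ^ \<alpha> i / w $ i) * g (chart UNIV w)) w
    = (2 * of_real pi * \<i>) ^ CARD('n) * a \<alpha>"
proof -
  let ?D = "inv_dom Uh"
  let ?Q = "\<lambda>w. g (chart UNIV w)"
  have D: "open (?D j)" for j by (rule open_inv_dom[of Uh j, OF Uh(1)])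
  have Q: "csh ?Q ?D"
    using g(1) sphere_hol_product[of Uh g] Uh(1) unfolding sphere_hol0_def inv_dom_csx[abs_def] by blast
  have Q0: "?Q w = 0" if w: "w \<in> cart ?D" "w $ j = 0" for w j
  proof -
    have "chart UNIV w \<in> Pi UNIV Uh" using w(1) by (simp add: chart_def cart_def inv_dom_def)
    moreover have "chart UNIV w j = None" using w(2) by (simp add: chart_def)
    ultimately show ?thesis using g(1) unfolding sphere_hol0_def by blast
  qed
  have "\<exists>R>0. \<forall>p. norm p \<ge> R \<longrightarrow> p \<in> ?D j" for j
    using inv_dom_large[of Uh j, OF Uh] by metis
  then obtain R where R: "\<And>j. R j > 0" "\<And>j p. norm p \<ge> R j \<Longrightarrow> p \<in> ?D j" by metis
  obtain s where s: "s > 0" "\<And>u. (\<forall>j. norm (u $ j) < s) \<Longrightarrow> psum a (emb u) = g (emb u)"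
    using g(2) unfolding eq_near_origin_iff by blast
  obtain r where r: "bnd a r" using a by (auto simp: conv_def)
  define t where "t = min r s"
  have t: "t > 0" using r s by (auto simp: t_def bnd_def)
  have bt: "bnd a t" by (rule bnd_smaller[OF r t]) (simp add: t_def)
  \<comment> \<open>Beyond \<open>R j\<close> the circle lies in the domain; beyond
    \<open>1 / t\<close> the series represents \<open>g\<close> at the reciprocals.\<close>
  define R' where "R' j = max (R j) (1 / t + 1)" for j
  have R': "R' j > 0" "R' j > 1 / t" for j
    using R(1)[of j] by (auto simp: R'_def less_max_iff_disj)
  have R'D: "p \<in> ?D j" if "R' j \<le> norm p" for j p using that R(2)[of j p] by (simp add: R'_def)
  let ?F = "\<lambda>w. (\<Prod>i\<in>UNIV. w $ i ^ \<alpha> i / w $ i) * ?Q w"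
  let ?L = "\<lambda>j. contour_integral (circlepath 0 (R' j))"
  let ?w = "(\<chi> i. complex_of_real (R' i)) :: complex ^ 'n"
  define E where "E = (\<lambda>j. {x. 1 / t < norm x} \<inter> (?D j - {0}))"
  have opE: "open (E j)" for j
    unfolding E_def by (intro open_Int open_Collect_less continuous_intros open_delete D)
  have L: "afun (E j) (?L j)" for j
    by (rule afun_contour_integral[OF opE]) (use R'[of j] R'D[of j] in \<open>auto simp: E_def\<close>)
  have nR: "norm (complex_of_real (R' j)) = R' j" for j using R'(1)[of j] by simp
  have wE: "?w \<in> cart E"
    unfolding cart_def E_def
  proof (intro CollectI allI)
    fix j
    have "?w $ j \<in> ?D j" by (rule R'D) (use nR[of j] in simp)
    then show "?w $ j \<in> {x. 1 / t < norm x} \<inter> (?D j - {0})" using R'[of j] nR[of j] by auto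
  qed
  have ED: "E j \<subseteq> ?D j" "E j \<subseteq> - {0}" for j by (auto simp: E_def)
  have "It js (\<lambda>j. cyc (\<gamma> j)) ?F w = It js ?L ?F w"
    by (rule It_cycles_eq_circles[OF D R'(1) R'D Q Q0 \<gamma>(1) \<gamma>(2) w js(1)])
  also have "\<dots> = It js ?L ?F ?w"
    by (rule It_agree) (simp add: js)
  also have "\<dots> = It js ?L (\<lambda>w. (\<Prod>i\<in>UNIV. w $ i ^ \<alpha> i / w $ i) * (\<Sum>\<^sub>\<infinity>\<beta>. a \<beta> * mono_fun \<beta> (\<chi> i. 1 / w $ i))) ?w"
  proof (rule It_cong[OF opE L _ wE])
    show "csh ?F E"
      by (intro csh_mult csh_prod csh_coord csh_subset[OF Q ED(1)]) (use ED(2) in \<open>auto intro!: holomorphic_intros\<close>)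
    fix v assume v: "v \<in> cart E"
    have v0: "v $ i \<noteq> 0" "1 / t < norm (v $ i)" for i using v by (auto simp: cart_def E_def)
    have "norm ((\<chi> i. 1 / v $ i) $ i) < s" for i
    proof -
      have "1 / norm (v $ i) < 1 / (1 / t)" using v0[of i] t by (intro divide_strict_left_mono) auto
      then show ?thesis by (simp add: norm_divide t_def)
    qed
    moreover have "chart UNIV v = emb (\<chi> i. 1 / v $ i)" using v0(1) by (simp add: chart_def emb_def)
    ultimately have "?Q v = psum a (emb (\<chi> i. 1 / v $ i))" using s(2) by simp
    then show "?F v = (\<Prod>i\<in>UNIV. v $ i ^ \<alpha> i / v $ i) * (\<Sum>\<^sub>\<infinity>\<beta>. a \<beta> * mono_fun \<beta> (\<chi> i. 1 / v $ i))"
      by (simp add: psum_emb)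
  qed
  also have "\<dots> = (2 * of_real pi * \<i>) ^ CARD('n) * a \<alpha>"
  proof (rule It_circles_power_series[OF bt R'(2) js])
    show "1 / t < norm (?w $ j)" for j using R'(2)[of j] nR[of j] by simp
  qed
  finally show ?thesis .
qed

section \<open>Polynomials as finitely supported families of coefficients\<close>

definition fs :: "('a \<Rightarrow> complex) \<Rightarrow> bool" where "fs c \<longleftrightarrow> finite {\<alpha>. c \<alpha> \<noteq> 0}"

text \<open>Working with coefficients, the diagonal action \<open>c \<alpha> * a \<alpha>\<close>
  makes sense without first knowing that a polynomial function determines its coefficients.\<close>

definition pf :: "(('n::finite \<Rightarrow> nat) \<Rightarrow> complex) \<Rightarrow> complex ^ 'n \<Rightarrow> complex" where
  "pf c z = (\<Sum>\<alpha> | c \<alpha> \<noteq> 0. c \<alpha> * mono_fun \<alpha> z)"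

lemma pf_superset: "finite A \<Longrightarrow> {\<alpha>. c \<alpha> \<noteq> 0} \<subseteq> A \<Longrightarrow> pf c z = (\<Sum>\<alpha>\<in>A. c \<alpha> * mono_fun \<alpha> z)"
  unfolding pf_def by (rule sum.mono_neutral_left) auto

lemma pf_combine:
  assumes "fs c" "fs d"
  shows "fs (\<lambda>\<alpha>. c \<alpha> + k * d \<alpha>)" "pf (\<lambda>\<alpha>. c \<alpha> + k * d \<alpha>) z = pf c z + k * pf d z"
proof -
  let ?A = "{\<alpha>. c \<alpha> \<noteq> 0} \<union> {\<alpha>. d \<alpha> \<noteq> 0}"
  have A: "finite ?A" using assms by (simp add: fs_def)
  then show "fs (\<lambda>\<alpha>. c \<alpha> + k * d \<alpha>)" unfolding fs_def by (rule finite_subset[rotated]) auto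
  have "pf (\<lambda>\<alpha>. c \<alpha> + k * d \<alpha>) z = (\<Sum>\<alpha>\<in>?A. (c \<alpha> + k * d \<alpha>) * mono_fun \<alpha> z)"
    by (rule pf_superset[OF A]) auto
  also have "\<dots> = (\<Sum>\<alpha>\<in>?A. c \<alpha> * mono_fun \<alpha> z) + k * (\<Sum>\<alpha>\<in>?A. d \<alpha> * mono_fun \<alpha> z)"
    by (simp add: algebra_simps sum.distrib sum_distrib_left)
  also have "\<dots> = pf c z + k * pf d z"
    by (simp add: pf_superset[OF A])
  finally show "pf (\<lambda>\<alpha>. c \<alpha> + k * d \<alpha>) z = pf c z + k * pf d z" .
qed

lemma fs_mult: "fs c \<Longrightarrow> fs (\<lambda>\<alpha>. c \<alpha> * a \<alpha>)"
  unfolding fs_def by (rule finite_subset[rotated]) auto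

lemma pf_mult: "fs c \<Longrightarrow> pf (\<lambda>\<alpha>. c \<alpha> * a \<alpha>) z = (\<Sum>\<alpha> | c \<alpha> \<noteq> 0. c \<alpha> * a \<alpha> * mono_fun \<alpha> z)"
  by (rule pf_superset) (auto simp: fs_def)

lemma pf_mult_combine:
  assumes "fs c" "fs d"
  shows "pf (\<lambda>\<alpha>. (c \<alpha> + k * d \<alpha>) * a \<alpha>) z = pf (\<lambda>\<alpha>. c \<alpha> * a \<alpha>) z + k * pf (\<lambda>\<alpha>. d \<alpha> * a \<alpha>) z"
  using pf_combine(2)[OF fs_mult[OF assms(1)] fs_mult[OF assms(2)], of a k a z] by (simp add: algebra_simps)

lemma csh_pf: "csh (pf c) D"
  unfolding pf_def[abs_def] by (intro csh_sum csh_mult csh_const csh_mono_fun)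

lemma pf_single: "pf (\<lambda>\<beta>. if \<beta> = \<alpha> then k else 0) z = k * mono_fun \<alpha> z" "fs (\<lambda>\<beta>. if \<beta> = \<alpha> then k else 0)"
proof -
  show "pf (\<lambda>\<beta>. if \<beta> = \<alpha> then k else 0) z = k * mono_fun \<alpha> z"
    by (subst pf_superset[of "{\<alpha>}"]) auto
  show "fs (\<lambda>\<beta>. if \<beta> = \<alpha> then k else 0)" unfolding fs_def by (rule finite_subset[of _ "{\<alpha>}"]) auto
qed

lemma poly_fun_pf:
  assumes "poly_fun p"
  obtains c where "fs c" "p = pf c"
proof -
  obtain A c where p: "finite A" "p = (\<lambda>z. \<Sum>\<alpha>\<in>A. c \<alpha> * mono_fun \<alpha> z)" using assms by (auto simp: poly_fun_def)
  let ?c = "\<lambda>\<alpha>. if \<alpha> \<in> A then c \<alpha> else 0"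
  have "fs ?c" unfolding fs_def using p(1) by (rule finite_subset[rotated]) auto
  moreover have "p = pf ?c"
    unfolding p(2) by (rule ext, subst pf_superset[OF p(1)]) auto
  ultimately show ?thesis using that by blast
qed

definition pmul :: "complex ^ 'n \<Rightarrow> complex ^ 'n \<Rightarrow> complex ^ 'n" where
  "pmul z w = (\<chi> j. z $ j * w $ j)"

lemma mono_fun_pmul: "mono_fun \<alpha> (pmul z w) = mono_fun \<alpha> z * mono_fun \<alpha> w"
  by (simp add: mono_fun_def pmul_def power_mult_distrib prod.distrib)

lemma cycle_integral_cong:
  fixes F :: "complex ^ 'n::finite \<Rightarrow> complex"
  assumes "\<And>w. (\<And>j. \<exists>c\<in>set (\<gamma> j). w $ j \<in> path_image c) \<Longrightarrow> F w = G w"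
  shows "cycle_integral \<gamma> F = cycle_integral \<gamma> G"
  unfolding cycle_integral_def
proof (intro sum.cong refl integral_cong)
  fix k and t :: "real ^ 'n" assume k: "k \<in> {k. \<forall>j. k j < length (\<gamma> j)}" and t: "t \<in> cbox 0 1"
  have "F (\<chi> j. (\<gamma> j ! k j) (t $ j)) = G (\<chi> j. (\<gamma> j ! k j) (t $ j))"
  proof (rule assms)
    fix j
    have "\<gamma> j ! k j \<in> set (\<gamma> j)" using k by simp
    moreover have "(\<gamma> j ! k j) (t $ j) \<in> path_image (\<gamma> j ! k j)"
      using t by (auto simp: path_image_def mem_box_cart)
    ultimately show "\<exists>c\<in>set (\<gamma> j). (\<chi> j. (\<gamma> j ! k j) (t $ j)) $ j \<in> path_image c" by auto
  qed
  then show "F (\<chi> j. (\<gamma> j ! k j) (t $ j)) * (\<Prod>j\<in>UNIV. vector_derivative (\<gamma> j ! k j) (at (t $ j) within {0..1})) =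
     G (\<chi> j. (\<gamma> j ! k j) (t $ j)) * (\<Prod>j\<in>UNIV. vector_derivative (\<gamma> j ! k j) (at (t $ j) within {0..1}))"
    by simp
qed

context
  fixes Om :: "'n::finite \<Rightarrow> complex set" and z :: "complex ^ 'n" and a :: "('n \<Rightarrow> nat) \<Rightarrow> complex"
    and Uh :: "'n \<Rightarrow> complex option set" and g :: "('n \<Rightarrow> complex option) \<Rightarrow> complex"
    and \<gamma> :: "'n \<Rightarrow> (real \<Rightarrow> complex) list" and js :: "'n list"
  assumes op: "\<And>j. open (Om j)" and z: "z \<in> cart Om" "\<And>j. z $ j \<noteq> 0"
    and a: "conv a" and isext: "is_extension Om z (series_germ a) Uh g" and \<gamma>: "admissible_cycles Om z Uh \<gamma>"
    and js: "distinct js" "set js = UNIV"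
begin

text \<open>The domain of the integrand in the variable \<open>w = 1 / \<zeta>\<close>. Leaving out
  \<open>0\<close> keeps the reciprocals finite.\<close>

private definition "Dz j = (inv_dom Uh j \<inter> {w. z $ j * w \<in> Om j}) - {0}"

text \<open>Up to sign, the factor of \<open>f (pmul z w)\<close> after the substitution
  \<open>\<zeta> = 1 / w\<close>: the Jacobian \<open>1 / w ^ 2\<close> and the denominator
  \<open>\<zeta>\<close> combine to \<open>1 / w\<close> in each variable.\<close>

private definition "Pz w = (\<Prod>i\<in>UNIV. 1 / w $ i) * g (chart UNIV w)" for w :: "complex ^ 'n"

private lemma Uh: "openin rsphere (Uh j)" "hat_set Om z j \<subseteq> Uh j" "Some 0 \<in> Uh j"
  and g: "sphere_hol0 g (Pi UNIV Uh)" "eq_near origin (psum a) g"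
  using isext zero_in_hat_set[where j = j and Om = Om, OF z(2)] unfolding is_extension_iff[OF z(2)] by blast+

private lemma cyc\<gamma>: "c \<in> set (\<gamma> j) \<Longrightarrow> valid_path c \<and> pathfinish c = pathstart c \<and> path_image c \<subseteq> Dz j"
  "p \<notin> inv_dom Uh j \<Longrightarrow> cycle_winding (\<gamma> j) p = 1"
  using \<gamma> unfolding admissible_cycles_iff Dz_def scaled_image[OF z(2)] by blast+

private lemma openDz: "open (Dz j)"
proof -
  have "open ((\<lambda>w. z $ j * w) -` Om j)" by (intro open_vimage op continuous_intros)
  then show ?thesis
    unfolding Dz_def using open_inv_dom[of Uh j, OF Uh(1)] by (simp add: vimage_def open_Int open_delete)
qed

private lemma Dz_ne: "cart Dz \<noteq> {}"
proof -
  have "\<exists>x. x \<in> Dz j" for j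
  \<comment> \<open>An empty cycle is admissible only if there is nothing to surround; then
    \<open>inv_dom Uh j\<close> is the whole plane and \<open>1\<close> is a point of
    \<open>Dz j\<close>.\<close>
  proof (cases "\<gamma> j")
    case Nil
    then have "inv_dom Uh j = UNIV" using cyc\<gamma>(2)[of _ j] by (force simp: cycle_winding_def)
    then have "1 \<in> Dz j" using z(1) by (simp add: Dz_def cart_def)
    then show ?thesis by blast
  next
    case (Cons c cs)
    then have "path_image c \<subseteq> Dz j" using cyc\<gamma>(1)[of c j] by simp
    then show ?thesis using path_image_nonempty[of c] by blast
  qed
  then obtain x where "\<And>j. x j \<in> Dz j" by metis
  then have "(\<chi> j. x j) \<in> cart Dz" by (simp add: cart_def)
  then show ?thesis by blast
qed

private lemma Lz: "afun (Dz j) (cyc (\<gamma> j))"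
  by (rule afun_cyc[OF openDz]) (use cyc\<gamma> in blast)

private lemma csh_Pz: "csh Pz Dz"
proof -
  have "csh (\<lambda>w. g (chart UNIV w)) (inv_dom Uh)"
    using g(1) sphere_hol_product[of Uh g] Uh(1) unfolding sphere_hol0_def inv_dom_csx[abs_def] by blast
  then have "csh (\<lambda>w. g (chart UNIV w)) Dz"
    by (rule csh_subset) (auto simp: Dz_def)
  then show ?thesis
    unfolding Pz_def[abs_def] by (intro csh_mult csh_prod csh_coord) (auto intro!: holomorphic_intros simp: Dz_def)
qed

private lemma csh_pmul:
  assumes "csh f Om"
  shows "csh (\<lambda>w. f (pmul z w)) Dz"
  unfolding pmul_def
  by (rule csh_compose_coord[OF assms, of "\<lambda>j x. z $ j * x"]) (auto intro!: holomorphic_intros simp: Dz_def)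

text \<open>The substitution contributes a factor \<open>-1\<close> for each variable, which cancels
  the sign in \<open>- 1 / (2 * of_real pi * \<i>)\<close>.\<close>

lemma cycle_integral_formula:
  assumes f: "csh f Om" and w: "w \<in> cart Dz"
  shows "(- 1 / (2 * of_real pi * \<i>)) ^ CARD('n) * cycle_integral (\<lambda>j. inv_cycle (\<gamma> j))
     (\<lambda>\<zeta>. f (\<chi> j. z $ j * (1 / \<zeta> $ j)) * (g (emb \<zeta>) / (\<Prod>j\<in>UNIV. \<zeta> $ j))) =
    (1 / (2 * of_real pi * \<i>)) ^ CARD('n) * It js (\<lambda>j. cyc (\<gamma> j)) (\<lambda>w. Pz w * f (pmul z w)) w"
proof -
  let ?G = "\<lambda>\<zeta>. f (\<chi> j. z $ j * (1 / \<zeta> $ j)) * (g (emb \<zeta>) / (\<Prod>j\<in>UNIV. \<zeta> $ j))"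
  let ?F = "\<lambda>w. (-1) ^ CARD('n) * (Pz w * f (pmul z w))"
  have PF: "csh (\<lambda>w. Pz w * f (pmul z w)) Dz" by (intro csh_mult csh_Pz csh_pmul f)
  have "cycle_integral (\<lambda>j. inv_cycle (\<gamma> j)) ?G = cycle_integral \<gamma> (\<lambda>w. ?G (\<chi> j. 1 / w $ j) * (\<Prod>j\<in>UNIV. - 1 / (w $ j)\<^sup>2))"
    by (rule cycle_integral_inv_cycle) (use cyc\<gamma>(1) in \<open>auto simp: Dz_def\<close>)
  also have "\<dots> = cycle_integral \<gamma> ?F"
  proof (rule cycle_integral_cong)
    fix w :: "complex ^ 'n" assume "\<And>j. \<exists>c\<in>set (\<gamma> j). w $ j \<in> path_image c"
    then have w0: "w $ j \<noteq> 0" for j using cyc\<gamma>(1)[of _ j] by (fastforce simp: Dz_def)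
    have "chart UNIV w = emb (\<chi> j. 1 / w $ j)" using w0 by (simp add: chart_def emb_def)
    moreover have "(\<Prod>j\<in>UNIV. - 1 / (w $ j)\<^sup>2) / (\<Prod>j\<in>UNIV. 1 / w $ j) = (-1) ^ CARD('n) * (\<Prod>j\<in>UNIV. 1 / w $ j)"
    proof -
      have "(\<Prod>j\<in>UNIV. - 1 / (w $ j)\<^sup>2) / (\<Prod>j\<in>UNIV. 1 / w $ j) = (\<Prod>j\<in>UNIV. (- 1 / (w $ j)\<^sup>2) / (1 / w $ j))"
        by (simp only: prod_dividef)
      also have "\<dots> = (\<Prod>j\<in>UNIV. (- 1) * (1 / w $ j))"
        by (rule prod.cong) (use w0 in \<open>auto simp: power2_eq_square\<close>)
      also have "\<dots> = (-1) ^ CARD('n) * (\<Prod>j\<in>UNIV. 1 / w $ j)"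
        by (simp only: prod.distrib prod_constant)
      finally show ?thesis .
    qed
    moreover have "?G (\<chi> j. 1 / w $ j) * (\<Prod>j\<in>UNIV. - 1 / (w $ j)\<^sup>2) =
        f (pmul z w) * g (emb (\<chi> j. 1 / w $ j)) * ((\<Prod>j\<in>UNIV. - 1 / (w $ j)\<^sup>2) / (\<Prod>j\<in>UNIV. 1 / w $ j))"
      by (simp add: pmul_def)
    ultimately show "?G (\<chi> j. 1 / w $ j) * (\<Prod>j\<in>UNIV. - 1 / (w $ j)\<^sup>2) = ?F w"
      by (simp only: Pz_def mult_ac)
  qed
  also have "\<dots> = It js (\<lambda>j. cyc (\<gamma> j)) ?F w"
    by (rule cycle_integral_eq_It[OF csh_mult[OF csh_const PF] openDz _ js w]) (use cyc\<gamma>(1) in blast)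
  also have "\<dots> = (-1) ^ CARD('n) * It js (\<lambda>j. cyc (\<gamma> j)) (\<lambda>w. Pz w * f (pmul z w)) w"
    by (rule It_cmult[OF openDz Lz PF w])
  finally have ci: "cycle_integral (\<lambda>j. inv_cycle (\<gamma> j)) ?G = (-1) ^ CARD('n) * It js (\<lambda>j. cyc (\<gamma> j)) (\<lambda>w. Pz w * f (pmul z w)) w" .
  have "(- 1 / (2 * of_real pi * \<i>)) ^ CARD('n) * (-1) ^ CARD('n) = ((1 / (2 * of_real pi * \<i>)) ^ CARD('n) :: complex)"
    by (simp add: power_mult_distrib[symmetric])
  then show ?thesis unfolding ci mult.assoc[symmetric] by (rule arg_cong)
qed

text \<open>The point \<open>z'\<close> is unrelated to \<open>z\<close>: in monomials it splits off
  as a factor, so the cycles chosen for \<open>z\<close> evaluate the diagonal operator on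
  polynomials at every point. This is what makes the later bounds locally uniform.\<close>

private lemma It_poly:
  assumes c: "fs c" and w: "w \<in> cart Dz"
  shows "It js (\<lambda>j. cyc (\<gamma> j)) (\<lambda>w. Pz w * pf c (pmul z' w)) w = (2 * of_real pi * \<i>) ^ CARD('n) * pf (\<lambda>\<alpha>. c \<alpha> * a \<alpha>) z'"
proof -
  let ?L = "\<lambda>j. cyc (\<gamma> j)" and ?A = "{\<alpha>. c \<alpha> \<noteq> 0}"
  let ?M = "\<lambda>\<alpha> w. (\<Prod>i\<in>UNIV. w $ i ^ \<alpha> i / w $ i) * g (chart UNIV w)"
  have eq: "Pz w * mono_fun \<alpha> w = ?M \<alpha> w" for \<alpha> w
  proof -
    have "(\<Prod>i\<in>UNIV. w $ i ^ \<alpha> i / w $ i) = mono_fun \<alpha> w * (\<Prod>i\<in>UNIV. 1 / w $ i)"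
      by (simp add: mono_fun_def flip: prod.distrib)
    then show ?thesis by (simp add: Pz_def)
  qed
  have PM: "csh (?M \<alpha>) Dz" for \<alpha>
    unfolding eq[symmetric] by (intro csh_mult csh_Pz csh_mono_fun)
  have w': "w \<in> cart (\<lambda>j. inv_dom Uh j - {0})" using w by (auto simp: cart_def Dz_def)
  have "(\<lambda>w. Pz w * pf c (pmul z' w)) = (\<lambda>w. \<Sum>\<alpha>\<in>?A. (c \<alpha> * mono_fun \<alpha> z') * ?M \<alpha> w)"
    unfolding pf_def eq[symmetric] by (rule ext) (simp add: sum_distrib_left mono_fun_pmul mult_ac)
  then have "It js ?L (\<lambda>w. Pz w * pf c (pmul z' w)) w = It js ?L (\<lambda>w. \<Sum>\<alpha>\<in>?A. (c \<alpha> * mono_fun \<alpha> z') * ?M \<alpha> w) w"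
    by simp
  also have "\<dots> = (\<Sum>\<alpha>\<in>?A. It js ?L (\<lambda>w. (c \<alpha> * mono_fun \<alpha> z') * ?M \<alpha> w) w)"
    by (rule It_sum[OF openDz Lz csh_mult[OF csh_const PM] w])
  also have "\<dots> = (\<Sum>\<alpha>\<in>?A. (c \<alpha> * mono_fun \<alpha> z') * It js ?L (?M \<alpha>) w)"
    by (intro sum.cong refl It_cmult[OF openDz Lz PM w])
  also have "\<dots> = (\<Sum>\<alpha>\<in>?A. (c \<alpha> * mono_fun \<alpha> z') * ((2 * of_real pi * \<i>) ^ CARD('n) * a \<alpha>))"
  proof (intro sum.cong refl arg_cong2[of _ _ _ _ "(*)"])
    fix \<alpha>
    show "It js ?L (?M \<alpha>) w = (2 * of_real pi * \<i>) ^ CARD('n) * a \<alpha>"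
      by (rule coefficient_identity[OF a Uh(1,3) g _ cyc\<gamma>(2) js w'])
         (use cyc\<gamma>(1) in \<open>auto simp: Dz_def\<close>)
  qed
  also have "\<dots> = (2 * of_real pi * \<i>) ^ CARD('n) * pf (\<lambda>\<alpha>. c \<alpha> * a \<alpha>) z'"
    unfolding pf_mult[OF c] by (simp add: sum_distrib_left mult_ac)
  finally show ?thesis .
qed

text \<open>\<open>F\<close> is left free for two applications: \<open>F w = f (pmul z w)\<close>
  compares the integral with polynomials, and \<open>F w = 0\<close> bounds the diagonal operator
  near \<open>z\<close>.\<close>

private lemma approx_bound:
  obtains K C where "\<And>j. compact (K j)" "\<And>j. K j \<subseteq> Dz j" "C \<ge> 0"
    "\<And>F c z' w e. csh F Dz \<Longrightarrow> fs c \<Longrightarrow> w \<in> cart Dz \<Longrightarrow> e \<ge> 0 \<Longrightarrow> (\<And>u. u \<in> cart K \<Longrightarrow> norm (F u - pf c (pmul z' u)) \<le> e) \<Longrightarrow>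
      norm ((1 / (2 * of_real pi * \<i>)) ^ CARD('n) * It js (\<lambda>j. cyc (\<gamma> j)) (\<lambda>u. Pz u * F u) w - pf (\<lambda>\<alpha>. c \<alpha> * a \<alpha>) z') \<le> C * e"
proof (rule It_approx[OF openDz Lz js csh_Pz])
  fix K C
  let ?L = "\<lambda>j. cyc (\<gamma> j)"
  assume K: "\<And>j. compact (K j)" "\<And>j. K j \<subseteq> Dz j" "C \<ge> 0"
    and *: "\<And>F G w e. csh F Dz \<Longrightarrow> csh G Dz \<Longrightarrow> w \<in> cart Dz \<Longrightarrow> e \<ge> 0 \<Longrightarrow> (\<And>u. u \<in> cart K \<Longrightarrow> norm (F u - G u) \<le> e) \<Longrightarrow>
      norm (It js ?L (\<lambda>u. Pz u * F u) w - It js ?L (\<lambda>u. Pz u * G u) w) \<le> C * e"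
  let ?k = "(1 / (2 * of_real pi * \<i>)) ^ CARD('n) :: complex"
  have "norm (?k * It js ?L (\<lambda>u. Pz u * F u) w - pf (\<lambda>\<alpha>. c \<alpha> * a \<alpha>) z') \<le> (norm ?k * C) * e"
    if h: "csh F Dz" "fs c" "w \<in> cart Dz" "e \<ge> 0" "\<And>u. u \<in> cart K \<Longrightarrow> norm (F u - pf c (pmul z' u)) \<le> e" for F c z' w e
  proof -
    have G: "csh (\<lambda>u. pf c (pmul z' u)) Dz"
      unfolding pmul_def
      by (rule csh_compose_coord[OF csh_pf[of c "\<lambda>_. UNIV"], of "\<lambda>j x. z' $ j * x"]) (auto intro!: holomorphic_intros)
    have "?k * (2 * of_real pi * \<i>) ^ CARD('n) = 1" by (simp flip: power_mult_distrib)
    then have "?k * It js ?L (\<lambda>u. Pz u * F u) w - pf (\<lambda>\<alpha>. c \<alpha> * a \<alpha>) z' =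
        ?k * (It js ?L (\<lambda>u. Pz u * F u) w - It js ?L (\<lambda>u. Pz u * pf c (pmul z' u)) w)"
      unfolding It_poly[OF h(2,3)] right_diff_distrib mult.assoc[symmetric] by simp
    also have "norm \<dots> \<le> norm ?k * (C * e)"
      unfolding norm_mult by (rule mult_left_mono[OF *[OF h(1) G h(3-5)]]) auto
    finally show ?thesis by (simp only: mult.assoc)
  qed
  note bd = this
  have "norm ?k * C \<ge> 0" using K(3) by simp
  then show thesis by (rule that[of K "norm ?k * C", OF K(1,2)]) (rule bd; blast)
qed

lemma cycle_integral_approx:
  obtains K C where "compact K" "K \<subseteq> cart Om" "C \<ge> 0"
    "\<And>f c e. csh f Om \<Longrightarrow> fs c \<Longrightarrow> e \<ge> 0 \<Longrightarrow> (\<And>\<zeta>. \<zeta> \<in> K \<Longrightarrow> norm (f \<zeta> - pf c \<zeta>) \<le> e) \<Longrightarrow>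
      norm ((- 1 / (2 * of_real pi * \<i>)) ^ CARD('n) * cycle_integral (\<lambda>j. inv_cycle (\<gamma> j))
       (\<lambda>\<zeta>. f (\<chi> j. z $ j * (1 / \<zeta> $ j)) * (g (emb \<zeta>) / (\<Prod>j\<in>UNIV. \<zeta> $ j))) - pf (\<lambda>\<alpha>. c \<alpha> * a \<alpha>) z) \<le> C * e"
proof (rule approx_bound)
  fix K C
  assume K: "\<And>j. compact (K j)" "\<And>j. K j \<subseteq> Dz j" "C \<ge> 0"
    and *: "\<And>F c z' w e. csh F Dz \<Longrightarrow> fs c \<Longrightarrow> w \<in> cart Dz \<Longrightarrow> e \<ge> 0 \<Longrightarrow> (\<And>u. u \<in> cart K \<Longrightarrow> norm (F u - pf c (pmul z' u)) \<le> e) \<Longrightarrow>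
      norm ((1 / (2 * of_real pi * \<i>)) ^ CARD('n) * It js (\<lambda>j. cyc (\<gamma> j)) (\<lambda>u. Pz u * F u) w - pf (\<lambda>\<alpha>. c \<alpha> * a \<alpha>) z') \<le> C * e"
  obtain w where w: "w \<in> cart Dz" using Dz_ne by blast
  show thesis
  proof (rule that[of "pmul z ` cart K" C])
    show "compact (pmul z ` cart K)"
      unfolding pmul_def by (intro compact_continuous_image continuous_on_vec_lambda continuous_intros compact_cart K)
    show "pmul z ` cart K \<subseteq> cart Om" using K(2) by (fastforce simp: cart_def pmul_def Dz_def)
    fix f c e assume h: "csh f Om" "fs c" "e \<ge> (0::real)" "\<And>\<zeta>. \<zeta> \<in> pmul z ` cart K \<Longrightarrow> norm (f \<zeta> - pf c \<zeta>) \<le> e"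
    show "norm ((- 1 / (2 * of_real pi * \<i>)) ^ CARD('n) * cycle_integral (\<lambda>j. inv_cycle (\<gamma> j))
       (\<lambda>\<zeta>. f (\<chi> j. z $ j * (1 / \<zeta> $ j)) * (g (emb \<zeta>) / (\<Prod>j\<in>UNIV. \<zeta> $ j))) - pf (\<lambda>\<alpha>. c \<alpha> * a \<alpha>) z) \<le> C * e"
      unfolding cycle_integral_formula[OF h(1) w] by (rule *[OF csh_pmul[OF h(1)] h(2) w h(3)]) (use h(4) in blast)
  qed (rule K)
qed

text \<open>The cycles belonging to \<open>z\<close> are kept while \<open>z'\<close> varies: the
  products of \<open>z'\<close> with the points of the compact set controlling the integral stay in
  a compact subset of \<open>cart Om\<close> for \<open>z'\<close> near \<open>z\<close>.\<close>

lemma local_bound_nonzero: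
  "\<exists>r>0. \<exists>K C. compact K \<and> K \<subseteq> cart Om \<and> C \<ge> 0 \<and> (\<forall>c B. fs c \<longrightarrow> B \<ge> 0 \<longrightarrow> (\<forall>\<zeta>\<in>K. norm (pf c \<zeta>) \<le> B) \<longrightarrow>
     (\<forall>z'\<in>ball z r. norm (pf (\<lambda>\<alpha>. c \<alpha> * a \<alpha>) z') \<le> C * B))"
proof (rule approx_bound)
  fix K C
  let ?L = "\<lambda>j. cyc (\<gamma> j)"
  assume K: "\<And>j. compact (K j)" "\<And>j. K j \<subseteq> Dz j" "C \<ge> 0"
    and *: "\<And>F c z' w e. csh F Dz \<Longrightarrow> fs c \<Longrightarrow> w \<in> cart Dz \<Longrightarrow> e \<ge> 0 \<Longrightarrow> (\<And>u. u \<in> cart K \<Longrightarrow> norm (F u - pf c (pmul z' u)) \<le> e) \<Longrightarrow>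
      norm ((1 / (2 * of_real pi * \<i>)) ^ CARD('n) * It js ?L (\<lambda>u. Pz u * F u) w - pf (\<lambda>\<alpha>. c \<alpha> * a \<alpha>) z') \<le> C * e"
  obtain w where w: "w \<in> cart Dz" using Dz_ne by blast
  have cK: "compact (pmul z ` cart K)"
    unfolding pmul_def by (intro compact_continuous_image continuous_on_vec_lambda continuous_intros compact_cart K)
  have sK: "pmul z ` cart K \<subseteq> cart Om" using K(2) by (fastforce simp: cart_def pmul_def Dz_def)
  obtain e where e: "e > 0" "(\<Union>x\<in>pmul z ` cart K. ball x e) \<subseteq> cart Om"
    using compact_subset_open_imp_ball_epsilon_subset[OF cK open_cart[OF op] sK] by blast
  obtain M where M: "M > 0" "\<And>u. u \<in> cart K \<Longrightarrow> norm u \<le> M"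
    using compact_imp_bounded[OF compact_cart[of K, OF K(1)]] by (auto simp: bounded_pos)
  \<comment> \<open>Moving \<open>z\<close> by at most \<open>r\<close> moves the products by at
    most \<open>r * M\<close>, which is less than \<open>e\<close>.\<close>
  define r where "r = e / (2 * M)"
  have r: "r > 0" "r * M < e" using e M by (auto simp: r_def)
  define K' where "K' = (\<lambda>(z', u). pmul z' u) ` (cball z r \<times> cart K)"
  have cont: "continuous_on S (\<lambda>p. pmul (fst p) (snd p))" for S :: "((complex ^ 'n) \<times> (complex ^ 'n)) set"
    unfolding pmul_def by (intro continuous_on_vec_lambda continuous_intros)
  have cK': "compact K'"
    unfolding K'_def split_beta by (intro compact_continuous_image cont compact_Times compact_cball compact_cart K)
  have sK': "K' \<subseteq> cart Om"
  proof
    fix x assume "x \<in> K'"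
    then obtain z' u where x: "x = pmul z' u" "dist z z' \<le> r" "u \<in> cart K" by (auto simp: K'_def)
    have "norm (pmul z u - pmul z' u) \<le> norm (complex_of_real M *s (z - z'))"
    proof (rule norm_le_componentwise_cart)
      fix i
      have "norm (u $ i) \<le> M" using M(2)[OF x(3)] Finite_Cartesian_Product.norm_nth_le[of u i] by linarith
      then show "norm ((pmul z u - pmul z' u) $ i) \<le> norm ((complex_of_real M *s (z - z')) $ i)"
      proof -
        have "(pmul z u - pmul z' u) $ i = u $ i * (z $ i - z' $ i)" by (simp add: pmul_def algebra_simps)
        moreover have "(complex_of_real M *s (z - z')) $ i = of_real M * (z $ i - z' $ i)"
          by (simp only: vector_smult_component vector_minus_component)
        ultimately show ?thesis
          using \<open>norm (u $ i) \<le> M\<close> M(1) by (simp only: norm_mult norm_of_real abs_of_pos mult_right_mono norm_ge_zero)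
      qed
    qed
    also have "\<dots> = norm (M *\<^sub>R (z - z'))"
      by (rule arg_cong[of _ _ norm], unfold vec_eq_iff vector_smult_component vector_scaleR_component) (simp add: scaleR_conv_of_real)
    also have "\<dots> \<le> r * M" using x(2) M(1) by (simp add: dist_norm mult.commute)
    finally have "x \<in> ball (pmul z u) e" using r(2) x(1) by (simp add: dist_norm)
    then show "x \<in> cart Om" using e(2) x(3) by blast
  qed
  have "norm (pf (\<lambda>\<alpha>. c \<alpha> * a \<alpha>) z') \<le> C * B"
    if h: "fs c" "B \<ge> 0" "\<forall>\<zeta>\<in>K'. norm (pf c \<zeta>) \<le> B" "z' \<in> ball z r" for c B z'
  proof -
    have "norm ((1 / (2 * of_real pi * \<i>)) ^ CARD('n) * It js ?L (\<lambda>u. Pz u * 0) w - pf (\<lambda>\<alpha>. c \<alpha> * a \<alpha>) z') \<le> C * B"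
    proof (rule *[OF csh_const h(1) w h(2)])
      fix u assume "u \<in> cart K"
      then have "pmul z' u \<in> K'" using h(4) by (auto simp: K'_def)
      then show "norm (0 - pf c (pmul z' u)) \<le> B" using h(3) by simp
    qed
    then show ?thesis using It_zero[OF openDz Lz w] by simp
  qed
  then show ?thesis using r(1) cK' sK' K(3) by blast
qed

end

subsection \<open>From sequences to multipliers\<close>

text \<open>Continuity of the diagonal operator given by \<open>a\<close>, restricted to
  polynomials, with an estimate uniform on \<open>S\<close>.\<close>

definition qbound :: "(('n::finite \<Rightarrow> nat) \<Rightarrow> complex) \<Rightarrow> (complex ^ 'n) set \<Rightarrow> real \<Rightarrow> (complex ^ 'n) set \<Rightarrow> bool" where
  "qbound a K C S \<longleftrightarrow> (\<forall>c B. fs c \<longrightarrow> B \<ge> 0 \<longrightarrow> (\<forall>\<zeta>\<in>K. norm (pf c \<zeta>) \<le> B) \<longrightarrow>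
     (\<forall>z\<in>S. norm (pf (\<lambda>\<alpha>. c \<alpha> * a \<alpha>) z) \<le> C * B))"

lemma qbound_mono: "qbound a K C S \<Longrightarrow> K \<subseteq> K' \<Longrightarrow> C \<le> C' \<Longrightarrow> S' \<subseteq> S \<Longrightarrow> qbound a K' C' S'"
  unfolding qbound_def by (meson mult_right_mono order_trans subsetD)

lemma qbound_compact:
  assumes T: "compact T" and loc: "\<And>t. t \<in> T \<Longrightarrow> \<exists>r>0. \<exists>K C. compact K \<and> K \<subseteq> \<Omega> \<and> C \<ge> 0 \<and> qbound a K C (ball t r)"
  shows "\<exists>K C. compact K \<and> K \<subseteq> \<Omega> \<and> C \<ge> 0 \<and> qbound a K C T"
proof -
  obtain r K C where h: "\<And>t. t \<in> T \<Longrightarrow> r t > 0 \<and> compact (K t) \<and> K t \<subseteq> \<Omega> \<and> C t \<ge> 0 \<and> qbound a (K t) (C t) (ball t (r t))"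
    using loc by metis
  have "T \<subseteq> (\<Union>t\<in>T. ball t (r t))" using h by force
  then obtain F where F: "F \<subseteq> T" "finite F" "T \<subseteq> (\<Union>t\<in>F. ball t (r t))"
    using compactE_image[OF T, of T "\<lambda>t. ball t (r t)"] by auto
  let ?K = "\<Union>t\<in>F. K t" and ?C = "\<Sum>t\<in>F. C t"
  have "qbound a ?K ?C (ball t (r t))" if t: "t \<in> F" for t
  proof (rule qbound_mono)
    show "qbound a (K t) (C t) (ball t (r t))" using h F t by blast
    show "C t \<le> ?C" by (rule member_le_sum) (use t F h in auto)
  qed (use t in auto)
  note qb = this
  have "qbound a ?K ?C T"
    unfolding qbound_def
  proof (intro allI impI ballI)
    fix c B z assume h: "fs c" "0 \<le> B" "\<forall>\<zeta>\<in>?K. norm (pf c \<zeta>) \<le> B" "z \<in> T"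
    obtain t where "t \<in> F" "z \<in> ball t (r t)" using F(3) h(4) by blast
    then show "norm (pf (\<lambda>\<alpha>. c \<alpha> * a \<alpha>) z) \<le> ?C * B"
      using qb[of t, unfolded qbound_def] h(1-3) by blast
  qed
  moreover have "compact ?K" using F h by (intro compact_UN) auto
  moreover have "?K \<subseteq> \<Omega>" "?C \<ge> 0" using F h by (auto intro!: sum_nonneg)
  ultimately show ?thesis by blast
qed

text \<open>The one-variable maximum principle moves the coordinates in \<open>S\<close> to their
  circles one after another. For all coordinates this is the distinguished boundary of the
  polydisc.\<close>

lemma polydisc_maximum:
  assumes P: "csh P (\<lambda>_. UNIV)" and r: "r > 0" and z: "\<And>j. dist (z0 $ j) (z $ j) \<le> r"
  shows "\<exists>z'. (\<forall>j\<in>S. dist (z0 $ j) (z' $ j) = r) \<and> (\<forall>j. dist (z0 $ j) (z' $ j) \<le> r) \<and> norm (P z) \<le> norm (P z')"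
  using finite[of S]
proof (induction S)
  case empty
  then show ?case using z by blast
next
  case (insert j S)
  then obtain z' where z': "\<And>j. j \<in> S \<Longrightarrow> dist (z0 $ j) (z' $ j) = r" "\<And>j. dist (z0 $ j) (z' $ j) \<le> r" "norm (P z) \<le> norm (P z')"
    by blast
  let ?\<phi> = "\<lambda>x. P (vupd z' j x)"
  have hol: "?\<phi> holomorphic_on UNIV" using csh_slice[OF P, of z' j] by (simp add: cart_def)
  have cont: "continuous_on A ?\<phi>" for A using hol by (meson continuous_on_subset holomorphic_on_imp_continuous_on subset_UNIV)
  have "sphere (z0 $ j) r \<noteq> {}" using r by simp
  then obtain x where x: "x \<in> sphere (z0 $ j) r" "\<And>y. y \<in> sphere (z0 $ j) r \<Longrightarrow> norm (?\<phi> y) \<le> norm (?\<phi> x)"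
    using continuous_attains_sup[OF compact_sphere _ continuous_on_norm[OF cont[of "sphere (z0 $ j) r"]]] by blast
  have "norm (?\<phi> (z' $ j)) \<le> norm (?\<phi> x)"
  proof (rule maximum_modulus_frontier[of ?\<phi> "cball (z0 $ j) r"])
    show "?\<phi> holomorphic_on interior (cball (z0 $ j) r)" using hol by (rule holomorphic_on_subset) simp
    show "norm (?\<phi> y) \<le> norm (?\<phi> x)" if "y \<in> frontier (cball (z0 $ j) r)" for y using that x(2) r by simp
  qed (use cont z' in auto)
  then have "norm (P z) \<le> norm (P (vupd z' j x))" using z'(3) by simp
  moreover have "dist (z0 $ i) (vupd z' j x $ i) = r" if "i \<in> insert j S" for i
    using that x(1) z'(1) by (cases "i = j") auto
  moreover have "dist (z0 $ i) (vupd z' j x $ i) \<le> r" for i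
    using x(1) z'(2) by (cases "i = j") auto
  ultimately show ?case by blast
qed

text \<open>A circle of such a radius about \<open>z0 $ j\<close> misses \<open>0\<close>, so the
  torus consists of points with non-zero coordinates.\<close>

lemma torus_radius:
  fixes z0 :: "complex ^ 'n::finite"
  assumes "e > 0"
  obtains r where "0 < r" "r < e" "\<And>j. r \<noteq> norm (z0 $ j)"
proof -
  have "infinite {0<..<e}" using assms infinite_Ioo by blast
  then have "\<exists>r. r \<in> {0<..<e} - range (\<lambda>j. norm (z0 $ j))"
    by (metis Diff_eq_empty_iff ex_in_conv finite finite_imageI finite_subset)
  then show ?thesis using that by (auto simp: image_iff)
qed

context
  fixes Om :: "'n::finite \<Rightarrow> complex set" and a :: "('n \<Rightarrow> nat) \<Rightarrow> complex"
  assumes op: "\<And>j. open (Om j)" and R: "runge_domain (cart Om)" and a: "ext_seq Om a"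
begin

lemma qbound_nonzero:
  assumes z: "z \<in> cart Om" "\<And>j. z $ j \<noteq> 0"
  shows "\<exists>r>0. \<exists>K C. compact K \<and> K \<subseteq> cart Om \<and> C \<ge> 0 \<and> qbound a K C (ball z r)"
proof -
  obtain Uh g where ext: "is_extension Om z (series_germ a) Uh g"
    using a z by (auto simp: ext_seq_def)
  have "\<And>j. openin rsphere (Uh j)" "\<And>j. hat_set Om z j \<subseteq> Uh j"
    using ext by (auto simp: is_extension_def)
  then obtain \<gamma> where \<gamma>: "admissible_cycles Om z Uh \<gamma>"
    using admissible_cycles_exist[OF op runge_factor_simply_connected[OF op R] z] by blast
  obtain js :: "'n list" where js: "distinct js" "set js = UNIV" by (rule enum_list)
  have "conv a" using a by (simp add: ext_seq_def)
  from local_bound_nonzero[OF op z this ext \<gamma> js] show ?thesis unfolding qbound_def .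
qed

lemma qbound_local:
  assumes z0: "z0 \<in> cart Om"
  shows "\<exists>r>0. \<exists>K C. compact K \<and> K \<subseteq> cart Om \<and> C \<ge> 0 \<and> qbound a K C (ball z0 r)"
proof -
  obtain e where e: "e > 0" "cart (\<lambda>j. cball (z0 $ j) e) \<subseteq> cart Om"
    using polydisc_in_open[OF open_cart[OF op] z0] by blast
  obtain r where r: "0 < r" "r < e" "\<And>j. r \<noteq> norm (z0 $ j)" using torus_radius[OF e(1)] by blast
  let ?T = "cart (\<lambda>j. sphere (z0 $ j) r) :: (complex ^ 'n) set"
  have T: "compact ?T" by (rule compact_cart) simp
  have TO: "?T \<subseteq> cart Om" using e(2) r(2) by (fastforce simp: cart_def)
  have T0: "t $ j \<noteq> 0" if "t \<in> ?T" for t j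
  proof
    assume "t $ j = 0"
    moreover have "dist (z0 $ j) (t $ j) = r" using that by (simp add: cart_def)
    ultimately show False using r(3)[of j] by simp
  qed
  obtain K C where K: "compact K" "K \<subseteq> cart Om" "C \<ge> 0" "qbound a K C ?T"
    using qbound_compact[OF T qbound_nonzero[OF subsetD[OF TO] T0]] by blast
  have "qbound a K C (ball z0 r)"
    unfolding qbound_def
  proof (intro allI impI ballI)
    fix c :: "('n \<Rightarrow> nat) \<Rightarrow> complex" and B :: real and z
    assume h: "fs c" "0 \<le> B" "\<forall>\<zeta>\<in>K. norm (pf c \<zeta>) \<le> B" "z \<in> ball z0 r"
    have "dist (z0 $ j) (z $ j) \<le> r" for j
      using dist_vec_nth_le[of z0 j z] h(4) by simp
    then obtain z' where z': "\<forall>j\<in>UNIV. dist (z0 $ j) (z' $ j) = r" "norm (pf (\<lambda>\<alpha>. c \<alpha> * a \<alpha>) z) \<le> norm (pf (\<lambda>\<alpha>. c \<alpha> * a \<alpha>) z')"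
      using polydisc_maximum[where P = "pf (\<lambda>\<alpha>. c \<alpha> * a \<alpha>)" and S = UNIV, OF csh_pf r(1)] by blast
    then have "z' \<in> ?T" by (simp add: cart_def)
    then have "norm (pf (\<lambda>\<alpha>. c \<alpha> * a \<alpha>) z') \<le> C * B" using K(4) h unfolding qbound_def by blast
    then show "norm (pf (\<lambda>\<alpha>. c \<alpha> * a \<alpha>) z) \<le> C * B" using z'(2) by linarith
  qed
  then show ?thesis using r(1) K by blast
qed

end

text \<open>A functional that is bounded with respect to the supremum over \<open>K\<close> extends to the uniform
  limits on \<open>K\<close>; it is given by its graph.\<close>

lemma bounded_functional_extension:
  fixes G :: "(('x \<Rightarrow> complex) \<times> complex) set"
  assumes bound: "\<And>f s f' s' B. (f, s) \<in> G \<Longrightarrow> (f', s') \<in> G \<Longrightarrow> B \<ge> 0 \<Longrightarrow> (\<And>x. x \<in> K \<Longrightarrow> norm (f x - f' x) \<le> B) \<Longrightarrow> norm (s - s') \<le> C * B"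
    and C: "C \<ge> 0"
    and approx: "\<And>e. e > 0 \<Longrightarrow> \<exists>(f, s)\<in>G. \<forall>x\<in>K. norm (h x - f x) \<le> e"
  shows "\<exists>y. \<forall>f s B. (f, s) \<in> G \<longrightarrow> B \<ge> 0 \<longrightarrow> (\<forall>x\<in>K. norm (h x - f x) \<le> B) \<longrightarrow> norm (y - s) \<le> C * B"
proof -
  have "\<forall>n. \<exists>f s. (f, s) \<in> G \<and> (\<forall>x\<in>K. norm (h x - f x) \<le> inverse (real (Suc n)))"
    using approx[of "inverse (real (Suc n))" for n] by fastforce
  then obtain f s where fs: "\<And>n. (f n, s n) \<in> G" "\<And>n x. x \<in> K \<Longrightarrow> norm (h x - f n x) \<le> inverse (real (Suc n))"
    by metis
  have close: "norm (s n - t) \<le> C * (inverse (real (Suc n)) + B)"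
    if "(g, t) \<in> G" "B \<ge> 0" "\<And>x. x \<in> K \<Longrightarrow> norm (h x - g x) \<le> B" for g t B n
  proof (rule bound[OF fs(1) that(1)])
    show "inverse (real (Suc n)) + B \<ge> 0" using that(2) by simp
    fix x assume x: "x \<in> K"
    have eq: "f n x - g x = (h x - g x) - (h x - f n x)" by simp
    have "norm (f n x - g x) \<le> norm (h x - g x) + norm (h x - f n x)"
      unfolding eq by (rule norm_triangle_ineq4)
    then show "norm (f n x - g x) \<le> inverse (real (Suc n)) + B"
      using that(3)[OF x] fs(2)[OF x, of n] by linarith
  qed
  have i0: "(\<lambda>n. inverse (real (Suc n))) \<longlonglongrightarrow> 0" by (rule LIMSEQ_inverse_real_of_nat)
  have "Cauchy s"
  proof (rule CauchyI)
    fix e :: real assume e: "e > 0"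
    obtain N where N: "inverse (real (Suc N)) < e / (2 * (C + 1))"
      using reals_Archimedean[of "e / (2 * (C + 1))"] e C by auto
    have "norm (s m - s n) < e" if "m \<ge> N" "n \<ge> N" for m n
    proof -
      have "inverse (real (Suc m)) \<le> inverse (real (Suc N))" "inverse (real (Suc n)) \<le> inverse (real (Suc N))"
        using that by (auto simp: field_simps)
      then have "norm (s m - s n) \<le> C * (2 * inverse (real (Suc N)))"
        using close[OF fs(1), of "inverse (real (Suc n))" n m] fs(2) C
        by (smt (verit) mult_left_mono inverse_nonnegative_iff_nonnegative of_nat_0_le_iff)
      also have "\<dots> \<le> (C + 1) * (2 * inverse (real (Suc N)))" by (rule mult_right_mono) auto
      also have "\<dots> < e" using N C by (simp add: field_simps)
      finally show ?thesis .
    qed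
    then show "\<exists>N. \<forall>m\<ge>N. \<forall>n\<ge>N. norm (s m - s n) < e" by blast
  qed
  then obtain y where y: "s \<longlonglongrightarrow> y" using Cauchy_convergent_iff convergent_def by blast
  have "norm (y - t) \<le> C * B"
    if g: "(g, t) \<in> G" "B \<ge> 0" "\<And>x. x \<in> K \<Longrightarrow> norm (h x - g x) \<le> B" for g t B
  proof (rule tendsto_le[OF sequentially_bot])
    show "(\<lambda>n. C * (inverse (real (Suc n)) + B)) \<longlonglongrightarrow> C * B"
      using tendsto_mult_left[OF tendsto_add[OF i0 tendsto_const[of B]], of C] by simp
    show "(\<lambda>n. norm (s n - t)) \<longlonglongrightarrow> norm (y - t)" by (intro tendsto_intros y)
    show "\<forall>\<^sub>F n in sequentially. norm (s n - t) \<le> C * (inverse (real (Suc n)) + B)"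
      using close[OF g] by (intro always_eventually allI)
  qed
  then show ?thesis by blast
qed

section \<open>Approximation and continuity in the space of holomorphic functions\<close>

lemma hol_space_approx:
  assumes R: "runge_domain \<Omega>" and f: "f \<in> hol_space \<Omega>" and K: "compact K" "K \<subseteq> \<Omega>" and e: "e > 0"
  shows "\<exists>c. fs c \<and> (\<forall>z\<in>K. norm (f z - pf c z) \<le> e)"
proof -
  obtain p where p: "poly_fun p" "\<forall>z\<in>K. dist (p z) (f z) < e"
    using R f K e unfolding runge_domain_def hol_space_def by blast
  obtain c where "fs c" "p = pf c" using poly_fun_pf[OF p(1)] by blast
  then show ?thesis using p(2) by (metis dist_norm less_imp_le norm_minus_commute)
qed

lemma local_bound_compact:
  assumes L: "compact L" "L \<subseteq> \<Omega>"
    and loc: "\<And>z. z \<in> \<Omega> \<Longrightarrow> \<exists>r>0. \<exists>K C. compact K \<and> K \<subseteq> \<Omega> \<and> C \<ge> 0 \<and>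
      (\<forall>f\<in>H. \<forall>B\<ge>0. (\<forall>\<zeta>\<in>K. norm (f \<zeta>) \<le> B) \<longrightarrow> (\<forall>z'\<in>ball z r \<inter> \<Omega>. norm (M f z') \<le> C * B))"
  shows "\<exists>K C. compact K \<and> K \<subseteq> \<Omega> \<and> C \<ge> 0 \<and>
      (\<forall>f\<in>H. \<forall>B\<ge>0. (\<forall>\<zeta>\<in>K. norm (f \<zeta> :: complex) \<le> B) \<longrightarrow> (\<forall>z\<in>L. norm (M f z :: complex) \<le> C * B))"
proof -
  define P where "P K C S \<longleftrightarrow> (\<forall>f\<in>H. \<forall>B\<ge>0. (\<forall>\<zeta>\<in>K. norm (f \<zeta>) \<le> B) \<longrightarrow> (\<forall>z'\<in>S. norm (M f z') \<le> C * B))" for K C S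
  obtain r K C where h: "\<And>t. t \<in> \<Omega> \<Longrightarrow> r t > 0 \<and> compact (K t) \<and> K t \<subseteq> \<Omega> \<and> C t \<ge> 0 \<and> P (K t) (C t) (ball t (r t) \<inter> \<Omega>)"
    using loc unfolding P_def[symmetric] by metis
  have "L \<subseteq> (\<Union>t\<in>L. ball t (r t))" using h L by force
  then obtain F where F: "F \<subseteq> L" "finite F" "L \<subseteq> (\<Union>t\<in>F. ball t (r t))"
    using compactE_image[OF L(1), of L "\<lambda>t. ball t (r t)"] by auto
  let ?K = "\<Union>t\<in>F. K t" and ?C = "\<Sum>t\<in>F. C t"
  have FO: "F \<subseteq> \<Omega>" using F L by blast
  have mono: "P K C S \<Longrightarrow> K \<subseteq> K' \<Longrightarrow> C \<le> C' \<Longrightarrow> P K' C' S" for K C S K' C'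
    unfolding P_def by (meson mult_right_mono order_trans subsetD)
  have "P ?K ?C (ball t (r t) \<inter> \<Omega>)" if t: "t \<in> F" for t
  proof (rule mono)
    show "P (K t) (C t) (ball t (r t) \<inter> \<Omega>)" using h FO t by blast
    show "C t \<le> ?C" by (rule member_le_sum) (use t F FO h in auto)
  qed (use t in auto)
  note PF = this
  have "P ?K ?C L"
    unfolding P_def
  proof (intro ballI allI impI)
    fix f B z assume h: "f \<in> H" "0 \<le> B" "\<forall>\<zeta>\<in>?K. norm (f \<zeta>) \<le> B" "z \<in> L"
    obtain t where "t \<in> F" "z \<in> ball t (r t) \<inter> \<Omega>" using F(3) L(2) h(4) by blast
    then show "norm (M f z) \<le> ?C * B"
      using PF[of t, unfolded P_def] h(1-3) by blast
  qed
  moreover have "compact ?K" using F FO h by (intro compact_UN) auto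
  moreover have "?K \<subseteq> \<Omega>" "?C \<ge> 0" using FO h by (auto intro!: sum_nonneg)
  ultimately show ?thesis unfolding P_def by blast
qed

lemma topspace_hol_top: "topspace (hol_top \<Omega>) = hol_space \<Omega>"
proof
  show "topspace (hol_top \<Omega>) \<subseteq> hol_space \<Omega>" by (meson openin_hol_top openin_topspace)
  have "openin (hol_top \<Omega>) (hol_space \<Omega>)"
    unfolding openin_hol_top by (intro conjI ballI exI[of _ "{}"] exI[of _ "1::real"]) auto
  then show "hol_space \<Omega> \<subseteq> topspace (hol_top \<Omega>)" by (rule openin_subset)
qed

lemma hol_space_combine:
  assumes "open \<Omega>" "f \<in> hol_space \<Omega>" "g \<in> hol_space \<Omega>"
  shows "(\<lambda>z. f z + k * g z) \<in> hol_space \<Omega>"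
proof -
  have "holo (\<lambda>z. f z + k * g z) \<Omega>"
    unfolding holo_def
  proof
    fix z assume "z \<in> \<Omega>"
    then obtain D E where "(f has_derivative D) (at z)" "\<forall>c v. D (c *s v) = c * D v"
      "(g has_derivative E) (at z)" "\<forall>c v. E (c *s v) = c * E v"
      using assms(2,3) unfolding hol_space_def holo_def by blast
    then have "((\<lambda>z. f z + k * g z) has_derivative (\<lambda>v. D v + k * E v)) (at z)"
      "\<forall>c v. D (c *s v) + k * E (c *s v) = c * (D v + k * E v)"
      by (auto intro!: derivative_eq_intros simp: algebra_simps)
    then show "\<exists>D. ((\<lambda>z. f z + k * g z) has_derivative D) (at z) \<and> (\<forall>c v. D (c *s v) = c * D v)" by blast
  qed
  then show ?thesis using assms(2,3) by (simp add: hol_space_def)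
qed

lemma continuous_map_hol_top:
  assumes \<Omega>: "open \<Omega>" and MH: "\<And>f. f \<in> hol_space \<Omega> \<Longrightarrow> M f \<in> hol_space \<Omega>"
    and lin: "\<And>f g k z. f \<in> hol_space \<Omega> \<Longrightarrow> g \<in> hol_space \<Omega> \<Longrightarrow> M (\<lambda>z. f z + k * g z) z = M f z + k * M g z"
    and loc: "\<And>z. z \<in> \<Omega> \<Longrightarrow> \<exists>r>0. \<exists>K C. compact K \<and> K \<subseteq> \<Omega> \<and> C \<ge> 0 \<and>
      (\<forall>f\<in>hol_space \<Omega>. \<forall>B\<ge>0. (\<forall>\<zeta>\<in>K. norm (f \<zeta>) \<le> B) \<longrightarrow> (\<forall>z'\<in>ball z r \<inter> \<Omega>. norm (M f z') \<le> C * B))"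
  shows "continuous_map (hol_top \<Omega>) (hol_top \<Omega>) M"
  unfolding continuous_map_def topspace_hol_top
proof (intro conjI allI impI)
  show "M \<in> hol_space \<Omega> \<rightarrow> hol_space \<Omega>" using MH by blast
  fix V assume V: "openin (hol_top \<Omega>) V"
  show "openin (hol_top \<Omega>) {f \<in> hol_space \<Omega>. M f \<in> V}"
    unfolding openin_hol_top
  proof (intro conjI ballI)
    fix f assume "f \<in> {f \<in> hol_space \<Omega>. M f \<in> V}"
    then have f: "f \<in> hol_space \<Omega>" "M f \<in> V" by auto
    obtain L e where L: "compact L" "L \<subseteq> \<Omega>" "(0::real) < e" "{g \<in> hol_space \<Omega>. \<forall>z\<in>L. dist (M f z) (g z) < e} \<subseteq> V"
      using V f(2) unfolding openin_hol_top by meson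
    obtain K C where K: "compact K" "K \<subseteq> \<Omega>" "C \<ge> 0"
      "\<And>f B. f\<in>hol_space \<Omega> \<Longrightarrow> B\<ge>0 \<Longrightarrow> (\<forall>\<zeta>\<in>K. norm (f \<zeta>) \<le> B) \<Longrightarrow> (\<forall>z\<in>L. norm (M f z) \<le> C * B)"
      using local_bound_compact[OF L(1,2) loc] by blast
    define d where "d = e / (C + 1)"
    have d: "d > 0" "C * d < e" using L(3) K(3) by (auto simp: d_def field_simps)
    have "{g \<in> hol_space \<Omega>. \<forall>z\<in>K. dist (f z) (g z) < d} \<subseteq> {f \<in> hol_space \<Omega>. M f \<in> V}"
    proof clarify
      fix g assume g: "g \<in> hol_space \<Omega>" "\<forall>z\<in>K. dist (f z) (g z) < d"
      let ?h = "\<lambda>z. f z + (-1) * g z"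
      have h: "?h \<in> hol_space \<Omega>" by (rule hol_space_combine[OF \<Omega> f(1) g(1)])
      have "\<forall>\<zeta>\<in>K. norm (?h \<zeta>) \<le> d" using g(2) by (auto simp: dist_norm less_imp_le)
      then have "\<forall>z\<in>L. norm (M ?h z) \<le> C * d" using K(4)[OF h] d(1) by simp
      then have "\<forall>z\<in>L. dist (M f z) (M g z) < e"
        using lin[OF f(1) g(1), of "-1"] d(2) by (force simp: dist_norm)
      then show "M g \<in> V" using L(4) MH[OF g(1)] by blast
    qed
    then show "\<exists>K e. compact K \<and> K \<subseteq> \<Omega> \<and> 0 < e \<and> {g \<in> hol_space \<Omega>. \<forall>z\<in>K. dist (f z) (g z) < e} \<subseteq> {f \<in> hol_space \<Omega>. M f \<in> V}"
      using K d by blast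
  qed auto
qed

lemma le_if_le_eps:
  fixes x y C :: real
  assumes "C \<ge> 0" "\<And>e. e > 0 \<Longrightarrow> x \<le> y + C * e"
  shows "x \<le> y"
proof (rule field_le_epsilon)
  fix e :: real assume e: "e > 0"
  have "x \<le> y + C * (e / (C + 1))" by (rule assms(2)) (use e assms(1) in simp)
  also have "C * (e / (C + 1)) \<le> e" using assms(1) e by (simp add: field_simps)
  finally show "x \<le> y + e" by simp
qed

subsection \<open>Functionals on uniform limits of polynomials\<close>

text \<open>The uniform algebra commonly written P(K), with functions considered only through their
  values on \<open>K\<close>.\<close>

definition appr :: "(complex ^ 'n::finite) set \<Rightarrow> (complex ^ 'n \<Rightarrow> complex) set" where
  "appr K = {f. \<forall>e>0. \<exists>c. fs c \<and> (\<forall>x\<in>K. norm (f x - pf c x) \<le> e)}"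

lemma apprE:
  assumes "f \<in> appr K" "e > 0"
  obtains c where "fs c" "\<And>x. x \<in> K \<Longrightarrow> norm (f x - pf c x) \<le> e"
  using assms unfolding appr_def by blast

lemma appr_cong: "f \<in> appr K \<Longrightarrow> (\<And>x. x \<in> K \<Longrightarrow> f x = g x) \<Longrightarrow> g \<in> appr K"
  unfolding appr_def by simp

lemma appr_pf: "fs c \<Longrightarrow> pf c \<in> appr K"
  unfolding appr_def by (intro CollectI allI impI exI[of _ c]) auto

lemma appr_const: "(\<lambda>x. k) \<in> appr K"
proof -
  have "pf (\<lambda>\<beta>. if \<beta> = (\<lambda>_. 0) then k else 0) \<in> appr K" by (rule appr_pf[OF pf_single(2)])
  then show ?thesis by (rule appr_cong) (simp add: pf_single mono_fun_def)
qed

lemma appr_combine: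
  assumes f: "f \<in> appr K" and g: "g \<in> appr K"
  shows "(\<lambda>x. f x + k * g x) \<in> appr K"
  unfolding appr_def
proof (intro CollectI allI impI)
  fix e :: real assume e: "e > 0"
  define d where "d = e / (1 + norm k)"
  have k: "1 + norm k > 0" by (simp add: add_pos_nonneg)
  then have "(1 + norm k) * d = e" by (simp add: d_def)
  then have d: "d > 0" "d + norm k * d = e" using e k by (simp_all add: distrib_right) (simp add: d_def)
  obtain c where c: "fs c" "\<And>x. x \<in> K \<Longrightarrow> norm (f x - pf c x) \<le> d" using f d(1) by (rule apprE) (rule that; blast)
  obtain b where b: "fs b" "\<And>x. x \<in> K \<Longrightarrow> norm (g x - pf b x) \<le> d" using g d(1) by (rule apprE) (rule that; blast)
  have "norm (f x + k * g x - pf (\<lambda>\<alpha>. c \<alpha> + k * b \<alpha>) x) \<le> e" if x: "x \<in> K" for x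
  proof -
    have eq: "f x + k * g x - pf (\<lambda>\<alpha>. c \<alpha> + k * b \<alpha>) x = (f x - pf c x) + k * (g x - pf b x)"
      by (simp add: pf_combine(2)[OF c(1) b(1)] algebra_simps)
    have "norm (k * (g x - pf b x)) \<le> norm k * d"
      using mult_left_mono[OF b(2)[OF x], of "norm k"] by (simp add: norm_mult)
    then show ?thesis unfolding eq d(2)[symmetric] by (rule norm_triangle_mono[OF c(2)[OF x]])
  qed
  then show "\<exists>c. fs c \<and> (\<forall>x\<in>K. norm (f x + k * g x - pf c x) \<le> e)" using pf_combine(1)[OF c(1) b(1)] by blast
qed

lemma appr_cmult: "g \<in> appr K \<Longrightarrow> (\<lambda>x. k * g x) \<in> appr K"
  using appr_combine[OF appr_const, of g K 0 k] by simp

lemma appr_limit: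
  assumes "\<And>e. e > 0 \<Longrightarrow> \<exists>g\<in>appr K. \<forall>x\<in>K. norm (f x - g x) \<le> e"
  shows "f \<in> appr K"
  unfolding appr_def
proof (intro CollectI allI impI)
  fix e :: real assume e: "e > 0"
  then obtain g where g: "g \<in> appr K" "\<forall>x\<in>K. norm (f x - g x) \<le> e / 2" using assms[of "e/2"] by auto
  obtain c where c: "fs c" "\<And>x. x \<in> K \<Longrightarrow> norm (g x - pf c x) \<le> e / 2"
    by (rule apprE[OF g(1), of "e/2"]) (use e in auto)
  have "norm (f x - pf c x) \<le> e" if "x \<in> K" for x
    using norm_triangle_mono[of "f x - g x" "e/2" "g x - pf c x" "e/2"] g(2) c(2) that by simp
  then show "\<exists>c. fs c \<and> (\<forall>x\<in>K. norm (f x - pf c x) \<le> e)" using c(1) by blast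
qed

context
  fixes K :: "(complex ^ 'n::finite) set" and Om :: "'n \<Rightarrow> complex set"
  assumes op: "\<And>j. open (Om j)" and R: "runge_domain (cart Om)" and K: "compact K" "K \<subseteq> cart Om"
begin

lemma appr_holo:
  assumes "csh f Om"
  shows "f \<in> appr K"
  unfolding appr_def
proof (intro CollectI allI impI)
  fix e :: real assume e: "e > 0"
  have "holo f (cart Om)" by (rule csh_imp_holo[OF assms op])
  then obtain p where p: "poly_fun p" "\<forall>z\<in>K. dist (p z) (f z) < e" using R K e unfolding runge_domain_def by blast
  then obtain c where "fs c" "p = pf c" by (meson poly_fun_pf)
  then show "\<exists>c. fs c \<and> (\<forall>x\<in>K. norm (f x - pf c x) \<le> e)"
    using p(2) by (metis dist_norm dist_commute less_imp_le)
qed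

lemma appr_bounded:
  assumes "f \<in> appr K"
  obtains B where "B > 0" "\<And>x. x \<in> K \<Longrightarrow> norm (f x) \<le> B"
proof -
  obtain c where c: "fs c" "\<And>x. x \<in> K \<Longrightarrow> norm (f x - pf c x) \<le> 1" by (rule apprE[OF assms, of 1]) auto
  have "continuous_on K (pf c)"
    using csh_continuous[OF csh_pf[of c Om]] K(2) continuous_on_subset by blast
  then have "bounded (pf c ` K)" using K(1) compact_continuous_image compact_imp_bounded by blast
  then obtain B where B: "B > 0" "\<forall>x\<in>K. norm (pf c x) \<le> B" unfolding bounded_pos by auto
  have "norm (f x) \<le> 1 + B" if "x \<in> K" for x
    using norm_triangle_mono[of "f x - pf c x" 1 "pf c x" B] c(2) B(2) that by simp
  then show ?thesis using that[of "1 + B"] B(1) by simp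
qed

lemma appr_mult:
  assumes f: "f \<in> appr K" and g: "g \<in> appr K"
  shows "(\<lambda>x. f x * g x) \<in> appr K"
proof (rule appr_limit)
  fix e :: real assume e: "e > 0"
  obtain B where B: "B > 0" "\<And>x. x \<in> K \<Longrightarrow> norm (f x) \<le> B" by (rule appr_bounded[OF f]) (rule that; blast)
  obtain b where b: "fs b" "\<And>x. x \<in> K \<Longrightarrow> norm (g x - pf b x) \<le> e / (2 * B)"
    by (rule apprE[OF g, of "e / (2 * B)"]) (use e B(1) in auto)
  \<comment> \<open>The order matters: \<open>b\<close> is fixed by means of \<open>B\<close>, and
    its own bound \<open>B'\<close> then determines how well \<open>f\<close> has to be
    approximated.\<close>
  obtain B' where B': "B' > 0" "\<And>x. x \<in> K \<Longrightarrow> norm (pf b x) \<le> B'" by (rule appr_bounded[OF appr_pf[OF b(1)]]) (rule that; blast)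
  obtain c where c: "fs c" "\<And>x. x \<in> K \<Longrightarrow> norm (f x - pf c x) \<le> e / (2 * B')"
    by (rule apprE[OF f, of "e / (2 * B')"]) (use e B'(1) in auto)
  have "norm (f x * g x - pf c x * pf b x) \<le> e" if x: "x \<in> K" for x
  proof -
    have eq: "f x * g x - pf c x * pf b x = f x * (g x - pf b x) + (f x - pf c x) * pf b x" by (simp add: algebra_simps)
    have "norm (f x * (g x - pf b x)) \<le> B * (e / (2 * B))"
      unfolding norm_mult by (rule mult_mono[OF B(2)[OF x] b(2)[OF x]]) (use B(1) in auto)
    moreover have "norm ((f x - pf c x) * pf b x) \<le> (e / (2 * B')) * B'"
      unfolding norm_mult by (rule mult_mono[OF c(2)[OF x] B'(2)[OF x]]) (use e B'(1) in auto)
    ultimately have "norm (f x * g x - pf c x * pf b x) \<le> B * (e / (2 * B)) + (e / (2 * B')) * B'"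
      unfolding eq by (rule norm_triangle_mono)
    also have "\<dots> = e" using B(1) B'(1) by simp
    finally show ?thesis .
  qed
  moreover have "(\<lambda>x. pf c x * pf b x) \<in> appr K" by (rule appr_holo[OF csh_mult[OF csh_pf csh_pf]])
  ultimately show "\<exists>h\<in>appr K. \<forall>x\<in>K. norm (f x * g x - h x) \<le> e" by (intro bexI[of _ "\<lambda>x. pf c x * pf b x"]) auto
qed

lemma appr_prod:
  assumes "\<And>i. i \<in> A \<Longrightarrow> f i \<in> appr K"
  shows "(\<lambda>x. \<Prod>i\<in>A. f i x) \<in> appr K"
  using assms
proof (induction A rule: infinite_finite_induct)
  case (insert i A)
  have "(\<lambda>x. f i x * (\<Prod>i\<in>A. f i x)) \<in> appr K" by (rule appr_mult) (use insert in auto)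
  then show ?case using insert(1,2) by simp
qed (auto intro: appr_const)

lemma appr_power: "f \<in> appr K \<Longrightarrow> (\<lambda>x. f x ^ k) \<in> appr K"
  using appr_prod[of "{..<k}" "\<lambda>_. f"] by simp

lemma appr_sum:
  assumes "\<And>i. i \<in> A \<Longrightarrow> f i \<in> appr K"
  shows "(\<lambda>x. \<Sum>i\<in>A. f i x) \<in> appr K"
  using assms
proof (induction A rule: infinite_finite_induct)
  case (insert i A)
  have "(\<lambda>x. f i x + 1 * (\<Sum>i\<in>A. f i x)) \<in> appr K" by (rule appr_combine) (use insert in auto)
  then show ?case using insert(1,2) by simp
qed (auto intro: appr_const)

text \<open>The perturbed inverse is a Neumann series.\<close>

lemma appr_inverse_perturb:
  assumes g: "(\<lambda>x. 1 / l x) \<in> appr K" and l: "\<And>x. x \<in> K \<Longrightarrow> l x \<noteq> 0"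
    and B: "B > 0" "\<And>x. x \<in> K \<Longrightarrow> norm (1 / l x) \<le> B"
    and s: "s \<in> appr K" "\<And>x. x \<in> K \<Longrightarrow> norm (s x) * B \<le> 1 / 2"
  shows "\<And>x. x \<in> K \<Longrightarrow> l x - s x \<noteq> 0" and "(\<lambda>x. 1 / (l x - s x)) \<in> appr K"
proof -
  let ?t = "\<lambda>x. s x * (1 / l x)"
  have t: "norm (?t x) \<le> 1 / 2" if x: "x \<in> K" for x
  proof -
    have "norm (?t x) \<le> norm (s x) * B" unfolding norm_mult by (rule mult_left_mono[OF B(2)[OF x]]) simp
    then show ?thesis using s(2)[OF x] by simp
  qed
  have ls: "l x - s x = l x * (1 - ?t x)" if "x \<in> K" for x using l[OF that] by (simp add: field_simps)
  have t1: "norm (1 - ?t x) \<ge> 1 / 2" if x: "x \<in> K" for x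
    using norm_triangle_ineq2[of 1 "?t x"] t[OF x] by simp
  have t2: "1 - ?t x \<noteq> 0" if x: "x \<in> K" for x using t1[OF x] by (metis norm_zero not_le half_gt_zero zero_less_one)
  show "l x - s x \<noteq> 0" if "x \<in> K" for x unfolding ls[OF that] using l[OF that] t2[OF that] by simp
  have geo: "1 / (1 - t) - (\<Sum>k<N. t ^ k) = t ^ N / (1 - t)" if "1 - t \<noteq> 0" for t :: complex and N
    using that sum_gp_strict[of t N] by (simp add: diff_divide_distrib)
  show "(\<lambda>x. 1 / (l x - s x)) \<in> appr K"
  proof (rule appr_limit)
    fix e :: real assume e: "e > 0"
    obtain N where N: "(1 / 2 :: real) ^ N < e / (2 * B)" using real_arch_pow_inv[of "e / (2 * B)" "1/2"] e B(1) by auto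
    let ?h = "\<lambda>x. (1 / l x) * (\<Sum>k<N. ?t x ^ k)"
    have "?h \<in> appr K" by (rule appr_mult[OF g appr_sum[OF appr_power[OF appr_mult[OF s(1) g]]]])
    moreover have "norm (1 / (l x - s x) - ?h x) \<le> e" if x: "x \<in> K" for x
    proof -
      have "1 / (l x - s x) - ?h x = (1 / l x) * (1 / (1 - ?t x) - (\<Sum>k<N. ?t x ^ k))"
        unfolding ls[OF x] by (simp only: right_diff_distrib[of "1 / l x"] times_divide_times_eq mult_1_left)
      also have "1 / (1 - ?t x) - (\<Sum>k<N. ?t x ^ k) = ?t x ^ N / (1 - ?t x)"
        by (rule geo[OF t2[OF x]])
      finally have "norm (1 / (l x - s x) - ?h x) = norm (1 / l x) * (norm (?t x) ^ N / norm (1 - ?t x))"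
        by (simp only: norm_mult norm_divide norm_power)
      also have "\<dots> \<le> B * ((1/2) ^ N / (1/2))"
      proof (rule mult_mono[OF B(2)[OF x] frac_le])
        show "norm (?t x) ^ N \<le> (1/2) ^ N" by (rule power_mono[OF t[OF x] norm_ge_zero])
        show "1 / 2 \<le> norm (1 - ?t x)" by (rule t1[OF x])
      qed (use B(1) in simp_all)
      also have "\<dots> = 2 * B * (1/2) ^ N" by simp
      also have "\<dots> \<le> 2 * B * (e / (2 * B))" by (rule mult_left_mono[OF less_imp_le[OF N]]) (use B(1) in simp)
      also have "\<dots> = e" using B(1) by simp
      finally show ?thesis .
    qed
    ultimately show "\<exists>h\<in>appr K. \<forall>x\<in>K. norm (1 / (l x - s x) - h x) \<le> e"
      by (intro bexI[of _ ?h] ballI)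
  qed
qed

end

text \<open>The estimate on polynomials determines the value at every uniform limit, and linearity
  passes to the limit. The gain is that \<open>appr K\<close> also contains functions that are not
  holomorphic on the whole domain, such as Cauchy kernels with a pole outside
  \<open>K\<close>.\<close>

lemma appr_functional:
  fixes m :: "('n::finite \<Rightarrow> nat) \<Rightarrow> complex"
  assumes q: "qbound m K C {z}" and C: "C \<ge> 0"
  obtains T where "\<And>f g k. f \<in> appr K \<Longrightarrow> g \<in> appr K \<Longrightarrow> T (\<lambda>x. f x + k * g x) = T f + k * T g"
    "\<And>f B. f \<in> appr K \<Longrightarrow> B \<ge> 0 \<Longrightarrow> (\<And>x. x \<in> K \<Longrightarrow> norm (f x) \<le> B) \<Longrightarrow> norm (T f) \<le> C * B"
    "\<And>c. fs c \<Longrightarrow> T (pf c) = pf (\<lambda>\<alpha>. c \<alpha> * m \<alpha>) z"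
proof -
  let ?q = "\<lambda>c. pf (\<lambda>\<alpha>. c \<alpha> * m \<alpha>) z"
  define good where "good y f \<longleftrightarrow> (\<forall>c B. fs c \<longrightarrow> B \<ge> 0 \<longrightarrow> (\<forall>x\<in>K. norm (f x - pf c x) \<le> B) \<longrightarrow> norm (y - ?q c) \<le> C * B)"
    for y f
  have diff: "norm (?q c - ?q d) \<le> C * B"
    if "fs c" "fs d" "B \<ge> 0" "\<forall>x\<in>K. norm (pf c x - pf d x) \<le> B" for c d B
  proof -
    have "fs (\<lambda>\<alpha>. c \<alpha> + (-1) * d \<alpha>)" by (rule pf_combine(1)[OF that(1,2)])
    moreover have "\<forall>x\<in>K. norm (pf (\<lambda>\<alpha>. c \<alpha> + (-1) * d \<alpha>) x) \<le> B"
      using that(4) pf_combine(2)[OF that(1,2), of "-1"] by simp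
    ultimately have "norm (pf (\<lambda>\<alpha>. (c \<alpha> + (-1) * d \<alpha>) * m \<alpha>) z) \<le> C * B"
      using q that(3) unfolding qbound_def by blast
    then show ?thesis using pf_mult_combine[OF that(1,2), of "-1" m z] by simp
  qed
  have "\<exists>y. good y f" if f: "f \<in> appr K" for f
  proof -
    let ?G = "{(pf c, ?q c) |c. fs c}"
    have "\<exists>y. \<forall>g s B. (g, s) \<in> ?G \<longrightarrow> B \<ge> 0 \<longrightarrow> (\<forall>x\<in>K. norm (f x - g x) \<le> B) \<longrightarrow> norm (y - s) \<le> C * B"
    proof (rule bounded_functional_extension)
      fix g s g' s' B
      assume "(g, s) \<in> ?G" "(g', s') \<in> ?G" "(0::real) \<le> B" "\<And>x. x \<in> K \<Longrightarrow> norm (g x - g' x) \<le> B"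
      then show "norm (s - s') \<le> C * B" using diff by blast
    next
      fix e :: real assume "e > 0"
      then obtain c where "fs c" "\<forall>x\<in>K. norm (f x - pf c x) \<le> e" using f unfolding appr_def by blast
      then show "\<exists>(g, s)\<in>?G. \<forall>x\<in>K. norm (f x - g x) \<le> e" by blast
    qed (rule C)
    then show ?thesis unfolding good_def by blast
  qed
  then obtain T where T: "\<And>f. f \<in> appr K \<Longrightarrow> good (T f) f" by metis
  have est: "norm (T f - ?q c) \<le> C * B" if "f \<in> appr K" "fs c" "B \<ge> 0" "\<And>x. x \<in> K \<Longrightarrow> norm (f x - pf c x) \<le> B" for f c B
    using T[OF that(1)] that(2-4) unfolding good_def by blast
  show ?thesis
  proof (rule that)
    fix f g k assume f: "f \<in> appr K" and g: "g \<in> appr K"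
    let ?h = "\<lambda>x. f x + k * g x"
    have h: "?h \<in> appr K" by (rule appr_combine[OF f g])
    have "norm (T ?h - (T f + k * T g)) \<le> 0"
    proof (rule le_if_le_eps)
      show "2 * (C * (1 + norm k)) \<ge> 0" using C by simp
      fix e :: real assume e: "e > 0"
      obtain c where c: "fs c" "\<And>x. x \<in> K \<Longrightarrow> norm (f x - pf c x) \<le> e" using f e by (rule apprE) (rule that; blast)
      obtain d where d: "fs d" "\<And>x. x \<in> K \<Longrightarrow> norm (g x - pf d x) \<le> e" using g e by (rule apprE) (rule that; blast)
      let ?b = "\<lambda>\<alpha>. c \<alpha> + k * d \<alpha>"
      have b: "norm (?h x - pf ?b x) \<le> e + norm k * e" if x: "x \<in> K" for x
      proof -
        have eq: "?h x - pf ?b x = (f x - pf c x) + k * (g x - pf d x)"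
          by (simp add: pf_combine(2)[OF c(1) d(1)] algebra_simps)
        have "norm (k * (g x - pf d x)) \<le> norm k * e"
          using mult_left_mono[OF d(2)[OF x], of "norm k"] by (simp add: norm_mult)
        then show ?thesis unfolding eq by (rule norm_triangle_mono[OF c(2)[OF x]])
      qed
      have 1: "norm (T ?h - ?q ?b) \<le> C * (e + norm k * e)"
        by (rule est[OF h pf_combine(1)[OF c(1) d(1)] _ b]) (use e in auto)
      have 2: "norm (T f - ?q c) \<le> C * e" by (rule est[OF f c(1) _ c(2)]) (use e in auto)
      have 3: "norm (T g - ?q d) \<le> C * e" by (rule est[OF g d(1) _ d(2)]) (use e in auto)
      have 4: "norm (k * (T g - ?q d)) \<le> norm k * (C * e)"
        using mult_left_mono[OF 3, of "norm k"] by (simp add: norm_mult)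
      have eq: "?q ?b = ?q c + k * ?q d" by (rule pf_mult_combine[OF c(1) d(1)])
      have E: "T ?h - (T f + k * T g) = (T ?h - ?q ?b) - ((T f - ?q c) + k * (T g - ?q d))"
        unfolding eq by (simp only: ring_distribs) simp
      have "norm (T ?h - (T f + k * T g)) \<le> C * (e + norm k * e) + (C * e + norm k * (C * e))"
        unfolding E by (rule order.trans[OF norm_triangle_ineq4 add_mono[OF 1 norm_triangle_mono[OF 2 4]]])
      then show "norm (T ?h - (T f + k * T g)) \<le> 0 + 2 * (C * (1 + norm k)) * e"
        by (simp add: algebra_simps)
    qed
    then show "T ?h = T f + k * T g" by simp
  next
    fix f B assume f: "f \<in> appr K" "B \<ge> 0" "\<And>x. x \<in> K \<Longrightarrow> norm (f x) \<le> B"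
    have z0: "fs (\<lambda>_. 0)" "pf (\<lambda>_. 0) x = 0" for x :: "complex ^ 'n" by (auto simp: fs_def pf_def)
    show "norm (T f) \<le> C * B" using est[OF f(1) z0(1) f(2)] f(3) by (simp add: z0(2))
  next
    fix c :: "('n \<Rightarrow> nat) \<Rightarrow> complex" assume c: "fs c"
    show "T (pf c) = ?q c" using est[OF appr_pf[OF c] c, of 0] by simp
  qed
qed

text \<open>Every point \<open>z\<close> has its own compact set and its own functional
  \<open>T z\<close>. By \<open>est\<close> the values \<open>M f\<close> near \<open>z0\<close> are
  approximated uniformly by the diagonal operator applied to polynomials; this gives holomorphy of
  \<open>M f\<close> and, with the zero polynomial, continuity of \<open>M\<close>.\<close>

theorem ext_seq_multiplier:
  fixes Om :: "'n::finite \<Rightarrow> complex set"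
  assumes op: "\<And>j. open (Om j)" and R: "runge_domain (cart Om)" and a: "ext_seq Om a"
  shows "\<exists>M\<in>multipliers (cart Om). \<forall>\<alpha>. \<forall>z\<in>cart Om. M (zero_ext (cart Om) (mono_fun \<alpha>)) z = a \<alpha> * mono_fun \<alpha> z"
proof -
  let ?\<Omega> = "cart Om" and ?H = "hol_space (cart Om)"
  have opO: "open ?\<Omega>" by (rule open_cart[OF op])
  let ?q = "\<lambda>c. pf (\<lambda>\<alpha>. c \<alpha> * a \<alpha>)"
  have diff: "norm (?q c z - ?q d z) \<le> C * B"
    if "qbound a K C S" "z \<in> S" "fs c" "fs d" "B \<ge> 0" "\<forall>x\<in>K. norm (pf c x - pf d x) \<le> B" for K C S c d z B
  proof -
    have "fs (\<lambda>\<alpha>. c \<alpha> + (-1) * d \<alpha>)" by (rule pf_combine(1)[OF that(3,4)])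
    moreover have "\<forall>x\<in>K. norm (pf (\<lambda>\<alpha>. c \<alpha> + (-1) * d \<alpha>) x) \<le> B"
      using that(6) pf_combine(2)[OF that(3,4), of "-1"] by simp
    ultimately have "norm (pf (\<lambda>\<alpha>. (c \<alpha> + (-1) * d \<alpha>) * a \<alpha>) z) \<le> C * B"
      using that(1,2,5) unfolding qbound_def by blast
    then show ?thesis using pf_mult_combine[OF that(3,4), of "-1" a z] by simp
  qed
  obtain r K C where loc: "\<And>z. z \<in> ?\<Omega> \<Longrightarrow> r z > 0 \<and> compact (K z) \<and> K z \<subseteq> ?\<Omega> \<and> C z \<ge> 0 \<and> qbound a (K z) (C z) (ball z (r z))"
    using qbound_local[OF op R a] by metis
  have HA: "f \<in> appr (K z)" if "z \<in> ?\<Omega>" "f \<in> ?H" for z f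
    unfolding appr_def using hol_space_approx[OF R that(2), of "K z"] loc[OF that(1)] by blast
  have "\<exists>T. (\<forall>f\<in>appr (K z). \<forall>g\<in>appr (K z). \<forall>k. T (\<lambda>x. f x + k * g x) = T f + k * T g) \<and>
      (\<forall>f\<in>appr (K z). \<forall>B\<ge>0. (\<forall>x\<in>K z. norm (f x) \<le> B) \<longrightarrow> norm (T f) \<le> C z * B) \<and>
      (\<forall>c. fs c \<longrightarrow> T (pf c) = ?q c z)" if z: "z \<in> ?\<Omega>" for z
  proof -
    have q: "qbound a (K z) (C z) (ball z (r z))" "r z > 0" using loc[OF z] by blast+
    have "qbound a (K z) (C z) {z}" by (rule qbound_mono[OF q(1) subset_refl order_refl]) (use q(2) in simp)
    then show ?thesis
    proof (rule appr_functional)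
      show "C z \<ge> 0" using loc[OF z] by simp
      fix T
      assume "\<And>f g k. f \<in> appr (K z) \<Longrightarrow> g \<in> appr (K z) \<Longrightarrow> T (\<lambda>x. f x + k * g x) = T f + k * T g"
        "\<And>f B. f \<in> appr (K z) \<Longrightarrow> B \<ge> 0 \<Longrightarrow> (\<And>x. x \<in> K z \<Longrightarrow> norm (f x) \<le> B) \<Longrightarrow> norm (T f) \<le> C z * B"
        "\<And>c. fs c \<Longrightarrow> T (pf c) = ?q c z"
      then show ?thesis by (intro exI[of _ T] conjI ballI allI impI) simp_all
    qed
  qed
  then have "\<exists>T. \<forall>z\<in>?\<Omega>. (\<forall>f\<in>appr (K z). \<forall>g\<in>appr (K z). \<forall>k. T z (\<lambda>x. f x + k * g x) = T z f + k * T z g) \<and>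
      (\<forall>f\<in>appr (K z). \<forall>B\<ge>0. (\<forall>x\<in>K z. norm (f x) \<le> B) \<longrightarrow> norm (T z f) \<le> C z * B) \<and>
      (\<forall>c. fs c \<longrightarrow> T z (pf c) = ?q c z)"
    by (intro bchoice ballI)
  then obtain T where T: "\<forall>z\<in>?\<Omega>. (\<forall>f\<in>appr (K z). \<forall>g\<in>appr (K z). \<forall>k. T z (\<lambda>x. f x + k * g x) = T z f + k * T z g) \<and>
      (\<forall>f\<in>appr (K z). \<forall>B\<ge>0. (\<forall>x\<in>K z. norm (f x) \<le> B) \<longrightarrow> norm (T z f) \<le> C z * B) \<and>
      (\<forall>c. fs c \<longrightarrow> T z (pf c) = ?q c z)"
    by (elim exE)
  have T1: "T z (\<lambda>x. f x + k * g x) = T z f + k * T z g" if "z \<in> ?\<Omega>" "f \<in> appr (K z)" "g \<in> appr (K z)" for z f g k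
    using bspec[OF T that(1), THEN conjunct1] that(2,3) by simp
  have T2: "norm (T z f) \<le> C z * B" if "z \<in> ?\<Omega>" "f \<in> appr (K z)" "B \<ge> 0" "\<forall>x\<in>K z. norm (f x) \<le> B" for z f B
    using bspec[OF T that(1), THEN conjunct2, THEN conjunct1] that(2-4) by simp
  have T3: "T z (pf c) = ?q c z" if "z \<in> ?\<Omega>" "fs c" for z c
    using bspec[OF T that(1), THEN conjunct2, THEN conjunct2] that(2) by simp
  define M where "M f = (if f \<in> ?H then (\<lambda>z. if z \<in> ?\<Omega> then T z f else 0) else undefined)" for f
  have Mz: "M f z = T z f" if "f \<in> ?H" "z \<in> ?\<Omega>" for f z using that by (simp add: M_def)
  have M0: "M f z = 0" if "f \<in> ?H" "z \<notin> ?\<Omega>" for f z using that by (simp add: M_def)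
  \<comment> \<open>An auxiliary polynomial \<open>d\<close>, close to \<open>f\<close> on both
    compact sets, links the functional at \<open>z\<close> with the bound valid around
    \<open>z0\<close>; its error \<open>e\<close> is arbitrary.\<close>
  have est: "norm (M f z - ?q c z) \<le> C z0 * B"
    if z0: "z0 \<in> ?\<Omega>" and z: "z \<in> ball z0 (r z0) \<inter> ?\<Omega>" and f: "f \<in> ?H" and c: "fs c" "B \<ge> 0" "\<forall>x\<in>K z0. norm (f x - pf c x) \<le> B"
    for z0 z f c B
  proof -
    have zO: "z \<in> ?\<Omega>" using z by simp
    have nn: "C z0 + C z \<ge> 0" using loc z0 zO by (simp add: add_nonneg_nonneg)
    show ?thesis
    proof (rule le_if_le_eps[OF nn])
      fix e :: real assume e: "e > 0"
      obtain d where d: "fs d" "\<forall>x\<in>K z0 \<union> K z. norm (f x - pf d x) \<le> e"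
        using hol_space_approx[OF R f, of "K z0 \<union> K z" e] loc[OF z0] loc[OF zO] e by (auto intro: compact_Un)
      have "norm (M f z - ?q d z) \<le> C z * e"
      proof -
        have "T z (\<lambda>x. f x + (-1) * pf d x) = M f z - ?q d z"
          using T1[OF zO HA[OF zO f] appr_pf[OF d(1)], of "-1"] by (simp add: Mz[OF f zO] T3[OF zO d(1)])
        moreover have "norm (T z (\<lambda>x. f x + (-1) * pf d x)) \<le> C z * e"
          by (rule T2[OF zO appr_combine[OF HA[OF zO f] appr_pf[OF d(1)]]]) (use d(2) e in auto)
        ultimately show ?thesis by simp
      qed
      moreover have "norm (?q d z - ?q c z) \<le> C z0 * (e + B)"
      proof (rule diff)
        show "qbound a (K z0) (C z0) (ball z0 (r z0))" using loc[OF z0] by simp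
        show "\<forall>x\<in>K z0. norm (pf d x - pf c x) \<le> e + B"
        proof
          fix x assume x: "x \<in> K z0"
          have "pf d x - pf c x = (f x - pf c x) - (f x - pf d x)" by simp
          then have "norm (pf d x - pf c x) \<le> norm (f x - pf c x) + norm (f x - pf d x)"
            by (metis norm_triangle_ineq4)
          then show "norm (pf d x - pf c x) \<le> e + B" using c(3) d(2) x by force
        qed
      qed (use z c d e in auto)
      moreover have "norm (M f z - ?q c z) \<le> norm (M f z - ?q d z) + norm (?q d z - ?q c z)"
        using norm_triangle_ineq[of "M f z - ?q d z" "?q d z - ?q c z"] by simp
      ultimately show "norm (M f z - ?q c z) \<le> C z0 * B + (C z0 + C z) * e" by (simp add: algebra_simps)
    qed
  qed
  have MH: "M f \<in> ?H" if f: "f \<in> ?H" for f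
  proof -
    have "holo (M f) ?\<Omega>"
    proof (rule holo_uniform_limit[OF opO])
      fix z0 assume z0: "z0 \<in> ?\<Omega>"
      obtain s where s: "s > 0" "ball z0 s \<subseteq> ?\<Omega>" using opO z0 open_contains_ball by blast
      define t where "t = min s (r z0)"
      have t: "t > 0" "ball z0 t \<subseteq> ball z0 (r z0) \<inter> ?\<Omega>" using s loc[OF z0] by (auto simp: t_def)
      have "\<exists>G. holo G ?\<Omega> \<and> (\<forall>w\<in>ball z0 t. dist (G w) (M f w) \<le> e)" if e: "e > 0" for e
      proof -
        have C0: "C z0 \<ge> 0" using loc[OF z0] by simp
        then have "e / (C z0 + 1) > 0" using e by simp
        then obtain c where c: "fs c" "\<forall>x\<in>K z0. norm (f x - pf c x) \<le> e / (C z0 + 1)"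
          using hol_space_approx[OF R f, of "K z0"] loc[OF z0] by blast
        have "C z0 * (e / (C z0 + 1)) \<le> e" using C0 e by (simp add: field_simps)
        have "dist (?q c w) (M f w) \<le> e" if w: "w \<in> ball z0 t" for w
        proof -
          have "norm (M f w - ?q c w) \<le> C z0 * (e / (C z0 + 1))"
            by (rule est[OF z0 _ f c(1) less_imp_le[OF \<open>e / (C z0 + 1) > 0\<close>] c(2)]) (use t(2) w in blast)
          then show ?thesis using \<open>C z0 * (e / (C z0 + 1)) \<le> e\<close> by (simp add: dist_norm norm_minus_commute)
        qed
        moreover have "holo (?q c) ?\<Omega>" by (rule csh_imp_holo[OF csh_pf op])
        ultimately show ?thesis by blast
      qed
      then show "\<exists>t>0. ball z0 t \<subseteq> ?\<Omega> \<and> (\<forall>e>0. \<exists>G. holo G ?\<Omega> \<and> (\<forall>w\<in>ball z0 t. dist (G w) (M f w) \<le> e))"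
        using t by blast
    qed
    then show ?thesis using M0[OF f] by (simp add: hol_space_def)
  qed
  have lin: "M (\<lambda>z. f z + k * g z) z = M f z + k * M g z" if f: "f \<in> ?H" and g: "g \<in> ?H" for f g k z
  proof (cases "z \<in> ?\<Omega>")
    case False
    then show ?thesis using M0 f g hol_space_combine[OF opO f g] by simp
  next
    case z: True
    then show ?thesis
      using T1[OF z HA[OF z f] HA[OF z g]] by (simp add: Mz f g hol_space_combine[OF opO f g])
  qed
  have locM: "\<exists>r>0. \<exists>K C. compact K \<and> K \<subseteq> ?\<Omega> \<and> C \<ge> 0 \<and>
      (\<forall>f\<in>?H. \<forall>B\<ge>0. (\<forall>\<zeta>\<in>K. norm (f \<zeta>) \<le> B) \<longrightarrow> (\<forall>z'\<in>ball z r \<inter> ?\<Omega>. norm (M f z') \<le> C * B))" if z: "z \<in> ?\<Omega>" for z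
  proof -
    have z0: "fs (\<lambda>_. 0)" "pf (\<lambda>_. 0) x = 0" for x :: "complex ^ 'n" by (auto simp: fs_def pf_def)
    have "norm (M f z') \<le> C z * B" if "f \<in> ?H" "B \<ge> 0" "\<forall>\<zeta>\<in>K z. norm (f \<zeta>) \<le> B" "z' \<in> ball z (r z) \<inter> ?\<Omega>" for f B z'
      using est[OF z that(4,1) z0(1) that(2)] that(3) by (simp add: z0(2))
    then show ?thesis using loc[OF z] by blast
  qed
  have mono: "zero_ext ?\<Omega> (mono_fun \<alpha>) \<in> ?H" for \<alpha>
  proof -
    have "holo (mono_fun \<alpha>) ?\<Omega>" by (rule csh_imp_holo[OF csh_mono_fun op])
    then have "holo (zero_ext ?\<Omega> (mono_fun \<alpha>)) ?\<Omega>" by (rule holo_cong_open[OF _ opO]) (simp add: zero_ext_def)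
    then show ?thesis by (simp add: hol_space_def zero_ext_def)
  qed
  have Mmono: "M (zero_ext ?\<Omega> (mono_fun \<alpha>)) z = a \<alpha> * mono_fun \<alpha> z" if z: "z \<in> ?\<Omega>" for \<alpha> z
  proof -
    let ?c = "\<lambda>\<beta>. if \<beta> = \<alpha> then (1::complex) else 0"
    have "norm (M (zero_ext ?\<Omega> (mono_fun \<alpha>)) z - ?q ?c z) \<le> C z * 0"
    proof (rule est[OF z _ mono pf_single(2)])
      show "\<forall>x\<in>K z. norm (zero_ext ?\<Omega> (mono_fun \<alpha>) x - pf ?c x) \<le> 0"
        using loc[OF z] by (auto simp: zero_ext_def pf_single)
    qed (use z loc[OF z] in auto)
    moreover have "?q ?c z = a \<alpha> * mono_fun \<alpha> z"
    proof -
      have "(\<lambda>\<beta>. ?c \<beta> * a \<beta>) = (\<lambda>\<beta>. if \<beta> = \<alpha> then a \<alpha> else 0)" by auto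
      then show ?thesis using pf_single(1)[of \<alpha> "a \<alpha>" z] by simp
    qed
    ultimately show ?thesis by simp
  qed
  have zeroH: "(\<lambda>z. 0) \<in> ?H" using csh_imp_holo[OF csh_const op] by (simp add: hol_space_def)
  have "M \<in> multipliers ?\<Omega>"
    unfolding multipliers_def
  proof (intro CollectI conjI ballI allI)
    show "M \<in> extensional ?H" by (simp add: M_def extensional_def)
    show "continuous_map (hol_top ?\<Omega>) (hol_top ?\<Omega>) M"
      by (rule continuous_map_hol_top[OF opO MH lin locM])
    show "M (\<lambda>z. f z + g z) = (\<lambda>z. M f z + M g z)" if "f \<in> ?H" "g \<in> ?H" for f g
      using lin[OF that, of 1] by auto
    show "M (\<lambda>z. c * f z) = (\<lambda>z. c * M f z)" if f: "f \<in> ?H" for c f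
    proof
      fix z
      have "M (\<lambda>z. 0) z = 0" using lin[OF zeroH zeroH, of "-1" z] by simp
      then show "M (\<lambda>z. c * f z) z = c * M f z" using lin[OF zeroH f, of c z] by simp
    qed
    show "\<exists>m. \<forall>z\<in>?\<Omega>. M (zero_ext ?\<Omega> (mono_fun \<alpha>)) z = m * mono_fun \<alpha> z" for \<alpha>
      using Mmono by blast
  qed
  then show ?thesis using Mmono by blast
qed

subsection \<open>From multipliers to sequences\<close>

context
  fixes K :: "(complex ^ 'n::finite) set" and Om :: "'n \<Rightarrow> complex set" and z :: "complex ^ 'n"
    and m :: "('n \<Rightarrow> nat) \<Rightarrow> complex" and T :: "(complex ^ 'n \<Rightarrow> complex) \<Rightarrow> complex" and C :: real
  assumes op: "\<And>j. open (Om j)" and R: "runge_domain (cart Om)" and K: "compact K" "K \<subseteq> cart Om"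
    and z0: "\<And>j. z $ j \<noteq> 0" and C: "C \<ge> 0"
    and T_lin: "\<And>f g k. f \<in> appr K \<Longrightarrow> g \<in> appr K \<Longrightarrow> T (\<lambda>x. f x + k * g x) = T f + k * T g"
    and T_bound: "\<And>f B. f \<in> appr K \<Longrightarrow> B \<ge> 0 \<Longrightarrow> (\<And>x. x \<in> K \<Longrightarrow> norm (f x) \<le> B) \<Longrightarrow> norm (T f) \<le> C * B"
    and T_pf: "\<And>c. fs c \<Longrightarrow> T (pf c) = pf (\<lambda>\<alpha>. c \<alpha> * m \<alpha>) z"
begin

lemmas ap_mult = appr_mult[OF op R K] and ap_prod = appr_prod[OF op R K]
  and ap_holo = appr_holo[OF op R K] and ap_bounded = appr_bounded[OF op R K]
  and ap_perturb = appr_inverse_perturb[OF op R K]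

lemma T_diff_bound:
  assumes "f \<in> appr K" "g \<in> appr K" "B \<ge> 0" "\<And>x. x \<in> K \<Longrightarrow> norm (f x - g x) \<le> B"
  shows "norm (T f - T g) \<le> C * B"
proof -
  have "norm (T (\<lambda>x. f x + (-1) * g x)) \<le> C * B"
    by (rule T_bound[OF appr_combine[OF assms(1,2)] assms(3)]) (use assms(4) in simp)
  then show ?thesis using T_lin[OF assms(1,2), of "-1"] by simp
qed

lemma T_cong:
  assumes "f \<in> appr K" "\<And>x. x \<in> K \<Longrightarrow> f x = g x"
  shows "T f = T g"
  using T_diff_bound[OF assms(1) appr_cong[OF assms], of 0] assms(2) by simp

lemma T_cmult: "g \<in> appr K \<Longrightarrow> T (\<lambda>x. k * g x) = k * T g"
proof -
  assume g: "g \<in> appr K"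
  have 0: "T (\<lambda>x. 0) = 0" using T_bound[OF appr_const, of 0 0] by simp
  show ?thesis using T_lin[OF appr_const g, of 0 k] 0 by simp
qed

lemma T_continuous:
  fixes h :: "'p::metric_space \<Rightarrow> complex ^ 'n \<Rightarrow> complex"
  assumes h: "\<And>w. w \<in> U \<Longrightarrow> h w \<in> appr K" and cont: "continuous_on (U \<times> K) (\<lambda>p. h (fst p) (snd p))"
  shows "continuous_on U (\<lambda>w. T (h w))"
  unfolding continuous_on_def
proof (intro ballI tendstoI)
  fix w0 and e :: real assume w0: "w0 \<in> U" and e: "e > 0"
  define d where "d = e / (C + 1)"
  have d: "d > 0" "C * d < e" using e C by (auto simp: d_def field_simps)
  obtain Y where Y: "w0 \<in> Y" "open Y" "\<forall>w\<in>Y \<inter> U. \<forall>t\<in>K. dist (h w t) (h w0 t) \<le> d"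
    by (rule continuous_on_prod_compactE[OF cont K(1) w0 d(1)]) (rule that; simp)
  have "dist (T (h w)) (T (h w0)) < e" if w: "w \<in> Y" "w \<in> U" for w
  proof -
    have "norm (T (h w) - T (h w0)) \<le> C * d"
      by (rule T_diff_bound[OF h[OF w(2)] h[OF w0]]) (use d Y(3) w in \<open>auto simp: dist_norm\<close>)
    then show ?thesis using d(2) by (simp add: dist_norm)
  qed
  then show "\<forall>\<^sub>F w in at w0 within U. dist (T (h w)) (T (h w0)) < e"
    unfolding eventually_at_topological using Y(1,2) by blast
qed

text \<open>By \<open>1 / x - 1 / y = (y - x) / (x * y)\<close> the difference quotient is minus the
  value of \<open>T\<close> at \<open>S * N\<close> times two reciprocals, and this depends
  continuously on \<open>v\<close>.\<close>

lemma T_holomorphic: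
  fixes l :: "complex \<Rightarrow> complex ^ 'n \<Rightarrow> complex"
  assumes D: "open D" and l: "\<And>v \<zeta>. l v \<zeta> = A \<zeta> + v * N \<zeta>"
    and nz: "\<And>v \<zeta>. v \<in> D \<Longrightarrow> \<zeta> \<in> K \<Longrightarrow> l v \<zeta> \<noteq> 0"
    and ap: "\<And>v. v \<in> D \<Longrightarrow> (\<lambda>\<zeta>. 1 / l v \<zeta>) \<in> appr K" "S \<in> appr K" "N \<in> appr K"
    and cont: "continuous_on K S" "continuous_on K A" "continuous_on K N"
  shows "(\<lambda>v. T (\<lambda>\<zeta>. S \<zeta> * (1 / l v \<zeta>))) holomorphic_on D"
  unfolding holomorphic_on_open[OF D]
proof (intro ballI)
  fix v0 assume v0: "v0 \<in> D"
  let ?f = "\<lambda>v. T (\<lambda>\<zeta>. S \<zeta> * (1 / l v \<zeta>))"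
  let ?d = "\<lambda>v \<zeta>. S \<zeta> * N \<zeta> * ((1 / l v0 \<zeta>) * (1 / l v \<zeta>))"
  have S: "(\<lambda>\<zeta>. S \<zeta> * (1 / l v \<zeta>)) \<in> appr K" if "v \<in> D" for v by (rule ap_mult[OF ap(2) ap(1)[OF that]])
  have d: "?d v \<in> appr K" if "v \<in> D" for v
    by (rule ap_mult[OF ap_mult[OF ap(2,3)] ap_mult[OF ap(1)[OF v0] ap(1)[OF that]]])
  have f: "?f v - ?f v0 = - (v - v0) * T (?d v)" if v: "v \<in> D" for v
  proof -
    have "?f v = T (\<lambda>\<zeta>. S \<zeta> * (1 / l v0 \<zeta>) + (- (v - v0)) * ?d v \<zeta>)"
    proof (rule T_cong[OF S[OF v]])
      fix \<zeta> assume \<zeta>: "\<zeta> \<in> K"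
      have lv: "l v0 \<zeta> = l v \<zeta> - (v - v0) * N \<zeta>" by (simp add: l algebra_simps)
      have "1 / l v \<zeta> = 1 / l v0 \<zeta> + (- (v - v0)) * (N \<zeta> * ((1 / l v0 \<zeta>) * (1 / l v \<zeta>)))"
      proof -
        have inv: "1 / x = 1 / y + (- (x - y)) * ((1 / y) * (1 / x))" if "x \<noteq> 0" "y \<noteq> 0" for x y :: complex
          using that by (simp add: field_simps)
        have xy: "- (l v \<zeta> - l v0 \<zeta>) = (- (v - v0)) * N \<zeta>" by (simp add: lv algebra_simps)
        show ?thesis using inv[OF nz[OF v \<zeta>] nz[OF v0 \<zeta>]] unfolding xy by (simp only: mult.assoc)
      qed
      then show "S \<zeta> * (1 / l v \<zeta>) = S \<zeta> * (1 / l v0 \<zeta>) + (- (v - v0)) * ?d v \<zeta>"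
        by (metis (no_types, opaque_lifting) distrib_left mult.assoc mult.left_commute)
    qed
    also have "\<dots> = ?f v0 + (- (v - v0)) * T (?d v)" by (rule T_lin[OF S[OF v0] d[OF v]])
    finally show ?thesis by simp
  qed
  have "continuous_on D (\<lambda>v. T (?d v))"
  proof (rule T_continuous[OF d])
    have 1: "continuous_on (D \<times> K) (\<lambda>p. g (snd p))" if "continuous_on K g" for g :: "complex ^ 'n \<Rightarrow> complex"
      by (rule continuous_on_compose2[OF that continuous_on_snd[OF continuous_on_id]]) auto
    show "continuous_on (D \<times> K) (\<lambda>p. ?d (fst p) (snd p))"
      using nz v0 unfolding l by (intro continuous_intros 1 cont) (auto simp: l)
  qed
  then have "isCont (\<lambda>v. T (?d v)) v0" unfolding continuous_on_eq_continuous_at[OF D] using v0 by (rule bspec)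
  then have "((\<lambda>v. T (?d v)) \<longlongrightarrow> T (?d v0)) (at v0)" by (rule isContD)
  then have lim: "((\<lambda>v. - T (?d v)) \<longlongrightarrow> - T (?d v0)) (at v0)" by (rule tendsto_minus)
  have aux: "- t = y / (v - v0)" if "v \<noteq> v0" "y = - (v - v0) * t" for t y v
    using that by (simp add: eq_divide_eq algebra_simps)
  have "((\<lambda>v. (?f v - ?f v0) / (v - v0)) \<longlongrightarrow> - T (?d v0)) (at v0)"
  proof (rule Lim_transform_within_open[OF lim D v0])
    fix v assume "v \<in> D" "v \<noteq> v0"
    then show "- T (?d v) = (?f v - ?f v0) / (v - v0)" by (intro aux f)
  qed
  then show "\<exists>f'. (?f has_field_derivative f') (at v0)" unfolding has_field_derivative_iff by blast
qed

text \<open>\<open>p\<close> and \<open>q\<close> are homogeneous coordinates of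
  \<open>x = p / q\<close>, in which the Cauchy kernel is
  \<open>q * z $ j / (q * z $ j - p * \<zeta> $ j)\<close>. In this form infinity, where
  \<open>q = 0\<close>, is a point like any other.\<close>

definition gd :: "'n \<Rightarrow> complex \<Rightarrow> complex \<Rightarrow> bool" where
  "gd j p q \<longleftrightarrow> (\<forall>\<zeta>\<in>K. q * z $ j - p * \<zeta> $ j \<noteq> 0) \<and> (\<lambda>\<zeta>. 1 / (q * z $ j - p * \<zeta> $ j)) \<in> appr K"

lemma gd_scale:
  assumes "k \<noteq> 0"
  shows "gd j (k * p) (k * q) \<longleftrightarrow> gd j p q"
proof -
  have *: "gd j (k * p) (k * q)" if k: "k \<noteq> 0" and g: "gd j p q" for k p q
  proof -
    have "(\<lambda>\<zeta>. (1 / k) * (1 / (q * z $ j - p * \<zeta> $ j))) \<in> appr K"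
      by (rule appr_cmult) (use g in \<open>simp add: gd_def\<close>)
    moreover have eq: "k * q * z $ j - k * p * \<zeta> $ j = k * (q * z $ j - p * \<zeta> $ j)" for \<zeta> :: "complex ^ 'n"
      by (simp add: algebra_simps)
    ultimately show ?thesis using g k unfolding gd_def eq by simp
  qed
  show ?thesis using *[OF assms, of p q] *[of "1 / k" "k * p" "k * q"] assms by auto
qed

lemma coord_appr: "(\<lambda>\<zeta>. \<zeta> $ j) \<in> appr K"
  by (rule ap_holo[OF csh_coord[where f = "\<lambda>x. x"]]) simp

text \<open>A small change of the homogeneous coordinates changes the denominator by a function
  small on \<open>K\<close>, so \<open>appr_inverse_perturb\<close> applies. This openness is the
  source of the neighbourhood to which the germ extends.\<close>

lemma gd_open:
  assumes g: "gd j p q"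
  obtains d where "d > 0" "\<And>p' q'. norm (p' - p) < d \<Longrightarrow> norm (q' - q) < d \<Longrightarrow> gd j p' q'"
proof -
  let ?l = "\<lambda>\<zeta>::complex ^ 'n. q * z $ j - p * \<zeta> $ j"
  have l: "(\<lambda>\<zeta>. 1 / ?l \<zeta>) \<in> appr K" "\<And>\<zeta>. \<zeta> \<in> K \<Longrightarrow> ?l \<zeta> \<noteq> 0" using g by (auto simp: gd_def)
  obtain B where B: "B > 0" "\<And>x. x \<in> K \<Longrightarrow> norm (1 / ?l x) \<le> B" by (rule ap_bounded[OF l(1)]) (rule that; blast)
  obtain B' where B': "B' > 0" "\<And>x. x \<in> K \<Longrightarrow> norm (x $ j) \<le> B'" by (rule ap_bounded[OF coord_appr]) (rule that; blast)
  \<comment> \<open>The perturbation is at most \<open>d * (norm (z $ j) + B')\<close>, which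
    becomes \<open>1 / 2\<close> after multiplication by \<open>B\<close>.\<close>
  define d where "d = 1 / (2 * B * (norm (z $ j) + B'))"
  have zB: "norm (z $ j) + B' > 0" using B'(1) by (simp add: add_nonneg_pos)
  show ?thesis
  proof (rule that)
    show d0: "d > 0" unfolding d_def using B(1) zB by simp
    fix p' q' assume pq: "norm (p' - p) < d" "norm (q' - q) < d"
    let ?s = "\<lambda>\<zeta>::complex ^ 'n. - (q' - q) * z $ j + (p' - p) * \<zeta> $ j"
    have s: "?s \<in> appr K" by (rule appr_combine[OF appr_const coord_appr])
    have sB: "norm (?s \<zeta>) * B \<le> 1 / 2" if \<zeta>: "\<zeta> \<in> K" for \<zeta>
    proof -
      have "norm (?s \<zeta>) \<le> d * norm (z $ j) + d * B'"
        by (rule norm_triangle_mono; unfold norm_mult norm_minus_cancel; rule mult_mono)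
          (use pq B'(2)[OF \<zeta>] d0 in auto)
      then have "norm (?s \<zeta>) * B \<le> (d * norm (z $ j) + d * B') * B" using B(1) by (intro mult_right_mono) auto
      also have "\<dots> = (norm (z $ j) + B') * (d * B)" by (simp add: algebra_simps)
      also have "\<dots> = 1 / 2" unfolding d_def using zB B(1) by simp
      finally show ?thesis .
    qed
    have eq: "?l \<zeta> - ?s \<zeta> = q' * z $ j - p' * \<zeta> $ j" for \<zeta> by (simp add: algebra_simps)
    show "gd j p' q'"
      using ap_perturb[OF l B s sB] unfolding gd_def eq by blast
  qed
qed

text \<open>The factor in direction \<open>j\<close> of the domain of the extension. It depends on
  \<open>K\<close>, hence on the functional, and not only on \<open>Om j\<close>.\<close>

definition gset :: "'n \<Rightarrow> complex option set" where
  "gset j = {x. case x of None \<Rightarrow> gd j 1 0 | Some u \<Rightarrow> gd j u 1}"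

lemma gset_simps: "None \<in> gset j \<longleftrightarrow> gd j 1 0" "Some u \<in> gset j \<longleftrightarrow> gd j u 1"
  by (auto simp: gset_def)

lemma openin_gset: "openin rsphere (gset j)"
proof (rule rsphere_openI)
  show "open {u. Some u \<in> gset j}"
    unfolding open_dist
  proof (intro ballI)
    fix u assume "u \<in> {u. Some u \<in> gset j}"
    then have "gd j u 1" by (simp add: gset_simps)
    then obtain d where d: "d > 0" "\<And>p' q'. norm (p' - u) < d \<Longrightarrow> norm (q' - 1) < d \<Longrightarrow> gd j p' q'" by (rule gd_open) (rule that; blast)
    then have "gd j y 1" if "dist y u < d" for y using that by (simp add: dist_norm)
    then show "\<exists>e>0. \<forall>y. dist y u < e \<longrightarrow> y \<in> {u. Some u \<in> gset j}" using d(1) by (auto simp: gset_simps)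
  qed
next
  assume "None \<in> gset j"
  then have "gd j 1 0" by (simp add: gset_simps)
  then obtain d where d: "d > 0" "\<And>p' q'. norm (p' - 1) < d \<Longrightarrow> norm (q' - 0) < d \<Longrightarrow> gd j p' q'" by (rule gd_open) (rule that; blast)
  have "Some u \<in> gset j" if u: "norm u > 1 / d" for u
  proof -
    have u0: "u \<noteq> 0" using u d(1) by (metis divide_pos_pos norm_zero not_less_iff_gr_or_eq zero_less_one)
    then have "norm (1 / u) < d" using u d(1) by (simp add: norm_divide field_simps)
    then have "gd j 1 (1 / u)" using d by simp
    then show ?thesis using gd_scale[OF u0, of j 1 "1 / u"] u0 by (simp add: gset_simps)
  qed
  then show "\<exists>R. \<forall>u. norm u > R \<longrightarrow> Some u \<in> gset j" by blast
qed

text \<open>Homogeneous coordinates of the point with coordinate \<open>v\<close> in the chart \<open>I\<close>.\<close>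

definition hP :: "'n set \<Rightarrow> 'n \<Rightarrow> complex \<Rightarrow> complex" where "hP I j v = (if j \<in> I then 1 else v)"
definition hQ :: "'n set \<Rightarrow> 'n \<Rightarrow> complex \<Rightarrow> complex" where "hQ I j v = (if j \<in> I then v else 1)"

lemma csx_gset: "csx I j v \<in> gset j \<longleftrightarrow> gd j (hP I j v) (hQ I j v)"
  using gd_scale[of v j "1 / v" 1] by (cases "v = 0") (auto simp: csx_def gset_simps hP_def hQ_def)

text \<open>The value \<open>0\<close> at infinity is the limit of the kernel for
  \<open>\<xi> \<noteq> 0\<close>; it makes the extension vanish at points with an infinite
  coordinate.\<close>

definition kern :: "'n \<Rightarrow> complex option \<Rightarrow> complex \<Rightarrow> complex" where
  "kern j x \<xi> = (case x of None \<Rightarrow> 0 | Some u \<Rightarrow> z $ j / (z $ j - u * \<xi>))"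

lemma kern_csx: "kern j (csx I j v) \<xi> = (hQ I j v * z $ j) * (1 / (hQ I j v * z $ j - hP I j v * \<xi>))"
proof (cases "v = 0 \<or> j \<notin> I")
  case True
  then show ?thesis by (auto simp: kern_def csx_def hP_def hQ_def)
next
  case False
  then have "z $ j / (z $ j - 1 / v * \<xi>) = (v * z $ j) / (v * (z $ j - 1 / v * \<xi>))" by simp
  also have "v * (z $ j - 1 / v * \<xi>) = v * z $ j - \<xi>" using False by (simp add: algebra_simps)
  finally show ?thesis using False by (auto simp: kern_def csx_def hP_def hQ_def)
qed

definition ext_fun :: "('n \<Rightarrow> complex option) \<Rightarrow> complex" where
  "ext_fun x = T (\<lambda>\<zeta>. \<Prod>j\<in>UNIV. kern j (x j) (\<zeta> $ j))"

text \<open>The numerators of the kernels do not depend on \<open>\<zeta>\<close> and leave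
  \<open>T\<close> as a factor. The remaining denominators are affine in the chart coordinates,
  which is the situation of \<open>T_holomorphic\<close>.\<close>

lemma ext_fun_chart_csh:
  "csh (\<lambda>w. ext_fun (chart I w)) (\<lambda>j. {v. csx I j v \<in> gset j})" (is "csh _ ?D")
proof -
  let ?r = "\<lambda>j v \<zeta>::complex ^ 'n. 1 / (hQ I j v * z $ j - hP I j v * \<zeta> $ j)"
  have D: "gd j (hP I j v) (hQ I j v)" if "v \<in> ?D j" for j v using that by (simp add: csx_gset)
  have Dw: "gd j (hP I j (w $ j)) (hQ I j (w $ j))" if "w \<in> cart ?D" for j w
    by (rule D) (use that in \<open>auto simp: cart_def\<close>)
  have opD: "open (?D j)" for j by (rule open_csx[OF openin_gset])
  have r: "?r j v \<in> appr K" if "v \<in> ?D j" for j v using D[OF that] by (simp add: gd_def)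
  have rw: "?r j (w $ j) \<in> appr K" if "w \<in> cart ?D" for j w using Dw[OF that] by (simp add: gd_def)
  have nz: "hQ I j v * z $ j - hP I j v * \<zeta> $ j \<noteq> 0" if "v \<in> ?D j" "\<zeta> \<in> K" for j v \<zeta>
    using D[OF that(1)] that(2) by (simp add: gd_def)
  have nzw: "hQ I j (w $ j) * z $ j - hP I j (w $ j) * \<zeta> $ j \<noteq> 0" if "w \<in> cart ?D" "\<zeta> \<in> K" for j w \<zeta>
    using Dw[OF that(1)] that(2) by (simp add: gd_def)
  have lin: "hQ I j v * z $ j - hP I j v * \<zeta> $ j =
      (if j \<in> I then - \<zeta> $ j else z $ j) + v * (if j \<in> I then z $ j else - \<zeta> $ j)" for j v and \<zeta> :: "complex ^ 'n"
    by (simp add: hP_def hQ_def)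
  let ?T = "\<lambda>w. T (\<lambda>\<zeta>. \<Prod>j\<in>UNIV. ?r j (w $ j) \<zeta>)"
  have main: "csh ?T ?D"
    unfolding csh_def
  proof (intro conjI ballI allI)
    show "continuous_on (cart ?D) ?T"
    proof (rule T_continuous)
      show "(\<lambda>\<zeta>. \<Prod>j\<in>UNIV. ?r j (w $ j) \<zeta>) \<in> appr K" if "w \<in> cart ?D" for w by (rule ap_prod[OF rw[OF that]])
      show "continuous_on (cart ?D \<times> K) (\<lambda>p. \<Prod>j\<in>UNIV. ?r j (fst p $ j) (snd p))"
      proof (intro continuous_on_prod continuous_on_divide continuous_on_const)
        fix j
        show "\<forall>p\<in>cart ?D \<times> K. hQ I j (fst p $ j) * z $ j - hP I j (fst p $ j) * snd p $ j \<noteq> 0" using nzw by auto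
        show "continuous_on (cart ?D \<times> K) (\<lambda>p. hQ I j (fst p $ j) * z $ j - hP I j (fst p $ j) * snd p $ j)"
          unfolding hP_def hQ_def by (cases "j \<in> I") (auto intro!: continuous_intros)
      qed
    qed
    fix w j assume w: "w \<in> cart ?D"
    let ?S = "\<lambda>\<zeta>::complex ^ 'n. \<Prod>i\<in>UNIV - {j}. ?r i (w $ i) \<zeta>"
    have "(\<lambda>v. T (\<lambda>\<zeta>. ?S \<zeta> * ?r j v \<zeta>)) holomorphic_on ?D j"
    proof (rule T_holomorphic[OF opD lin nz r])
      show "?S \<in> appr K" by (rule ap_prod[OF rw[OF w]])
      show "(\<lambda>\<zeta>. if j \<in> I then z $ j else - \<zeta> $ j) \<in> appr K"
        using appr_cmult[OF coord_appr, of "-1" j] by (cases "j \<in> I") (auto intro: appr_const)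
      show "continuous_on K ?S" using nzw[OF w] by (intro continuous_intros) auto
      show "continuous_on K (\<lambda>\<zeta>. if j \<in> I then - \<zeta> $ j else z $ j)" "continuous_on K (\<lambda>\<zeta>. if j \<in> I then z $ j else - \<zeta> $ j)"
        by (cases "j \<in> I"; auto intro!: continuous_intros)+
    qed
    moreover have "(\<Prod>i\<in>UNIV. ?r i (vupd w j v $ i) \<zeta>) = ?S \<zeta> * ?r j v \<zeta>" for v \<zeta>
    proof -
      have "(\<Prod>i\<in>UNIV. ?r i (vupd w j v $ i) \<zeta>) = ?r j v \<zeta> * (\<Prod>i\<in>UNIV - {j}. ?r i (vupd w j v $ i) \<zeta>)"
        using prod.remove[of UNIV j "\<lambda>i. ?r i (vupd w j v $ i) \<zeta>"] by simp
      also have "(\<Prod>i\<in>UNIV - {j}. ?r i (vupd w j v $ i) \<zeta>) = ?S \<zeta>" by (rule prod.cong) auto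
      finally show ?thesis by (simp add: mult.commute)
    qed
    ultimately show "(\<lambda>v. ?T (vupd w j v)) holomorphic_on ?D j" by simp
  qed
  have "csh (\<lambda>w. (\<Prod>j\<in>UNIV. hQ I j (w $ j) * z $ j) * ?T w) ?D"
  proof (intro csh_mult csh_prod main csh_const)
    show "csh (\<lambda>w. hQ I j (w $ j)) ?D" for j
      by (rule csh_coord) (cases "j \<in> I"; simp add: hQ_def)
  qed
  then show ?thesis
  proof (rule csh_cong)
    fix w assume w: "w \<in> cart ?D"
    show "(\<Prod>j\<in>UNIV. hQ I j (w $ j) * z $ j) * ?T w = ext_fun (chart I w)"
      unfolding ext_fun_def chart_csx kern_csx prod.distrib
      unfolding prod.distrib[symmetric]
      by (subst prod.distrib, rule T_cmult[symmetric], rule ap_prod[OF rw[OF w]])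
  qed
qed

lemma sphere_hol0_ext_fun: "sphere_hol0 ext_fun (Pi UNIV gset)"
  unfolding sphere_hol0_def
proof (intro conjI ballI impI)
  show "sphere_hol ext_fun (Pi UNIV gset)"
    unfolding sphere_hol_product[OF openin_gset] using ext_fun_chart_csh by blast
  fix x :: "'n \<Rightarrow> complex option" assume "\<exists>j. x j = None"
  then obtain j where "x j = None" by blast
  then have P: "(\<Prod>j\<in>UNIV. kern j (x j) (\<zeta> $ j)) = 0" for \<zeta>
    by (intro prod_zero bexI[of _ j]) (simp_all add: kern_def)
  show "ext_fun x = 0" unfolding ext_fun_def P using T_bound[OF appr_const, of 0 0] by simp
qed

text \<open>For \<open>x\<close> in this set the denominator has no zero on \<open>Om j\<close>, so
  its reciprocal is holomorphic on all of \<open>cart Om\<close>, and the Runge property makes it a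
  uniform limit of polynomials on \<open>K\<close>.\<close>

lemma hat_set_gset: "hat_set Om z j \<subseteq> gset j"
proof
  have *: "gd j p q" if "\<And>a. a \<in> Om j \<Longrightarrow> q * z $ j - p * a \<noteq> 0" for p q
  proof -
    have "csh (\<lambda>\<zeta>. 1 / (q * z $ j - p * \<zeta> $ j)) Om"
      by (rule csh_coord[where f = "\<lambda>x. 1 / (q * z $ j - p * x)"]) (use that in \<open>auto intro!: holomorphic_intros\<close>)
    then show ?thesis unfolding gd_def using ap_holo that K(2) by (auto simp: cart_def)
  qed
  fix x assume x: "x \<in> hat_set Om z j"
  show "x \<in> gset j"
  proof (cases x)
    case None
    then show ?thesis using x *[of 0 1] by (auto simp: hat_set_None gset_simps)
  next
    case (Some u)
    have "1 * z $ j - u * a \<noteq> 0" if "a \<in> Om j" for a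
      using x that z0[of j] by (cases "a = 0") (auto simp: Some hat_set_Some)
    then show ?thesis unfolding Some gset_simps by (rule *)
  qed
qed

text \<open>For small \<open>w\<close> the product of the kernels is the geometric series in
  \<open>w $ j * \<zeta> $ j / z $ j\<close>, uniformly on \<open>K\<close>. By \<open>T_pf\<close>
  its terms are sent to \<open>m \<alpha> * mono_fun \<alpha> w\<close>, the powers of
  \<open>z\<close> cancelling.\<close>

lemma ext_fun_series:
  obtains r where "r > 0" "\<And>w. (\<And>j. norm (w $ j) < r) \<Longrightarrow> ((\<lambda>\<alpha>. m \<alpha> * mono_fun \<alpha> w) has_sum ext_fun (emb w)) UNIV"
proof -
  have "\<exists>B>0. \<forall>x\<in>K. norm (x $ j) \<le> B" for j by (rule ap_bounded[OF coord_appr]) blast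
  then obtain B where B: "\<And>j. B j > 0" "\<And>j x. x \<in> K \<Longrightarrow> norm (x $ j) \<le> B j" by metis
  \<comment> \<open>Chosen so that the ratios of the geometric series have norm at most
    \<open>1 / 2\<close> on \<open>K\<close>.\<close>
  define r where "r = Min (range (\<lambda>j. norm (z $ j) / (2 * B j)))"
  have r: "r > 0" unfolding r_def using B(1) z0 by (subst Min_gr_iff) auto
  have rj: "r * B j \<le> norm (z $ j) / 2" for j
  proof -
    have "r \<le> norm (z $ j) / (2 * B j)" unfolding r_def by (rule Min_le) auto
    then show ?thesis using B(1)[of j] by (simp add: field_simps)
  qed
  have "((\<lambda>\<alpha>. m \<alpha> * mono_fun \<alpha> w) has_sum ext_fun (emb w)) UNIV" if w: "\<And>j. norm (w $ j) < r" for w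
  proof -
    define u where "u \<zeta> = (\<chi> j. w $ j * \<zeta> $ j / z $ j)" for \<zeta> :: "complex ^ 'n"
    have u: "norm (u \<zeta> $ j) \<le> 1 / 2" if "\<zeta> \<in> K" for \<zeta> j
    proof -
      have "norm (w $ j) * norm (\<zeta> $ j) \<le> r * B j"
        by (rule mult_mono) (use w[of j] B(2)[OF that] r in auto)
      then show ?thesis using rj[of j] z0[of j] by (simp add: u_def norm_mult norm_divide field_simps)
    qed
    define F where "F \<zeta> = (\<Prod>j\<in>UNIV. kern j (emb w j) (\<zeta> $ j))" for \<zeta> :: "complex ^ 'n"
    have kern: "kern j (emb w j) (\<zeta> $ j) = 1 / (1 - u \<zeta> $ j)" for \<zeta> j
    proof -
      have "1 - u \<zeta> $ j = (z $ j - w $ j * \<zeta> $ j) / z $ j" using z0[of j] by (simp add: u_def field_simps)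
      then show ?thesis by (simp add: kern_def emb_def)
    qed
    have F: "F \<zeta> = (\<Sum>\<^sub>\<infinity>\<alpha>. 1 * mono_fun \<alpha> (u \<zeta>))" if "\<zeta> \<in> K" for \<zeta>
    proof -
      have "norm (u \<zeta> $ j) < 1" for j using u[OF that, of j] by simp
      then have "((\<lambda>\<alpha>. mono_fun \<alpha> (u \<zeta>)) has_sum (\<Prod>j\<in>UNIV. 1 / (1 - u \<zeta> $ j))) UNIV" by (rule geometric_has_sum)
      then show ?thesis unfolding F_def kern by (simp add: infsumI)
    qed
    have mono_u: "mono_fun \<alpha> (u \<zeta>) = (mono_fun \<alpha> w / mono_fun \<alpha> z) * mono_fun \<alpha> \<zeta>" for \<alpha> \<zeta>
      by (simp add: mono_fun_def u_def power_divide power_mult_distrib prod_dividef prod.distrib)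
    have mz: "mono_fun \<alpha> z \<noteq> 0" for \<alpha> using z0 by (simp add: mono_fun_def)
    define c where "c S \<alpha> = (if \<alpha> \<in> S then mono_fun \<alpha> w / mono_fun \<alpha> z else 0)" for S \<alpha>
    have c: "fs (c S)" "pf (c S) \<zeta> = (\<Sum>\<alpha>\<in>S. 1 * mono_fun \<alpha> (u \<zeta>))"
      "T (pf (c S)) = (\<Sum>\<alpha>\<in>S. m \<alpha> * mono_fun \<alpha> w)" if S: "finite S" for S \<zeta>
    proof -
      have sub: "{\<alpha>. c S \<alpha> \<noteq> 0} \<subseteq> S" "{\<alpha>. c S \<alpha> * m \<alpha> \<noteq> 0} \<subseteq> S" by (auto simp: c_def)
      show fs: "fs (c S)" unfolding fs_def by (rule finite_subset[OF sub(1) S])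
      show "pf (c S) \<zeta> = (\<Sum>\<alpha>\<in>S. 1 * mono_fun \<alpha> (u \<zeta>))"
        unfolding pf_superset[OF S sub(1)] by (rule sum.cong) (simp_all add: c_def mono_u)
      show "T (pf (c S)) = (\<Sum>\<alpha>\<in>S. m \<alpha> * mono_fun \<alpha> w)"
        unfolding T_pf[OF fs] pf_superset[OF S sub(2)] by (rule sum.cong) (simp_all add: c_def mz)
    qed
    have one: "bnd (\<lambda>_::'n \<Rightarrow> nat. 1) 1" unfolding bnd_def by auto
    have approx: "\<exists>S. finite S \<and> (\<forall>S'. finite S' \<longrightarrow> S \<subseteq> S' \<longrightarrow> (\<forall>\<zeta>\<in>K. norm (F \<zeta> - pf (c S') \<zeta>) \<le> e))" if e: "e > 0" for e
    proof -
      obtain S where S: "finite S" "\<forall>S' x. finite S' \<longrightarrow> S \<subseteq> S' \<longrightarrow> (\<forall>j. norm (x $ j) \<le> 1 / 2 * 1) \<longrightarrow>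
          dist (\<Sum>\<alpha>\<in>S'. 1 * mono_fun \<alpha> x) (\<Sum>\<^sub>\<infinity>\<alpha>. 1 * mono_fun \<alpha> (x :: complex ^ 'n)) < e"
        by (rule bnd_approx[OF one _ _ e, of "1/2"]) auto
      have "norm (F \<zeta> - pf (c S') \<zeta>) \<le> e" if "finite S'" "S \<subseteq> S'" "\<zeta> \<in> K" for S' \<zeta>
      proof -
        have "dist (\<Sum>\<alpha>\<in>S'. 1 * mono_fun \<alpha> (u \<zeta>)) (\<Sum>\<^sub>\<infinity>\<alpha>. 1 * mono_fun \<alpha> (u \<zeta>)) < e"
          using S(2) that(1,2) u[OF that(3)] by simp
        then show ?thesis unfolding F[OF that(3)] c(2)[OF that(1)] by (simp add: dist_norm norm_minus_commute)
      qed
      then show ?thesis using S(1) by blast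
    qed
    have Fa: "F \<in> appr K"
      unfolding appr_def
    proof (intro CollectI allI impI)
      fix e :: real assume "e > 0"
      then obtain S where "finite S" "\<forall>\<zeta>\<in>K. norm (F \<zeta> - pf (c S) \<zeta>) \<le> e" using approx by (meson order_refl)
      then show "\<exists>c. fs c \<and> (\<forall>x\<in>K. norm (F x - pf c x) \<le> e)" using c(1) by (intro exI[of _ "c S"] conjI)
    qed
    show ?thesis
      unfolding has_sum_def
    proof (rule tendstoI)
      fix e :: real assume e: "e > 0"
      define d where "d = e / (C + 1)"
      have d: "d > 0" "C * d < e" using e C by (auto simp: d_def field_simps)
      obtain S where S: "finite S" "\<And>S'. finite S' \<Longrightarrow> S \<subseteq> S' \<Longrightarrow> (\<forall>\<zeta>\<in>K. norm (F \<zeta> - pf (c S') \<zeta>) \<le> d)"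
        using approx[OF d(1)] by blast
      have "dist (\<Sum>\<alpha>\<in>S'. m \<alpha> * mono_fun \<alpha> w) (ext_fun (emb w)) < e" if S': "finite S'" "S \<subseteq> S'" for S'
      proof -
        have "norm (T F - T (pf (c S'))) \<le> C * d"
          by (rule T_diff_bound[OF Fa appr_pf[OF c(1)[OF S'(1)]]]) (use d S(2)[OF S'] in auto)
        moreover have "T F = ext_fun (emb w)" by (simp add: F_def[abs_def] ext_fun_def)
        ultimately show ?thesis using c(3)[OF S'(1)] d(2) by (simp add: dist_norm norm_minus_commute)
      qed
      then show "\<forall>\<^sub>F S' in finite_subsets_at_top UNIV. dist (\<Sum>\<alpha>\<in>S'. m \<alpha> * mono_fun \<alpha> w) (ext_fun (emb w)) < e"
        unfolding eventually_finite_subsets_at_top using S(1) by blast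
    qed
  qed
  then show ?thesis using that r by blast
qed

lemma functional_extension:
  "conv m \<and> (\<exists>Uh g. is_extension Om z (series_germ m) Uh g)"
proof -
  obtain r where r: "r > 0" "\<And>w. (\<And>j. norm (w $ j) < r) \<Longrightarrow> ((\<lambda>\<alpha>. m \<alpha> * mono_fun \<alpha> w) has_sum ext_fun (emb w)) UNIV"
    by (rule ext_fun_series) (rule that; blast)
  have "\<forall>\<^sub>F w in nhds 0. ((\<lambda>\<alpha>. m \<alpha> * mono_fun \<alpha> w) has_sum ext_fun (emb w)) UNIV"
    unfolding eventually_nhds_metric
  proof (intro exI conjI allI impI)
    show "r > 0" by (rule r(1))
    fix w :: "complex ^ 'n" assume "dist w 0 < r"
    then have "norm (w $ j) < r" for j using Finite_Cartesian_Product.norm_nth_le[of w j] by simp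
    then show "((\<lambda>\<alpha>. m \<alpha> * mono_fun \<alpha> w) has_sum ext_fun (emb w)) UNIV" by (rule r(2))
  qed
  then have "conv m" "eq_near origin (psum m) ext_fun" by (rule eventually_has_sum_imp_conv)+
  moreover from this have "is_extension Om z (series_germ m) gset ext_fun"
    unfolding is_extension_iff[OF z0] using openin_gset hat_set_gset sphere_hol0_ext_fun by blast
  ultimately show ?thesis by blast
qed

end

text \<open>The given point \<open>z\<close> supplies convergence of the series near the origin,
  which \<open>ext_seq\<close> demands separately from the extensions.\<close>

theorem qbound_imp_ext_seq:
  fixes Om :: "'n::finite \<Rightarrow> complex set"
  assumes op: "\<And>j. open (Om j)" and R: "runge_domain (cart Om)"
    and q: "\<And>z. z \<in> cart Om \<Longrightarrow> (\<And>j. z $ j \<noteq> 0) \<Longrightarrow> \<exists>K C. compact K \<and> K \<subseteq> cart Om \<and> C \<ge> 0 \<and> qbound m K C {z}"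
    and ne: "z \<in> cart Om" "\<And>j. z $ j \<noteq> 0"
  shows "ext_seq Om m"
proof -
  have *: "conv m \<and> (\<exists>Uh g. is_extension Om z (series_germ m) Uh g)" if z: "z \<in> cart Om" "\<And>j. z $ j \<noteq> 0" for z
  proof -
    obtain K C where K: "compact K" "K \<subseteq> cart Om" "C \<ge> 0" "qbound m K C {z}" using q[OF z] by blast
    show ?thesis
    proof (rule appr_functional[OF K(4,3)])
      fix T
      assume T: "\<And>f g k. f \<in> appr K \<Longrightarrow> g \<in> appr K \<Longrightarrow> T (\<lambda>x. f x + k * g x) = T f + k * T g"
        "\<And>f B. f \<in> appr K \<Longrightarrow> B \<ge> 0 \<Longrightarrow> (\<And>x. x \<in> K \<Longrightarrow> norm (f x) \<le> B) \<Longrightarrow> norm (T f) \<le> C * B"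
        "\<And>c. fs c \<Longrightarrow> T (pf c) = pf (\<lambda>\<alpha>. c \<alpha> * m \<alpha>) z"
      show ?thesis
        by (rule functional_extension[where T = T, OF op R K(1,2) z(2) K(3)]) (fact T)+
    qed
  qed
  show ?thesis unfolding ext_seq_def using * ne by blast
qed

subsection \<open>Multipliers and their sequences\<close>

lemma nonzero_point:
  fixes \<Omega> :: "(complex ^ 'n::finite) set"
  assumes "open \<Omega>" "\<Omega> \<noteq> {}"
  obtains z where "z \<in> \<Omega>" "\<And>j. z $ j \<noteq> 0"
proof -
  obtain z where "z \<in> \<Omega>" using assms(2) by blast
  then obtain r where r: "r > 0" "cart (\<lambda>j. cball (z $ j) r) \<subseteq> \<Omega>" using polydisc_in_open[OF assms(1)] by blast
  let ?w = "\<chi> j. if z $ j = 0 then complex_of_real r else z $ j"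
  have "?w \<in> cart (\<lambda>j. cball (z $ j) r)" using r(1) by (auto simp: cart_def dist_norm)
  then show ?thesis using that[of ?w] r by auto
qed

context
  fixes Om :: "'n::finite \<Rightarrow> complex set" and \<Omega> :: "(complex ^ 'n) set"
  assumes op: "\<And>j. open (Om j)" and \<Omega>: "\<Omega> = cart Om" and R: "runge_domain \<Omega>"
begin

lemma open_dom: "open \<Omega>"
  using R by (simp add: runge_domain_def)

lemma nonzero_point_dom:
  obtains z where "z \<in> \<Omega>" "\<And>j. z $ j \<noteq> 0"
  using nonzero_point[OF open_dom] R by (auto simp: runge_domain_def)

lemma zero_ext_hol_space: "csh f Om \<Longrightarrow> zero_ext \<Omega> f \<in> hol_space \<Omega>"
proof -
  assume "csh f Om"
  then have "holo f \<Omega>" unfolding \<Omega> by (rule csh_imp_holo[OF _ op])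
  then have "holo (zero_ext \<Omega> f) \<Omega>" by (rule holo_cong_open[OF _ open_dom]) (simp add: zero_ext_def)
  then show ?thesis by (simp add: hol_space_def zero_ext_def)
qed

lemma hol_space_csh: "f \<in> hol_space \<Omega> \<Longrightarrow> csh f Om"
  unfolding hol_space_def \<Omega> by (auto intro: holo_imp_csh)

lemma hol_space_outside: "f \<in> hol_space \<Omega> \<Longrightarrow> z \<notin> \<Omega> \<Longrightarrow> f z = 0"
  by (simp add: hol_space_def)

lemma zero_hol_space: "(\<lambda>z. 0) \<in> hol_space \<Omega>"
  using zero_ext_hol_space[OF csh_const[of 0]] by (simp add: zero_ext_def[abs_def] if_distrib cong: if_cong)

lemma mult_hol_space: "M \<in> multipliers \<Omega> \<Longrightarrow> f \<in> hol_space \<Omega> \<Longrightarrow> M f \<in> hol_space \<Omega>"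
  using continuous_map_image_subset_topspace[of "hol_top \<Omega>" "hol_top \<Omega>" M]
  unfolding multipliers_def topspace_hol_top by blast

lemma mult_linear:
  assumes M: "M \<in> multipliers \<Omega>" and f: "f \<in> hol_space \<Omega>" and g: "g \<in> hol_space \<Omega>"
  shows "M (\<lambda>z. f z + k * g z) z = M f z + k * M g z"
proof -
  have "(\<lambda>z. k * g z) \<in> hol_space \<Omega>" using hol_space_combine[OF open_dom zero_hol_space g, of k] by simp
  moreover have "\<forall>f\<in>hol_space \<Omega>. \<forall>g\<in>hol_space \<Omega>. M (\<lambda>z. f z + g z) = (\<lambda>z. M f z + M g z)"
    using M unfolding multipliers_def by blast
  ultimately have "M (\<lambda>z. f z + k * g z) = (\<lambda>z. M f z + M (\<lambda>z. k * g z) z)" using f by (simp only:)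
  moreover have "M (\<lambda>z. k * g z) = (\<lambda>z. k * M g z)" using M g unfolding multipliers_def by blast
  ultimately show ?thesis by simp
qed

lemma mult_cmult:
  assumes M: "M \<in> multipliers \<Omega>" and g: "g \<in> hol_space \<Omega>"
  shows "M (\<lambda>z. k * g z) = (\<lambda>z. k * M g z)"
  using M g unfolding multipliers_def by blast

lemma mult_seq_eqI:
  assumes "\<And>\<alpha> z. z \<in> \<Omega> \<Longrightarrow> M (zero_ext \<Omega> (mono_fun \<alpha>)) z = a \<alpha> * mono_fun \<alpha> z"
  shows "mult_seq \<Omega> M = a"
proof
  fix \<alpha>
  obtain z where z: "z \<in> \<Omega>" "\<And>j. z $ j \<noteq> 0" by (rule nonzero_point_dom) (rule that; blast)
  have nz: "mono_fun \<alpha> z \<noteq> 0" using z(2) by (simp add: mono_fun_def)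
  show "mult_seq \<Omega> M \<alpha> = a \<alpha>"
    unfolding mult_seq_def
  proof (rule the_equality)
    show "\<forall>z\<in>\<Omega>. M (zero_ext \<Omega> (mono_fun \<alpha>)) z = a \<alpha> * mono_fun \<alpha> z" using assms by blast
    fix m assume "\<forall>z\<in>\<Omega>. M (zero_ext \<Omega> (mono_fun \<alpha>)) z = m * mono_fun \<alpha> z"
    from bspec[OF this z(1)] have "m * mono_fun \<alpha> z = a \<alpha> * mono_fun \<alpha> z" unfolding assms[OF z(1)] by (rule sym)
    then show "m = a \<alpha>" using nz by simp
  qed
qed

lemma mult_mono:
  assumes M: "M \<in> multipliers \<Omega>" and z: "z \<in> \<Omega>"
  shows "M (zero_ext \<Omega> (mono_fun \<alpha>)) z = mult_seq \<Omega> M \<alpha> * mono_fun \<alpha> z"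
proof -
  have "\<forall>\<alpha>. \<exists>m. \<forall>z\<in>\<Omega>. M (zero_ext \<Omega> (mono_fun \<alpha>)) z = m * mono_fun \<alpha> z"
    using M unfolding multipliers_def by blast
  then obtain a where a: "\<And>\<alpha> z. z \<in> \<Omega> \<Longrightarrow> M (zero_ext \<Omega> (mono_fun \<alpha>)) z = a \<alpha> * mono_fun \<alpha> z" by metis
  show ?thesis using a[OF z] mult_seq_eqI[of M a, OF a] by simp
qed

lemma mult_pf:
  assumes M: "M \<in> multipliers \<Omega>" and c: "fs c" and z: "z \<in> \<Omega>"
  shows "M (zero_ext \<Omega> (pf c)) z = pf (\<lambda>\<alpha>. c \<alpha> * mult_seq \<Omega> M \<alpha>) z"
proof -
  have *: "M (zero_ext \<Omega> (\<lambda>z. \<Sum>\<alpha>\<in>A. c \<alpha> * mono_fun \<alpha> z)) z = (\<Sum>\<alpha>\<in>A. c \<alpha> * mult_seq \<Omega> M \<alpha> * mono_fun \<alpha> z)"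
    if "finite A" for A
    using that
  proof (induction A)
    case empty
    have "M (\<lambda>z. 0) z = 0" using mult_cmult[OF M zero_hol_space, of 0] by simp
    then show ?case by (simp add: zero_ext_def)
  next
    case (insert \<alpha> A)
    have "csh (\<lambda>z. \<Sum>\<alpha>\<in>A. c \<alpha> * mono_fun \<alpha> z) Om" by (intro csh_sum csh_mult csh_const csh_mono_fun)
    then have A: "zero_ext \<Omega> (\<lambda>z. \<Sum>\<alpha>\<in>A. c \<alpha> * mono_fun \<alpha> z) \<in> hol_space \<Omega>" by (rule zero_ext_hol_space)
    have \<alpha>: "zero_ext \<Omega> (mono_fun \<alpha>) \<in> hol_space \<Omega>" by (rule zero_ext_hol_space[OF csh_mono_fun])
    have "zero_ext \<Omega> (\<lambda>z. \<Sum>\<alpha>\<in>insert \<alpha> A. c \<alpha> * mono_fun \<alpha> z) =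
        (\<lambda>z. zero_ext \<Omega> (\<lambda>z. \<Sum>\<alpha>\<in>A. c \<alpha> * mono_fun \<alpha> z) z + c \<alpha> * zero_ext \<Omega> (mono_fun \<alpha>) z)"
      using insert by (auto simp: zero_ext_def)
    then show ?case
      using insert mult_linear[OF M A \<alpha>, of "c \<alpha>" z] mult_mono[OF M z, of \<alpha>] by simp
  qed
  have "finite {\<alpha>. c \<alpha> \<noteq> 0}" using c by (simp add: fs_def)
  moreover have "pf c = (\<lambda>z. \<Sum>\<alpha> | c \<alpha> \<noteq> 0. c \<alpha> * mono_fun \<alpha> z)" by (rule HOL.ext) (simp add: pf_def)
  ultimately show ?thesis unfolding pf_mult[OF c] using * by simp
qed

text \<open>The preimage of a neighbourhood of \<open>0\<close> contains a basic one, given by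
  \<open>K\<close> and \<open>e\<close>; scaling turns this into a norm estimate.\<close>

lemma mult_bound_compact:
  assumes M: "M \<in> multipliers \<Omega>" and L: "compact L" "L \<subseteq> \<Omega>"
  obtains K C where "compact K" "K \<subseteq> \<Omega>" "C \<ge> 0"
    "\<And>f B. f \<in> hol_space \<Omega> \<Longrightarrow> B \<ge> 0 \<Longrightarrow> (\<And>\<zeta>. \<zeta> \<in> K \<Longrightarrow> norm (f \<zeta>) \<le> B) \<Longrightarrow> (\<forall>z\<in>L. norm (M f z) \<le> C * B)"
proof -
  let ?H = "hol_space \<Omega>"
  \<comment> \<open>The margin \<open>s < 1\<close> makes this set open at once, with room for
    perturbations smaller than \<open>(1 - s) / 2\<close>.\<close>
  let ?V = "{h \<in> ?H. \<exists>s<1. \<forall>z\<in>L. norm (h z) \<le> s}"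
  have "openin (hol_top \<Omega>) ?V"
    unfolding openin_hol_top
  proof (intro conjI ballI)
    fix f assume "f \<in> ?V"
    then obtain s where s: "s < 1" "\<forall>z\<in>L. norm (f z) \<le> s" by blast
    have "{g \<in> ?H. \<forall>z\<in>L. dist (f z) (g z) < (1 - s) / 2} \<subseteq> ?V"
    proof clarify
      fix g assume g: "g \<in> ?H" "\<forall>z\<in>L. dist (f z) (g z) < (1 - s) / 2"
      have "norm (g z) \<le> (1 + s) / 2" if z: "z \<in> L" for z
      proof -
        have "norm (g z) \<le> norm (f z) + dist (f z) (g z)"
          using norm_triangle_sub[of "g z" "f z"] by (simp add: dist_norm norm_minus_commute)
        then show ?thesis using s(2) g(2) z by (simp add: field_simps) (smt (verit))
      qed
      then show "\<exists>s<1. \<forall>z\<in>L. norm (g z) \<le> s" using s(1) by (intro exI[of _ "(1 + s) / 2"]) auto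
    qed
    then show "\<exists>K e. compact K \<and> K \<subseteq> \<Omega> \<and> 0 < e \<and> {g \<in> ?H. \<forall>z\<in>K. dist (f z) (g z) < e} \<subseteq> ?V"
      using L s(1) by (intro exI[of _ L] exI[of _ "(1 - s) / 2"]) auto
  qed blast
  moreover have "continuous_map (hol_top \<Omega>) (hol_top \<Omega>) M" using M unfolding multipliers_def by blast
  ultimately have "openin (hol_top \<Omega>) {f \<in> ?H. M f \<in> ?V}"
    using openin_continuous_map_preimage[of "hol_top \<Omega>" "hol_top \<Omega>" M ?V] by (simp only: topspace_hol_top)
  moreover have "(\<lambda>z. 0) \<in> {f \<in> ?H. M f \<in> ?V}"
  proof -
    have "M (\<lambda>z. 0) = (\<lambda>z. 0)" using mult_cmult[OF M zero_hol_space, of 0] by simp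
    moreover have "\<exists>s<1. \<forall>z\<in>L. norm (0::complex) \<le> s" by (intro exI[of _ 0]) simp
    ultimately show ?thesis using zero_hol_space by simp
  qed
  ultimately obtain K e where K: "compact K" "K \<subseteq> \<Omega>" "(0::real) < e"
    "{g \<in> ?H. \<forall>z\<in>K. dist 0 (g z) < e} \<subseteq> {f \<in> ?H. M f \<in> ?V}"
    unfolding openin_hol_top by meson
  have small: "norm (M g z) \<le> 1" if "g \<in> ?H" "\<And>\<zeta>. \<zeta> \<in> K \<Longrightarrow> norm (g \<zeta>) < e" "z \<in> L" for g z
  proof -
    have "g \<in> {g \<in> ?H. \<forall>z\<in>K. dist 0 (g z) < e}" using that by simp
    then have "M g \<in> ?V" using K(4) by blast
    then show ?thesis using that(3) by force
  qed
  have "norm (M f z) \<le> 2 / e * B" if f: "f \<in> ?H" "B \<ge> 0" "\<And>\<zeta>. \<zeta> \<in> K \<Longrightarrow> norm (f \<zeta>) \<le> B" and z: "z \<in> L" for f B z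
  proof (rule le_if_le_eps)
    show "2 / e \<ge> 0" using K(3) by simp
    fix d :: real assume d: "d > 0"
    \<comment> \<open>The summand \<open>d > 0\<close> keeps the denominator positive when
      \<open>B = 0\<close>; it is arbitrarily small in the end.\<close>
    define t where "t = e / (2 * (B + d))"
    have t: "t > 0" "t * B < e" using K(3) d f(2) by (auto simp: t_def field_simps add_nonneg_pos intro!: add_nonneg_pos)
    have tH: "(\<lambda>z. of_real t * f z) \<in> ?H" using hol_space_combine[OF open_dom zero_hol_space f(1), of "of_real t"] by simp
    have "norm (M (\<lambda>z. of_real t * f z) z) \<le> 1"
    proof (rule small[OF tH _ z])
      fix \<zeta> assume "\<zeta> \<in> K"
      then have "t * norm (f \<zeta>) \<le> t * B" using f(3) t(1) by (intro mult_left_mono) auto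
      from le_less_trans[OF this t(2)] show "norm (of_real t * f \<zeta>) < e" using t(1) by (simp add: norm_mult)
    qed
    then have "t * norm (M f z) \<le> 1" using t(1) by (simp add: mult_cmult[OF M f(1)] norm_mult)
    then have "norm (M f z) \<le> 1 / t" using t(1) by (simp add: field_simps)
    also have "\<dots> = 2 / e * B + 2 / e * d" unfolding t_def by (simp add: distrib_left add_divide_distrib)
    finally show "norm (M f z) \<le> 2 / e * B + 2 / e * d" .
  qed
  then show ?thesis using that[OF K(1,2), of "2 / e"] K(3) by simp
qed

lemma mult_approx:
  assumes M: "M \<in> multipliers \<Omega>" and z: "z \<in> \<Omega>"
  obtains K C where "compact K" "K \<subseteq> \<Omega>" "C \<ge> 0"
    "\<And>f c B. f \<in> hol_space \<Omega> \<Longrightarrow> fs c \<Longrightarrow> B \<ge> 0 \<Longrightarrow> (\<And>\<zeta>. \<zeta> \<in> K \<Longrightarrow> norm (f \<zeta> - pf c \<zeta>) \<le> B) \<Longrightarrow>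
      norm (M f z - pf (\<lambda>\<alpha>. c \<alpha> * mult_seq \<Omega> M \<alpha>) z) \<le> C * B"
proof -
  have z': "compact {z}" "{z} \<subseteq> \<Omega>" using z by auto
  obtain K C where K: "compact K" "K \<subseteq> \<Omega>" "C \<ge> 0"
    "\<And>f B. f \<in> hol_space \<Omega> \<Longrightarrow> B \<ge> 0 \<Longrightarrow> (\<And>\<zeta>. \<zeta> \<in> K \<Longrightarrow> norm (f \<zeta>) \<le> B) \<Longrightarrow> (\<forall>w\<in>{z}. norm (M f w) \<le> C * B)"
    by (rule mult_bound_compact[OF M z']) (rule that; blast)
  show ?thesis
  proof (rule that[OF K(1-3)])
    fix f c B assume f: "f \<in> hol_space \<Omega>" and c: "fs c" and B: "(0::real) \<le> B" "\<And>\<zeta>. \<zeta> \<in> K \<Longrightarrow> norm (f \<zeta> - pf c \<zeta>) \<le> B"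
    let ?p = "zero_ext \<Omega> (pf c)"
    have p: "?p \<in> hol_space \<Omega>" by (rule zero_ext_hol_space[OF csh_pf])
    have "norm (f \<zeta> + (-1) * ?p \<zeta>) \<le> B" if "\<zeta> \<in> K" for \<zeta>
      using B(2)[OF that] that K(2) by (auto simp: zero_ext_def)
    then have "norm (M (\<lambda>\<zeta>. f \<zeta> + (-1) * ?p \<zeta>) z) \<le> C * B"
      using K(4)[OF hol_space_combine[OF open_dom f p, of "-1"] B(1)] by simp
    then show "norm (M f z - pf (\<lambda>\<alpha>. c \<alpha> * mult_seq \<Omega> M \<alpha>) z) \<le> C * B"
      unfolding mult_linear[OF M f p] mult_pf[OF M c z] by simp
  qed
qed

lemma mult_seq_ext_seq:
  assumes M: "M \<in> multipliers \<Omega>"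
  shows "ext_seq Om (mult_seq \<Omega> M)"
proof -
  obtain z where z: "z \<in> \<Omega>" "\<And>j. z $ j \<noteq> 0" by (rule nonzero_point_dom) (rule that; blast)
  show ?thesis
  proof (rule qbound_imp_ext_seq[OF op])
    show "runge_domain (cart Om)" using R by (simp add: \<Omega>)
    show "z \<in> cart Om" "z $ j \<noteq> 0" for j using z by (simp_all add: \<Omega>)
    fix w assume "w \<in> cart Om"
    then have w: "w \<in> \<Omega>" by (simp add: \<Omega>)
    obtain K C where K: "compact K" "K \<subseteq> \<Omega>" "C \<ge> 0"
      "\<And>f c B. f \<in> hol_space \<Omega> \<Longrightarrow> fs c \<Longrightarrow> B \<ge> 0 \<Longrightarrow> (\<And>\<zeta>. \<zeta> \<in> K \<Longrightarrow> norm (f \<zeta> - pf c \<zeta>) \<le> B) \<Longrightarrow>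
        norm (M f w - pf (\<lambda>\<alpha>. c \<alpha> * mult_seq \<Omega> M \<alpha>) w) \<le> C * B"
      by (rule mult_approx[OF M w]) (rule that; blast)
    have M0: "M (\<lambda>z. 0) w = 0" using mult_cmult[OF M zero_hol_space, of 0] by simp
    have "qbound (mult_seq \<Omega> M) K C {w}"
      unfolding qbound_def using K(4)[OF zero_hol_space] M0 by simp
    then show "\<exists>K C. compact K \<and> K \<subseteq> cart Om \<and> C \<ge> 0 \<and> qbound (mult_seq \<Omega> M) K C {w}"
      using K(1-3) unfolding \<Omega> by blast
  qed
qed

lemma ext_seq_imp_mult_seq:
  assumes "ext_seq Om a"
  obtains M where "M \<in> multipliers \<Omega>" "mult_seq \<Omega> M = a"
proof -
  obtain M where "M \<in> multipliers \<Omega>" "\<forall>\<alpha>. \<forall>z\<in>\<Omega>. M (zero_ext \<Omega> (mono_fun \<alpha>)) z = a \<alpha> * mono_fun \<alpha> z"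
    using ext_seq_multiplier[OF op _ assms] R unfolding \<Omega> by blast
  then show ?thesis using that[of M] mult_seq_eqI[of M a] by blast
qed

text \<open>Both operators are continuous and agree on polynomials, which are dense by the Runge
  property.\<close>

lemma multiplier_eqI:
  assumes M: "M \<in> multipliers \<Omega>" and N: "N \<in> multipliers \<Omega>" and eq: "mult_seq \<Omega> M = mult_seq \<Omega> N"
  shows "M = N"
proof (rule extensionalityI[of M "hol_space \<Omega>"])
  show "M \<in> extensional (hol_space \<Omega>)" "N \<in> extensional (hol_space \<Omega>)" using M N unfolding multipliers_def by blast+
  fix f assume f: "f \<in> hol_space \<Omega>"
  show "M f = N f"
  proof
    fix z
    show "M f z = N f z"
    proof (cases "z \<in> \<Omega>")
      case False
      then show ?thesis using hol_space_outside mult_hol_space[OF M f] mult_hol_space[OF N f] by metis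
    next
      case z: True
      obtain K C where K: "compact K" "K \<subseteq> \<Omega>" "C \<ge> 0"
        "\<And>f c B. f \<in> hol_space \<Omega> \<Longrightarrow> fs c \<Longrightarrow> B \<ge> 0 \<Longrightarrow> (\<And>\<zeta>. \<zeta> \<in> K \<Longrightarrow> norm (f \<zeta> - pf c \<zeta>) \<le> B) \<Longrightarrow>
          norm (M f z - pf (\<lambda>\<alpha>. c \<alpha> * mult_seq \<Omega> M \<alpha>) z) \<le> C * B"
        by (rule mult_approx[OF M z]) (rule that; blast)
      obtain K' C' where K': "compact K'" "K' \<subseteq> \<Omega>" "C' \<ge> 0"
        "\<And>f c B. f \<in> hol_space \<Omega> \<Longrightarrow> fs c \<Longrightarrow> B \<ge> 0 \<Longrightarrow> (\<And>\<zeta>. \<zeta> \<in> K' \<Longrightarrow> norm (f \<zeta> - pf c \<zeta>) \<le> B) \<Longrightarrow>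
          norm (N f z - pf (\<lambda>\<alpha>. c \<alpha> * mult_seq \<Omega> N \<alpha>) z) \<le> C' * B"
        by (rule mult_approx[OF N z]) (rule that; blast)
      have "norm (M f z - N f z) \<le> 0"
      proof (rule le_if_le_eps)
        show "C + C' \<ge> 0" using K(3) K'(3) by simp
        fix e :: real assume e: "e > 0"
        obtain c where c: "fs c" "\<forall>x\<in>K \<union> K'. norm (f x - pf c x) \<le> e"
          using hol_space_approx[OF R f, of "K \<union> K'" e] K K' e by (auto intro: compact_Un)
        let ?y = "pf (\<lambda>\<alpha>. c \<alpha> * mult_seq \<Omega> M \<alpha>) z"
        have "norm (M f z - ?y) \<le> C * e" by (rule K(4)[OF f c(1)]) (use c(2) e in auto)
        moreover have "norm (N f z - ?y) \<le> C' * e" unfolding eq by (rule K'(4)[OF f c(1)]) (use c(2) e in auto)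
        moreover have "norm (M f z - N f z) \<le> norm (M f z - ?y) + norm (N f z - ?y)"
          using norm_triangle_ineq4[of "M f z - ?y" "N f z - ?y"] by simp
        ultimately show "norm (M f z - N f z) \<le> 0 + (C + C') * e" by (simp add: distrib_right)
      qed
      then show ?thesis by simp
    qed
  qed
qed

section \<open>Operations on multipliers\<close>

lemma multiplierI:
  assumes ext: "M \<in> extensional (hol_space \<Omega>)" and H: "\<And>f. f \<in> hol_space \<Omega> \<Longrightarrow> M f \<in> hol_space \<Omega>"
    and lin: "\<And>f g k z. f \<in> hol_space \<Omega> \<Longrightarrow> g \<in> hol_space \<Omega> \<Longrightarrow> M (\<lambda>z. f z + k * g z) z = M f z + k * M g z"
    and bound: "\<And>L. compact L \<Longrightarrow> L \<subseteq> \<Omega> \<Longrightarrow> \<exists>K C. compact K \<and> K \<subseteq> \<Omega> \<and> C \<ge> 0 \<and>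
      (\<forall>f\<in>hol_space \<Omega>. \<forall>B\<ge>0. (\<forall>\<zeta>\<in>K. norm (f \<zeta>) \<le> B) \<longrightarrow> (\<forall>z\<in>L. norm (M f z) \<le> C * B))"
    and mono: "\<And>\<alpha> z. z \<in> \<Omega> \<Longrightarrow> M (zero_ext \<Omega> (mono_fun \<alpha>)) z = a \<alpha> * mono_fun \<alpha> z"
  shows "M \<in> multipliers \<Omega> \<and> mult_seq \<Omega> M = a"
proof
  show "M \<in> multipliers \<Omega>"
    unfolding multipliers_def
  proof (intro CollectI conjI ballI allI)
    show "continuous_map (hol_top \<Omega>) (hol_top \<Omega>) M"
    proof (rule continuous_map_hol_top[OF open_dom H lin])
      fix z assume "z \<in> \<Omega>"
      then obtain r where r: "r > 0" "cball z r \<subseteq> \<Omega>" using open_dom open_contains_cball by blast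
      obtain K C where "compact K" "K \<subseteq> \<Omega>" "C \<ge> 0"
        "\<forall>f\<in>hol_space \<Omega>. \<forall>B\<ge>0. (\<forall>\<zeta>\<in>K. norm (f \<zeta>) \<le> B) \<longrightarrow> (\<forall>z\<in>cball z r. norm (M f z) \<le> C * B)"
        using bound[OF compact_cball r(2)] by blast
      moreover have "ball z r \<inter> \<Omega> \<subseteq> cball z r" by auto
      ultimately show "\<exists>r>0. \<exists>K C. compact K \<and> K \<subseteq> \<Omega> \<and> C \<ge> 0 \<and>
        (\<forall>f\<in>hol_space \<Omega>. \<forall>B\<ge>0. (\<forall>\<zeta>\<in>K. norm (f \<zeta>) \<le> B) \<longrightarrow> (\<forall>z'\<in>ball z r \<inter> \<Omega>. norm (M f z') \<le> C * B))"
        using r(1) by (meson subsetD)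
    qed
    show "M (\<lambda>z. f z + g z) = (\<lambda>z. M f z + M g z)" if "f \<in> hol_space \<Omega>" "g \<in> hol_space \<Omega>" for f g
      using lin[OF that, of 1] by auto
    show "M (\<lambda>z. c * f z) = (\<lambda>z. c * M f z)" if f: "f \<in> hol_space \<Omega>" for c f
    proof
      fix z
      have "M (\<lambda>z. 0) z = 0" using lin[OF zero_hol_space zero_hol_space, of "-1" z] by simp
      then show "M (\<lambda>z. c * f z) z = c * M f z" using lin[OF zero_hol_space f, of c z] by simp
    qed
    show "\<exists>m. \<forall>z\<in>\<Omega>. M (zero_ext \<Omega> (mono_fun \<alpha>)) z = m * mono_fun \<alpha> z" for \<alpha>
      using mono by blast
  qed (rule ext)
  show "mult_seq \<Omega> M = a" by (rule mult_seq_eqI[OF mono])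
qed

lemma multiplier_id:
  "(\<lambda>f\<in>hol_space \<Omega>. f) \<in> multipliers \<Omega> \<and> mult_seq \<Omega> (\<lambda>f\<in>hol_space \<Omega>. f) = (\<lambda>\<alpha>. 1)" (is "?M \<in> _ \<and> _")
proof (rule multiplierI)
  show "?M (\<lambda>z. f z + k * g z) z = ?M f z + k * ?M g z" if "f \<in> hol_space \<Omega>" "g \<in> hol_space \<Omega>" for f g k z
    using that hol_space_combine[OF open_dom that, of k] by simp
  show "\<exists>K C. compact K \<and> K \<subseteq> \<Omega> \<and> C \<ge> 0 \<and>
      (\<forall>f\<in>hol_space \<Omega>. \<forall>B\<ge>0. (\<forall>\<zeta>\<in>K. norm (f \<zeta>) \<le> B) \<longrightarrow> (\<forall>z\<in>L. norm (?M f z) \<le> C * B))"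
    if "compact L" "L \<subseteq> \<Omega>" for L
    by (rule exI[of _ L], rule exI[of _ 1]) (use that in simp)
  show "?M (zero_ext \<Omega> (mono_fun \<alpha>)) z = 1 * mono_fun \<alpha> z" if "z \<in> \<Omega>" for \<alpha> z
    using that zero_ext_hol_space[OF csh_mono_fun] by (simp add: zero_ext_def)
qed auto

lemma multiplier_combine:
  assumes M: "M \<in> multipliers \<Omega>" and N: "N \<in> multipliers \<Omega>"
  shows "(\<lambda>f\<in>hol_space \<Omega>. (\<lambda>z. M f z + k * N f z)) \<in> multipliers \<Omega> \<and>
    mult_seq \<Omega> (\<lambda>f\<in>hol_space \<Omega>. (\<lambda>z. M f z + k * N f z)) = (\<lambda>\<alpha>. mult_seq \<Omega> M \<alpha> + k * mult_seq \<Omega> N \<alpha>)"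
    (is "?M \<in> _ \<and> _")
proof (rule multiplierI)
  have app: "?M f = (\<lambda>z. M f z + k * N f z)" if "f \<in> hol_space \<Omega>" for f using that by simp
  show "?M f \<in> hol_space \<Omega>" if "f \<in> hol_space \<Omega>" for f
    unfolding app[OF that] by (rule hol_space_combine[OF open_dom mult_hol_space[OF M that] mult_hol_space[OF N that]])
  show "?M (\<lambda>z. f z + l * g z) z = ?M f z + l * ?M g z" if "f \<in> hol_space \<Omega>" "g \<in> hol_space \<Omega>" for f g l z
    unfolding app[OF that(1)] app[OF that(2)] app[OF hol_space_combine[OF open_dom that, of l]]
      mult_linear[OF M that] mult_linear[OF N that] by (simp add: algebra_simps)
  show "\<exists>K C. compact K \<and> K \<subseteq> \<Omega> \<and> C \<ge> 0 \<and>
      (\<forall>f\<in>hol_space \<Omega>. \<forall>B\<ge>0. (\<forall>\<zeta>\<in>K. norm (f \<zeta>) \<le> B) \<longrightarrow> (\<forall>z\<in>L. norm (?M f z) \<le> C * B))"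
    if L: "compact L" "L \<subseteq> \<Omega>" for L
  proof -
    obtain K C where K: "compact K" "K \<subseteq> \<Omega>" "C \<ge> 0"
      "\<And>f B. f \<in> hol_space \<Omega> \<Longrightarrow> B \<ge> 0 \<Longrightarrow> (\<And>\<zeta>. \<zeta> \<in> K \<Longrightarrow> norm (f \<zeta>) \<le> B) \<Longrightarrow> (\<forall>z\<in>L. norm (M f z) \<le> C * B)"
      by (rule mult_bound_compact[OF M L]) (rule that; blast)
    obtain K' C' where K': "compact K'" "K' \<subseteq> \<Omega>" "C' \<ge> 0"
      "\<And>f B. f \<in> hol_space \<Omega> \<Longrightarrow> B \<ge> 0 \<Longrightarrow> (\<And>\<zeta>. \<zeta> \<in> K' \<Longrightarrow> norm (f \<zeta>) \<le> B) \<Longrightarrow> (\<forall>z\<in>L. norm (N f z) \<le> C' * B)"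
      by (rule mult_bound_compact[OF N L]) (rule that; blast)
    have "norm (?M f z) \<le> (C + norm k * C') * B"
      if f: "f \<in> hol_space \<Omega>" "B \<ge> 0" "\<forall>\<zeta>\<in>K \<union> K'. norm (f \<zeta>) \<le> B" and z: "z \<in> L" for f B z
    proof -
      have 1: "norm (M f z) \<le> C * B" using K(4)[OF f(1,2)] f(3) z by blast
      have "norm (N f z) \<le> C' * B" using K'(4)[OF f(1,2)] f(3) z by blast
      then have 2: "norm (k * N f z) \<le> norm k * (C' * B)" unfolding norm_mult by (rule mult_left_mono) simp
      show ?thesis unfolding app[OF f(1)] using norm_triangle_mono[OF 1 2] by (simp add: algebra_simps)
    qed
    moreover have "compact (K \<union> K')" "K \<union> K' \<subseteq> \<Omega>" "C + norm k * C' \<ge> 0" using K(1-3) K'(1-3) by (auto intro: compact_Un)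
    ultimately show ?thesis by (intro exI[of _ "K \<union> K'"] exI[of _ "C + norm k * C'"]) blast
  qed
  show "?M (zero_ext \<Omega> (mono_fun \<alpha>)) z = (mult_seq \<Omega> M \<alpha> + k * mult_seq \<Omega> N \<alpha>) * mono_fun \<alpha> z" if "z \<in> \<Omega>" for \<alpha> z
    unfolding app[OF zero_ext_hol_space[OF csh_mono_fun]] mult_mono[OF M that] mult_mono[OF N that]
    by (simp add: algebra_simps)
qed auto

lemma multiplier_compose:
  assumes M: "M \<in> multipliers \<Omega>" and N: "N \<in> multipliers \<Omega>"
  shows "compose (hol_space \<Omega>) M N \<in> multipliers \<Omega> \<and>
    mult_seq \<Omega> (compose (hol_space \<Omega>) M N) = (\<lambda>\<alpha>. mult_seq \<Omega> M \<alpha> * mult_seq \<Omega> N \<alpha>)"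
    (is "?M \<in> _ \<and> _")
proof (rule multiplierI)
  have app: "?M f = M (N f)" if "f \<in> hol_space \<Omega>" for f using that by (simp add: compose_def)
  note NH = mult_hol_space[OF N]
  show "?M f \<in> hol_space \<Omega>" if "f \<in> hol_space \<Omega>" for f
    unfolding app[OF that] by (rule mult_hol_space[OF M NH[OF that]])
  show "?M (\<lambda>z. f z + l * g z) z = ?M f z + l * ?M g z" if "f \<in> hol_space \<Omega>" "g \<in> hol_space \<Omega>" for f g l z
    unfolding app[OF that(1)] app[OF that(2)] app[OF hol_space_combine[OF open_dom that, of l]]
      mult_linear[OF N that, abs_def] by (rule mult_linear[OF M NH[OF that(1)] NH[OF that(2)]])
  show "\<exists>K C. compact K \<and> K \<subseteq> \<Omega> \<and> C \<ge> 0 \<and>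
      (\<forall>f\<in>hol_space \<Omega>. \<forall>B\<ge>0. (\<forall>\<zeta>\<in>K. norm (f \<zeta>) \<le> B) \<longrightarrow> (\<forall>z\<in>L. norm (?M f z) \<le> C * B))"
    if L: "compact L" "L \<subseteq> \<Omega>" for L
  proof -
    obtain K C where K: "compact K" "K \<subseteq> \<Omega>" "C \<ge> 0"
      "\<And>f B. f \<in> hol_space \<Omega> \<Longrightarrow> B \<ge> 0 \<Longrightarrow> (\<And>\<zeta>. \<zeta> \<in> K \<Longrightarrow> norm (f \<zeta>) \<le> B) \<Longrightarrow> (\<forall>z\<in>L. norm (M f z) \<le> C * B)"
      by (rule mult_bound_compact[OF M L]) (rule that; blast)
    obtain K' C' where K': "compact K'" "K' \<subseteq> \<Omega>" "C' \<ge> 0"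
      "\<And>f B. f \<in> hol_space \<Omega> \<Longrightarrow> B \<ge> 0 \<Longrightarrow> (\<And>\<zeta>. \<zeta> \<in> K' \<Longrightarrow> norm (f \<zeta>) \<le> B) \<Longrightarrow> (\<forall>z\<in>K. norm (N f z) \<le> C' * B)"
      by (rule mult_bound_compact[OF N K(1,2)]) (rule that; blast)
    have "norm (?M f z) \<le> C * C' * B"
      if f: "f \<in> hol_space \<Omega>" "B \<ge> 0" "\<forall>\<zeta>\<in>K'. norm (f \<zeta>) \<le> B" and z: "z \<in> L" for f B z
    proof -
      have "\<forall>z\<in>K. norm (N f z) \<le> C' * B" using K'(4)[OF f(1,2)] f(3) by blast
      then have "\<forall>z\<in>L. norm (M (N f) z) \<le> C * (C' * B)" using K(4)[OF NH[OF f(1)]] K'(3) f(2) by simp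
      then show ?thesis unfolding app[OF f(1)] using z by (simp add: mult.assoc)
    qed
    moreover have "C * C' \<ge> 0" using K(3) K'(3) by simp
    ultimately show ?thesis using K'(1,2) by (intro exI[of _ K'] exI[of _ "C * C'"]) blast
  qed
  show "?M (zero_ext \<Omega> (mono_fun \<alpha>)) z = (mult_seq \<Omega> M \<alpha> * mult_seq \<Omega> N \<alpha>) * mono_fun \<alpha> z" if "z \<in> \<Omega>" for \<alpha> z
  proof -
    let ?e = "zero_ext \<Omega> (mono_fun \<alpha>)"
    have e: "?e \<in> hol_space \<Omega>" by (rule zero_ext_hol_space[OF csh_mono_fun])
    \<comment> \<open>The identity must also hold off \<open>\<Omega>\<close>, where both sides
      vanish, in order to be an equality of functions to which \<open>M\<close> can be
      applied.\<close>
    have "N ?e z = mult_seq \<Omega> N \<alpha> * ?e z" for z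
      using mult_mono[OF N, of z \<alpha>] hol_space_outside[OF NH[OF e]] by (cases "z \<in> \<Omega>") (auto simp: zero_ext_def)
    then have "N ?e = (\<lambda>z. mult_seq \<Omega> N \<alpha> * ?e z)" by blast
    then show ?thesis unfolding app[OF e] using mult_cmult[OF M e] mult_mono[OF M that] by simp
  qed
qed (auto simp: compose_def)

lemma multiplier_zero:
  "(\<lambda>f\<in>hol_space \<Omega>. (\<lambda>z. 0)) \<in> multipliers \<Omega> \<and> mult_seq \<Omega> (\<lambda>f\<in>hol_space \<Omega>. (\<lambda>z. 0)) = (\<lambda>\<alpha>. 0)"
proof -
  have "(\<lambda>f\<in>hol_space \<Omega>. (\<lambda>z. (\<lambda>f\<in>hol_space \<Omega>. f) f z + (-1) * (\<lambda>f\<in>hol_space \<Omega>. f) f z)) = (\<lambda>f\<in>hol_space \<Omega>. (\<lambda>z. 0))"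
    by (rule HOL.ext) (simp add: restrict_def)
  then show ?thesis using multiplier_combine[of "\<lambda>f\<in>hol_space \<Omega>. f" "\<lambda>f\<in>hol_space \<Omega>. f" "-1"] multiplier_id by simp
qed

lemma multiplier_smult:
  assumes "M \<in> multipliers \<Omega>"
  shows "(\<lambda>f\<in>hol_space \<Omega>. (\<lambda>z. c * M f z)) \<in> multipliers \<Omega> \<and>
    mult_seq \<Omega> (\<lambda>f\<in>hol_space \<Omega>. (\<lambda>z. c * M f z)) = (\<lambda>\<alpha>. c * mult_seq \<Omega> M \<alpha>)"
proof -
  let ?Z = "\<lambda>f\<in>hol_space \<Omega>. (\<lambda>z. 0::complex)"
  have "(\<lambda>f\<in>hol_space \<Omega>. (\<lambda>z. ?Z f z + c * M f z)) = (\<lambda>f\<in>hol_space \<Omega>. (\<lambda>z. c * M f z))"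
    by (rule HOL.ext) (simp add: restrict_def)
  then show ?thesis using multiplier_combine[OF conjunct1[OF multiplier_zero] assms, of c] multiplier_zero by simp
qed

lemma multiplier_add:
  assumes "M \<in> multipliers \<Omega>" "N \<in> multipliers \<Omega>"
  shows "(\<lambda>f\<in>hol_space \<Omega>. (\<lambda>z. M f z + N f z)) \<in> multipliers \<Omega> \<and>
    mult_seq \<Omega> (\<lambda>f\<in>hol_space \<Omega>. (\<lambda>z. M f z + N f z)) = (\<lambda>\<alpha>. mult_seq \<Omega> M \<alpha> + mult_seq \<Omega> N \<alpha>)"
  using multiplier_combine[OF assms, of 1] by simp

end

subsection \<open>The two algebras\<close>

text \<open>\<open>\<theta>\<close> embeds the carrier into families of complex numbers with
  pointwise operations, so every axiom can be checked on coefficients.\<close>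

lemma algebra_by_coefficients:
  fixes A :: "(complex, 'b) module" (structure) and \<theta> :: "'b \<Rightarrow> 'i \<Rightarrow> complex"
  assumes inj: "inj_on \<theta> (carrier A)"
    and add: "\<And>x y. x \<in> carrier A \<Longrightarrow> y \<in> carrier A \<Longrightarrow> x \<oplus> y \<in> carrier A \<and> \<theta> (x \<oplus> y) = (\<lambda>\<alpha>. \<theta> x \<alpha> + \<theta> y \<alpha>)"
    and mult: "\<And>x y. x \<in> carrier A \<Longrightarrow> y \<in> carrier A \<Longrightarrow> x \<otimes> y \<in> carrier A \<and> \<theta> (x \<otimes> y) = (\<lambda>\<alpha>. \<theta> x \<alpha> * \<theta> y \<alpha>)"
    and smult: "\<And>c x. x \<in> carrier A \<Longrightarrow> c \<odot>\<^bsub>A\<^esub> x \<in> carrier A \<and> \<theta> (c \<odot>\<^bsub>A\<^esub> x) = (\<lambda>\<alpha>. c * \<theta> x \<alpha>)"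
    and zero: "\<zero> \<in> carrier A \<and> \<theta> \<zero> = (\<lambda>\<alpha>. 0)" and one: "\<one> \<in> carrier A \<and> \<theta> \<one> = (\<lambda>\<alpha>. 1)"
  shows "Module.algebra ring_of_type_algebra A"
proof -
  note closed = add[THEN conjunct1] mult[THEN conjunct1] smult[THEN conjunct1] zero[THEN conjunct1] one[THEN conjunct1]
  note coeff = add[THEN conjunct2] mult[THEN conjunct2] smult[THEN conjunct2] zero[THEN conjunct2] one[THEN conjunct2]
  have eqI: "x = y" if "\<theta> x = \<theta> y" "x \<in> carrier A" "y \<in> carrier A" for x y
    using inj that by (rule inj_onD)
  have "abelian_group A"
  proof (rule abelian_groupI)
    fix x assume x: "x \<in> carrier A"
    show "\<exists>y\<in>carrier A. y \<oplus> x = \<zero>"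
      by (rule bexI[of _ "(-1) \<odot>\<^bsub>A\<^esub> x"], rule eqI) (simp_all add: closed coeff x)
  next
    fix x y z assume xyz: "x \<in> carrier A" "y \<in> carrier A" "z \<in> carrier A"
    show "(x \<oplus> y) \<oplus> z = x \<oplus> (y \<oplus> z)" by (rule eqI) (simp_all add: closed coeff xyz add.assoc)
  next
    fix x y assume xy: "x \<in> carrier A" "y \<in> carrier A"
    show "x \<oplus> y = y \<oplus> x" by (rule eqI) (simp_all add: closed coeff xy add.commute)
  next
    fix x assume x: "x \<in> carrier A"
    show "\<zero> \<oplus> x = x" by (rule eqI) (simp_all add: closed coeff x)
  qed (simp_all add: closed)
  moreover have "comm_monoid A"
  proof (rule comm_monoidI)
    fix x y z assume xyz: "x \<in> carrier A" "y \<in> carrier A" "z \<in> carrier A"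
    show "(x \<otimes> y) \<otimes> z = x \<otimes> (y \<otimes> z)" by (rule eqI) (simp_all add: closed coeff xyz mult.assoc)
  next
    fix x y assume xy: "x \<in> carrier A" "y \<in> carrier A"
    show "x \<otimes> y = y \<otimes> x" by (rule eqI) (simp_all add: closed coeff xy mult.commute)
  next
    fix x assume x: "x \<in> carrier A"
    show "\<one> \<otimes> x = x" by (rule eqI) (simp_all add: closed coeff x)
  qed (simp_all add: closed)
  ultimately have cring: "cring A"
  proof (rule cringI)
    fix x y z assume xyz: "x \<in> carrier A" "y \<in> carrier A" "z \<in> carrier A"
    show "(x \<oplus> y) \<otimes> z = x \<otimes> z \<oplus> y \<otimes> z" by (rule eqI) (simp_all add: closed coeff xyz distrib_right)
  qed
  have K: "cring (ring_of_type_algebra :: complex ring)" by (rule cring_from_type_algebra)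
  note Kdef = ring_of_type_algebra_def
  show ?thesis
  proof (rule algebraI[OF K cring])
    fix a b :: complex and x y assume xy: "x \<in> carrier A" "y \<in> carrier A"
    show "a \<odot>\<^bsub>A\<^esub> x \<in> carrier A" using closed xy by blast
    show "(a \<oplus>\<^bsub>ring_of_type_algebra\<^esub> b) \<odot>\<^bsub>A\<^esub> x = a \<odot>\<^bsub>A\<^esub> x \<oplus> b \<odot>\<^bsub>A\<^esub> x"
      by (rule eqI) (simp_all add: closed coeff xy Kdef distrib_right)
    show "a \<odot>\<^bsub>A\<^esub> (x \<oplus> y) = a \<odot>\<^bsub>A\<^esub> x \<oplus> a \<odot>\<^bsub>A\<^esub> y"
      by (rule eqI) (simp_all add: closed coeff xy distrib_left)
    show "(a \<otimes>\<^bsub>ring_of_type_algebra\<^esub> b) \<odot>\<^bsub>A\<^esub> x = a \<odot>\<^bsub>A\<^esub> (b \<odot>\<^bsub>A\<^esub> x)"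
      by (rule eqI) (simp_all add: closed coeff xy Kdef mult.assoc)
    show "\<one>\<^bsub>ring_of_type_algebra\<^esub> \<odot>\<^bsub>A\<^esub> x = x"
      by (rule eqI) (simp_all add: closed coeff xy Kdef)
    show "(a \<odot>\<^bsub>A\<^esub> x) \<otimes> y = a \<odot>\<^bsub>A\<^esub> (x \<otimes> y)"
      by (rule eqI) (simp_all add: closed coeff xy mult.assoc)
  qed
qed

section \<open>Operations on germs in terms of Taylor coefficients\<close>

lemma series_germ_eq:
  "eq_near origin (psum a) f \<Longrightarrow> germ origin f = series_germ a"
  unfolding series_germ_psum by (rule germ_eq[symmetric])

lemma psum_in_series_germ: "conv a \<Longrightarrow> psum a \<in> series_germ a"
  unfolding series_germ_psum in_germ_iff using psum_hol_near eq_near_refl by blast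

lemma in_series_germ: "f \<in> series_germ a \<Longrightarrow> eq_near origin (psum a) f"
  unfolding series_germ_psum in_germ_iff by blast

lemma series_germ_add:
  assumes "conv a" "conv b"
  shows "(\<Union>f\<in>series_germ a. \<Union>g\<in>series_germ b. germ origin (\<lambda>x. f x + g x)) = series_germ (\<lambda>\<alpha>. a \<alpha> + b \<alpha>)"
proof -
  have *: "germ origin (\<lambda>x. f x + g x) = series_germ (\<lambda>\<alpha>. a \<alpha> + b \<alpha>)" if "f \<in> series_germ a" "g \<in> series_germ b" for f g
  proof (rule series_germ_eq)
    have "eq_near origin (\<lambda>x. psum a x + psum b x) (\<lambda>x. f x + g x)"
      by (rule eq_near_map2[where h = "(+)"]) (use that in \<open>auto intro: in_series_germ\<close>)
    moreover have "eq_near origin (psum (\<lambda>\<alpha>. a \<alpha> + b \<alpha>)) (\<lambda>x. psum a x + psum b x)"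
      using psum_combine[OF assms, of 1] by simp
    ultimately show "eq_near origin (psum (\<lambda>\<alpha>. a \<alpha> + b \<alpha>)) (\<lambda>x. f x + g x)" by (rule eq_near_trans[rotated])
  qed
  have "series_germ a \<noteq> {}" "series_germ b \<noteq> {}" using assms[THEN psum_in_series_germ] by blast+
  then show ?thesis by (simp add: * cong: SUP_cong_simp)
qed

lemma conv_zero: "conv (\<lambda>_. 0)"
  unfolding conv_def bnd_def by (intro exI[of _ 1]) auto

lemma eq_near_psum_zero: "eq_near origin (psum (\<lambda>\<alpha>. 0)) (\<lambda>x. 0)"
  by (simp add: psum_def[abs_def] eq_near_refl)

lemma series_germ_smult:
  assumes "conv a"
  shows "(\<Union>f\<in>series_germ a. germ origin (\<lambda>x. c * f x)) = series_germ (\<lambda>\<alpha>. c * a \<alpha>)"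
proof -
  have *: "germ origin (\<lambda>x. c * f x) = series_germ (\<lambda>\<alpha>. c * a \<alpha>)" if "f \<in> series_germ a" for f
  proof (rule series_germ_eq)
    have "eq_near origin (\<lambda>x. psum (\<lambda>_. 0) x + c * psum a x) (\<lambda>x. 0 + c * f x)"
      by (rule eq_near_map2[where h = "\<lambda>u v. u + c * v"]) (use that eq_near_psum_zero in \<open>auto intro: in_series_germ\<close>)
    moreover have "eq_near origin (psum (\<lambda>\<alpha>. 0 + c * a \<alpha>)) (\<lambda>x. psum (\<lambda>_. 0) x + c * psum a x)"
      by (rule psum_combine[OF conv_zero assms])
    ultimately have "eq_near origin (psum (\<lambda>\<alpha>. 0 + c * a \<alpha>)) (\<lambda>x. 0 + c * f x)" by (rule eq_near_trans[rotated])
    then show "eq_near origin (psum (\<lambda>\<alpha>. c * a \<alpha>)) (\<lambda>x. c * f x)" by simp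
  qed
  have "series_germ a \<noteq> {}" using psum_in_series_germ assms by blast
  then show ?thesis by (simp add: * cong: SUP_cong_simp)
qed

lemma ext_seq_conv: "ext_seq Om a \<Longrightarrow> conv a"
  by (simp add: ext_seq_def)

lemma taylor_ext: "ext_seq Om a \<Longrightarrow> taylor (series_germ a) = a"
  by (rule taylor_series_germ[OF ext_seq_conv])

context
  fixes Om :: "'n::finite \<Rightarrow> complex set" and \<Omega> :: "(complex ^ 'n) set"
  assumes op: "\<And>j. open (Om j)" and \<Omega>: "\<Omega> = cart Om" and R: "runge_domain \<Omega>"
begin

lemma ext_seq_iff: "ext_seq Om a \<longleftrightarrow> (\<exists>M\<in>multipliers \<Omega>. mult_seq \<Omega> M = a)"
  using mult_seq_ext_seq[OF op \<Omega> R] ext_seq_imp_mult_seq[OF op \<Omega> R] by metis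

lemma ext_germs_image: "ext_germs Om = series_germ ` {a. ext_seq Om a}"
  by (rule Set.set_eqI) (simp add: ext_germs_iff[OF op] image_iff)

lemma ext_seqI: "M \<in> multipliers \<Omega> \<and> mult_seq \<Omega> M = a \<Longrightarrow> ext_seq Om a"
  using mult_seq_ext_seq[OF op \<Omega> R, of M] by simp

text \<open>Closure under the coefficientwise product is read off from the composition of
  multipliers; a direct argument would have to extend the Hadamard product of two germs.\<close>

lemma ext_seq_ops:
  assumes "ext_seq Om a" "ext_seq Om b"
  shows "ext_seq Om (\<lambda>\<alpha>. a \<alpha> + b \<alpha>)" "ext_seq Om (\<lambda>\<alpha>. a \<alpha> * b \<alpha>)" "ext_seq Om (\<lambda>\<alpha>. c * a \<alpha>)"
proof -
  obtain M where M: "M \<in> multipliers \<Omega>" "mult_seq \<Omega> M = a" by (rule ext_seq_imp_mult_seq[OF op \<Omega> R assms(1)])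
  obtain N where N: "N \<in> multipliers \<Omega>" "mult_seq \<Omega> N = b" by (rule ext_seq_imp_mult_seq[OF op \<Omega> R assms(2)])
  show "ext_seq Om (\<lambda>\<alpha>. a \<alpha> + b \<alpha>)"
    by (rule ext_seqI[OF multiplier_add[OF op \<Omega> R M(1) N(1), unfolded M(2) N(2)]])
  show "ext_seq Om (\<lambda>\<alpha>. a \<alpha> * b \<alpha>)"
    by (rule ext_seqI[OF multiplier_compose[OF op \<Omega> R M(1) N(1), unfolded M(2) N(2)]])
  show "ext_seq Om (\<lambda>\<alpha>. c * a \<alpha>)"
    by (rule ext_seqI[OF multiplier_smult[OF op \<Omega> R M(1), unfolded M(2)]])
qed

lemma ext_seq_consts: "ext_seq Om (\<lambda>\<alpha>. 0)" "ext_seq Om (\<lambda>\<alpha>. 1)"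
  by (rule ext_seqI[OF multiplier_zero[OF op \<Omega> R]], rule ext_seqI[OF multiplier_id[OF op \<Omega> R]])

lemma germ_ops:
  assumes a: "ext_seq Om a" and b: "ext_seq Om b"
  shows "series_germ a \<oplus>\<^bsub>germ_algebra Om\<^esub> series_germ b = series_germ (\<lambda>\<alpha>. a \<alpha> + b \<alpha>)"
    "series_germ a \<otimes>\<^bsub>germ_algebra Om\<^esub> series_germ b = series_germ (\<lambda>\<alpha>. a \<alpha> * b \<alpha>)"
    "c \<odot>\<^bsub>germ_algebra Om\<^esub> series_germ a = series_germ (\<lambda>\<alpha>. c * a \<alpha>)"
  using series_germ_add[OF a[THEN ext_seq_conv] b[THEN ext_seq_conv]] series_germ_smult[OF a[THEN ext_seq_conv], of c]
  by (simp_all add: germ_algebra_def taylor_ext[OF a] taylor_ext[OF b])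

lemma germ_consts: "\<zero>\<^bsub>germ_algebra Om\<^esub> = series_germ (\<lambda>\<alpha>. 0)" "\<one>\<^bsub>germ_algebra Om\<^esub> = series_germ (\<lambda>\<alpha>. 1)"
  using series_germ_eq[OF eq_near_psum_zero] by (simp_all add: germ_algebra_def)

lemma germ_carrier: "carrier (germ_algebra Om) = series_germ ` {a. ext_seq Om a}"
  by (simp add: germ_algebra_def ext_germs_image)

lemma germ_algebra: "Module.algebra ring_of_type_algebra (germ_algebra Om)"
proof (rule algebra_by_coefficients[where \<theta> = taylor])
  show "inj_on taylor (carrier (germ_algebra Om))"
    unfolding germ_carrier by (rule inj_onI) (auto simp: taylor_ext)
  fix F G assume "F \<in> carrier (germ_algebra Om)" "G \<in> carrier (germ_algebra Om)"
  then obtain a b where a: "ext_seq Om a" "F = series_germ a" and b: "ext_seq Om b" "G = series_germ b"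
    unfolding germ_carrier by blast
  show "F \<oplus>\<^bsub>germ_algebra Om\<^esub> G \<in> carrier (germ_algebra Om) \<and> taylor (F \<oplus>\<^bsub>germ_algebra Om\<^esub> G) = (\<lambda>\<alpha>. taylor F \<alpha> + taylor G \<alpha>)"
    unfolding a(2) b(2) germ_ops[OF a(1) b(1)] germ_carrier
    using ext_seq_ops[OF a(1) b(1)] by (simp add: taylor_ext[OF a(1)] taylor_ext[OF b(1)] taylor_ext[where Om = Om])
  show "F \<otimes>\<^bsub>germ_algebra Om\<^esub> G \<in> carrier (germ_algebra Om) \<and> taylor (F \<otimes>\<^bsub>germ_algebra Om\<^esub> G) = (\<lambda>\<alpha>. taylor F \<alpha> * taylor G \<alpha>)"
    unfolding a(2) b(2) germ_ops[OF a(1) b(1)] germ_carrier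
    using ext_seq_ops[OF a(1) b(1)] by (simp add: taylor_ext[OF a(1)] taylor_ext[OF b(1)] taylor_ext[where Om = Om])
next
  fix c F assume "F \<in> carrier (germ_algebra Om)"
  then obtain a where a: "ext_seq Om a" "F = series_germ a" unfolding germ_carrier by blast
  show "c \<odot>\<^bsub>germ_algebra Om\<^esub> F \<in> carrier (germ_algebra Om) \<and> taylor (c \<odot>\<^bsub>germ_algebra Om\<^esub> F) = (\<lambda>\<alpha>. c * taylor F \<alpha>)"
    unfolding a(2) germ_ops[OF a(1) a(1)] germ_carrier
    using ext_seq_ops(3)[OF a(1) a(1), of c] by (simp add: taylor_ext[OF a(1)] taylor_ext[where Om = Om])
qed (simp_all add: germ_consts germ_carrier ext_seq_consts taylor_ext[where Om = Om])

lemma inj_mult_seq: "inj_on (mult_seq \<Omega>) (multipliers \<Omega>)"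
  by (rule inj_onI) (rule multiplier_eqI[OF op \<Omega> R])

lemma multiplier_algebra: "Module.algebra ring_of_type_algebra (multiplier_algebra \<Omega>)"
proof (rule algebra_by_coefficients[where \<theta> = "mult_seq \<Omega>"])
  show "inj_on (mult_seq \<Omega>) (carrier (multiplier_algebra \<Omega>))"
    using inj_mult_seq by (simp add: multiplier_algebra_def)
qed (simp_all add: multiplier_algebra_def multiplier_add[OF op \<Omega> R] multiplier_compose[OF op \<Omega> R]
    multiplier_smult[OF op \<Omega> R] multiplier_zero[OF op \<Omega> R] multiplier_id[OF op \<Omega> R])

lemma Psi_hat_iso: "Psi_hat \<Omega> \<in> ring_iso (multiplier_algebra \<Omega>) (germ_algebra Om)"
  unfolding ring_iso_def
proof (intro CollectI conjI)
  have carrier: "carrier (multiplier_algebra \<Omega>) = multipliers \<Omega>" by (simp add: multiplier_algebra_def)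
  note seq = mult_seq_ext_seq[OF op \<Omega> R]
  show "Psi_hat \<Omega> \<in> ring_hom (multiplier_algebra \<Omega>) (germ_algebra Om)"
  proof (rule ring_hom_memI)
    fix M assume "M \<in> carrier (multiplier_algebra \<Omega>)"
    then show "Psi_hat \<Omega> M \<in> carrier (germ_algebra Om)"
      using seq by (simp add: carrier germ_carrier Psi_hat_def)
  next
    fix M N assume "M \<in> carrier (multiplier_algebra \<Omega>)" "N \<in> carrier (multiplier_algebra \<Omega>)"
    then have M: "M \<in> multipliers \<Omega>" and N: "N \<in> multipliers \<Omega>" by (simp_all add: carrier)
    show "Psi_hat \<Omega> (M \<otimes>\<^bsub>multiplier_algebra \<Omega>\<^esub> N) = Psi_hat \<Omega> M \<otimes>\<^bsub>germ_algebra Om\<^esub> Psi_hat \<Omega> N"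
      unfolding Psi_hat_def germ_ops[OF seq[OF M] seq[OF N]]
      by (simp add: multiplier_algebra_def multiplier_compose[OF op \<Omega> R M N])
    show "Psi_hat \<Omega> (M \<oplus>\<^bsub>multiplier_algebra \<Omega>\<^esub> N) = Psi_hat \<Omega> M \<oplus>\<^bsub>germ_algebra Om\<^esub> Psi_hat \<Omega> N"
      unfolding Psi_hat_def germ_ops[OF seq[OF M] seq[OF N]]
      by (simp add: multiplier_algebra_def multiplier_add[OF op \<Omega> R M N])
  next
    show "Psi_hat \<Omega> \<one>\<^bsub>multiplier_algebra \<Omega>\<^esub> = \<one>\<^bsub>germ_algebra Om\<^esub>"
      unfolding Psi_hat_def germ_consts by (simp add: multiplier_algebra_def multiplier_id[OF op \<Omega> R])
  qed
  have "inj_on (Psi_hat \<Omega>) (multipliers \<Omega>)"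
    by (rule inj_onI) (metis Psi_hat_def multiplier_eqI[OF op \<Omega> R] seq taylor_ext)
  moreover have "Psi_hat \<Omega> ` multipliers \<Omega> = carrier (germ_algebra Om)"
    unfolding germ_carrier Psi_hat_def[abs_def] using ext_seq_iff by auto
  ultimately show "bij_betw (Psi_hat \<Omega>) (carrier (multiplier_algebra \<Omega>)) (carrier (germ_algebra Om))"
    by (simp add: bij_betw_def carrier)
qed

text \<open>Both sides depend continuously on \<open>f\<close> and agree on polynomials, which
  approximate \<open>f\<close> on the union of the two compact sets involved.\<close>

lemma multiplier_integral_formula:
  assumes M: "M \<in> multipliers \<Omega>" and z: "z \<in> \<Omega>" "\<And>j. z $ j \<noteq> 0"
    and E: "is_extension Om z (Psi_hat \<Omega> M) Uh g" and \<gamma>: "admissible_cycles Om z Uh \<gamma>" and f: "f \<in> hol_space \<Omega>"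
  shows "M f z = (- 1 / (2 * of_real pi * \<i>)) ^ CARD('n) * cycle_integral (\<lambda>j. inv_cycle (\<gamma> j))
    (\<lambda>\<zeta>. f (\<chi> j. z $ j * (1 / \<zeta> $ j)) * (g (emb \<zeta>) / (\<Prod>j\<in>UNIV. \<zeta> $ j)))" (is "_ = ?I")
proof -
  obtain js :: "'n list" where js: "distinct js" "set js = UNIV" using enum_list by blast
  have a: "conv (mult_seq \<Omega> M)" by (rule ext_seq_conv[OF mult_seq_ext_seq[OF op \<Omega> R M]])
  have z': "z \<in> cart Om" using z(1) by (simp add: \<Omega>)
  obtain K C where K: "compact K" "K \<subseteq> cart Om" "C \<ge> 0"
    "\<And>f c e. csh f Om \<Longrightarrow> fs c \<Longrightarrow> e \<ge> 0 \<Longrightarrow> (\<And>\<zeta>. \<zeta> \<in> K \<Longrightarrow> norm (f \<zeta> - pf c \<zeta>) \<le> e) \<Longrightarrow>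
      norm ((- 1 / (2 * of_real pi * \<i>)) ^ CARD('n) * cycle_integral (\<lambda>j. inv_cycle (\<gamma> j))
       (\<lambda>\<zeta>. f (\<chi> j. z $ j * (1 / \<zeta> $ j)) * (g (emb \<zeta>) / (\<Prod>j\<in>UNIV. \<zeta> $ j))) - pf (\<lambda>\<alpha>. c \<alpha> * mult_seq \<Omega> M \<alpha>) z) \<le> C * e"
    by (rule cycle_integral_approx[OF op z' z(2) a E[unfolded Psi_hat_def] \<gamma> js]) (rule that; blast)
  obtain K' C' where K': "compact K'" "K' \<subseteq> \<Omega>" "C' \<ge> 0"
    "\<And>f c B. f \<in> hol_space \<Omega> \<Longrightarrow> fs c \<Longrightarrow> B \<ge> 0 \<Longrightarrow> (\<And>\<zeta>. \<zeta> \<in> K' \<Longrightarrow> norm (f \<zeta> - pf c \<zeta>) \<le> B) \<Longrightarrow>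
      norm (M f z - pf (\<lambda>\<alpha>. c \<alpha> * mult_seq \<Omega> M \<alpha>) z) \<le> C' * B"
    by (rule mult_approx[OF op \<Omega> R M z(1)]) (rule that; blast)
  have "norm (M f z - ?I) \<le> 0"
  proof (rule le_if_le_eps)
    show "C' + C \<ge> 0" using K(3) K'(3) by simp
    fix e :: real assume e: "e > 0"
    obtain c where c: "fs c" "\<forall>x\<in>K \<union> K'. norm (f x - pf c x) \<le> e"
      using hol_space_approx[OF R f, of "K \<union> K'" e] K K' e unfolding \<Omega> by (auto intro: compact_Un)
    let ?y = "pf (\<lambda>\<alpha>. c \<alpha> * mult_seq \<Omega> M \<alpha>) z"
    have 1: "norm (M f z - ?y) \<le> C' * e" by (rule K'(4)[OF f c(1)]) (use c(2) e in auto)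
    have 2: "norm (?I - ?y) \<le> C * e" by (rule K(4)[OF hol_space_csh[OF op \<Omega> R f] c(1)]) (use c(2) e in auto)
    have "norm (M f z - ?I) \<le> norm (M f z - ?y) + norm (?I - ?y)"
      using norm_triangle_ineq4[of "M f z - ?y" "?I - ?y"] by simp
    then show "norm (M f z - ?I) \<le> 0 + (C' + C) * e" using 1 2 unfolding distrib_right by linarith
  qed
  then show ?thesis by simp
qed

end

theorem theorem4p2:
  fixes Om :: "'n::finite \<Rightarrow> complex set" and \<Omega> :: "(complex ^ 'n) set"
  assumes "\<And>j. open (Om j)"
    and "\<Omega> = cart Om"
    and "runge_domain \<Omega>"
  shows "Module.algebra ring_of_type_algebra (multiplier_algebra \<Omega>) \<and>
    Module.algebra ring_of_type_algebra (germ_algebra Om) \<and>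
    Psi_hat \<Omega> \<in> ring_iso (multiplier_algebra \<Omega>) (germ_algebra Om) \<and>
    (\<forall>c. \<forall>M\<in>multipliers \<Omega>. Psi_hat \<Omega> (c \<odot>\<^bsub>multiplier_algebra \<Omega>\<^esub> M)
           = c \<odot>\<^bsub>germ_algebra Om\<^esub> Psi_hat \<Omega> M) \<and>
    (\<forall>M\<in>multipliers \<Omega>. mult_seq \<Omega> M = taylor (Psi_hat \<Omega> M)) \<and>
    (\<forall>\<psi>\<in>ext_germs Om. \<forall>z\<in>\<Omega>. (\<forall>j. z $ j \<noteq> 0) \<longrightarrow>
           (\<exists>Uh \<psi>z. is_extension Om z \<psi> Uh \<psi>z) \<and>
           (\<forall>Uh \<psi>z. is_extension Om z \<psi> Uh \<psi>z \<longrightarrow>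
              (\<exists>\<gamma>. admissible_cycles Om z Uh \<gamma>) \<and>
              (\<forall>\<gamma>. admissible_cycles Om z Uh \<gamma> \<longrightarrow>
                (\<forall>f\<in>hol_space \<Omega>.
                   the_inv_into (multipliers \<Omega>) (Psi_hat \<Omega>) \<psi> f z =
                     (- 1 / (2 * of_real pi * \<i>)) ^ CARD('n) *
                     cycle_integral (\<lambda>j. inv_cycle (\<gamma> j))
                       (\<lambda>\<zeta>. f (\<chi> j. z $ j * (1 / \<zeta> $ j)) *
                            (\<psi>z (emb \<zeta>) / (\<Prod>j\<in>UNIV. \<zeta> $ j)))))))"
proof (intro conjI ballI allI impI)
  note A = assms
  note seq = mult_seq_ext_seq[OF A]
  have carrier: "carrier (multiplier_algebra \<Omega>) = multipliers \<Omega>" "carrier (germ_algebra Om) = ext_germs Om"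
    by (simp_all add: multiplier_algebra_def germ_algebra_def)
  show "Module.algebra ring_of_type_algebra (multiplier_algebra \<Omega>)" by (rule multiplier_algebra[OF A])
  show "Module.algebra ring_of_type_algebra (germ_algebra Om)" by (rule germ_algebra[OF A])
  show iso: "Psi_hat \<Omega> \<in> ring_iso (multiplier_algebra \<Omega>) (germ_algebra Om)" by (rule Psi_hat_iso[OF A])
  fix M assume M: "M \<in> multipliers \<Omega>"
  show "Psi_hat \<Omega> (c \<odot>\<^bsub>multiplier_algebra \<Omega>\<^esub> M) = c \<odot>\<^bsub>germ_algebra Om\<^esub> Psi_hat \<Omega> M" for c
    unfolding Psi_hat_def germ_ops[OF A seq[OF M] seq[OF M]]
    by (simp add: multiplier_algebra_def multiplier_smult[OF A M])
  show "mult_seq \<Omega> M = taylor (Psi_hat \<Omega> M)"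
    unfolding Psi_hat_def by (rule taylor_ext[OF seq[OF M], symmetric])
next
  note A = assms
  have bij: "bij_betw (Psi_hat \<Omega>) (multipliers \<Omega>) (ext_germs Om)"
    using Psi_hat_iso[OF A] by (simp add: ring_iso_def multiplier_algebra_def germ_algebra_def)
  fix \<psi> z assume \<psi>: "\<psi> \<in> ext_germs Om" and z: "z \<in> \<Omega>" "\<forall>j. z $ j \<noteq> 0"
  then have z': "z \<in> cart Om" "\<And>j. z $ j \<noteq> 0" using A(2) by auto
  obtain M where M: "M \<in> multipliers \<Omega>" "\<psi> = Psi_hat \<Omega> M" using bij \<psi> unfolding bij_betw_def by blast
  have inv: "the_inv_into (multipliers \<Omega>) (Psi_hat \<Omega>) \<psi> = M"
    unfolding M(2) by (rule the_inv_into_f_f[OF bij_betw_imp_inj_on[OF bij] M(1)])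
  show "\<exists>Uh \<psi>z. is_extension Om z \<psi> Uh \<psi>z"
    using mult_seq_ext_seq[OF A M(1)] z z' unfolding ext_seq_def M(2) Psi_hat_def by blast
  fix Uh \<psi>z assume E: "is_extension Om z \<psi> Uh \<psi>z"
  show "\<exists>\<gamma>. admissible_cycles Om z Uh \<gamma>"
  proof (rule admissible_cycles_exist[OF A(1) _ z'])
    show "simply_connected (Om j)" for j by (rule runge_factor_simply_connected[OF A(1)]) (use A(2,3) in auto)
  qed (use E in \<open>auto simp: is_extension_def\<close>)
  fix \<gamma> f assume "admissible_cycles Om z Uh \<gamma>" "f \<in> hol_space \<Omega>"
  then show "the_inv_into (multipliers \<Omega>) (Psi_hat \<Omega>) \<psi> f z =
      (- 1 / (2 * of_real pi * \<i>)) ^ CARD('n) * cycle_integral (\<lambda>j. inv_cycle (\<gamma> j))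
        (\<lambda>\<zeta>. f (\<chi> j. z $ j * (1 / \<zeta> $ j)) * (\<psi>z (emb \<zeta>) / (\<Prod>j\<in>UNIV. \<zeta> $ j)))"
    unfolding inv using multiplier_integral_formula[OF A M(1) z(1) z'(2) E[unfolded M(2)]] by blast
qed

end
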